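(* Let $\pi:E\to Q$, $\pi':E'\to Q'$ be fibred manifolds with $\dim Q=\dim Q'=n$ and fibre rank $m$, let $r\ge1$, and let $\Phi_0:E\to E'$ be a hodograph-type transformation from $\pi$ to $\pi'$. The hodograph prolongation $\Phi^{(r)}:\mathcal U_r\to J^r\pi'$ satisfies $$T\Phi^{(r)}(\mathcal C^r_\pi)=\mathcal C^r_{\pi'}.$$ Hence, since $\mathcal C^r_\pi$ and $\mathcal C^r_{\pi'}$ are the canonical $N^r_\pi$- and $N^r_{\pi'}$-contact distributions of the corresponding jet spaces, every hodograph prolongation is a local $k$-contact transformation on its domain of definition. Moreover, it is a Legendrian-polarised transcontact transformation.
   Context: $J^r\pi$ is the $r$-th jet bundle ($J^0\pi=E$), $\pi_{r,s}$ the projections, $\mathcal C^r_\pi$ the Cartan distribution (locally the common kernel of $du^\alpha_I-\sum_iu^\alpha_{I+\widehat e_i}dx^i$, $|I|\le r-1$), $\mathcal G^r_\pi=\ker T\pi_{r,r-1}$; $N^r_\pi=N^r_{\pi'}=m\binom{n+r-1}{r-1}$ is the corank of the Cartan distributions, and a local $k$-contact transformation is a local diffeomorphism which, together with its local inverse, maps the Cartan distribution into the Cartan distribution. A hodograph-type transformation is a local diffeomorphism $\Phi_0:E\to E'$ sending local graphs of sections of $\pi$, whenever their images are transverse to $\pi'$, into local graphs of sections of $\pi'$. In adapted coordinates it reads $(x^i,u^\alpha)\mapsto(X^i(x,u),U^\alpha(x,u))$; put $D_iX^j=\partial X^j/\partial x^i+\sum_\alpha u^\alpha_i\,\partial X^j/\partial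 u^\alpha$ and $\mathcal U_r=\{j^r_x\phi\in J^r\pi:\det(D_iX^j)(j^1_x\phi)\ne0\}$. For $j^r_x\phi\in\mathcal U_r$, $\Phi_0(\phi(U))$ is, near $\Phi_0(\phi(x))$, the image of a section $\phi'$ of $\pi'$, and $\Phi^{(r)}(j^r_x\phi):=j^r_{x'}\phi'$, $x'=\pi'(\Phi_0(\phi(x)))$. The equality $T\Phi^{(r)}(\mathcal C^r_\pi)=\mathcal C^r_{\pi'}$ is understood on $\mathcal U_r$ and its image. A subspace $H\subset(\mathcal C^r_\pi)_p$ is isotropic if $[X,Y]_p\in(\mathcal C^r_\pi)_p$ for all local $X,Y\in\Gamma(\mathcal C^r_\pi)$ with $X_p,Y_p\in H$; it is $\mathcal G^r_\pi$-polarised Legendrian if it is isotropic and $(\mathcal C^r_\pi)_p=H\oplus(\mathcal G^r_\pi)_p$. A map $\Phi$ is a Legendrian-polarised transcontact morphism (transformation) if $T\Phi(\mathcal C^r_\pi)\subset\mathcal C^r_{\pi'}$ and, at every point of its domain, $T\Phi$ sends every $\mathcal G^r_\pi$-polarised Legendrian plane to a $\mathcal G^r_{\pi'}$-polarised Legendrian plane. *)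

theory Defs
  imports
    "HOL-Analysis.Analysis"
    "HOL-Library.Function_Algebras"
    "HOL-Library.Multiset"
begin

section \<open>Smooth maps between open subsets of Euclidean spaces\<close>

text \<open>These notions are meant for open sets \<open>S\<close> only.\<close>

primrec Ck_on ::
  "nat \<Rightarrow> 'a::real_normed_vector set \<Rightarrow> ('a \<Rightarrow> 'b::real_normed_vector) \<Rightarrow> bool" where
  "Ck_on 0 S f \<longleftrightarrow> continuous_on S f"
| "Ck_on (Suc k) S f \<longleftrightarrow>
     f differentiable_on S \<and> (\<forall>v. Ck_on k S (\<lambda>x. frechet_derivative f (at x) v))"

definition smooth_on ::
  "'a::real_normed_vector set \<Rightarrow> ('a \<Rightarrow> 'b::real_normed_vector) \<Rightarrow> bool" where
  "smooth_on S f \<longleftrightarrow> (\<forall>k. Ck_on k S f)"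


section \<open>Manifolds\<close>

text \<open>A chart is a pair (domain, coordinate map); the values of the coordinate map outside the
  domain are irrelevant. A manifold is given by an atlas, the underlying set being the union of
  the chart domains, with the topology induced by the charts.\<close>

type_synonym ('a, 'b) chart = "'a set \<times> ('a \<Rightarrow> 'b)"

abbreviation cdom :: "('a, 'b) chart \<Rightarrow> 'a set" where "cdom c \<equiv> fst c"
abbreviation cmap :: "('a, 'b) chart \<Rightarrow> 'a \<Rightarrow> 'b" where "cmap c \<equiv> snd c"
abbreviation cinv :: "('a, 'b) chart \<Rightarrow> 'b \<Rightarrow> 'a" where "cinv c \<equiv> inv_into (cdom c) (cmap c)"

definition is_chart :: "('a, 'b::euclidean_space) chart \<Rightarrow> bool" where
  "is_chart c \<longleftrightarrow> inj_on (cmap c) (cdom c) \<and> open (cmap c ` cdom c)"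

definition smooth_transition ::
  "('a, 'b::euclidean_space) chart \<Rightarrow> ('a, 'b) chart \<Rightarrow> bool" where
  "smooth_transition c d \<longleftrightarrow>
     open (cmap c ` (cdom c \<inter> cdom d)) \<and>
     smooth_on (cmap c ` (cdom c \<inter> cdom d)) (cmap d \<circ> cinv c)"

definition is_atlas :: "('a, 'b::euclidean_space) chart set \<Rightarrow> bool" where
  "is_atlas A \<longleftrightarrow> (\<forall>c\<in>A. is_chart c) \<and> (\<forall>c\<in>A. \<forall>d\<in>A. smooth_transition c d)"

definition carrier_of :: "('a, 'b) chart set \<Rightarrow> 'a set" where
  "carrier_of A = (\<Union>c\<in>A. cdom c)"

definition max_atlas :: "('a, 'b::euclidean_space) chart set \<Rightarrow> ('a, 'b) chart set" where
  "max_atlas A = {c. is_chart c \<and> cdom c \<subseteq> carrier_of A \<and>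
                     (\<forall>d\<in>A. smooth_transition c d \<and> smooth_transition d c)}"

definition mtop :: "('a, 'b::euclidean_space) chart set \<Rightarrow> 'a topology" where
  "mtop A = topology (\<lambda>W. W \<subseteq> carrier_of A \<and> (\<forall>c\<in>A. open (cmap c ` (W \<inter> cdom c))))"

definition smooth_manifold :: "('a, 'b::euclidean_space) chart set \<Rightarrow> bool" where
  "smooth_manifold A \<longleftrightarrow>
     is_atlas A \<and> Hausdorff_space (mtop A) \<and> second_countable (mtop A)"

definition smooth_map_on ::
  "('a, 'b::euclidean_space) chart set \<Rightarrow> ('c, 'd::euclidean_space) chart set \<Rightarrow>
   'a set \<Rightarrow> ('a \<Rightarrow> 'c) \<Rightarrow> bool" where
  "smooth_map_on A B U f \<longleftrightarrow>
     openin (mtop A) U \<and>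
     continuous_map (subtopology (mtop A) U) (mtop B) f \<and>
     (\<forall>c\<in>A. \<forall>d\<in>B.
        smooth_on (cmap c ` {p \<in> U \<inter> cdom c. f p \<in> cdom d}) (cmap d \<circ> f \<circ> cinv c))"

definition diffeo_on ::
  "('a, 'b::euclidean_space) chart set \<Rightarrow> ('c, 'd::euclidean_space) chart set \<Rightarrow>
   'a set \<Rightarrow> ('a \<Rightarrow> 'c) \<Rightarrow> bool" where
  "diffeo_on A B W f \<longleftrightarrow>
     inj_on f W \<and> smooth_map_on A B W f \<and> smooth_map_on B A (f ` W) (inv_into W f)"

definition local_diffeo_on ::
  "('a, 'b::euclidean_space) chart set \<Rightarrow> ('c, 'd::euclidean_space) chart set \<Rightarrow>
   'a set \<Rightarrow> ('a \<Rightarrow> 'c) \<Rightarrow> bool" where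
  "local_diffeo_on A B U f \<longleftrightarrow>
     openin (mtop A) U \<and> (\<forall>p\<in>U. \<exists>W. p \<in> W \<and> W \<subseteq> U \<and> diffeo_on A B W f)"


section \<open>Tangent spaces, distributions\<close>

instantiation "fun" :: (type, real_vector) real_vector
begin
definition scaleR_fun :: "real \<Rightarrow> ('a \<Rightarrow> 'b) \<Rightarrow> 'a \<Rightarrow> 'b" where
  "scaleR_fun a f = (\<lambda>x. a *\<^sub>R f x)"
instance
  by standard (auto simp: scaleR_fun_def fun_eq_iff algebra_simps)
end

text \<open>A tangent vector at \<open>p\<close> is the family of its component vectors in the charts around \<open>p\<close>,
  related by the derivatives of the transition maps (and put to \<open>0\<close> at all other charts).
  Vector space operations are pointwise.\<close>

type_synonym ('a, 'b) tvec = "('a, 'b) chart \<Rightarrow> 'b"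

definition tangent_space ::
  "('a, 'b::euclidean_space) chart set \<Rightarrow> 'a \<Rightarrow> ('a, 'b) tvec set" where
  "tangent_space A p = {v.
     (\<forall>c. \<not> (c \<in> A \<and> p \<in> cdom c) \<longrightarrow> v c = 0) \<and>
     (\<forall>c\<in>A. \<forall>d\<in>A. p \<in> cdom c \<and> p \<in> cdom d \<longrightarrow>
        v d = frechet_derivative (cmap d \<circ> cinv c) (at (cmap c p)) (v c))}"

text \<open>The tangent map at \<open>p\<close> of a map smooth near \<open>p\<close>; its value does not depend on the
  chosen chart around \<open>p\<close>.\<close>

definition tangent_map ::
  "('a, 'b::euclidean_space) chart set \<Rightarrow> ('c, 'd::euclidean_space) chart set \<Rightarrow>
   ('a \<Rightarrow> 'c) \<Rightarrow> 'a \<Rightarrow> ('a, 'b) tvec \<Rightarrow> ('c, 'd) tvec" where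
  "tangent_map A B f p v = (\<lambda>d.
     if d \<in> B \<and> f p \<in> cdom d then
       (let c = (SOME c. c \<in> A \<and> p \<in> cdom c)
        in frechet_derivative (cmap d \<circ> f \<circ> cinv c) (at (cmap c p)) (v c))
     else 0)"

text \<open>A distribution \<open>D\<close> assigns to a point a subspace of the tangent space. \<open>Gamma_at A D p\<close>
  consists of the smooth local sections of \<open>D\<close> defined near \<open>p\<close>.\<close>

definition Gamma_at ::
  "('a, 'b::euclidean_space) chart set \<Rightarrow> ('a \<Rightarrow> ('a, 'b) tvec set) \<Rightarrow> 'a \<Rightarrow>
   ('a \<Rightarrow> ('a, 'b) tvec) set" where
  "Gamma_at A D p = {X. \<exists>W. openin (mtop A) W \<and> p \<in> W \<and> (\<forall>q\<in>W. X q \<in> D q) \<and>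
     (\<forall>c\<in>A. smooth_on (cmap c ` (W \<inter> cdom c)) (\<lambda>y. X (cinv c y) c))}"

definition lie_bracket ::
  "('a, 'b::euclidean_space) chart set \<Rightarrow>
   ('a \<Rightarrow> ('a, 'b) tvec) \<Rightarrow> ('a \<Rightarrow> ('a, 'b) tvec) \<Rightarrow> 'a \<Rightarrow> ('a, 'b) tvec" where
  "lie_bracket A X Y p = (\<lambda>c.
     if c \<in> A \<and> p \<in> cdom c then
       frechet_derivative (\<lambda>y. Y (cinv c y) c) (at (cmap c p)) (X p c) -
       frechet_derivative (\<lambda>y. X (cinv c y) c) (at (cmap c p)) (Y p c)
     else 0)"

definition isotropic_at ::
  "('a, 'b::euclidean_space) chart set \<Rightarrow> ('a \<Rightarrow> ('a, 'b) tvec set) \<Rightarrow> 'a \<Rightarrow>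
   ('a, 'b) tvec set \<Rightarrow> bool" where
  "isotropic_at A D p H \<longleftrightarrow> subspace H \<and> H \<subseteq> D p \<and>
     (\<forall>X\<in>Gamma_at A D p. \<forall>Y\<in>Gamma_at A D p.
        X p \<in> H \<and> Y p \<in> H \<longrightarrow> lie_bracket A X Y p \<in> D p)"

definition polarised_legendrian ::
  "('a, 'b::euclidean_space) chart set \<Rightarrow> ('a \<Rightarrow> ('a, 'b) tvec set) \<Rightarrow>
   ('a \<Rightarrow> ('a, 'b) tvec set) \<Rightarrow> 'a \<Rightarrow> ('a, 'b) tvec set \<Rightarrow> bool" where
  "polarised_legendrian A D G p H \<longleftrightarrow>
     isotropic_at A D p H \<and> D p = {h + g | h g. h \<in> H \<and> g \<in> G p} \<and> H \<inter> G p = {0}"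

definition corank_distribution ::
  "nat \<Rightarrow> ('a, 'b::euclidean_space) chart set \<Rightarrow> ('a \<Rightarrow> ('a, 'b) tvec set) \<Rightarrow> bool" where
  "corank_distribution k A D \<longleftrightarrow>
     (\<forall>p\<in>carrier_of A. subspace (D p) \<and> D p \<subseteq> tangent_space A p \<and>
        dim (tangent_space A p) = dim (D p) + k)"

text \<open>The corank condition only serves to fix the meaning of the number \<open>k\<close>.\<close>

definition local_k_contact_transformation ::
  "nat \<Rightarrow> ('a, 'b::euclidean_space) chart set \<Rightarrow> ('a \<Rightarrow> ('a, 'b) tvec set) \<Rightarrow>
   ('c, 'd::euclidean_space) chart set \<Rightarrow> ('c \<Rightarrow> ('c, 'd) tvec set) \<Rightarrow>
   'a set \<Rightarrow> ('a \<Rightarrow> 'c) \<Rightarrow> bool" where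
  "local_k_contact_transformation k A D B D' U f \<longleftrightarrow>
     corank_distribution k A D \<and> corank_distribution k B D' \<and>
     local_diffeo_on A B U f \<and>
     (\<forall>W. W \<subseteq> U \<and> diffeo_on A B W f \<longrightarrow>
        (\<forall>p\<in>W. tangent_map A B f p ` D p \<subseteq> D' (f p) \<and>
                tangent_map B A (inv_into W f) (f p) ` D' (f p) \<subseteq> D p))"

definition legendrian_polarised_transcontact ::
  "('a, 'b::euclidean_space) chart set \<Rightarrow> ('a \<Rightarrow> ('a, 'b) tvec set) \<Rightarrow>
   ('a \<Rightarrow> ('a, 'b) tvec set) \<Rightarrow>
   ('c, 'd::euclidean_space) chart set \<Rightarrow> ('c \<Rightarrow> ('c, 'd) tvec set) \<Rightarrow>
   ('c \<Rightarrow> ('c, 'd) tvec set) \<Rightarrow> 'a set \<Rightarrow> ('a \<Rightarrow> 'c) \<Rightarrow> bool" where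
  "legendrian_polarised_transcontact A D G B D' G' U f \<longleftrightarrow>
     (\<forall>p\<in>U. tangent_map A B f p ` D p \<subseteq> D' (f p) \<and>
        (\<forall>H. polarised_legendrian A D G p H \<longrightarrow>
              polarised_legendrian B D' G' (f p) (tangent_map A B f p ` H)))"


section \<open>Fibred manifolds\<close>

text \<open>The base has dimension \<open>CARD('n)\<close> and the fibres have dimension \<open>CARD('m)\<close>.\<close>

record ('e, 'q, 'n, 'm) fibred =
  tot :: "('e, (real^'n) \<times> (real^'m)) chart set"
  base :: "('q, real^'n) chart set"
  proj :: "'e \<Rightarrow> 'q"

definition fibred_manifold :: "('e, 'q, 'n::finite, 'm::finite) fibred \<Rightarrow> bool" where
  "fibred_manifold F \<longleftrightarrow>
     smooth_manifold (tot F) \<and> smooth_manifold (base F) \<and>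
     smooth_map_on (tot F) (base F) (carrier_of (tot F)) (proj F) \<and>
     proj F ` carrier_of (tot F) = carrier_of (base F) \<and>
     (\<forall>e\<in>carrier_of (tot F).
        tangent_map (tot F) (base F) (proj F) e ` tangent_space (tot F) e
          = tangent_space (base F) (proj F e))"

text \<open>An adapted chart \<open>(x, u)\<close> of the total space, together with the chart \<open>x\<close> of the base.\<close>

definition adapted_charts ::
  "('e, 'q, 'n::finite, 'm::finite) fibred \<Rightarrow>
   (('e, (real^'n) \<times> (real^'m)) chart \<times> ('q, real^'n) chart) set" where
  "adapted_charts F = {(c, b). c \<in> max_atlas (tot F) \<and> b \<in> max_atlas (base F) \<and>
     proj F ` cdom c \<subseteq> cdom b \<and> (\<forall>e\<in>cdom c. fst (cmap c e) = cmap b (proj F e))}"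

definition local_section ::
  "('e, 'q, 'n::finite, 'm::finite) fibred \<Rightarrow> 'q set \<Rightarrow> ('q \<Rightarrow> 'e) \<Rightarrow> bool" where
  "local_section F U s \<longleftrightarrow>
     smooth_map_on (base F) (tot F) U s \<and> (\<forall>q\<in>U. proj F (s q) = q)"

definition sections_at ::
  "('e, 'q, 'n::finite, 'm::finite) fibred \<Rightarrow> 'q \<Rightarrow> ('q \<Rightarrow> 'e) set" where
  "sections_at F q = {s. \<exists>U. q \<in> U \<and> local_section F U s}"

definition section_rep ::
  "('e, (real^'n) \<times> (real^'m)) chart \<Rightarrow> ('q, real^'n) chart \<Rightarrow> ('q \<Rightarrow> 'e) \<Rightarrow>
   real^'n \<Rightarrow> real^'m" where
  "section_rep c b s = (\<lambda>x. snd (cmap c (s (cinv b x))))"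


section \<open>Jets\<close>

text \<open>A multi-index in \<open>n\<close> variables is a multiset of directions: its length is the size, and
  \<open>I + e\<^sub>i\<close> is \<^term>\<open>add_mset i I\<close>. For smooth maps \<open>mderiv I f\<close> does not depend on the order
  in which the partial derivatives are taken.\<close>

primrec pderivs ::
  "'n::finite list \<Rightarrow> (real^'n \<Rightarrow> real^'m::finite) \<Rightarrow> real^'n \<Rightarrow> real^'m" where
  "pderivs [] f = f"
| "pderivs (i # is) f = (\<lambda>x. frechet_derivative (pderivs is f) (at x) (axis i 1))"

definition mderiv ::
  "'n::finite multiset \<Rightarrow> (real^'n \<Rightarrow> real^'m::finite) \<Rightarrow> real^'n \<Rightarrow> real^'m" where
  "mderiv I f = pderivs (SOME l. mset l = I) f"

definition jet_equiv ::
  "('e, 'q, 'n::finite, 'm::finite) fibred \<Rightarrow> nat \<Rightarrow> 'q \<Rightarrow> ('q \<Rightarrow> 'e) \<Rightarrow> ('q \<Rightarrow> 'e) \<Rightarrow> bool" where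
  "jet_equiv F r q s t \<longleftrightarrow> s q = t q \<and>
     (\<forall>(c, b)\<in>adapted_charts F. s q \<in> cdom c \<longrightarrow>
        (\<forall>I. size I \<le> r \<longrightarrow>
           mderiv I (section_rep c b s) (cmap b q) = mderiv I (section_rep c b t) (cmap b q)))"

text \<open>A jet is its source point together with an equivalence class of local sections.\<close>

type_synonym ('q, 'e) jet = "'q \<times> ('q \<Rightarrow> 'e) set"

definition jet ::
  "('e, 'q, 'n::finite, 'm::finite) fibred \<Rightarrow> nat \<Rightarrow> ('q \<Rightarrow> 'e) \<Rightarrow> 'q \<Rightarrow> ('q, 'e) jet" where
  "jet F r s q = (q, {t \<in> sections_at F q. jet_equiv F r q s t})"

definition jets :: "('e, 'q, 'n::finite, 'm::finite) fibred \<Rightarrow> nat \<Rightarrow> ('q, 'e) jet set" where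
  "jets F r = {jet F r s q | s q. s \<in> sections_at F q}"

definition rep_section :: "('q, 'e) jet \<Rightarrow> 'q \<Rightarrow> 'e" where
  "rep_section p = (SOME s. s \<in> snd p)"

definition target :: "('q, 'e) jet \<Rightarrow> 'e" where
  "target p = rep_section p (fst p)"

text \<open>The projection of jets of order at least \<open>k\<close> to jets of order \<open>k\<close>.\<close>

definition jet_proj ::
  "('e, 'q, 'n::finite, 'm::finite) fibred \<Rightarrow> nat \<Rightarrow> ('q, 'e) jet \<Rightarrow> ('q, 'e) jet" where
  "jet_proj F k p = jet F k (rep_section p) (fst p)"


section \<open>Jet bundles as manifolds\<close>

text \<open>The model space of a jet bundle has to be a type depending on the order, so the order is
  carried by a finite type: \<open>'s\<close> stands for the order \<open>CARD('s) - 1\<close>. Hence \<open>'r option\<close> stands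
  for the order \<open>CARD('r) \<ge> 1\<close>, and \<open>'r\<close> itself for the order just below.\<close>

definition jorder :: "'s::finite itself \<Rightarrow> nat" where
  "jorder _ = CARD('s) - 1"

typedef (overloaded) ('n::finite, 's::finite) mindex = "{I :: 'n multiset. size I < CARD('s)}"
  by (rule exI[of _ "{#}"]) simp

instance mindex :: (finite, finite) finite
proof
  have "{I :: 'a multiset. size I < CARD('b)}
          \<subseteq> mset ` {l. set l \<subseteq> UNIV \<and> length l \<le> CARD('b)}"
  proof
    fix I :: "'a multiset"
    assume "I \<in> {I. size I < CARD('b)}"
    moreover obtain l where "mset l = I" using ex_mset by blast
    ultimately show "I \<in> mset ` {l. set l \<subseteq> UNIV \<and> length l \<le> CARD('b)}"
      by (force simp: image_iff)
  qed
  moreover have "finite {l :: 'a list. set l \<subseteq> UNIV \<and> length l \<le> CARD('b)}"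
    by (rule finite_lists_length_le) simp
  ultimately have "finite {I :: 'a multiset. size I < CARD('b)}"
    by (meson finite_imageI finite_subset)
  then have "finite (Abs_mindex ` {I :: 'a multiset. size I < CARD('b)} :: ('a, 'b) mindex set)"
    by (rule finite_imageI)
  then show "finite (UNIV :: ('a, 'b) mindex set)"
    by (simp add: type_definition.Abs_image[OF type_definition_mindex])
qed

text \<open>Points \<open>(x\<^sup>i, u\<^sup>\<alpha>\<^sub>I)\<close> with \<open>I\<close> of length at most the order.\<close>

type_synonym ('n, 'm, 's) jetspace = "(real^'n) \<times> ((real^'m)^('n, 's) mindex)"

text \<open>Only meaningful for multi-indices of length at most the order.\<close>

definition ucoord ::
  "('n::finite, 'm::finite, 's::finite) jetspace \<Rightarrow> 'n multiset \<Rightarrow> real^'m" where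
  "ucoord y I = snd y $ Abs_mindex I"

definition jet_chart ::
  "'s::finite itself \<Rightarrow> ('e, 'q, 'n::finite, 'm::finite) fibred \<Rightarrow>
   ('e, (real^'n) \<times> (real^'m)) chart \<Rightarrow> ('q, real^'n) chart \<Rightarrow>
   (('q, 'e) jet, ('n, 'm, 's) jetspace) chart" where
  "jet_chart T F c b =
     ({p \<in> jets F (jorder T). target p \<in> cdom c},
      \<lambda>p. (cmap b (fst p),
           \<chi> I. mderiv (Rep_mindex I) (section_rep c b (rep_section p)) (cmap b (fst p))))"

definition jet_atlas ::
  "'s::finite itself \<Rightarrow> ('e, 'q, 'n::finite, 'm::finite) fibred \<Rightarrow>
   (('q, 'e) jet, ('n, 'm, 's) jetspace) chart set" where
  "jet_atlas T F = {jet_chart T F c b | c b. (c, b) \<in> adapted_charts F}"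

text \<open>The common kernel, at the point with coordinates \<open>y\<close>, of the forms
  \<open>du\<^sup>\<alpha>\<^sub>I - \<Sum>\<^sub>i u\<^sup>\<alpha>\<^sub>I\<^sub>+\<^sub>e\<^sub>i dx\<^sup>i\<close> with \<open>I\<close> of length less than the order.\<close>

definition contact_kernel ::
  "('n::finite, 'm::finite, 's::finite) jetspace \<Rightarrow> ('n, 'm, 's) jetspace set" where
  "contact_kernel y = {v. \<forall>I. size I < jorder TYPE('s) \<longrightarrow>
     ucoord v I - (\<Sum>i\<in>UNIV. fst v $ i *\<^sub>R ucoord y (add_mset i I)) = 0}"

definition cartan ::
  "'s::finite itself \<Rightarrow> ('e, 'q, 'n::finite, 'm::finite) fibred \<Rightarrow> ('q, 'e) jet \<Rightarrow>
   (('q, 'e) jet, ('n, 'm, 's) jetspace) tvec set" where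
  "cartan T F p = {v \<in> tangent_space (jet_atlas T F) p.
     \<forall>c\<in>jet_atlas T F. p \<in> cdom c \<longrightarrow> v c \<in> contact_kernel (cmap c p)}"

definition jet_vertical ::
  "'r::finite option itself \<Rightarrow> ('e, 'q, 'n::finite, 'm::finite) fibred \<Rightarrow> ('q, 'e) jet \<Rightarrow>
   (('q, 'e) jet, ('n, 'm, 'r option) jetspace) tvec set" where
  "jet_vertical T F p = {v \<in> tangent_space (jet_atlas T F) p.
     tangent_map (jet_atlas T F) (jet_atlas TYPE('r) F) (jet_proj F (jorder TYPE('r))) p v = 0}"


section \<open>Hodograph-type transformations and their prolongations\<close>

text \<open>The image of \<open>f \<circ> s\<close> is transverse to the fibres at the image of \<open>q\<close>.\<close>

definition transverse_at ::
  "('e, 'q, 'n::finite, 'm::finite) fibred \<Rightarrow> ('e2, 'q2, 'n, 'm) fibred \<Rightarrow>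
   ('e \<Rightarrow> 'e2) \<Rightarrow> ('q \<Rightarrow> 'e) \<Rightarrow> 'q \<Rightarrow> bool" where
  "transverse_at F F' f s q \<longleftrightarrow>
     {tangent_map (base F) (tot F') (f \<circ> s) q v + w | v w.
        v \<in> tangent_space (base F) q \<and> w \<in> tangent_space (tot F') (f (s q)) \<and>
        tangent_map (tot F') (base F') (proj F') (f (s q)) w = 0}
     = tangent_space (tot F') (f (s q))"

definition hodograph_type ::
  "('e, 'q, 'n::finite, 'm::finite) fibred \<Rightarrow> ('e2, 'q2, 'n, 'm) fibred \<Rightarrow>
   ('e \<Rightarrow> 'e2) \<Rightarrow> bool" where
  "hodograph_type F F' f \<longleftrightarrow>
     local_diffeo_on (tot F) (tot F') (carrier_of (tot F)) f \<and>
     (\<forall>U s. local_section F U s \<and> (\<forall>q\<in>U. transverse_at F F' f s q) \<longrightarrow>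
        (\<forall>q\<in>U. \<exists>V V' s'. openin (mtop (base F)) V \<and> q \<in> V \<and> V \<subseteq> U \<and>
           local_section F' V' s' \<and> f ` s ` V = s' ` V'))"

text \<open>For \<open>X = (X\<^sup>1, \<dots>, X\<^sup>n)\<close> the matrix of the \<open>D\<^sub>i X\<^sup>j\<close> at the point with jet coordinates \<open>y\<close>.\<close>

definition total_jacobian ::
  "((real^'n) \<times> (real^'m) \<Rightarrow> real^'n) \<Rightarrow> ('n::finite, 'm::finite, 's::finite) jetspace \<Rightarrow>
   real^'n^'n" where
  "total_jacobian X y = (\<chi> i j.
     (let D = frechet_derivative X (at (fst y, ucoord y {#}))
      in D (axis i 1, 0) $ j + (\<Sum>\<alpha>\<in>UNIV. ucoord y {#i#} $ \<alpha> * D (0, axis \<alpha> 1) $ j)))"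

definition prolongation_domain ::
  "'r::finite option itself \<Rightarrow> ('e, 'q, 'n::finite, 'm::finite) fibred \<Rightarrow>
   ('e2, 'q2, 'n, 'm) fibred \<Rightarrow> ('e \<Rightarrow> 'e2) \<Rightarrow> ('q, 'e) jet set" where
  "prolongation_domain T F F' f = {p \<in> jets F (jorder T).
     \<forall>(c, b)\<in>adapted_charts F. \<forall>(c', b')\<in>adapted_charts F'.
       target p \<in> cdom c \<and> f (target p) \<in> cdom c' \<longrightarrow>
       det (total_jacobian (fst \<circ> cmap c' \<circ> f \<circ> cinv c) (cmap (jet_chart T F c b) p)) \<noteq> 0}"

text \<open>The \<open>r\<close>-jet of the local section \<open>s'\<close> of \<open>F'\<close> whose image is the image under \<open>f\<close> of a
  local section \<open>s\<close> representing \<open>p\<close>; on the prolongation domain it exists and is independent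
  of the choices.\<close>

definition prolongation ::
  "('e, 'q, 'n::finite, 'm::finite) fibred \<Rightarrow> ('e2, 'q2, 'n, 'm) fibred \<Rightarrow>
   ('e \<Rightarrow> 'e2) \<Rightarrow> nat \<Rightarrow> ('q, 'e) jet \<Rightarrow> ('q2, 'e2) jet" where
  "prolongation F F' f r p = (SOME p'. \<exists>s V s' V'.
     p = jet F r s (fst p) \<and> fst p \<in> V \<and> local_section F V s \<and>
     local_section F' V' s' \<and> f ` s ` V = s' ` V' \<and>
     p' = jet F' r s' (proj F' (f (s (fst p)))))"

end

theory Submission
  imports Defs
begin

text \<open>In adapted coordinates \<open>(x, u)\<close> and \<open>(x', u')\<close> the transformation is a map
  \<open>h (x, u) = (X (x, u), U (x, u))\<close>. A section \<open>s\<close> is carried to the section \<open>s'\<close> with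
  \<open>s' (X (x, s x)) = U (x, s x)\<close>. Differentiating \<open>\<partial>\<^sub>I s' (X (x, s x)) = U\<^sub>I (j s x)\<close> in the direction
  \<open>x\<^sup>j\<close> gives \<open>\<Sum>\<^sub>i (D\<^sub>j X\<^sup>i) U\<^sub>I\<^sub>+\<^sub>i = D\<^sub>j U\<^sub>I\<close>, and since the matrix \<open>D\<^sub>j X\<^sup>i\<close> is invertible on the domain
  of the prolongation, the functions \<open>U\<^sub>I\<close> are determined recursively (\<open>prolong_comp\<close>). Cramer's
  rule shows that they are smooth, and each \<open>U\<^sub>I\<close> only depends on derivatives of \<open>u\<close> of order at most
  \<open>|I|\<close>. Together with \<open>X\<close> they form the coordinate expression \<open>prolong_map h\<close> of the prolongation.

  The same recursion gives the contact property. A vector in the Cartan distribution is, up to the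
  components of top order, a combination \<open>\<Sum>\<^sub>j v\<^sup>j D\<^sub>j\<close> of total derivatives. For \<open>|I| < r\<close> the derivative of
  \<open>U\<^sub>I\<close> along it is therefore \<open>\<Sum>\<^sub>j v\<^sup>j D\<^sub>j U\<^sub>I = \<Sum>\<^sub>i (\<Sum>\<^sub>j v\<^sup>j D\<^sub>j X\<^sup>i) U\<^sub>I\<^sub>+\<^sub>i\<close>, and the inner sum is the \<open>x'\<^sup>i\<close>-component of
  the image vector: this is the contact equation there (\<open>prolong_map_contact\<close>). Vertical vectors, whose
  components of order less than \<open>r\<close> vanish, stay vertical because \<open>X\<close> and the \<open>U\<^sub>I\<close> with \<open>|I| < r\<close> do not
  involve the derivatives of order \<open>r\<close> (\<open>prolong_map_vertical\<close>; here \<open>r \<ge> 1\<close> enters).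

  Every point of the model space is the jet of a polynomial, and the inverse function theorem
  provides the transformed section; hence identities between jet coordinates can be read off from
  sections. In particular, where \<open>k\<close> inverts \<open>h\<close>, \<open>prolong_map k\<close> inverts \<open>prolong_map h\<close>
  (\<open>prolong_map_inverse\<close>). So the prolongation is a local diffeomorphism, and applying the two
  inclusions above to it and to its inverse turns them into equalities, for the Cartan and for the
  vertical distribution. For the identity of the total space the construction yields the transition
  maps of the jet bundle: they are smooth, and both distributions can be tested in a single chart.

  The remaining claims are formal. The corank is that of the kernel of a surjective linear map, its
  target having one copy of the fibre for each multi-index of length less than \<open>r\<close>. A diffeomorphism
  that maps one distribution onto another transports its local sections, and brackets are natural;
  so it maps isotropic subspaces to isotropic subspaces (\<open>isotropic_at_image\<close>), and complements of the
  vertical distribution to complements of the vertical distribution.\<close>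

section \<open>Calculus of smooth maps\<close>

lemma frechet_derivative_cong:
  assumes "open S" "x \<in> S" "\<And>y. y \<in> S \<Longrightarrow> f y = g y"
  shows "frechet_derivative f (at x) = frechet_derivative g (at x)"
proof -
  have "(f has_derivative f') (at x) \<longleftrightarrow> (g has_derivative f') (at x)" for f'
    using has_derivative_transform_within_open[OF _ assms(1,2)] assms(3) by metis
  then show ?thesis
    unfolding frechet_derivative_def by simp
qed

lemma differentiable_at_cong:
  assumes "open S" "x \<in> S" "\<And>y. y \<in> S \<Longrightarrow> f y = g y"
  shows "f differentiable (at x) \<longleftrightarrow> g differentiable (at x)"
  unfolding differentiable_def
  using has_derivative_transform_within_open[OF _ assms(1,2)] assms(3) by metis

lemma Ck_on_cong:
  assumes "open S" "\<And>y. y \<in> S \<Longrightarrow> f y = g y"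
  shows "Ck_on k S f \<longleftrightarrow> Ck_on k S g"
  using assms(2)
proof (induction k arbitrary: f g)
  case 0
  then show ?case by (simp cong: continuous_on_cong)
next
  case (Suc k)
  have "f differentiable_on S \<longleftrightarrow> g differentiable_on S"
    unfolding differentiable_on_eq_differentiable_at[OF assms(1)]
    using Suc.prems differentiable_at_cong[OF assms(1)] by blast
  moreover have "Ck_on k S (\<lambda>x. frechet_derivative f (at x) v)
      \<longleftrightarrow> Ck_on k S (\<lambda>x. frechet_derivative g (at x) v)" for v
    by (rule Suc.IH) (use frechet_derivative_cong[OF assms(1)] Suc.prems in metis)
  ultimately show ?case by simp
qed

lemma Ck_on_SucI:
  assumes "open S" "\<And>x. x \<in> S \<Longrightarrow> (f has_derivative f' x) (at x)"
    and "\<And>v. Ck_on k S (\<lambda>x. f' x v)"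
  shows "Ck_on (Suc k) S f"
proof -
  have "Ck_on k S (\<lambda>x. frechet_derivative f (at x) v)" for v
  proof (subst Ck_on_cong[OF assms(1)])
    show "frechet_derivative f (at x) v = f' x v" if "x \<in> S" for x
      using frechet_derivative_at[OF assms(2)[OF that]] by simp
  qed (rule assms(3))
  moreover have "f differentiable_on S"
    using assms(1,2) by (auto simp: differentiable_on_eq_differentiable_at differentiable_def)
  ultimately show ?thesis by simp
qed

lemma Ck_on_has_derivative:
  assumes "open S" "Ck_on (Suc k) S f" "x \<in> S"
  shows "(f has_derivative frechet_derivative f (at x)) (at x)"
  using assms by (simp add: differentiable_on_eq_differentiable_at flip: frechet_derivative_works)

lemma Ck_on_Suc_imp: "Ck_on (Suc k) S f \<Longrightarrow> Ck_on k S f"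
proof (induction k arbitrary: f)
  case 0
  then show ?case by (simp add: differentiable_imp_continuous_on)
next
  case (Suc k)
  then show ?case by auto
qed

lemma Ck_on_subset: "Ck_on k S f \<Longrightarrow> T \<subseteq> S \<Longrightarrow> Ck_on k T f"
  by (induction k arbitrary: f) (auto intro: continuous_on_subset differentiable_on_subset)

lemma Ck_on_local:
  assumes "open S" "\<And>x. x \<in> S \<Longrightarrow> \<exists>T. open T \<and> x \<in> T \<and> Ck_on k T f"
  shows "Ck_on k S f"
  using assms(2)
proof (induction k arbitrary: f)
  case 0
  have "\<exists>T. x \<in> T \<and> open T \<and> continuous_on T f" if "x \<in> S" for x
    using 0[OF that] by auto
  then have "isCont f x" if "x \<in> S" for x
    using that continuous_on_eq_continuous_at by blast
  then show ?case by (simp add: continuous_at_imp_continuous_on)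
next
  case (Suc k)
  have "f differentiable (at x)" if "x \<in> S" for x
    using Suc.prems[OF that] by (auto simp: differentiable_on_eq_differentiable_at)
  moreover have "Ck_on k S (\<lambda>x. frechet_derivative f (at x) v)" for v
  proof (rule Suc.IH)
    fix x assume "x \<in> S"
    then show "\<exists>T. open T \<and> x \<in> T \<and> Ck_on k T (\<lambda>x. frechet_derivative f (at x) v)"
      using Suc.prems[of x] by auto
  qed
  ultimately show ?case
    by (simp add: differentiable_on_eq_differentiable_at[OF assms(1)])
qed

lemma Ck_on_const: "open S \<Longrightarrow> Ck_on k S (\<lambda>x. c)"
proof (induction k arbitrary: c)
  case (Suc k)
  show ?case
    by (rule Ck_on_SucI[where f' = "\<lambda>_ _. 0"]) (use Suc in auto)
qed auto

lemma Ck_on_bounded_linear: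
  assumes "open S" "bounded_linear L" "Ck_on k S f"
  shows "Ck_on k S (\<lambda>x. L (f x))"
  using assms(3)
proof (induction k arbitrary: f)
  case 0
  then show ?case using assms(2) by (simp add: bounded_linear.continuous_on)
next
  case (Suc k)
  show ?case
  proof (rule Ck_on_SucI[OF assms(1), where f' = "\<lambda>x v. L (frechet_derivative f (at x) v)"])
    show "((\<lambda>x. L (f x)) has_derivative (\<lambda>v. L (frechet_derivative f (at x) v))) (at x)"
      if "x \<in> S" for x
      by (rule bounded_linear.has_derivative[OF assms(2) Ck_on_has_derivative[OF assms(1) Suc.prems that]])
  qed (use Suc in auto)
qed

lemma Ck_on_add:
  assumes "open S" "Ck_on k S f" "Ck_on k S g"
  shows "Ck_on k S (\<lambda>x. f x + g x)"
  using assms(2,3)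
proof (induction k arbitrary: f g)
  case 0
  then show ?case by (simp add: continuous_on_add)
next
  case (Suc k)
  show ?case
    by (rule Ck_on_SucI[OF assms(1),
          where f' = "\<lambda>x v. frechet_derivative f (at x) v + frechet_derivative g (at x) v"])
      (use Suc Ck_on_has_derivative[OF assms(1) Suc.prems(1)]
         Ck_on_has_derivative[OF assms(1) Suc.prems(2)] in \<open>auto intro!: has_derivative_add\<close>)
qed

lemma Ck_on_sum:
  assumes "open S" "\<And>i. i \<in> A \<Longrightarrow> Ck_on k S (f i)"
  shows "Ck_on k S (\<lambda>x. \<Sum>i\<in>A. f i x)"
  using assms(2) by (induction A rule: infinite_finite_induct) (simp_all add: Ck_on_const Ck_on_add assms(1))

lemma Ck_on_bilinear:
  assumes "open S" "bounded_bilinear B" "Ck_on k S f" "Ck_on k S g"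
  shows "Ck_on k S (\<lambda>x. B (f x) (g x))"
  using assms(3,4)
proof (induction k arbitrary: f g)
  case 0
  then show ?case using assms(2) by (simp add: bounded_bilinear.continuous_on)
next
  case (Suc k)
  show ?case
  proof (rule Ck_on_SucI[OF assms(1),
          where f' = "\<lambda>x v. B (f x) (frechet_derivative g (at x) v) + B (frechet_derivative f (at x) v) (g x)"])
    fix x assume "x \<in> S"
    then show "((\<lambda>x. B (f x) (g x)) has_derivative
        (\<lambda>v. B (f x) (frechet_derivative g (at x) v) + B (frechet_derivative f (at x) v) (g x))) (at x)"
      by (intro bounded_bilinear.FDERIV[OF assms(2)] 
          Ck_on_has_derivative[OF assms(1) Suc.prems(1)] Ck_on_has_derivative[OF assms(1) Suc.prems(2)])
  next
    fix v
    show "Ck_on k S (\<lambda>x. B (f x) (frechet_derivative g (at x) v) + B (frechet_derivative f (at x) v) (g x))"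
      by (intro Ck_on_add Suc.IH assms(1) Ck_on_Suc_imp[OF Suc.prems(1)] Ck_on_Suc_imp[OF Suc.prems(2)])
        (use Suc.prems in auto)
  qed
qed

lemma Ck_on_componentwise:
  fixes f :: "'a::euclidean_space \<Rightarrow> 'b::euclidean_space"
  assumes "open S" "\<And>b. b \<in> Basis \<Longrightarrow> Ck_on k S (\<lambda>x. f x \<bullet> b)"
  shows "Ck_on k S f"
proof -
  have "Ck_on k S (\<lambda>x. \<Sum>b\<in>Basis. (f x \<bullet> b) *\<^sub>R b)"
    using assms by (intro Ck_on_sum Ck_on_bilinear[OF _ bounded_bilinear_scaleR] Ck_on_const) auto
  then show ?thesis by (simp add: euclidean_representation)
qed

lemma linear_basis_expand:
  fixes L :: "'a::euclidean_space \<Rightarrow> 'b::real_vector"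
  assumes "linear L"
  shows "L v = (\<Sum>b\<in>Basis. (v \<bullet> b) *\<^sub>R L b)"
proof -
  have "L (\<Sum>b\<in>Basis. (v \<bullet> b) *\<^sub>R b) = (\<Sum>b\<in>Basis. (v \<bullet> b) *\<^sub>R L b)"
    using assms by (simp add: linear_sum linear_scale)
  then show ?thesis by (simp add: euclidean_representation)
qed

text \<open>The composition rule goes by induction: the derivative of a composite is a finite sum of
  products of derivatives of the factors, the outer ones composed with the inner map.\<close>

lemma Ck_on_compose:
  fixes f :: "'a::euclidean_space \<Rightarrow> 'b::euclidean_space"
  assumes "open S" "open T" "Ck_on k S f" "Ck_on k T g" "f ` S \<subseteq> T"
  shows "Ck_on k S (\<lambda>x. g (f x))"
  using assms(3,4)
proof (induction k arbitrary: g)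
  case 0
  then show ?case using assms(5) by (auto intro: continuous_on_compose2)
next
  case (Suc k)
  have lin: "linear (frechet_derivative g (at (f x)))" if "x \<in> S" for x
    using Ck_on_has_derivative[OF assms(2) Suc.prems(2)] assms(5) that
    by (meson has_derivative_linear image_subset_iff)
  show ?case
  proof (rule Ck_on_SucI[OF assms(1),
          where f' = "\<lambda>x v. frechet_derivative g (at (f x)) (frechet_derivative f (at x) v)"])
    fix x assume "x \<in> S"
    then show "((\<lambda>x. g (f x)) has_derivative
        (\<lambda>v. frechet_derivative g (at (f x)) (frechet_derivative f (at x) v))) (at x)"
      using Ck_on_has_derivative[OF assms(1) Suc.prems(1)] Ck_on_has_derivative[OF assms(2) Suc.prems(2)]
        assms(5) diff_chain_at[of f _ x g] by (auto simp: o_def)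
  next
    fix v
    have "Ck_on k S (\<lambda>x. \<Sum>b\<in>Basis. (frechet_derivative f (at x) v \<bullet> b) *\<^sub>R frechet_derivative g (at (f x)) b)"
      by (intro Ck_on_sum Ck_on_bilinear[OF _ bounded_bilinear_scaleR] Suc.IH assms(1)
          Ck_on_bounded_linear[OF _ bounded_linear_inner_left] Ck_on_Suc_imp[OF Suc.prems(1)])
        (use Suc.prems in auto)
    then show "Ck_on k S (\<lambda>x. frechet_derivative g (at (f x)) (frechet_derivative f (at x) v))"
      by (subst Ck_on_cong[OF assms(1)]) (use lin in \<open>auto intro: linear_basis_expand\<close>)
  qed
qed

lemma Ck_on_inverse:
  fixes f :: "'a::euclidean_space \<Rightarrow> real"
  assumes "open S" "Ck_on k S f" "\<And>x. x \<in> S \<Longrightarrow> f x \<noteq> 0"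
  shows "Ck_on k S (\<lambda>x. inverse (f x))"
  using assms(2)
proof (induction k)
  case 0
  then have "continuous_on S f" by simp
  then show ?case unfolding Ck_on.simps using assms(3) by (intro continuous_on_inverse) simp_all
next
  case (Suc k)
  note IH = Suc.IH[OF Ck_on_Suc_imp[OF Suc.prems]]
  show ?case
  proof (rule Ck_on_SucI[OF assms(1),
          where f' = "\<lambda>x v. - (inverse (f x) * frechet_derivative f (at x) v * inverse (f x))"])
    fix x assume "x \<in> S"
    then show "((\<lambda>x. inverse (f x)) has_derivative
        (\<lambda>v. - (inverse (f x) * frechet_derivative f (at x) v * inverse (f x)))) (at x)"
      by (intro Deriv.has_derivative_inverse Ck_on_has_derivative[OF assms(1) Suc.prems] assms(3))
  next
    fix v
    show "Ck_on k S (\<lambda>x. - (inverse (f x) * frechet_derivative f (at x) v * inverse (f x)))"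
      using Suc.prems
      by (intro Ck_on_bounded_linear[OF assms(1) bounded_linear_minus[OF bounded_linear_ident],
            of k "\<lambda>x. inverse (f x) * frechet_derivative f (at x) v * inverse (f x)"]
          Ck_on_bilinear[OF assms(1) bounded_bilinear_mult] IH) auto
  qed
qed

lemma smooth_on_cong:
  "open S \<Longrightarrow> (\<And>y. y \<in> S \<Longrightarrow> f y = g y) \<Longrightarrow> smooth_on S f \<longleftrightarrow> smooth_on S g"
  unfolding smooth_on_def using Ck_on_cong[of S f g] by auto

lemma smooth_on_eq:
  "smooth_on S f \<Longrightarrow> open S \<Longrightarrow> (\<And>y. y \<in> S \<Longrightarrow> f y = g y) \<Longrightarrow> smooth_on S g"
  using smooth_on_cong[of S f g] by auto

lemma smooth_on_has_derivative:
  "smooth_on S f \<Longrightarrow> open S \<Longrightarrow> x \<in> S \<Longrightarrow> (f has_derivative frechet_derivative f (at x)) (at x)"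
  unfolding smooth_on_def using Ck_on_has_derivative by blast

lemma smooth_on_linear_derivative:
  "smooth_on S f \<Longrightarrow> open S \<Longrightarrow> x \<in> S \<Longrightarrow> linear (frechet_derivative f (at x))"
  using smooth_on_has_derivative has_derivative_linear by blast

lemma smooth_on_subset: "smooth_on S f \<Longrightarrow> T \<subseteq> S \<Longrightarrow> smooth_on T f"
  unfolding smooth_on_def using Ck_on_subset by blast

lemma smooth_on_continuous_on: "smooth_on S f \<Longrightarrow> continuous_on S f"
  using Ck_on.simps(1)[of S f] by (simp add: smooth_on_def)

lemma smooth_on_derivative:
  "smooth_on S f \<Longrightarrow> smooth_on S (\<lambda>x. frechet_derivative f (at x) v)"
  unfolding smooth_on_def
proof
  fix k assume "\<forall>k. Ck_on k S f"
  then have "Ck_on (Suc k) S f" ..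
  then show "Ck_on k S (\<lambda>x. frechet_derivative f (at x) v)" by simp
qed

lemma smooth_on_derivativeI:
  assumes "open S" "\<And>x. x \<in> S \<Longrightarrow> (f has_derivative f' x) (at x)" "\<And>v. smooth_on S (\<lambda>x. f' x v)"
  shows "smooth_on S f"
proof -
  have "Ck_on (Suc k) S f" for k
    by (rule Ck_on_SucI[OF assms(1,2)]) (use assms(3) in \<open>auto simp: smooth_on_def\<close>)
  then show ?thesis unfolding smooth_on_def using Ck_on_Suc_imp by blast
qed

lemma smooth_on_local:
  assumes "open S" "\<And>x. x \<in> S \<Longrightarrow> \<exists>T. open T \<and> x \<in> T \<and> smooth_on T f"
  shows "smooth_on S f"
  unfolding smooth_on_def
proof (intro allI Ck_on_local[OF assms(1)])
  fix k x assume "x \<in> S"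
  then obtain T where "open T" "x \<in> T" "smooth_on T f" using assms(2) by blast
  then show "\<exists>T. open T \<and> x \<in> T \<and> Ck_on k T f"
    unfolding smooth_on_def by blast
qed

lemma smooth_on_const: "open S \<Longrightarrow> smooth_on S (\<lambda>x. c)"
  unfolding smooth_on_def by (auto intro: Ck_on_const)

lemma smooth_on_bounded_linear:
  "open S \<Longrightarrow> bounded_linear L \<Longrightarrow> smooth_on S f \<Longrightarrow> smooth_on S (\<lambda>x. L (f x))"
  unfolding smooth_on_def by (rule allI, rule Ck_on_bounded_linear[where L = L]) auto

lemma smooth_on_linear:
  fixes L :: "'b::euclidean_space \<Rightarrow> 'c::real_normed_vector"
  shows "open S \<Longrightarrow> linear L \<Longrightarrow> smooth_on S f \<Longrightarrow> smooth_on S (\<lambda>x. L (f x))"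
  by (simp add: linear_conv_bounded_linear smooth_on_bounded_linear)

lemma smooth_on_id: "open S \<Longrightarrow> smooth_on S (\<lambda>x. x)"
  by (rule smooth_on_derivativeI[where f' = "\<lambda>x v. v"]) (auto intro: smooth_on_const)

lemma smooth_on_add:
  "open S \<Longrightarrow> smooth_on S f \<Longrightarrow> smooth_on S g \<Longrightarrow> smooth_on S (\<lambda>x. f x + g x)"
  unfolding smooth_on_def by (rule allI, rule Ck_on_add) auto

lemma smooth_on_sum:
  "open S \<Longrightarrow> (\<And>i. i \<in> A \<Longrightarrow> smooth_on S (f i)) \<Longrightarrow> smooth_on S (\<lambda>x. \<Sum>i\<in>A. f i x)"
  unfolding smooth_on_def by (rule allI, rule Ck_on_sum) auto

lemma smooth_on_scaleR:
  "open S \<Longrightarrow> smooth_on S f \<Longrightarrow> smooth_on S g \<Longrightarrow> smooth_on S (\<lambda>x. f x *\<^sub>R g x)"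
  unfolding smooth_on_def by (rule allI, rule Ck_on_bilinear[OF _ bounded_bilinear_scaleR]) auto

lemma smooth_on_mult:
  fixes f :: "_ \<Rightarrow> real"
  shows "open S \<Longrightarrow> smooth_on S f \<Longrightarrow> smooth_on S g \<Longrightarrow> smooth_on S (\<lambda>x. f x * g x)"
  unfolding smooth_on_def by (rule allI, rule Ck_on_bilinear[OF _ bounded_bilinear_mult]) auto

lemma smooth_on_prod:
  fixes f :: "_ \<Rightarrow> _ \<Rightarrow> real"
  shows "open S \<Longrightarrow> (\<And>i. i \<in> A \<Longrightarrow> smooth_on S (f i)) \<Longrightarrow> smooth_on S (\<lambda>x. \<Prod>i\<in>A. f i x)"
  by (induction A rule: infinite_finite_induct) (simp_all add: smooth_on_const smooth_on_mult)

lemma smooth_on_compose: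
  fixes f :: "'a::euclidean_space \<Rightarrow> 'b::euclidean_space"
  shows "smooth_on T g \<Longrightarrow> smooth_on S f \<Longrightarrow> open S \<Longrightarrow> open T \<Longrightarrow> f ` S \<subseteq> T
    \<Longrightarrow> smooth_on S (\<lambda>x. g (f x))"
  unfolding smooth_on_def by (rule allI, rule Ck_on_compose[where T = T]) auto

lemma smooth_on_componentwise:
  fixes f :: "'a::euclidean_space \<Rightarrow> 'b::euclidean_space"
  assumes "open S" "\<And>b. b \<in> Basis \<Longrightarrow> smooth_on S (\<lambda>x. f x \<bullet> b)"
  shows "smooth_on S f"
  unfolding smooth_on_def
  by (rule allI, rule Ck_on_componentwise[OF assms(1)]) (use assms(2) in \<open>auto simp: smooth_on_def\<close>)

lemma smooth_on_Pair:
  fixes f :: "'a::euclidean_space \<Rightarrow> 'b::euclidean_space" and g :: "'a \<Rightarrow> 'c::euclidean_space"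
  assumes "open S" "smooth_on S f" "smooth_on S g"
  shows "smooth_on S (\<lambda>x. (f x, g x))"
proof -
  have "smooth_on S (\<lambda>x. (f x, 0) + (0, g x))"
    using assms by (intro smooth_on_add smooth_on_linear[where L = "\<lambda>z. (z, 0)"]
        smooth_on_linear[where L = "\<lambda>z. (0, z)"]) (auto intro!: linearI)
  then show ?thesis by simp
qed

lemma smooth_on_fst:
  fixes f :: "'a::euclidean_space \<Rightarrow> 'b::euclidean_space \<times> 'c::euclidean_space"
  shows "open S \<Longrightarrow> smooth_on S f \<Longrightarrow> smooth_on S (\<lambda>x. fst (f x))"
  by (rule smooth_on_bounded_linear[OF _ bounded_linear_fst])

lemma smooth_on_snd:
  fixes f :: "'a::euclidean_space \<Rightarrow> 'b::euclidean_space \<times> 'c::euclidean_space"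
  shows "open S \<Longrightarrow> smooth_on S f \<Longrightarrow> smooth_on S (\<lambda>x. snd (f x))"
  by (rule smooth_on_bounded_linear[OF _ bounded_linear_snd])

lemma smooth_on_vec_nth:
  fixes f :: "'a::euclidean_space \<Rightarrow> 'b::euclidean_space ^ 'k"
  shows "open S \<Longrightarrow> smooth_on S f \<Longrightarrow> smooth_on S (\<lambda>x. f x $ i)"
  by (rule smooth_on_bounded_linear[OF _ bounded_linear_vec_nth])

lemma smooth_on_vec_lambda:
  fixes f :: "'k::finite \<Rightarrow> 'a::euclidean_space \<Rightarrow> 'b::euclidean_space"
  assumes "open S" "\<And>i. smooth_on S (f i)"
  shows "smooth_on S (\<lambda>x. \<chi> i. f i x)"
proof (rule smooth_on_componentwise[OF assms(1)])
  fix b :: "'b^'k" assume "b \<in> Basis"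
  then obtain i c where "b = axis i c" by (auto simp: Basis_vec_def)
  then have "(\<lambda>x. (\<chi> i. f i x) \<bullet> b) = (\<lambda>x. f i x \<bullet> c)" by (simp add: inner_axis)
  then show "smooth_on S (\<lambda>x. (\<chi> i. f i x) \<bullet> b)"
    using assms by (auto intro: smooth_on_bounded_linear[OF _ bounded_linear_inner_left])
qed

lemma smooth_on_derivative_apply:
  fixes f :: "'a::euclidean_space \<Rightarrow> 'b::euclidean_space"
  assumes "open S" "smooth_on S f" "smooth_on S X"
  shows "smooth_on S (\<lambda>x. frechet_derivative f (at x) (X x))"
proof -
  have "smooth_on S (\<lambda>x. \<Sum>b\<in>Basis. (X x \<bullet> b) *\<^sub>R frechet_derivative f (at x) b)"
    using assms by (intro smooth_on_sum smooth_on_scaleR smooth_on_derivative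
        smooth_on_bounded_linear[OF _ bounded_linear_inner_left])
  then show ?thesis
    by (rule smooth_on_eq[OF _ assms(1)])
      (use assms smooth_on_linear_derivative in \<open>auto intro!: linear_basis_expand[symmetric]\<close>)
qed

lemma smooth_on_det:
  fixes A :: "'a::euclidean_space \<Rightarrow> real^'k^'k"
  assumes "open S" "\<And>i j. smooth_on S (\<lambda>x. A x $ i $ j)"
  shows "smooth_on S (\<lambda>x. det (A x))"
  unfolding det_def using assms
  by (intro smooth_on_sum smooth_on_mult smooth_on_const smooth_on_prod)

lemma has_derivative_frechet:
  "(f has_derivative f') (at x) \<Longrightarrow> frechet_derivative f (at x) = f'"
  using frechet_derivative_at by metis

lemma frechet_derivative_compose:
  assumes "(f has_derivative f') (at x)" "(g has_derivative g') (at (f x))"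
  shows "frechet_derivative (\<lambda>x. g (f x)) (at x) = (\<lambda>v. g' (f' v))"
  using diff_chain_at[OF assms] by (auto simp: o_def intro: has_derivative_frechet)

section \<open>Symmetry of second derivatives and naturality of the Lie bracket\<close>

lemma has_real_derivative_along_line:
  fixes g :: "'a::real_normed_vector \<Rightarrow> real"
  assumes "(g has_derivative g') (at (p + s *\<^sub>R u))"
  shows "((\<lambda>s. g (p + s *\<^sub>R u)) has_real_derivative g' u) (at s)"
proof -
  have "((\<lambda>s. p + s *\<^sub>R u) has_derivative (\<lambda>h. h *\<^sub>R u)) (at s)"
    by (auto intro!: derivative_eq_intros)
  from diff_chain_at[OF this assms]
  have "((\<lambda>s. g (p + s *\<^sub>R u)) has_derivative (\<lambda>h. g' (h *\<^sub>R u))) (at s)"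
    by (simp add: o_def)
  moreover have "g' (h *\<^sub>R u) = g' u * h" for h
    using has_derivative_linear[OF assms] by (simp add: linear_scale)
  ultimately show ?thesis by (simp add: has_field_derivative_def)
qed

text \<open>The second difference is symmetric in \<open>u\<close> and \<open>v\<close>, and two applications of the mean value theorem,
  first along \<open>u\<close> and then along \<open>v\<close>, express it by a mixed derivative at a nearby point. Exchanging
  the directions and letting \<open>t\<close> tend to \<open>0\<close> yields the symmetry of second derivatives.\<close>

lemma second_difference_mean_value:
  fixes g :: "'a::euclidean_space \<Rightarrow> real"
  assumes S: "open S" "smooth_on S g" and ball: "ball x d \<subseteq> S"
    and t: "0 < t" "t * (norm u + norm v) < d"
  obtains z where "norm (z - x) \<le> t * (norm u + norm v)"
    "g (x + t *\<^sub>R u + t *\<^sub>R v) - g (x + t *\<^sub>R u) - g (x + t *\<^sub>R v) + g x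
      = t * t * frechet_derivative (\<lambda>y. frechet_derivative g (at y) u) (at z) v"
proof -
  define D where "D = (\<lambda>y. frechet_derivative g (at y))"
  have est: "norm (s *\<^sub>R u + r *\<^sub>R v) \<le> t * (norm u + norm v)" if "0 \<le> s" "s \<le> t" "0 \<le> r" "r \<le> t" for s r
  proof -
    have "norm (s *\<^sub>R u + r *\<^sub>R v) \<le> s * norm u + r * norm v"
      using norm_triangle_ineq[of "s *\<^sub>R u" "r *\<^sub>R v"] that by simp
    also have "\<dots> \<le> t * norm u + t * norm v"
      using that by (intro add_mono mult_right_mono) auto
    finally show ?thesis by (simp add: distrib_left)
  qed
  have inS: "x + s *\<^sub>R u + r *\<^sub>R v \<in> S" if "0 \<le> s" "s \<le> t" "0 \<le> r" "r \<le> t" for s r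
  proof -
    have "dist x (x + s *\<^sub>R u + r *\<^sub>R v) = norm (s *\<^sub>R u + r *\<^sub>R v)"
      by (simp add: dist_norm norm_minus_commute algebra_simps)
    then show ?thesis using est[OF that] t ball by auto
  qed
  have der: "(g has_derivative D y) (at y)" if "y \<in> S" for y
    unfolding D_def using smooth_on_has_derivative[OF S(2,1) that] .
  have der2: "((\<lambda>y. D y u) has_derivative frechet_derivative (\<lambda>y. D y u) (at y)) (at y)" if "y \<in> S" for y
    unfolding D_def using smooth_on_has_derivative[OF smooth_on_derivative[OF S(2)] S(1) that] .
  have "\<exists>s>0. s < t \<and> (g (x + t *\<^sub>R v + t *\<^sub>R u) - g (x + t *\<^sub>R u)) - (g (x + t *\<^sub>R v + 0 *\<^sub>R u) - g (x + 0 *\<^sub>R u))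
      = (t - 0) * (D (x + t *\<^sub>R v + s *\<^sub>R u) u - D (x + s *\<^sub>R u) u)"
  proof (rule MVT2[OF t(1)])
    fix s assume s: "0 \<le> s" "s \<le> t"
    have "x + t *\<^sub>R v + s *\<^sub>R u \<in> S" "x + s *\<^sub>R u \<in> S"
      using inS[of s t] inS[of s 0] s t by (simp_all add: algebra_simps)
    then show "((\<lambda>s. g (x + t *\<^sub>R v + s *\<^sub>R u) - g (x + s *\<^sub>R u)) has_real_derivative
        D (x + t *\<^sub>R v + s *\<^sub>R u) u - D (x + s *\<^sub>R u) u) (at s)"
      by (intro DERIV_diff has_real_derivative_along_line der)
  qed
  then obtain s where s: "0 < s" "s < t"
    "(g (x + t *\<^sub>R v + t *\<^sub>R u) - g (x + t *\<^sub>R u)) - (g (x + t *\<^sub>R v) - g x)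
      = t * (D (x + t *\<^sub>R v + s *\<^sub>R u) u - D (x + s *\<^sub>R u) u)"
    by auto
  have "\<exists>r>0. r < t \<and> D (x + s *\<^sub>R u + t *\<^sub>R v) u - D (x + s *\<^sub>R u + 0 *\<^sub>R v) u
      = (t - 0) * frechet_derivative (\<lambda>y. D y u) (at (x + s *\<^sub>R u + r *\<^sub>R v)) v"
  proof (rule MVT2[OF t(1)])
    fix r assume r: "0 \<le> r" "r \<le> t"
    then show "((\<lambda>r. D (x + s *\<^sub>R u + r *\<^sub>R v) u) has_real_derivative
        frechet_derivative (\<lambda>y. D y u) (at (x + s *\<^sub>R u + r *\<^sub>R v)) v) (at r)"
      using inS[of s r] s by (intro has_real_derivative_along_line[of "\<lambda>y. D y u"] der2) auto
  qed
  then obtain r where r: "0 < r" "r < t"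
    "D (x + s *\<^sub>R u + t *\<^sub>R v) u - D (x + s *\<^sub>R u) u
      = t * frechet_derivative (\<lambda>y. D y u) (at (x + s *\<^sub>R u + r *\<^sub>R v)) v"
    by auto
  show ?thesis
  proof
    show "norm (x + s *\<^sub>R u + r *\<^sub>R v - x) \<le> t * (norm u + norm v)"
      using est[of s r] s r by simp
    have eq: "x + t *\<^sub>R v + s *\<^sub>R u = x + s *\<^sub>R u + t *\<^sub>R v" "x + t *\<^sub>R v + t *\<^sub>R u = x + t *\<^sub>R u + t *\<^sub>R v"
      by simp_all
    show "g (x + t *\<^sub>R u + t *\<^sub>R v) - g (x + t *\<^sub>R u) - g (x + t *\<^sub>R v) + g x
      = t * t * frechet_derivative (\<lambda>y. frechet_derivative g (at y) u) (at (x + s *\<^sub>R u + r *\<^sub>R v)) v"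
      using s(3)[unfolded eq r(3)] by (simp add: D_def mult.assoc)
  qed
qed

lemma second_derivative_commute_real:
  fixes g :: "'a::euclidean_space \<Rightarrow> real"
  assumes S: "open S" "smooth_on S g" and x: "x \<in> S"
  shows "frechet_derivative (\<lambda>y. frechet_derivative g (at y) u) (at x) v
       = frechet_derivative (\<lambda>y. frechet_derivative g (at y) v) (at x) u"
proof -
  define P where "P = (\<lambda>z. frechet_derivative (\<lambda>y. frechet_derivative g (at y) u) (at z) v)"
  define Q where "Q = (\<lambda>z. frechet_derivative (\<lambda>y. frechet_derivative g (at y) v) (at z) u)"
  have cont: "isCont P x" "isCont Q x"
    unfolding P_def Q_def
    using smooth_on_continuous_on[OF smooth_on_derivative[OF smooth_on_derivative[OF S(2)]]]
      S(1) x by (auto simp: continuous_on_eq_continuous_at)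
  obtain d where d: "0 < d" "ball x d \<subseteq> S" using S(1) x openE by blast
  have "\<bar>P x - Q x\<bar> \<le> e" if "e > 0" for e
  proof -
    obtain d1 where d1: "d1 > 0" "\<And>z. norm (z - x) < d1 \<Longrightarrow> \<bar>P z - P x\<bar> < e / 2"
      using cont(1) \<open>e > 0\<close> half_gt_zero[of e] unfolding continuous_at_eps_delta
      by (metis dist_norm dist_real_def)
    obtain d2 where d2: "d2 > 0" "\<And>z. norm (z - x) < d2 \<Longrightarrow> \<bar>Q z - Q x\<bar> < e / 2"
      using cont(2) \<open>e > 0\<close> half_gt_zero[of e] unfolding continuous_at_eps_delta
      by (metis dist_norm dist_real_def)
    \<comment> \<open>this \<open>t\<close> puts both intermediate points within \<open>d3 / 2\<close> of \<open>x\<close>; the summand \<open>1\<close> covers \<open>u = v = 0\<close>\<close>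
    define d3 where "d3 = min d (min d1 d2)"
    define t where "t = d3 / (2 * (norm u + norm v + 1))"
    have pos: "d3 > 0" using d d1 d2 by (simp add: d3_def)
    have n: "norm u + norm v + 1 > 0" by (simp add: add_nonneg_pos)
    have t: "t > 0" using pos n by (simp add: t_def)
    have "t * (norm u + norm v) < d3"
    proof -
      have "t * (norm u + norm v) \<le> t * (norm u + norm v + 1)" using t by simp
      also have "\<dots> = d3 / 2" using n by (simp add: t_def field_simps)
      finally show ?thesis using pos by simp
    qed
    then have small: "t * (norm u + norm v) < d" "t * (norm u + norm v) < d1" "t * (norm u + norm v) < d2"
      by (auto simp: d3_def)
    obtain z where z: "norm (z - x) \<le> t * (norm u + norm v)"
      "g (x + t *\<^sub>R u + t *\<^sub>R v) - g (x + t *\<^sub>R u) - g (x + t *\<^sub>R v) + g x = t * t * P z"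
      using second_difference_mean_value[OF S d(2) t small(1)] unfolding P_def by blast
    obtain w where w: "norm (w - x) \<le> t * (norm v + norm u)"
      "g (x + t *\<^sub>R v + t *\<^sub>R u) - g (x + t *\<^sub>R v) - g (x + t *\<^sub>R u) + g x = t * t * Q w"
      using second_difference_mean_value[OF S d(2) t, of v u] small(1) unfolding Q_def
      by (metis add.commute)
    have eq: "x + t *\<^sub>R v + t *\<^sub>R u = x + t *\<^sub>R u + t *\<^sub>R v" by simp
    have "t * t * P z = t * t * Q w" using z(2) w(2)[unfolded eq] by linarith
    then have "P z = Q w" using t by simp
    moreover have "\<bar>P z - P x\<bar> < e / 2" using d1(2) z(1) small by simp
    moreover have "\<bar>Q w - Q x\<bar> < e / 2" using d2(2) w(1) small by (simp add: add.commute)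
    ultimately show ?thesis by linarith
  qed
  then have "P x = Q x" using field_le_epsilon[of "\<bar>P x - Q x\<bar>" 0] by simp
  then show ?thesis by (simp add: P_def Q_def)
qed

lemma frechet_derivative_inner:
  fixes f :: "'a::real_normed_vector \<Rightarrow> 'b::euclidean_space"
  assumes "f differentiable (at x)"
  shows "frechet_derivative (\<lambda>y. f y \<bullet> b) (at x) v = frechet_derivative f (at x) v \<bullet> b"
  using has_derivative_frechet[OF has_derivative_inner_left[OF assms[unfolded frechet_derivative_works]]]
  by metis

lemma smooth_on_differentiable: "smooth_on S f \<Longrightarrow> open S \<Longrightarrow> x \<in> S \<Longrightarrow> f differentiable (at x)"
  using smooth_on_has_derivative differentiableI by blast

lemma second_derivative_commute:
  fixes f :: "'a::euclidean_space \<Rightarrow> 'b::euclidean_space"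
  assumes S: "open S" "smooth_on S f" and x: "x \<in> S"
  shows "frechet_derivative (\<lambda>y. frechet_derivative f (at y) u) (at x) v
       = frechet_derivative (\<lambda>y. frechet_derivative f (at y) v) (at x) u"
proof (rule euclidean_eqI)
  fix b :: 'b assume "b \<in> Basis"
  have comp: "frechet_derivative (\<lambda>y. frechet_derivative f (at y) u) (at x) v \<bullet> b
      = frechet_derivative (\<lambda>y. frechet_derivative (\<lambda>y. f y \<bullet> b) (at y) u) (at x) v" for u v
  proof -
    have "frechet_derivative (\<lambda>y. frechet_derivative (\<lambda>y. f y \<bullet> b) (at y) u) (at x)
        = frechet_derivative (\<lambda>y. frechet_derivative f (at y) u \<bullet> b) (at x)"
      by (rule frechet_derivative_cong[OF S(1) x])
        (rule frechet_derivative_inner[OF smooth_on_differentiable[OF S(2,1)]])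
    then show ?thesis
      using frechet_derivative_inner[OF smooth_on_differentiable[OF smooth_on_derivative[OF S(2)] S(1) x]]
      by metis
  qed
  have "smooth_on S (\<lambda>y. f y \<bullet> b)"
    by (rule smooth_on_bounded_linear[OF S(1) bounded_linear_inner_left S(2)])
  from second_derivative_commute_real[OF S(1) this x]
  show "frechet_derivative (\<lambda>y. frechet_derivative f (at y) u) (at x) v \<bullet> b
      = frechet_derivative (\<lambda>y. frechet_derivative f (at y) v) (at x) u \<bullet> b"
    unfolding comp .
qed

text \<open>The product rule for \<open>z \<mapsto> D h(z) X(z)\<close>. Expanding \<open>X\<close> in the basis makes it a finite sum of products;
  the symmetry of the second derivative reassembles the terms with \<open>D\<^sup>2 h\<close>.\<close>

lemma has_derivative_derivative_apply:
  fixes h :: "'a::euclidean_space \<Rightarrow> 'b::euclidean_space"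
  assumes N: "open N" "smooth_on N h" "y \<in> N" and X: "(X has_derivative X') (at y)"
  shows "((\<lambda>z. frechet_derivative h (at z) (X z)) has_derivative
    (\<lambda>v. frechet_derivative (\<lambda>z. frechet_derivative h (at z) (X y)) (at y) v
        + frechet_derivative h (at y) (X' v))) (at y)"
proof -
  define D where "D = (\<lambda>z. frechet_derivative h (at z))"
  define D2 where "D2 = (\<lambda>w. frechet_derivative (\<lambda>z. D z w) (at y))"
  have lin: "linear (D z)" if "z \<in> N" for z
    unfolding D_def using smooth_on_linear_derivative[OF N(2,1) that] .
  have d2: "((\<lambda>z. D z w) has_derivative D2 w) (at y)" for w
    unfolding D2_def D_def using smooth_on_has_derivative[OF smooth_on_derivative[OF N(2)] N(1,3)] .
  have sym: "D2 w v = D2 v w" for v w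
    unfolding D2_def D_def by (rule second_derivative_commute[OF N])
  have "((\<lambda>z. \<Sum>b\<in>Basis. (X z \<bullet> b) *\<^sub>R D z b) has_derivative
      (\<lambda>v. \<Sum>b\<in>Basis. (X y \<bullet> b) *\<^sub>R D2 b v + (X' v \<bullet> b) *\<^sub>R D y b)) (at y)"
    by (intro has_derivative_sum has_derivative_scaleR has_derivative_inner_left X d2)
  moreover have "(\<Sum>b\<in>Basis. (X y \<bullet> b) *\<^sub>R D2 b v + (X' v \<bullet> b) *\<^sub>R D y b) = D2 (X y) v + D y (X' v)" for v
  proof -
    have "(\<Sum>b\<in>Basis. (X y \<bullet> b) *\<^sub>R D2 b v) = D2 v (X y)"
      using linear_basis_expand[OF has_derivative_linear[OF d2[of v]], of "X y"] by (simp add: sym)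
    moreover have "(\<Sum>b\<in>Basis. (X' v \<bullet> b) *\<^sub>R D y b) = D y (X' v)"
      using linear_basis_expand[OF lin[OF N(3)], of "X' v"] by simp
    ultimately show ?thesis by (simp add: sum.distrib sym)
  qed
  ultimately have "((\<lambda>z. \<Sum>b\<in>Basis. (X z \<bullet> b) *\<^sub>R D z b) has_derivative (\<lambda>v. D2 (X y) v + D y (X' v))) (at y)"
    by simp
  then have "((\<lambda>z. D z (X z)) has_derivative (\<lambda>v. D2 (X y) v + D y (X' v))) (at y)"
    by (rule has_derivative_transform_within_open[OF _ N(1,3)])
      (rule linear_basis_expand[OF lin, symmetric])
  then show ?thesis by (simp add: D_def D2_def)
qed

text \<open>Both terms on the left contain the second derivative \<open>D\<^sup>2 h (X, Y)\<close>; it is symmetric, so it cancels.\<close>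

lemma bracket_natural:
  fixes h :: "'a::euclidean_space \<Rightarrow> 'b::euclidean_space"
  assumes N: "open N" "smooth_on N h" "y \<in> N"
    and X: "X differentiable (at y)" "X' differentiable (at (h y))"
      "\<And>z. z \<in> N \<Longrightarrow> X' (h z) = frechet_derivative h (at z) (X z)"
    and Y: "Y differentiable (at y)" "Y' differentiable (at (h y))"
      "\<And>z. z \<in> N \<Longrightarrow> Y' (h z) = frechet_derivative h (at z) (Y z)"
  shows "frechet_derivative Y' (at (h y)) (X' (h y)) - frechet_derivative X' (at (h y)) (Y' (h y))
    = frechet_derivative h (at y) (frechet_derivative Y (at y) (X y) - frechet_derivative X (at y) (Y y))"
proof -
  have h: "(h has_derivative frechet_derivative h (at y)) (at y)"
    using smooth_on_has_derivative[OF N(2,1,3)] .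
  have main: "frechet_derivative X' (at (h y)) (frechet_derivative h (at y) v)
      = frechet_derivative (\<lambda>z. frechet_derivative h (at z) (X y)) (at y) v
        + frechet_derivative h (at y) (frechet_derivative X (at y) v)"
    if X: "X differentiable (at y)" "X' differentiable (at (h y))"
      "\<And>z. z \<in> N \<Longrightarrow> X' (h z) = frechet_derivative h (at z) (X z)" for X X' v
  proof -
    have "((\<lambda>z. X' (h z)) has_derivative
      (\<lambda>v. frechet_derivative (\<lambda>z. frechet_derivative h (at z) (X y)) (at y) v
        + frechet_derivative h (at y) (frechet_derivative X (at y) v))) (at y)"
      by (rule has_derivative_transform_within_open[OF
            has_derivative_derivative_apply[OF N X(1)[unfolded frechet_derivative_works]] N(1,3)])
        (simp add: X(3))
    from has_derivative_frechet[OF this]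
      frechet_derivative_compose[OF h X(2)[unfolded frechet_derivative_works]]
    show ?thesis by metis
  qed
  have "linear (frechet_derivative h (at y))" using h has_derivative_linear by blast
  then show ?thesis
    using main[OF X, of "Y y"] main[OF Y, of "X y"] X(3)[OF N(3)] Y(3)[OF N(3)]
      second_derivative_commute[OF N, of "X y" "Y y"]
    by (simp add: linear_diff)
qed

section \<open>Linear systems with smooth coefficients and smooth inverse functions\<close>

lemma Ck_on_prod:
  fixes f :: "_ \<Rightarrow> _ \<Rightarrow> real"
  shows "open S \<Longrightarrow> (\<And>i. i \<in> A \<Longrightarrow> Ck_on k S (f i)) \<Longrightarrow> Ck_on k S (\<lambda>x. \<Prod>i\<in>A. f i x)"
  by (induction A rule: infinite_finite_induct)
    (simp_all add: Ck_on_const Ck_on_bilinear[OF _ bounded_bilinear_mult])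

lemma Ck_on_det:
  fixes A :: "'a::euclidean_space \<Rightarrow> real^'k^'k"
  assumes "open S" "\<And>i j. Ck_on k S (\<lambda>x. A x $ i $ j)"
  shows "Ck_on k S (\<lambda>x. det (A x))"
  unfolding det_def using assms
  by (intro Ck_on_sum Ck_on_bilinear[OF _ bounded_bilinear_mult] Ck_on_const Ck_on_prod)

text \<open>By Cramer's rule the solution is a rational function of the coefficients. Matrices being indexed by
  finite types, a type \<open>'k\<close> with as many elements as \<open>'b\<close> has dimensions serves to choose coordinates.\<close>

lemma Ck_on_solve:
  fixes L :: "'a::euclidean_space \<Rightarrow> 'b::euclidean_space \<Rightarrow> 'b"
  assumes S: "open S" and dim: "DIM('b) = CARD('k::finite)"
    and L: "\<And>x. x \<in> S \<Longrightarrow> linear (L x)" "\<And>x. x \<in> S \<Longrightarrow> inj (L x)" "\<And>v. Ck_on k S (\<lambda>x. L x v)"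
    and b: "Ck_on k S b" and w: "\<And>x. x \<in> S \<Longrightarrow> L x (w x) = b x"
  shows "Ck_on k S w"
proof -
  have "DIM('b) = DIM(real^'k)" using dim by simp
  then obtain P :: "'b \<Rightarrow> real^'k" and Q where PQ: "linear P" "linear Q" "\<And>x. Q (P x) = x" "\<And>y. P (Q y) = y"
    using isomorphisms_UNIV_UNIV by metis
  have bl: "bounded_linear P" "bounded_linear Q" using PQ linear_conv_bounded_linear by blast+
  define A where "A = (\<lambda>x. matrix (\<lambda>v. P (L x (Q v))))"
  have lin: "linear (\<lambda>v. P (L x (Q v)))" if "x \<in> S" for x
    using linear_compose[OF linear_compose[OF PQ(2) L(1)[OF that]] PQ(1)] by (simp add: o_def)
  have Av: "A x *v v = P (L x (Q v))" if "x \<in> S" for x v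
    unfolding A_def using lin[OF that] by (simp add: matrix_works linear_matrix_vector_mul_eq)
  have "inj (\<lambda>v. P (L x (Q v)))" if "x \<in> S" for x
    using L(2)[OF that] PQ(3,4) unfolding inj_def by metis
  then have det: "det (A x) \<noteq> 0" if "x \<in> S" for x
    using that det_nz_iff_inj[OF lin[OF that]] by (simp add: A_def)
  have smA: "Ck_on k S (\<lambda>x. A x $ i $ j)" for i j
    unfolding A_def matrix_def
    by (simp, intro Ck_on_bounded_linear[OF S bounded_linear_vec_nth]
        Ck_on_bounded_linear[OF S bl(1)] L(3))
  have smb: "Ck_on k S (\<lambda>x. P (b x) $ i)" for i
    by (intro Ck_on_bounded_linear[OF S bounded_linear_vec_nth] Ck_on_bounded_linear[OF S bl(1)] b)
  define W where "W = (\<lambda>x. \<chi> m. det (\<chi> i j. if j = m then P (b x) $ i else A x $ i $ j) * inverse (det (A x)))"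
  have "Ck_on k S W"
  proof (rule Ck_on_componentwise[OF S])
    fix c :: "real^'k" assume "c \<in> Basis"
    then obtain m where c: "c = axis m 1" by (auto simp: Basis_vec_def)
    have 1: "Ck_on k S (\<lambda>x. det (\<chi> i j. if j = m then P (b x) $ i else A x $ i $ j))"
    proof (rule Ck_on_det[OF S])
      show "Ck_on k S (\<lambda>x. (\<chi> i j. if j = m then P (b x) $ i else A x $ i $ j) $ i $ j)" for i j
        by (cases "j = m") (simp_all add: smA smb)
    qed
    have 2: "Ck_on k S (\<lambda>x. inverse (det (A x)))"
      by (rule Ck_on_inverse[OF S Ck_on_det[OF S smA] det])
    have "Ck_on k S (\<lambda>x. det (\<chi> i j. if j = m then P (b x) $ i else A x $ i $ j) * inverse (det (A x)))"
      by (rule Ck_on_bilinear[OF S bounded_bilinear_mult 1 2])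
    then show "Ck_on k S (\<lambda>x. W x \<bullet> c)"
      by (simp add: W_def c inner_axis)
  qed
  then have "Ck_on k S (\<lambda>x. Q (W x))" by (rule Ck_on_bounded_linear[OF S bl(2)])
  moreover have "Q (W x) = w x" if "x \<in> S" for x
  proof -
    have "A x *v P (w x) = P (b x)" using Av[OF that] w[OF that] PQ(3) by simp
    then have "P (w x) = W x"
      unfolding W_def cramer[OF det[OF that]] by (simp add: divide_inverse)
    then show ?thesis using PQ(3) by metis
  qed
  ultimately show ?thesis using Ck_on_cong[OF S, of "\<lambda>x. Q (W x)" w k] by simp
qed

lemma smooth_on_solve:
  fixes L :: "'a::euclidean_space \<Rightarrow> 'b::euclidean_space \<Rightarrow> 'b"
  assumes "open S" "DIM('b) = CARD('k::finite)"
    and "\<And>x. x \<in> S \<Longrightarrow> linear (L x)" "\<And>x. x \<in> S \<Longrightarrow> inj (L x)" "\<And>v. smooth_on S (\<lambda>x. L x v)"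
    and "smooth_on S b" "\<And>x. x \<in> S \<Longrightarrow> L x (w x) = b x"
  shows "smooth_on S w"
  unfolding smooth_on_def
  by (rule allI, rule Ck_on_solve[OF assms(1,2), of L _ b]) (use assms in \<open>auto simp: smooth_on_def\<close>)

text \<open>The classical theorem gives a differentiable inverse \<open>g\<close> with \<open>D f(g y) (D g(y) v) = v\<close>. This is a
  linear system for \<open>D g(y) v\<close> whose coefficients are as regular as \<open>g\<close>, so \<open>g\<close> gains one derivative at
  a time.\<close>

lemma smooth_inverse_function:
  fixes f :: "'b::euclidean_space \<Rightarrow> 'b"
  assumes S: "open S" "smooth_on S f" "x0 \<in> S" and inj: "inj (frechet_derivative f (at x0))"
    and dim: "DIM('b) = CARD('k::finite)"
  obtains U V g where "open U" "U \<subseteq> S" "x0 \<in> U" "open V" "f ` U = V" "g ` V = U" "smooth_on V g"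
    "\<And>x. x \<in> U \<Longrightarrow> g (f x) = x" "\<And>y. y \<in> V \<Longrightarrow> f (g y) = y"
    "\<And>y. y \<in> V \<Longrightarrow> inj (frechet_derivative f (at (g y)))"
proof -
  define D where "D = (\<lambda>x. frechet_derivative f (at x))"
  have der: "(f has_derivative D x) (at x)" if "x \<in> S" for x
    unfolding D_def using smooth_on_has_derivative[OF S(2,1) that] .
  have lin: "linear (D x)" if "x \<in> S" for x using der[OF that] has_derivative_linear by blast
  have app: "blinfun_apply (Blinfun (D x)) = D x" if "x \<in> S" for x
    using der[OF that] by (simp add: bounded_linear_Blinfun_apply has_derivative_bounded_linear)
  have 1: "(f has_derivative blinfun_apply (Blinfun (D x))) (at x)" if "x \<in> S" for x
    using der app that by simp
  have 2: "continuous_on S (\<lambda>x. Blinfun (D x))"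
  proof (rule continuous_on_blinfun_componentwise)
    fix i :: 'b
    have "continuous_on S (\<lambda>x. D x i)"
      unfolding D_def by (rule smooth_on_continuous_on[OF smooth_on_derivative[OF S(2)]])
    then show "continuous_on S (\<lambda>x. blinfun_apply (Blinfun (D x)) i)"
      using app by (simp cong: continuous_on_cong)
  qed
  obtain g0 where g0: "linear g0" "\<And>v. g0 (D x0 v) = v"
    using linear_injective_left_inverse[OF lin[OF S(3)]] inj unfolding D_def
    by (metis comp_apply id_apply)
  have "Blinfun g0 o\<^sub>L Blinfun (D x0) = id_blinfun"
    using g0 app[OF S(3)] by (intro blinfun_eqI) (simp add: bounded_linear_Blinfun_apply linear_conv_bounded_linear)
  from inverse_function_theorem[OF S(1) 1 2 S(3) this]
  obtain U V g g' where *: "open U" "U \<subseteq> S" "x0 \<in> U" "open V" "homeomorphism U V f g"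
    "\<And>y. y \<in> V \<Longrightarrow> (g has_derivative (g' y)) (at y)"
    "\<And>y. y \<in> V \<Longrightarrow> g' y = inv (blinfun_apply (Blinfun (D (g y))))"
    "\<And>y. y \<in> V \<Longrightarrow> bij (blinfun_apply (Blinfun (D (g y))))"
    by metis
  have hom: "f ` U = V" "g ` V = U" "\<And>x. x \<in> U \<Longrightarrow> g (f x) = x" "\<And>y. y \<in> V \<Longrightarrow> f (g y) = y"
    using *(5) unfolding homeomorphism_def by auto
  have gS: "g y \<in> S" if "y \<in> V" for y using hom(2) *(2) that by auto
  have bij: "bij (D (g y))" if "y \<in> V" for y using *(8)[OF that] app[OF gS[OF that]] by simp
  have g': "D (g y) (g' y v) = v" if "y \<in> V" for y v
    using *(7)[OF that] app[OF gS[OF that]] bij[OF that] by (simp add: surj_f_inv_f bij_is_surj)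
  have "Ck_on k V g" for k
  proof (induction k)
    case 0
    then show ?case using *(5) by (simp add: homeomorphism_def)
  next
    case (Suc k)
    show ?case
    proof (rule Ck_on_SucI[OF *(4) *(6)])
      fix v
      show "Ck_on k V (\<lambda>y. g' y v)"
      proof (rule Ck_on_solve[OF *(4) dim, of "\<lambda>y. D (g y)" _ "\<lambda>_. v"])
        show "Ck_on k V (\<lambda>y. D (g y) w)" for w
          by (rule Ck_on_compose[OF *(4) S(1) Suc])
            (use smooth_on_derivative[OF S(2)] gS in \<open>auto simp: D_def smooth_on_def\<close>)
      qed (use lin gS bij g' *(4) in \<open>auto simp: bij_is_inj Ck_on_const\<close>)
    qed
  qed
  then have "smooth_on V g" by (simp add: smooth_on_def)
  then show thesis
    using that[OF *(1-4) hom(1,2) _ hom(3,4)] bij by (auto simp: D_def bij_is_inj)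
qed

section \<open>Smooth maps in charts\<close>

lemma cinv_cmap: "is_chart c \<Longrightarrow> q \<in> cdom c \<Longrightarrow> cinv c (cmap c q) = q"
  by (simp add: is_chart_def)

lemma cinv_image:
  assumes "is_chart c" "y \<in> cmap c ` cdom c"
  shows "cinv c y \<in> cdom c" "cmap c (cinv c y) = y"
  using assms by (auto simp: inv_into_into f_inv_into_f)

lemma openin_mtop:
  assumes "is_atlas A"
  shows "openin (mtop A) W \<longleftrightarrow> W \<subseteq> carrier_of A \<and> (\<forall>c\<in>A. open (cmap c ` (W \<inter> cdom c)))"
proof -
  have "istopology (\<lambda>W. W \<subseteq> carrier_of A \<and> (\<forall>c\<in>A. open (cmap c ` (W \<inter> cdom c))))"
    unfolding istopology_def
  proof (intro conjI allI impI ballI)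
    fix S T c
    assume *: "S \<subseteq> carrier_of A \<and> (\<forall>c\<in>A. open (cmap c ` (S \<inter> cdom c)))"
      "T \<subseteq> carrier_of A \<and> (\<forall>c\<in>A. open (cmap c ` (T \<inter> cdom c)))"
    show "S \<inter> T \<subseteq> carrier_of A" using * by blast
    assume c: "c \<in> A"
    then have "inj_on (cmap c) (cdom c)" using assms by (auto simp: is_atlas_def is_chart_def)
    then have "cmap c ` (S \<inter> T \<inter> cdom c) = cmap c ` (S \<inter> cdom c) \<inter> cmap c ` (T \<inter> cdom c)"
      unfolding inj_on_def by blast
    then show "open (cmap c ` (S \<inter> T \<inter> cdom c))" using * c by auto
  next
    fix K assume *: "\<forall>W\<in>K. W \<subseteq> carrier_of A \<and> (\<forall>c\<in>A. open (cmap c ` (W \<inter> cdom c)))"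
    then show "\<Union>K \<subseteq> carrier_of A" by blast
    fix c assume c: "c \<in> A"
    have "cmap c ` (\<Union>K \<inter> cdom c) = (\<Union>W\<in>K. cmap c ` (W \<inter> cdom c))" by auto
    then show "open (cmap c ` (\<Union>K \<inter> cdom c))" using * c by auto
  qed
  then show ?thesis unfolding mtop_def by (simp add: topology_inverse')
qed

lemma topspace_mtop:
  assumes "is_atlas A"
  shows "topspace (mtop A) = carrier_of A"
proof -
  have "openin (mtop A) (carrier_of A)"
    unfolding openin_mtop[OF assms]
  proof (intro conjI ballI)
    fix c assume "c \<in> A"
    then have "carrier_of A \<inter> cdom c = cdom c" "is_chart c"
      using assms by (auto simp: carrier_of_def is_atlas_def)
    then show "open (cmap c ` (carrier_of A \<inter> cdom c))" by (simp add: is_chart_def)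
  qed auto
  then show ?thesis
    using openin_mtop[OF assms] openin_subset openin_topspace by (metis subset_antisym)
qed

text \<open>Smoothness of a map at one point, in one pair of charts. Requiring a whole neighbourhood in which
  the map is defined and takes values in the second chart makes the notion stable under composition
  and under change of charts.\<close>

definition rep_smooth_at ::
  "('a, 'b::euclidean_space) chart \<Rightarrow> ('c, 'd::euclidean_space) chart \<Rightarrow> 'a set \<Rightarrow> ('a \<Rightarrow> 'c) \<Rightarrow> 'a \<Rightarrow> bool" where
  "rep_smooth_at c d U f p \<longleftrightarrow> (\<exists>T. open T \<and> cmap c p \<in> T \<and>
     T \<subseteq> cmap c ` {q \<in> U \<inter> cdom c. f q \<in> cdom d} \<and> smooth_on T (cmap d \<circ> f \<circ> cinv c))"

lemma rep_smooth_at_mono: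
  assumes "rep_smooth_at c d U f p" "U \<subseteq> V"
  shows "rep_smooth_at c d V f p"
proof -
  obtain T where T: "open T" "cmap c p \<in> T" "T \<subseteq> cmap c ` {q \<in> U \<inter> cdom c. f q \<in> cdom d}"
    "smooth_on T (cmap d \<circ> f \<circ> cinv c)"
    using assms(1) unfolding rep_smooth_at_def by blast
  have "T \<subseteq> cmap c ` {q \<in> V \<inter> cdom c. f q \<in> cdom d}" using T(3) assms(2) by blast
  then show ?thesis unfolding rep_smooth_at_def using T by blast
qed

lemma rep_smooth_at_transition:
  assumes "smooth_transition c d" "p \<in> cdom c" "p \<in> cdom d"
  shows "rep_smooth_at c d UNIV (\<lambda>q. q) p"
  using assms unfolding rep_smooth_at_def smooth_transition_def
  by (intro exI[of _ "cmap c ` (cdom c \<inter> cdom d)"]) (auto simp: o_def)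

text \<open>Two maps compose in coordinates only near the point, where the intermediate value stays in the
  middle chart. The neighbourhood found here serves both for smoothness and for the chain rule.\<close>

lemma rep_smooth_at_compose_near:
  assumes ch: "is_chart c" "is_chart d" and p: "p \<in> cdom c"
    and f: "rep_smooth_at c d U f p" and g: "rep_smooth_at d e V g (f p)"
  obtains T where "open T" "cmap c p \<in> T" "T \<subseteq> cmap c ` {q \<in> U \<inter> cdom c. f q \<in> V \<and> f q \<in> cdom d \<and> g (f q) \<in> cdom e}"
    "smooth_on T (cmap e \<circ> (\<lambda>q. g (f q)) \<circ> cinv c)"
    "\<forall>y\<in>T. (cmap e \<circ> (\<lambda>q. g (f q)) \<circ> cinv c) y = (cmap e \<circ> g \<circ> cinv d) ((cmap d \<circ> f \<circ> cinv c) y)"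
    "((cmap d \<circ> f \<circ> cinv c) has_derivative frechet_derivative (cmap d \<circ> f \<circ> cinv c) (at (cmap c p))) (at (cmap c p))"
    "((cmap e \<circ> g \<circ> cinv d) has_derivative frechet_derivative (cmap e \<circ> g \<circ> cinv d) (at (cmap d (f p)))) (at (cmap d (f p)))"
proof -
  obtain T1 where T1: "open T1" "cmap c p \<in> T1" "T1 \<subseteq> cmap c ` {q \<in> U \<inter> cdom c. f q \<in> cdom d}"
    "smooth_on T1 (cmap d \<circ> f \<circ> cinv c)"
    using f unfolding rep_smooth_at_def by blast
  obtain T2 where T2: "open T2" "cmap d (f p) \<in> T2" "T2 \<subseteq> cmap d ` {q \<in> V \<inter> cdom d. g q \<in> cdom e}"
    "smooth_on T2 (cmap e \<circ> g \<circ> cinv d)"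
    using g unfolding rep_smooth_at_def by blast
  define T where "T = T1 \<inter> (cmap d \<circ> f \<circ> cinv c) -` T2"
  have "open T"
    unfolding T_def using continuous_open_preimage[OF smooth_on_continuous_on[OF T1(4)] T1(1) T2(1)] .
  have fp: "f p \<in> cdom d"
  proof -
    obtain q where "q \<in> cdom c" "f q \<in> cdom d" "cmap c q = cmap c p" using T1(2,3) by auto
    then show ?thesis using p ch(1) by (metis cinv_cmap)
  qed
  have mem: "cmap c p \<in> T"
    using T1(2) T2(2) p ch(1) by (simp add: T_def cinv_cmap)
  have pt: "\<exists>q. y = cmap c q \<and> q \<in> U \<inter> cdom c \<and> f q \<in> V \<and> f q \<in> cdom d \<and> g (f q) \<in> cdom e" if y: "y \<in> T" for y
  proof -
    obtain q where q: "q \<in> U \<inter> cdom c" "f q \<in> cdom d" "y = cmap c q" using T1(3) y unfolding T_def by blast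
    then have "cmap d (f q) \<in> T2" using y ch(1) by (simp add: T_def cinv_cmap)
    then obtain q' where "q' \<in> V \<inter> cdom d" "g q' \<in> cdom e" "cmap d q' = cmap d (f q)" using T2(3) by auto
    then have "f q \<in> V" "g (f q) \<in> cdom e" using q(2) ch(2) by (metis IntD1 IntD2 cinv_cmap)+
    then show ?thesis using q by blast
  qed
  have eq: "(cmap e \<circ> (\<lambda>q. g (f q)) \<circ> cinv c) y = (cmap e \<circ> g \<circ> cinv d) ((cmap d \<circ> f \<circ> cinv c) y)" if "y \<in> T" for y
    using pt[OF that] ch by (auto simp: cinv_cmap)
  have "smooth_on T (\<lambda>y. (cmap e \<circ> g \<circ> cinv d) ((cmap d \<circ> f \<circ> cinv c) y))"
    by (rule smooth_on_compose[OF T2(4) smooth_on_subset[OF T1(4)] \<open>open T\<close> T2(1)]) (auto simp: T_def)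
  then have sm: "smooth_on T (cmap e \<circ> (\<lambda>q. g (f q)) \<circ> cinv c)"
    by (rule smooth_on_eq[OF _ \<open>open T\<close>]) (rule eq[symmetric])
  have sub: "T \<subseteq> cmap c ` {q \<in> U \<inter> cdom c. f q \<in> V \<and> f q \<in> cdom d \<and> g (f q) \<in> cdom e}"
    using pt by blast
  show thesis
    by (rule that[OF \<open>open T\<close> mem sub sm ballI[OF eq] smooth_on_has_derivative[OF T1(4,1,2)] smooth_on_has_derivative[OF T2(4,1,2)]])
qed

lemma rep_smooth_at_compose:
  assumes "is_chart c" "is_chart d" "p \<in> cdom c" "rep_smooth_at c d U f p" "rep_smooth_at d e V g (f p)"
  shows "rep_smooth_at c e {q \<in> U. f q \<in> V} (\<lambda>q. g (f q)) p"
proof -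
  obtain T where T: "open T" "cmap c p \<in> T" "T \<subseteq> cmap c ` {q \<in> U \<inter> cdom c. f q \<in> V \<and> f q \<in> cdom d \<and> g (f q) \<in> cdom e}"
    "smooth_on T (cmap e \<circ> (\<lambda>q. g (f q)) \<circ> cinv c)"
    "\<forall>y\<in>T. (cmap e \<circ> (\<lambda>q. g (f q)) \<circ> cinv c) y = (cmap e \<circ> g \<circ> cinv d) ((cmap d \<circ> f \<circ> cinv c) y)"
    "((cmap d \<circ> f \<circ> cinv c) has_derivative frechet_derivative (cmap d \<circ> f \<circ> cinv c) (at (cmap c p))) (at (cmap c p))"
    "((cmap e \<circ> g \<circ> cinv d) has_derivative frechet_derivative (cmap e \<circ> g \<circ> cinv d) (at (cmap d (f p)))) (at (cmap d (f p)))"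
    by (rule rep_smooth_at_compose_near[OF assms]) (rule that; assumption)
  then show ?thesis unfolding rep_smooth_at_def by (intro exI[of _ T]) auto
qed

lemma derivative_compose_rep:
  assumes "is_chart c" "is_chart d" "p \<in> cdom c" "rep_smooth_at c d U f p" "rep_smooth_at d e V g (f p)"
  shows "frechet_derivative (cmap e \<circ> (\<lambda>q. g (f q)) \<circ> cinv c) (at (cmap c p)) v
    = frechet_derivative (cmap e \<circ> g \<circ> cinv d) (at (cmap d (f p)))
        (frechet_derivative (cmap d \<circ> f \<circ> cinv c) (at (cmap c p)) v)"
proof -
  obtain T where T: "open T" "cmap c p \<in> T" "T \<subseteq> cmap c ` {q \<in> U \<inter> cdom c. f q \<in> V \<and> f q \<in> cdom d \<and> g (f q) \<in> cdom e}"
    "smooth_on T (cmap e \<circ> (\<lambda>q. g (f q)) \<circ> cinv c)"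
    "\<forall>y\<in>T. (cmap e \<circ> (\<lambda>q. g (f q)) \<circ> cinv c) y = (cmap e \<circ> g \<circ> cinv d) ((cmap d \<circ> f \<circ> cinv c) y)"
    "((cmap d \<circ> f \<circ> cinv c) has_derivative frechet_derivative (cmap d \<circ> f \<circ> cinv c) (at (cmap c p))) (at (cmap c p))"
    "((cmap e \<circ> g \<circ> cinv d) has_derivative frechet_derivative (cmap e \<circ> g \<circ> cinv d) (at (cmap d (f p)))) (at (cmap d (f p)))"
    by (rule rep_smooth_at_compose_near[OF assms]) (rule that; assumption)
  have e0: "(cmap d \<circ> f \<circ> cinv c) (cmap c p) = cmap d (f p)" using assms by (simp add: cinv_cmap)
  have "frechet_derivative (cmap e \<circ> (\<lambda>q. g (f q)) \<circ> cinv c) (at (cmap c p))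
      = frechet_derivative (\<lambda>y. (cmap e \<circ> g \<circ> cinv d) ((cmap d \<circ> f \<circ> cinv c) y)) (at (cmap c p))"
    by (rule frechet_derivative_cong[OF T(1,2)]) (rule T(5)[rule_format])
  also have "\<dots> = (\<lambda>v. frechet_derivative (cmap e \<circ> g \<circ> cinv d) (at (cmap d (f p)))
      (frechet_derivative (cmap d \<circ> f \<circ> cinv c) (at (cmap c p)) v))"
    by (rule frechet_derivative_compose[OF T(6)]) (simp only: e0 T(7))
  finally show ?thesis by simp
qed

lemma rep_smooth_at_derivative:
  assumes "rep_smooth_at c d U f p"
  shows "((cmap d \<circ> f \<circ> cinv c) has_derivative frechet_derivative (cmap d \<circ> f \<circ> cinv c) (at (cmap c p))) (at (cmap c p))"
    "linear (frechet_derivative (cmap d \<circ> f \<circ> cinv c) (at (cmap c p)))"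
proof -
  obtain T where "open T" "cmap c p \<in> T" "smooth_on T (cmap d \<circ> f \<circ> cinv c)"
    using assms unfolding rep_smooth_at_def by blast
  from smooth_on_has_derivative[OF this(3,1,2)] smooth_on_linear_derivative[OF this(3,1,2)]
  show "((cmap d \<circ> f \<circ> cinv c) has_derivative frechet_derivative (cmap d \<circ> f \<circ> cinv c) (at (cmap c p))) (at (cmap c p))"
    "linear (frechet_derivative (cmap d \<circ> f \<circ> cinv c) (at (cmap c p)))" .
qed

lemma max_atlas_supset: "is_atlas A \<Longrightarrow> c \<in> A \<Longrightarrow> c \<in> max_atlas A"
  unfolding is_atlas_def max_atlas_def carrier_of_def by auto

lemma max_atlas_chart: "c \<in> max_atlas A \<Longrightarrow> is_chart c"
  unfolding max_atlas_def by simp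

lemma atlas_chart: "is_atlas A \<Longrightarrow> c \<in> A \<Longrightarrow> is_chart c"
  unfolding is_atlas_def by simp

lemma max_atlas_carrier: "c \<in> max_atlas A \<Longrightarrow> q \<in> cdom c \<Longrightarrow> \<exists>a\<in>A. q \<in> cdom a"
  unfolding max_atlas_def carrier_of_def by blast

text \<open>Two charts of the maximal atlas need not be compared directly: near each point the transition
  passes through a chart of the given atlas.\<close>

lemma rep_smooth_at_max_atlas:
  assumes A: "is_atlas A" and c: "c \<in> max_atlas A" "d \<in> max_atlas A" and p: "p \<in> cdom c" "p \<in> cdom d"
  shows "rep_smooth_at c d UNIV (\<lambda>q. q) p"
proof -
  obtain a where a: "a \<in> A" "p \<in> cdom a" using max_atlas_carrier c(1) p(1) by metis
  have tr: "smooth_transition c a" "smooth_transition a d" "is_chart c" 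
    using c a max_atlas_chart[OF c(1)] max_atlas_chart[OF c(2)] unfolding max_atlas_def by auto
  have "rep_smooth_at c d {q \<in> UNIV. q \<in> UNIV} (\<lambda>q. q) p"
    by (rule rep_smooth_at_compose[of c a p UNIV "\<lambda>q. q" d UNIV "\<lambda>q. q"])
      (use tr p a A in \<open>auto intro: rep_smooth_at_transition atlas_chart\<close>)
  then show ?thesis by simp
qed

lemma rep_smooth_at_change:
  assumes A: "is_atlas A" "is_atlas B" and f: "rep_smooth_at c d U f p"
    and c: "c \<in> max_atlas A" "c' \<in> max_atlas A" "p \<in> cdom c" "p \<in> cdom c'"
    and d: "d \<in> max_atlas B" "d' \<in> max_atlas B" "f p \<in> cdom d" "f p \<in> cdom d'"
  shows "rep_smooth_at c' d' U f p"
proof -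
  have "rep_smooth_at c d' {q \<in> U. f q \<in> UNIV} (\<lambda>q. f q) p"
    by (rule rep_smooth_at_compose[OF _ _ c(3) f, of d' UNIV "\<lambda>q. q"])
      (use c d in \<open>auto intro: max_atlas_chart rep_smooth_at_max_atlas[OF A(2)]\<close>)
  then have f': "rep_smooth_at c d' U f p" by simp
  have "rep_smooth_at c' d' {q \<in> UNIV. q \<in> U} (\<lambda>q. f q) p"
    by (rule rep_smooth_at_compose[of c' c p UNIV "\<lambda>q. q", OF _ _ _ _ f'])
      (use c in \<open>auto intro: max_atlas_chart rep_smooth_at_max_atlas[OF A(1)]\<close>)
  then show ?thesis by simp
qed

lemma rep_set_open:
  assumes "\<And>p. p \<in> U \<Longrightarrow> p \<in> cdom c \<Longrightarrow> f p \<in> cdom d \<Longrightarrow> rep_smooth_at c d U f p"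
  shows "open (cmap c ` {q \<in> U \<inter> cdom c. f q \<in> cdom d})"
    "smooth_on (cmap c ` {q \<in> U \<inter> cdom c. f q \<in> cdom d}) (cmap d \<circ> f \<circ> cinv c)"
proof -
  let ?S = "cmap c ` {q \<in> U \<inter> cdom c. f q \<in> cdom d}"
  have loc: "\<exists>T. open T \<and> y \<in> T \<and> T \<subseteq> ?S \<and> smooth_on T (cmap d \<circ> f \<circ> cinv c)" if "y \<in> ?S" for y
    using that assms unfolding rep_smooth_at_def by blast
  then show "open ?S" by (subst open_subopen) blast
  then show "smooth_on ?S (cmap d \<circ> f \<circ> cinv c)"
    by (rule smooth_on_local) (use loc in blast)
qed

lemma smooth_map_on_subset: "smooth_map_on A B U f \<Longrightarrow> is_atlas A \<Longrightarrow> U \<subseteq> carrier_of A"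
  unfolding smooth_map_on_def using openin_subset topspace_mtop by metis

lemma smooth_map_on_range: "smooth_map_on A B U f \<Longrightarrow> is_atlas A \<Longrightarrow> is_atlas B \<Longrightarrow> p \<in> U \<Longrightarrow> f p \<in> carrier_of B"
  unfolding smooth_map_on_def continuous_map_def using topspace_mtop openin_subset
  by (metis (no_types, lifting) IntI Pi_iff subsetD topspace_subtopology)

lemma smooth_map_on_preimage:
  assumes A: "is_atlas A" and f: "smooth_map_on A B U f" and V: "openin (mtop B) V"
  shows "openin (mtop A) {q \<in> U. f q \<in> V}"
proof -
  have "openin (subtopology (mtop A) U) {q \<in> topspace (subtopology (mtop A) U). f q \<in> V}"
    using f V unfolding smooth_map_on_def continuous_map_def by blast
  moreover have "openin (mtop A) U" using f by (simp add: smooth_map_on_def)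
  ultimately have "openin (mtop A) {q \<in> topspace (subtopology (mtop A) U). f q \<in> V}"
    using openin_trans_full by blast
  moreover have "topspace (subtopology (mtop A) U) = U"
    using smooth_map_on_subset[OF f A] topspace_mtop[OF A] by auto
  ultimately show ?thesis by (simp only:)
qed

lemma smooth_map_on_restrict:
  assumes f: "smooth_map_on A B U f" and V: "openin (mtop A) V" "V \<subseteq> U"
  shows "smooth_map_on A B V f"
proof -
  have "continuous_map (subtopology (mtop A) V) (mtop B) f"
    using f V(2) continuous_map_from_subtopology_mono unfolding smooth_map_on_def by blast
  moreover have "smooth_on (cmap c ` {p \<in> V \<inter> cdom c. f p \<in> cdom d}) (cmap d \<circ> f \<circ> cinv c)"
    if "c \<in> A" "d \<in> B" for c d
  proof (rule smooth_on_subset)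
    show "smooth_on (cmap c ` {p \<in> U \<inter> cdom c. f p \<in> cdom d}) (cmap d \<circ> f \<circ> cinv c)"
      using f that unfolding smooth_map_on_def by blast
  qed (use V(2) in blast)
  ultimately show ?thesis using V(1) unfolding smooth_map_on_def by blast
qed

lemma openin_cdom:
  assumes "is_atlas A" "c \<in> A"
  shows "openin (mtop A) (cdom c)"
  unfolding openin_mtop[OF assms(1)]
proof (intro conjI ballI)
  show "cdom c \<subseteq> carrier_of A" using assms by (auto simp: carrier_of_def)
  fix e assume "e \<in> A"
  then have "smooth_transition e c" using assms by (simp add: is_atlas_def)
  then show "open (cmap e ` (cdom c \<inter> cdom e))" by (simp add: smooth_transition_def Int_commute)
qed

lemma smooth_map_on_rep:
  assumes A: "is_atlas A" "is_atlas B" and f: "smooth_map_on A B U f"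
    and c: "c \<in> max_atlas A" "p \<in> cdom c" and d: "d \<in> max_atlas B" "f p \<in> cdom d" and p: "p \<in> U"
  shows "rep_smooth_at c d U f p"
proof -
  obtain a where a: "a \<in> A" "p \<in> cdom a" using max_atlas_carrier c by metis
  obtain b where b: "b \<in> B" "f p \<in> cdom b" using max_atlas_carrier d by metis
  have "openin (mtop A) {q \<in> U. f q \<in> cdom b}"
    by (rule smooth_map_on_preimage[OF A(1) f openin_cdom[OF A(2) b(1)]])
  then have "open (cmap a ` ({q \<in> U. f q \<in> cdom b} \<inter> cdom a))"
    using a by (simp add: openin_mtop[OF A(1)])
  moreover have "{q \<in> U. f q \<in> cdom b} \<inter> cdom a = {q \<in> U \<inter> cdom a. f q \<in> cdom b}" by auto
  ultimately have "rep_smooth_at a b U f p"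
    unfolding rep_smooth_at_def using a b p f
    by (intro exI[of _ "cmap a ` {q \<in> U \<inter> cdom a. f q \<in> cdom b}"]) (auto simp: smooth_map_on_def)
  then show ?thesis
    by (rule rep_smooth_at_change[OF A]) (use a b c d A in \<open>auto intro: max_atlas_supset\<close>)
qed

text \<open>Smoothness, continuity included, is a local matter: it suffices to exhibit one good pair of charts at
  each point, and these may come from the maximal atlases.\<close>

lemma smooth_map_onI:
  assumes A: "is_atlas A" "is_atlas B"
    and loc: "\<And>p. p \<in> U \<Longrightarrow> \<exists>c\<in>max_atlas A. \<exists>d\<in>max_atlas B. p \<in> cdom c \<and> f p \<in> cdom d \<and> rep_smooth_at c d U f p"
  shows "smooth_map_on A B U f"
proof -
  have sm: "rep_smooth_at c d U f p" if "c \<in> A" "d \<in> B" "p \<in> U" "p \<in> cdom c" "f p \<in> cdom d" for c d p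
    using loc[OF that(3)] rep_smooth_at_change[OF A] that A max_atlas_supset by metis
  have U: "U \<subseteq> carrier_of A" using loc max_atlas_carrier unfolding carrier_of_def by fastforce
  have fU: "f ` U \<subseteq> carrier_of B" using loc max_atlas_carrier unfolding carrier_of_def by fastforce
  have pre: "openin (mtop A) {q \<in> U. f q \<in> W}" if W: "openin (mtop B) W" for W
    unfolding openin_mtop[OF A(1)]
  proof (intro conjI ballI)
    show "{q \<in> U. f q \<in> W} \<subseteq> carrier_of A" using U by auto
    fix c assume c: "c \<in> A"
    have ch: "is_chart c" using A c atlas_chart by blast
    have "\<exists>T. open T \<and> y \<in> T \<and> T \<subseteq> cmap c ` ({q \<in> U. f q \<in> W} \<inter> cdom c)"
      if y: "y \<in> cmap c ` ({q \<in> U. f q \<in> W} \<inter> cdom c)" for y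
    proof -
      obtain p where p: "p \<in> U" "f p \<in> W" "p \<in> cdom c" "y = cmap c p" using y by auto
      obtain d where d: "d \<in> B" "f p \<in> cdom d" using fU p(1) by (auto simp: carrier_of_def)
      have dch: "is_chart d" using A d atlas_chart by blast
      obtain T where T: "open T" "cmap c p \<in> T" "T \<subseteq> cmap c ` {q \<in> U \<inter> cdom c. f q \<in> cdom d}"
        "smooth_on T (cmap d \<circ> f \<circ> cinv c)"
        using sm[OF c d(1) p(1,3) d(2)] unfolding rep_smooth_at_def by blast
      have oW: "open (cmap d ` (W \<inter> cdom d))" using W d by (simp add: openin_mtop[OF A(2)])
      let ?T = "T \<inter> (cmap d \<circ> f \<circ> cinv c) -` (cmap d ` (W \<inter> cdom d))"
      have "open ?T"
        using continuous_open_preimage[OF smooth_on_continuous_on[OF T(4)] T(1) oW] .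
      moreover have "y \<in> ?T" using T(2) p d ch by (simp add: cinv_cmap)
      moreover have "?T \<subseteq> cmap c ` ({q \<in> U. f q \<in> W} \<inter> cdom c)"
      proof
        fix z assume z: "z \<in> ?T"
        then obtain q where q: "q \<in> U" "q \<in> cdom c" "f q \<in> cdom d" "z = cmap c q" using T(3) by auto
        then have "cmap d (f q) \<in> cmap d ` (W \<inter> cdom d)" using z ch by (simp add: cinv_cmap)
        then obtain q' where q': "q' \<in> W" "q' \<in> cdom d" "cmap d (f q) = cmap d q'" by blast
        have "inj_on (cmap d) (cdom d)" using dch by (simp add: is_chart_def)
        from inj_onD[OF this q'(3) q(3) q'(2)] have "f q \<in> W" using q'(1) by simp
        then show "z \<in> cmap c ` ({q \<in> U. f q \<in> W} \<inter> cdom c)" using q by auto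
      qed
      ultimately show ?thesis by blast
    qed
    then show "open (cmap c ` ({q \<in> U. f q \<in> W} \<inter> cdom c))" by (subst open_subopen) blast
  qed
  have "openin (mtop A) {q \<in> U. f q \<in> carrier_of B}" using pre topspace_mtop[OF A(2)] by (metis openin_topspace)
  moreover have "{q \<in> U. f q \<in> carrier_of B} = U" using fU by auto
  ultimately have oU: "openin (mtop A) U" by simp
  have tU: "topspace (subtopology (mtop A) U) = U" using U topspace_mtop[OF A(1)] by auto
  have "continuous_map (subtopology (mtop A) U) (mtop B) f"
    unfolding continuous_map_def tU
  proof (intro conjI allI impI)
    show "f \<in> U \<rightarrow> topspace (mtop B)" using fU topspace_mtop[OF A(2)] by auto
    fix W assume "openin (mtop B) W"
    from pre[OF this] show "openin (subtopology (mtop A) U) {x \<in> U. f x \<in> W}"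
      by (simp add: openin_open_subtopology[OF oU])
  qed
  moreover have "smooth_on (cmap c ` {p \<in> U \<inter> cdom c. f p \<in> cdom d}) (cmap d \<circ> f \<circ> cinv c)" if "c \<in> A" "d \<in> B" for c d
    by (rule rep_set_open(2)) (rule sm[OF that])
  ultimately show ?thesis using oU unfolding smooth_map_on_def by blast
qed

lemma atlas_cover: "x \<in> carrier_of A \<Longrightarrow> is_atlas A \<Longrightarrow> \<exists>c\<in>max_atlas A. c \<in> A \<and> x \<in> cdom c"
  using max_atlas_supset unfolding carrier_of_def by blast

lemma smooth_map_on_compose:
  assumes A: "is_atlas A" "is_atlas B" "is_atlas C"
    and f: "smooth_map_on A B U f" and g: "smooth_map_on B C V g" and UV: "f ` U \<subseteq> V"
  shows "smooth_map_on A C U (\<lambda>q. g (f q))"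
proof (rule smooth_map_onI[OF A(1,3)])
  fix p assume p: "p \<in> U"
  obtain c where c: "c \<in> max_atlas A" "p \<in> cdom c" using atlas_cover smooth_map_on_subset f A p by (metis subsetD)
  obtain d where d: "d \<in> max_atlas B" "f p \<in> cdom d" using atlas_cover smooth_map_on_range f A p by metis
  obtain e where e: "e \<in> max_atlas C" "g (f p) \<in> cdom e" using atlas_cover smooth_map_on_range g A p UV by (metis imageI subsetD)
  have "rep_smooth_at c e {q \<in> U. f q \<in> V} (\<lambda>q. g (f q)) p"
    by (rule rep_smooth_at_compose[OF _ _ c(2) smooth_map_on_rep[OF A(1,2) f c d p]
          smooth_map_on_rep[OF A(2,3) g d e]])
      (use UV p c d in \<open>auto intro: max_atlas_chart\<close>)
  moreover have "{q \<in> U. f q \<in> V} = U" using UV by auto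
  ultimately show "\<exists>c\<in>max_atlas A. \<exists>d\<in>max_atlas C. p \<in> cdom c \<and> g (f p) \<in> cdom d \<and> rep_smooth_at c d U (\<lambda>q. g (f q)) p"
    using c e by auto
qed

lemma smooth_map_on_from_model:
  assumes A: "is_atlas A" "is_atlas B" and c: "c \<in> max_atlas A" "d \<in> max_atlas B"
    and N: "open N" "N \<subseteq> cmap c ` cdom c" "smooth_on N h" "h ` N \<subseteq> cmap d ` cdom d"
  shows "smooth_map_on A B {q \<in> cdom c. cmap c q \<in> N} (\<lambda>q. cinv d (h (cmap c q)))"
proof (rule smooth_map_onI[OF A])
  fix p assume p: "p \<in> {q \<in> cdom c. cmap c q \<in> N}"
  have ch: "is_chart c" "is_chart d" using max_atlas_chart[OF c(1)] max_atlas_chart[OF c(2)] .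
  have hd: "cinv d (h (cmap c q)) \<in> cdom d" if "q \<in> cdom c" "cmap c q \<in> N" for q
    using cinv_image[OF ch(2)] N(4) that by blast
  have eq: "(cmap d \<circ> (\<lambda>q. cinv d (h (cmap c q))) \<circ> cinv c) y = h y" if "y \<in> N" for y
  proof -
    have "y \<in> cmap c ` cdom c" "h y \<in> cmap d ` cdom d" using that N by blast+
    then show ?thesis by (simp add: cinv_image(2)[OF ch(1)] cinv_image(2)[OF ch(2)])
  qed
  have "N \<subseteq> cmap c ` {q \<in> {q \<in> cdom c. cmap c q \<in> N} \<inter> cdom c. cinv d (h (cmap c q)) \<in> cdom d}"
    using N(2) hd by blast
  moreover have "smooth_on N (cmap d \<circ> (\<lambda>q. cinv d (h (cmap c q))) \<circ> cinv c)"
    by (rule smooth_on_eq[OF N(3,1)]) (rule eq[symmetric])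
  ultimately have "rep_smooth_at c d {q \<in> cdom c. cmap c q \<in> N} (\<lambda>q. cinv d (h (cmap c q))) p"
    unfolding rep_smooth_at_def using N(1) p by (intro exI[of _ N]) auto
  then show "\<exists>c'\<in>max_atlas A. \<exists>d'\<in>max_atlas B. p \<in> cdom c' \<and> cinv d (h (cmap c p)) \<in> cdom d' \<and>
      rep_smooth_at c' d' {q \<in> cdom c. cmap c q \<in> N} (\<lambda>q. cinv d (h (cmap c q))) p"
    by (intro bexI[of _ c] bexI[of _ d]) (use p hd c in auto)
qed

section \<open>Tangent maps\<close>

abbreviation rep_deriv ::
  "('a, 'b::euclidean_space) chart \<Rightarrow> ('c, 'd::euclidean_space) chart \<Rightarrow> ('a \<Rightarrow> 'c) \<Rightarrow> 'a \<Rightarrow> 'b \<Rightarrow> 'd" where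
  "rep_deriv c d f p \<equiv> frechet_derivative (cmap d \<circ> f \<circ> cinv c) (at (cmap c p))"

lemma rep_deriv_id: "rep_deriv c d (\<lambda>q. q) p = frechet_derivative (cmap d \<circ> cinv c) (at (cmap c p))"
proof -
  have "cmap d \<circ> (\<lambda>q. q) \<circ> cinv c = cmap d \<circ> cinv c" by auto
  then show ?thesis by simp
qed

lemma tangent_space_change:
  assumes "v \<in> tangent_space A p" "c \<in> A" "d \<in> A" "p \<in> cdom c" "p \<in> cdom d"
  shows "v d = rep_deriv c d (\<lambda>q. q) p (v c)"
  using assms unfolding rep_deriv_id tangent_space_def by blast

lemma tangent_spaceI:
  assumes "\<And>c. \<not> (c \<in> A \<and> p \<in> cdom c) \<Longrightarrow> v c = 0"
    and "\<And>c d. c \<in> A \<Longrightarrow> d \<in> A \<Longrightarrow> p \<in> cdom c \<Longrightarrow> p \<in> cdom d \<Longrightarrow> v d = rep_deriv c d (\<lambda>q. q) p (v c)"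
  shows "v \<in> tangent_space A p"
  using assms unfolding tangent_space_def rep_deriv_id by blast

lemma tangent_space_zero: "v \<in> tangent_space A p \<Longrightarrow> \<not> (c \<in> A \<and> p \<in> cdom c) \<Longrightarrow> v c = 0"
  unfolding tangent_space_def by blast

lemma rep_smooth_at_id:
  "is_atlas A \<Longrightarrow> c \<in> A \<Longrightarrow> d \<in> A \<Longrightarrow> p \<in> cdom c \<Longrightarrow> p \<in> cdom d \<Longrightarrow> rep_smooth_at c d UNIV (\<lambda>q. q) p"
  by (rule rep_smooth_at_transition) (auto simp: is_atlas_def)

lemma smooth_map_on_rep_atlas:
  assumes "is_atlas A" "is_atlas B" "smooth_map_on A B U f"
    and "c \<in> A" "p \<in> cdom c" "d \<in> B" "f p \<in> cdom d" "p \<in> U"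
  shows "rep_smooth_at c d U f p"
  by (rule smooth_map_on_rep[OF assms(1,2,3) max_atlas_supset[OF assms(1,4)] assms(5)
        max_atlas_supset[OF assms(2,6)] assms(7,8)])

lemma tangent_map_apply:
  assumes A: "is_atlas A" "is_atlas B" and f: "smooth_map_on A B U f" "p \<in> U"
    and v: "v \<in> tangent_space A p" and c: "c \<in> A" "p \<in> cdom c" and d: "d \<in> B" "f p \<in> cdom d"
  shows "tangent_map A B f p v d = rep_deriv c d f p (v c)"
proof -
  define c0 where "c0 = (SOME c. c \<in> A \<and> p \<in> cdom c)"
  have c0: "c0 \<in> A" "p \<in> cdom c0"
    using someI[of "\<lambda>c. c \<in> A \<and> p \<in> cdom c" c] c unfolding c0_def by auto
  have "rep_deriv c0 d (\<lambda>q. f q) p (v c0) = rep_deriv c d f p (rep_deriv c0 c (\<lambda>q. q) p (v c0))"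
    by (rule derivative_compose_rep[OF atlas_chart[OF A(1) c0(1)] atlas_chart[OF A(1) c(1)] c0(2)
          rep_smooth_at_id[OF A(1) c0(1) c(1) c0(2) c(2)]
          smooth_map_on_rep_atlas[OF A f(1) c d f(2)]])
  also have "rep_deriv c0 c (\<lambda>q. q) p (v c0) = v c"
    using tangent_space_change[OF v c0(1) c(1) c0(2) c(2)] by simp
  finally have "rep_deriv c0 d f p (v c0) = rep_deriv c d f p (v c)" .
  then show ?thesis
    unfolding tangent_map_def c0_def[symmetric] Let_def using d by (simp only: if_True simp_thms)
qed

lemma tangent_map_outside:
  "\<not> (d \<in> B \<and> f p \<in> cdom d) \<Longrightarrow> tangent_map A B f p v d = 0"
  unfolding tangent_map_def by auto

lemma tangent_map_in:
  assumes A: "is_atlas A" "is_atlas B" and f: "smooth_map_on A B U f" "p \<in> U"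
    and v: "v \<in> tangent_space A p"
  shows "tangent_map A B f p v \<in> tangent_space B (f p)"
proof (rule tangent_spaceI)
  fix d e assume d: "d \<in> B" "e \<in> B" "f p \<in> cdom d" "f p \<in> cdom e"
  obtain c where c: "c \<in> A" "p \<in> cdom c"
    using smooth_map_on_subset[OF f(1) A(1)] f(2) unfolding carrier_of_def by blast
  have "rep_deriv c e (\<lambda>q. f q) p (v c) = rep_deriv d e (\<lambda>q. q) (f p) (rep_deriv c d f p (v c))"
    by (rule derivative_compose_rep[OF atlas_chart[OF A(1) c(1)] atlas_chart[OF A(2) d(1)] c(2)
          smooth_map_on_rep_atlas[OF A f(1) c d(1,3) f(2)] rep_smooth_at_id[OF A(2) d]])
  then show "tangent_map A B f p v e = rep_deriv d e (\<lambda>q. q) (f p) (tangent_map A B f p v d)"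
    using tangent_map_apply[OF A f v c] d by simp
qed (rule tangent_map_outside)

text \<open>In charts this is the chain rule for \<open>g \<circ> f\<close>, which is the identity near the point.\<close>

lemma tangent_map_inverse:
  assumes A: "is_atlas A" "is_atlas B" and f: "smooth_map_on A B U f" and g: "smooth_map_on B A V g"
    and p: "p \<in> U" "f p \<in> V" and id: "\<And>q. q \<in> U \<Longrightarrow> g (f q) = q"
    and v: "v \<in> tangent_space A p"
  shows "tangent_map B A g (f p) (tangent_map A B f p v) = v"
proof
  fix c
  show "tangent_map B A g (f p) (tangent_map A B f p v) c = v c"
  proof (cases "c \<in> A \<and> p \<in> cdom c")
    case False
    then show ?thesis
      using tangent_space_zero[OF v False] id[OF p(1)] by (simp add: tangent_map_outside)
  next
    case True
    obtain d where d: "d \<in> B" "f p \<in> cdom d"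
      using smooth_map_on_range[OF f A p(1)] unfolding carrier_of_def by blast
    have gc: "g (f p) \<in> cdom c" using True id[OF p(1)] by simp
    have ch: "is_chart c" using atlas_chart A(1) True by blast
    have "tangent_map B A g (f p) (tangent_map A B f p v) c = rep_deriv d c g (f p) (tangent_map A B f p v d)"
      using tangent_map_apply[OF A(2,1) g p(2) tangent_map_in[OF A f p(1) v] d] True gc by blast
    also have "\<dots> = rep_deriv d c g (f p) (rep_deriv c d f p (v c))"
      using tangent_map_apply[OF A f p(1) v _ _ d, of c] True by simp
    also have "\<dots> = rep_deriv c c (\<lambda>q. g (f q)) p (v c)"
      by (rule derivative_compose_rep[OF ch atlas_chart[OF A(2) d(1)] _ smooth_map_on_rep_atlas[OF A f _ _ d p(1)]
            smooth_map_on_rep_atlas[OF A(2,1) g d _ gc p(2)], symmetric]) (use True in auto)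
    also have "rep_deriv c c (\<lambda>q. g (f q)) p = frechet_derivative (\<lambda>y. y) (at (cmap c p))"
    proof (rule frechet_derivative_cong[of "cmap c ` (U \<inter> cdom c)"])
      have "openin (mtop A) U" using f by (simp add: smooth_map_on_def)
      then show "open (cmap c ` (U \<inter> cdom c))" using True by (simp add: openin_mtop[OF A(1)])
      show "cmap c p \<in> cmap c ` (U \<inter> cdom c)" using True p by auto
      show "(cmap c \<circ> (\<lambda>q. g (f q)) \<circ> cinv c) y = y" if "y \<in> cmap c ` (U \<inter> cdom c)" for y
        using that id by (auto simp: cinv_cmap[OF ch])
    qed
    also have "\<dots> = (\<lambda>v. v)" by simp
    finally show ?thesis .
  qed
qed

lemma subspace_tangent_space:
  assumes A: "is_atlas A"
  shows "subspace (tangent_space A p)"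
proof -
  have lin: "linear (rep_deriv c d (\<lambda>q. q) p)" if "c \<in> A" "d \<in> A" "p \<in> cdom c" "p \<in> cdom d" for c d
    using rep_smooth_at_derivative(2)[OF rep_smooth_at_id[OF A that]] .
  show ?thesis
    unfolding subspace_def
  proof (intro conjI ballI allI)
    show "0 \<in> tangent_space A p"
      by (rule tangent_spaceI) (use lin in \<open>auto simp: linear_0\<close>)
    fix v w assume v: "v \<in> tangent_space A p" "w \<in> tangent_space A p"
    show "v + w \<in> tangent_space A p"
      by (rule tangent_spaceI)
        (use v lin in \<open>auto simp: linear_add tangent_space_zero tangent_space_change[OF v(1), symmetric]
           tangent_space_change[OF v(2), symmetric]\<close>)
  next
    fix a :: real and v assume v: "v \<in> tangent_space A p"
    show "a *\<^sub>R v \<in> tangent_space A p"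
      by (rule tangent_spaceI)
        (use v lin in \<open>auto simp: scaleR_fun_def linear_scale tangent_space_zero
           tangent_space_change[OF v, symmetric]\<close>)
  qed
qed

lemma tangent_map_linear:
  assumes A: "is_atlas A" "is_atlas B" and f: "smooth_map_on A B U f" "p \<in> U"
    and v: "v \<in> tangent_space A p" "w \<in> tangent_space A p"
  shows "tangent_map A B f p (v + w) = tangent_map A B f p v + tangent_map A B f p w"
    "tangent_map A B f p (a *\<^sub>R v) = a *\<^sub>R tangent_map A B f p v"
proof -
  obtain c where c: "c \<in> A" "p \<in> cdom c"
    using smooth_map_on_subset[OF f(1) A(1)] f(2) unfolding carrier_of_def by blast
  note T = subspace_tangent_space[OF A(1), of p]
  have lin: "linear (rep_deriv c d f p)" if "d \<in> B" "f p \<in> cdom d" for d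
    using rep_smooth_at_derivative(2)[OF smooth_map_on_rep_atlas[OF A f(1) c that f(2)]] .
  show "tangent_map A B f p (v + w) = tangent_map A B f p v + tangent_map A B f p w"
  proof
    fix d
    show "tangent_map A B f p (v + w) d = (tangent_map A B f p v + tangent_map A B f p w) d"
      by (cases "d \<in> B \<and> f p \<in> cdom d")
        (simp_all add: tangent_map_apply[OF A f _ c] v subspace_add[OF T] linear_add[OF lin] tangent_map_outside)
  qed
  show "tangent_map A B f p (a *\<^sub>R v) = a *\<^sub>R tangent_map A B f p v"
  proof
    fix d
    show "tangent_map A B f p (a *\<^sub>R v) d = (a *\<^sub>R tangent_map A B f p v) d"
    proof (cases "d \<in> B \<and> f p \<in> cdom d")
      case True
      have "tangent_map A B f p (a *\<^sub>R v) d = rep_deriv c d f p ((a *\<^sub>R v) c)"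
        by (rule tangent_map_apply[OF A f subspace_scale[OF T v(1)] c]) (use True in auto)
      also have "\<dots> = a *\<^sub>R rep_deriv c d f p (v c)"
        using linear_scale[OF lin] True by (simp add: scaleR_fun_def)
      also have "rep_deriv c d f p (v c) = tangent_map A B f p v d"
        by (rule tangent_map_apply[OF A f v(1) c, symmetric]) (use True in auto)
      finally show ?thesis by (simp add: scaleR_fun_def)
    qed (simp add: tangent_map_outside scaleR_fun_def)
  qed
qed

lemma subspace_tangent_map_image:
  assumes A: "is_atlas A" "is_atlas B" and f: "smooth_map_on A B U f" "p \<in> U"
    and H: "subspace H" "H \<subseteq> tangent_space A p"
  shows "subspace (tangent_map A B f p ` H)"
  unfolding subspace_def
proof (intro conjI ballI allI)
  have z: "0 \<in> H" using H(1) subspace_0 by blast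
  have "tangent_map A B f p (0 *\<^sub>R 0) = 0 *\<^sub>R tangent_map A B f p 0"
    using tangent_map_linear(2)[OF A f, of 0 0 0] z H(2) by blast
  then show "0 \<in> tangent_map A B f p ` H" using z by (metis image_eqI scaleR_zero_left)
next
  fix v w assume "v \<in> tangent_map A B f p ` H" "w \<in> tangent_map A B f p ` H"
  then obtain v' w' where "v' \<in> H" "w' \<in> H" "v = tangent_map A B f p v'" "w = tangent_map A B f p w'" by blast
  then show "v + w \<in> tangent_map A B f p ` H"
    using tangent_map_linear(1)[OF A f, of v' w'] H subspace_add[OF H(1)] by (metis image_eqI subsetD)
next
  fix a :: real and v assume "v \<in> tangent_map A B f p ` H"
  then obtain v' where "v' \<in> H" "v = tangent_map A B f p v'" by blast
  then show "a *\<^sub>R v \<in> tangent_map A B f p ` H"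
    using tangent_map_linear(2)[OF A f, of v' v' a] H subspace_scale[OF H(1)] by (metis image_eqI subsetD)
qed

text \<open>A tangent vector is determined by its components in one chart; this is the vector with the given
  components.\<close>

definition tangent_of ::
  "('a, 'b::euclidean_space) chart set \<Rightarrow> 'a \<Rightarrow> ('a, 'b) chart \<Rightarrow> 'b \<Rightarrow> ('a, 'b) tvec" where
  "tangent_of A p c w = (\<lambda>d. if d \<in> A \<and> p \<in> cdom d then rep_deriv c d (\<lambda>q. q) p w else 0)"

lemma tangent_of_props:
  assumes A: "is_atlas A" and c: "c \<in> A" "p \<in> cdom c"
  shows "tangent_of A p c w \<in> tangent_space A p" "tangent_of A p c w c = w"
    "v \<in> tangent_space A p \<Longrightarrow> tangent_of A p c (v c) = v"
    "linear (tangent_of A p c)"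
proof -
  have ch: "is_chart c" using A c atlas_chart by blast
  have "rep_deriv c c (\<lambda>q. q) p = frechet_derivative (\<lambda>y. y) (at (cmap c p))"
    by (rule frechet_derivative_cong[of "cmap c ` cdom c"])
      (use ch c in \<open>auto simp: cinv_cmap is_chart_def\<close>)
  then show "tangent_of A p c w c = w" using c by (simp add: tangent_of_def)
  show "tangent_of A p c w \<in> tangent_space A p"
  proof (rule tangent_spaceI)
    fix d e assume d: "d \<in> A" "e \<in> A" "p \<in> cdom d" "p \<in> cdom e"
    have "rep_deriv c e (\<lambda>q. q) p w = rep_deriv d e (\<lambda>q. q) p (rep_deriv c d (\<lambda>q. q) p w)"
      by (rule derivative_compose_rep[OF ch atlas_chart[OF A d(1)] c(2)
            rep_smooth_at_id[OF A c(1) d(1) c(2) d(3)] rep_smooth_at_id[OF A d]])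
    then show "tangent_of A p c w e = rep_deriv d e (\<lambda>q. q) p (tangent_of A p c w d)"
      using d by (simp add: tangent_of_def)
  qed (auto simp: tangent_of_def)
  show "tangent_of A p c (v c) = v" if v: "v \<in> tangent_space A p"
  proof
    fix d
    show "tangent_of A p c (v c) d = v d"
      using tangent_space_zero[OF v] tangent_space_change[OF v c(1) _ c(2)] by (auto simp: tangent_of_def)
  qed
  have lin: "linear (rep_deriv c d (\<lambda>q. q) p)" if "d \<in> A" "p \<in> cdom d" for d
    using rep_smooth_at_derivative(2)[OF rep_smooth_at_id[OF A c(1) that(1) c(2) that(2)]] .
  show "linear (tangent_of A p c)"
    by (rule linearI; rule ext; simp add: tangent_of_def scaleR_fun_def linear_add[OF lin] linear_scale[OF lin])
qed

section \<open>Transport of distributions by diffeomorphisms\<close>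

lemma diffeo_on_tangent_inverse:
  assumes A: "is_atlas A" "is_atlas B" and f: "diffeo_on A B W f" and p: "p \<in> W"
  shows "v \<in> tangent_space A p \<Longrightarrow> tangent_map B A (inv_into W f) (f p) (tangent_map A B f p v) = v"
    "w \<in> tangent_space B (f p) \<Longrightarrow> tangent_map A B f p (tangent_map B A (inv_into W f) (f p) w) = w"
proof -
  have sm: "smooth_map_on A B W f" "smooth_map_on B A (f ` W) (inv_into W f)" "inj_on f W"
    using f by (auto simp: diffeo_on_def)
  show "tangent_map B A (inv_into W f) (f p) (tangent_map A B f p v) = v" if "v \<in> tangent_space A p"
    by (rule tangent_map_inverse[OF A sm(1,2) p]) (use p sm that in auto)
  have eq: "inv_into W f (f p) = p" using sm(3) p by simp
  have "tangent_map A B f (inv_into W f (f p)) (tangent_map B A (inv_into W f) (f p) w) = w"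
    if "w \<in> tangent_space B (f p)"
    by (rule tangent_map_inverse[OF A(2,1) sm(2,1)]) (use p sm that in \<open>auto simp: f_inv_into_f\<close>)
  then show "tangent_map A B f p (tangent_map B A (inv_into W f) (f p) w) = w" if "w \<in> tangent_space B (f p)"
    using that eq by simp
qed

text \<open>Where the diffeomorphism preserves the distributions, a section \<open>X'\<close> of the second one is related to
  its pullback \<open>X\<close>, a section of the first. The last claim collects what the naturality of the bracket
  requires at \<open>p\<close>, in a given pair of charts.\<close>

lemma Gamma_at_pullback:
  assumes A: "is_atlas A" "is_atlas B" and f: "diffeo_on A B W f" and p: "p \<in> W"
    and DA: "\<And>q. q \<in> W \<Longrightarrow> D q \<subseteq> tangent_space A q"
    and DD: "\<And>q. q \<in> W \<Longrightarrow> tangent_map A B f q ` D q = D' (f q)"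
    and X': "X' \<in> Gamma_at B D' (f p)"
    and X_def: "X = (\<lambda>q. tangent_map B A (inv_into W f) (f q) (X' (f q)))"
    and c: "c \<in> A" "p \<in> cdom c" and d: "d \<in> B" "f p \<in> cdom d"
  shows "X \<in> Gamma_at A D p" "tangent_map A B f p (X p) = X' (f p)"
    "\<exists>S. open S \<and> cmap c p \<in> S \<and> S \<subseteq> cmap c ` {q \<in> W \<inter> cdom c. f q \<in> cdom d} \<and>
      smooth_on S (cmap d \<circ> f \<circ> cinv c) \<and>
      smooth_on S (\<lambda>y. X (cinv c y) c) \<and>
      (\<lambda>z. X' (cinv d z) d) differentiable (at (cmap d (f p))) \<and>
      (\<forall>y\<in>S. X' (cinv d ((cmap d \<circ> f \<circ> cinv c) y)) d
          = frechet_derivative (cmap d \<circ> f \<circ> cinv c) (at y) (X (cinv c y) c))"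
proof -
  let ?g = "inv_into W f"
  have sm: "smooth_map_on A B W f" "smooth_map_on B A (f ` W) ?g" "inj_on f W"
    using f by (auto simp: diffeo_on_def)
  have gf: "?g (f q) = q" if "q \<in> W" for q using that sm(3) by simp
  obtain V where V: "openin (mtop B) V" "f p \<in> V" "\<And>q. q \<in> V \<Longrightarrow> X' q \<in> D' q"
    "\<And>e. e \<in> B \<Longrightarrow> smooth_on (cmap e ` (V \<inter> cdom e)) (\<lambda>z. X' (cinv e z) e)"
    using X' unfolding Gamma_at_def by blast
  \<comment> \<open>the part of \<open>W\<close> over which \<open>X'\<close> is defined\<close>
  define W1 where "W1 = {q \<in> W. f q \<in> V}"
  have W1o: "openin (mtop A) W1" unfolding W1_def by (rule smooth_map_on_preimage[OF A(1) sm(1) V(1)])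
  have W1W: "W1 \<subseteq> W" by (auto simp: W1_def)
  have smf: "smooth_map_on A B W1 f" by (rule smooth_map_on_restrict[OF sm(1) W1o W1W])
  have "openin (mtop B) {z \<in> f ` W. ?g z \<in> W1}" by (rule smooth_map_on_preimage[OF A(2) sm(2) W1o])
  moreover have "{z \<in> f ` W. ?g z \<in> W1} = f ` W1" using gf W1W by (auto simp: image_iff) 
  ultimately have fW1o: "openin (mtop B) (f ` W1)" by simp
  have smg: "smooth_map_on B A (f ` W1) ?g"
    by (rule smooth_map_on_restrict[OF sm(2) fW1o]) (use W1W in blast)
  have XD: "X q \<in> D q" and XX': "tangent_map A B f q (X q) = X' (f q)" and X'T: "X' (f q) \<in> tangent_space B (f q)"
    and XT: "X q \<in> tangent_space A q" if q: "q \<in> W1" for q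
  proof -
    have qW: "q \<in> W" "f q \<in> V" using q by (auto simp: W1_def)
    then obtain v where v: "v \<in> D q" "X' (f q) = tangent_map A B f q v" using V(3) DD[OF qW(1)] by blast
    have vT: "v \<in> tangent_space A q" using v DA[OF qW(1)] by blast
    have Xv: "X q = v"
      unfolding X_def v(2) by (rule diffeo_on_tangent_inverse(1)[OF A f qW(1) vT])
    then show "X q \<in> D q" "tangent_map A B f q (X q) = X' (f q)" "X q \<in> tangent_space A q" using v vT by simp_all
    show "X' (f q) \<in> tangent_space B (f q)" unfolding v(2) by (rule tangent_map_in[OF A sm(1) qW(1) vT])
  qed
  have smX: "open S \<and> smooth_on S (cmap e \<circ> f \<circ> cinv a) \<and> smooth_on S (\<lambda>y. X (cinv a y) a)"
    if a: "a \<in> A" and e: "e \<in> B" and S: "S = cmap a ` {q \<in> W1 \<inter> cdom a. f q \<in> cdom e}" for a e S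
  proof -
    have ach: "is_chart a" and ech: "is_chart e" using a e A atlas_chart by blast+
    let ?h = "cmap e \<circ> f \<circ> cinv a" and ?k = "cmap a \<circ> ?g \<circ> cinv e"
    define Z where "Z = cmap e ` {z \<in> f ` W1 \<inter> cdom e. ?g z \<in> cdom a}"
    have h: "open S" "smooth_on S ?h"
      unfolding S using rep_set_open[of W1 a f e] smooth_map_on_rep_atlas[OF A smf a _ e] by auto
    have k: "open Z" "smooth_on Z ?k"
      unfolding Z_def using rep_set_open[of "f ` W1" e ?g a] smooth_map_on_rep_atlas[OF A(2,1) smg e _ a] by auto
    have "smooth_on Z (\<lambda>z. X' (cinv e z) e)"
      by (rule smooth_on_subset[OF V(4)[OF e]]) (auto simp: Z_def W1_def)
    then have "smooth_on Z (\<lambda>z. frechet_derivative ?k (at z) (X' (cinv e z) e))"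
      by (rule smooth_on_derivative_apply[OF k])
    moreover have "?h ` S \<subseteq> Z" unfolding S Z_def using gf W1W by (auto simp: cinv_cmap[OF ach])
    ultimately have "smooth_on S (\<lambda>y. frechet_derivative ?k (at (?h y)) (X' (cinv e (?h y)) e))"
      using smooth_on_compose[of Z "\<lambda>z. frechet_derivative ?k (at z) (X' (cinv e z) e)" S ?h] h k by blast
    then have "smooth_on S (\<lambda>y. X (cinv a y) a)"
    proof (rule smooth_on_eq[OF _ h(1)])
      fix y assume "y \<in> S"
      then obtain q where q: "q \<in> W1" "q \<in> cdom a" "f q \<in> cdom e" "y = cmap a q" unfolding S by blast
      have gq: "?g (f q) = q" using gf q(1) W1W by blast
      have "X q a = rep_deriv e a ?g (f q) (X' (f q) e)"
        unfolding X_def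
        by (rule tangent_map_apply[OF A(2,1) smg _ X'T[OF q(1)] e q(3) a]) (use q gq in auto)
      then show "frechet_derivative ?k (at (?h y)) (X' (cinv e (?h y)) e) = X (cinv a y) a"
        using q by (simp add: cinv_cmap[OF ach] cinv_cmap[OF ech])
    qed
    then show ?thesis using h by blast
  qed
  have pW1: "p \<in> W1" using p V(2) by (simp add: W1_def)
  show "tangent_map A B f p (X p) = X' (f p)" by (rule XX'[OF pW1])
  show "X \<in> Gamma_at A D p"
    unfolding Gamma_at_def
  proof (intro CollectI exI conjI ballI)
    show "openin (mtop A) W1" "p \<in> W1" by fact+
    show "X q \<in> D q" if "q \<in> W1" for q by (rule XD[OF that])
    fix a assume a: "a \<in> A"
    show "smooth_on (cmap a ` (W1 \<inter> cdom a)) (\<lambda>y. X (cinv a y) a)"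
    proof (rule smooth_on_local)
      show "open (cmap a ` (W1 \<inter> cdom a))" using W1o a by (simp add: openin_mtop[OF A(1)])
      fix y assume "y \<in> cmap a ` (W1 \<inter> cdom a)"
      then obtain q where q: "q \<in> W1" "q \<in> cdom a" "y = cmap a q" by blast
      obtain e where e: "e \<in> B" "f q \<in> cdom e"
        using smooth_map_on_range[OF smf A q(1)] unfolding carrier_of_def by blast
      show "\<exists>T. open T \<and> y \<in> T \<and> smooth_on T (\<lambda>y. X (cinv a y) a)"
        using smX[OF a e(1) refl] q e by blast
    qed
  qed
  define S where "S = cmap c ` {q \<in> W1 \<inter> cdom c. f q \<in> cdom d}"
  have dch: "is_chart d" "is_chart c" using d c A atlas_chart by blast+
  have S: "open S" "smooth_on S (cmap d \<circ> f \<circ> cinv c)" "smooth_on S (\<lambda>y. X (cinv c y) c)"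
    using smX[OF c(1) d(1) S_def] by auto
  have "smooth_on (cmap d ` (V \<inter> cdom d)) (\<lambda>z. X' (cinv d z) d)" "open (cmap d ` (V \<inter> cdom d))"
    using V d by (auto simp: openin_mtop[OF A(2)])
  then have diff: "(\<lambda>z. X' (cinv d z) d) differentiable (at (cmap d (f p)))"
    by (rule smooth_on_differentiable) (use V d in auto)
  have rel: "X' (cinv d ((cmap d \<circ> f \<circ> cinv c) y)) d
          = frechet_derivative (cmap d \<circ> f \<circ> cinv c) (at y) (X (cinv c y) c)" if y: "y \<in> S" for y
  proof -
    obtain q where q: "q \<in> W1" "q \<in> cdom c" "f q \<in> cdom d" "y = cmap c q" using y unfolding S_def by blast
    have "X' (f q) d = rep_deriv c d f q (X q c)"
      using tangent_map_apply[OF A smf q(1) XT[OF q(1)] c(1) q(2) d(1) q(3)] XX'[OF q(1)] by simp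
    then show ?thesis using q by (simp add: cinv_cmap[OF dch(1)] cinv_cmap[OF dch(2)])
  qed
  have "cmap c p \<in> S" using pW1 c d by (auto simp: S_def)
  moreover have "S \<subseteq> cmap c ` {q \<in> W \<inter> cdom c. f q \<in> cdom d}" using W1W by (auto simp: S_def)
  ultimately show "\<exists>S. open S \<and> cmap c p \<in> S \<and> S \<subseteq> cmap c ` {q \<in> W \<inter> cdom c. f q \<in> cdom d} \<and>
      smooth_on S (cmap d \<circ> f \<circ> cinv c) \<and>
      smooth_on S (\<lambda>y. X (cinv c y) c) \<and>
      (\<lambda>z. X' (cinv d z) d) differentiable (at (cmap d (f p))) \<and>
      (\<forall>y\<in>S. X' (cinv d ((cmap d \<circ> f \<circ> cinv c) y)) d
          = frechet_derivative (cmap d \<circ> f \<circ> cinv c) (at y) (X (cinv c y) c))"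
    using S diff rel by blast
qed

text \<open>Local sections with values in the image of \<open>H\<close> are pulled back to local sections with values in \<open>H\<close>.
  The bracket of the latter lies in \<open>D\<close>, and by naturality it is mapped to the bracket of the former.\<close>

lemma isotropic_at_image:
  assumes A: "is_atlas A" "is_atlas B" and f: "diffeo_on A B W f" and p: "p \<in> W"
    and DA: "\<And>q. q \<in> W \<Longrightarrow> D q \<subseteq> tangent_space A q"
    and DD: "\<And>q. q \<in> W \<Longrightarrow> tangent_map A B f q ` D q = D' (f q)"
    and H: "isotropic_at A D p H"
  shows "isotropic_at B D' (f p) (tangent_map A B f p ` H)"
  unfolding isotropic_at_def
proof (intro conjI ballI impI)
  have sm: "smooth_map_on A B W f" using f by (auto simp: diffeo_on_def)
  have H': "subspace H" "H \<subseteq> D p" using H by (auto simp: isotropic_at_def)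
  have HT: "H \<subseteq> tangent_space A p" using H' DA[OF p] by blast
  show "subspace (tangent_map A B f p ` H)"
    by (rule subspace_tangent_map_image[OF A sm p H'(1) HT])
  show "tangent_map A B f p ` H \<subseteq> D' (f p)" using H'(2) DD[OF p] by blast
  fix X' Y' assume X': "X' \<in> Gamma_at B D' (f p)" and Y': "Y' \<in> Gamma_at B D' (f p)"
    and mem: "X' (f p) \<in> tangent_map A B f p ` H \<and> Y' (f p) \<in> tangent_map A B f p ` H"
  define X where "X = (\<lambda>q. tangent_map B A (inv_into W f) (f q) (X' (f q)))"
  define Y where "Y = (\<lambda>q. tangent_map B A (inv_into W f) (f q) (Y' (f q)))"
  \<comment> \<open>the chart in which \<open>tangent_map\<close> evaluates the bracket, which is not known to be a tangent vector\<close>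
  define c where "c = (SOME c. c \<in> A \<and> p \<in> cdom c)"
  have "\<exists>c. c \<in> A \<and> p \<in> cdom c"
    using smooth_map_on_subset[OF sm A(1)] p unfolding carrier_of_def by blast
  then have c: "c \<in> A" "p \<in> cdom c"
    using someI_ex[of "\<lambda>c. c \<in> A \<and> p \<in> cdom c"] unfolding c_def by auto
  obtain d0 where d0: "d0 \<in> B" "f p \<in> cdom d0"
    using smooth_map_on_range[OF sm A p] unfolding carrier_of_def by blast
  have ch: "is_chart c" using c A atlas_chart by blast
  note pbX = Gamma_at_pullback[OF A f p DA DD X' X_def c]
  note pbY = Gamma_at_pullback[OF A f p DA DD Y' Y_def c]
  have "X p \<in> H" "Y p \<in> H"
  proof -
    obtain v w where v: "v \<in> H" "w \<in> H" "X' (f p) = tangent_map A B f p v" "Y' (f p) = tangent_map A B f p w"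
      using mem by blast
    then have "X p = v" "Y p = w"
      unfolding X_def Y_def using diffeo_on_tangent_inverse(1)[OF A f p] HT by auto
    then show "X p \<in> H" "Y p \<in> H" using v by auto
  qed
  moreover have "X \<in> Gamma_at A D p" "Y \<in> Gamma_at A D p" using pbX(1)[OF _ _ d0] pbY(1)[OF _ _ d0] by auto
  ultimately have br: "lie_bracket A X Y p \<in> D p" using H by (auto simp: isotropic_at_def)
  have "lie_bracket B X' Y' (f p) = tangent_map A B f p (lie_bracket A X Y p)"
  proof
    fix d
    show "lie_bracket B X' Y' (f p) d = tangent_map A B f p (lie_bracket A X Y p) d"
    proof (cases "d \<in> B \<and> f p \<in> cdom d")
      case False
      then show ?thesis by (auto simp: lie_bracket_def tangent_map_def)
    next
      case True
      then have d: "d \<in> B" "f p \<in> cdom d" by auto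
      have dch: "is_chart d" using d A atlas_chart by blast
      let ?h = "cmap d \<circ> f \<circ> cinv c"
      let ?X = "\<lambda>y. X (cinv c y) c" and ?X' = "\<lambda>z. X' (cinv d z) d"
      let ?Y = "\<lambda>y. Y (cinv c y) c" and ?Y' = "\<lambda>z. Y' (cinv d z) d"
      obtain S where S: "open S" "cmap c p \<in> S" "smooth_on S ?h" "smooth_on S ?X"
        "?X' differentiable (at (cmap d (f p)))"
        "\<forall>y\<in>S. ?X' (?h y) = frechet_derivative ?h (at y) (?X y)"
        using pbX(3)[OF _ _ d] by auto
      obtain S2 where S2: "open S2" "cmap c p \<in> S2" "smooth_on S2 ?Y"
        "?Y' differentiable (at (cmap d (f p)))"
        "\<forall>y\<in>S2. ?Y' (?h y) = frechet_derivative ?h (at y) (?Y y)"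
        using pbY(3)[OF _ _ d] by auto
      have hp: "?h (cmap c p) = cmap d (f p)" using c by (simp add: cinv_cmap[OF ch])
      have N: "open (S \<inter> S2)" "smooth_on (S \<inter> S2) ?h" "cmap c p \<in> S \<inter> S2"
        using S S2 by (auto intro: smooth_on_subset)
      have "frechet_derivative ?Y' (at (?h (cmap c p))) (?X' (?h (cmap c p)))
          - frechet_derivative ?X' (at (?h (cmap c p))) (?Y' (?h (cmap c p)))
        = frechet_derivative ?h (at (cmap c p))
          (frechet_derivative ?Y (at (cmap c p)) (?X (cmap c p)) - frechet_derivative ?X (at (cmap c p)) (?Y (cmap c p)))"
      proof (rule bracket_natural[OF N])
        show "?X differentiable at (cmap c p)" "?Y differentiable at (cmap c p)"
          using smooth_on_differentiable S S2 by blast+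
        show "?X' differentiable at (?h (cmap c p))" "?Y' differentiable at (?h (cmap c p))"
          unfolding hp using S S2 by blast+
      qed (use S S2 in blast)+
      then have "lie_bracket B X' Y' (f p) d = frechet_derivative ?h (at (cmap c p)) (lie_bracket A X Y p c)"
        unfolding hp using c d by (simp add: lie_bracket_def cinv_cmap[OF ch] cinv_cmap[OF dch])
      also have "\<dots> = tangent_map A B f p (lie_bracket A X Y p) d"
        unfolding tangent_map_def c_def[symmetric] using d by (simp add: Let_def)
      finally show ?thesis .
    qed
  qed
  then show "lie_bracket B X' Y' (f p) \<in> D' (f p)" using br DD[OF p] by blast
qed

lemma polarised_legendrian_image:
  fixes A :: "('a, 'b::euclidean_space) chart set" and B :: "('c, 'd::euclidean_space) chart set"
  assumes A: "is_atlas A" "is_atlas B" and f: "diffeo_on A B W f" and p: "p \<in> W"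
    and DA: "\<And>q. q \<in> W \<Longrightarrow> D q \<subseteq> tangent_space A q"
    and DD: "\<And>q. q \<in> W \<Longrightarrow> tangent_map A B f q ` D q = D' (f q)"
    and G: "G p \<subseteq> tangent_space A p" "tangent_map A B f p ` G p = G' (f p)"
    and H: "polarised_legendrian A D G p H"
  shows "polarised_legendrian B D' G' (f p) (tangent_map A B f p ` H)"
proof -
  have sm: "smooth_map_on A B W f" using f by (auto simp: diffeo_on_def)
  have iso: "isotropic_at A D p H" and dec: "D p = {h + g | h g. h \<in> H \<and> g \<in> G p}" and int: "H \<inter> G p = {0}"
    using H by (auto simp: polarised_legendrian_def)
  have HT: "H \<subseteq> tangent_space A p" using iso DA[OF p] by (auto simp: isotropic_at_def)
  let ?T = "tangent_map A B f p"
  have add: "?T (h + g) = ?T h + ?T g" if "h \<in> H" "g \<in> G p" for h g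
    using tangent_map_linear(1)[OF A sm p] HT G that by blast
  have "D' (f p) = {h + g | h g. h \<in> ?T ` H \<and> g \<in> G' (f p)}"
  proof -
    have "D' (f p) = ?T ` {h + g | h g. h \<in> H \<and> g \<in> G p}" using DD[OF p] dec by simp
    also have "\<dots> = {?T h + ?T g | h g. h \<in> H \<and> g \<in> G p}"
    proof (intro equalityI subsetI)
      fix x assume "x \<in> ?T ` {h + g | h g. h \<in> H \<and> g \<in> G p}"
      then obtain h g where "h \<in> H" "g \<in> G p" "x = ?T (h + g)" by blast
      then show "x \<in> {?T h + ?T g | h g. h \<in> H \<and> g \<in> G p}" using add by blast
    next
      fix x assume "x \<in> {?T h + ?T g | h g. h \<in> H \<and> g \<in> G p}"
      then obtain h g where "h \<in> H" "g \<in> G p" "x = ?T h + ?T g" by blast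
      then have "x = ?T (h + g)" "h + g \<in> {h + g | h g. h \<in> H \<and> g \<in> G p}" using add by auto
      then show "x \<in> ?T ` {h + g | h g. h \<in> H \<and> g \<in> G p}" by (rule image_eqI)
    qed
    also have "\<dots> = {h + g | h g. h \<in> ?T ` H \<and> g \<in> ?T ` G p}" by blast
    finally show ?thesis using G by simp
  qed
  moreover have "?T ` H \<inter> G' (f p) = {0}"
  proof -
    have "0 \<in> H" "0 \<in> G p" using int by auto
    then have T0: "?T 0 = 0"
      using tangent_map_linear(2)[OF A sm p, of 0 0 0] HT by auto
    have inj: "h = g" if "h \<in> H" "g \<in> G p" "?T h = ?T g" for h g
      using diffeo_on_tangent_inverse(1)[OF A f p] that HT G by (metis subsetD)
    show ?thesis
    proof (intro equalityI subsetI)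
      fix x assume "x \<in> ?T ` H \<inter> G' (f p)"
      then obtain h g where x: "h \<in> H" "g \<in> G p" "x = ?T h" "x = ?T g" unfolding G(2)[symmetric] by blast
      then have "h = g" using inj by simp
      then have "h \<in> {0}" using x int by blast
      then show "x \<in> {0}" using x T0 by simp
    next
      fix x assume "x \<in> {0 :: ('c, 'd) tvec}"
      then show "x \<in> ?T ` H \<inter> G' (f p)"
        unfolding G(2)[symmetric] using T0 \<open>0 \<in> H\<close> \<open>0 \<in> G p\<close> by (metis IntI image_eqI singletonD)
    qed
  qed
  ultimately show ?thesis
    using isotropic_at_image[OF A f p DA DD iso] by (simp add: polarised_legendrian_def)
qed

section \<open>Iterated partial derivatives\<close>

lemma smooth_on_pderivs: "open N \<Longrightarrow> smooth_on N s \<Longrightarrow> smooth_on N (pderivs l s)"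
  by (induction l) (simp_all add: smooth_on_derivative)

lemma pderivs_cong:
  assumes "open N" "x \<in> N" "\<And>x. x \<in> N \<Longrightarrow> s x = t x"
  shows "pderivs l s x = pderivs l t x"
  using assms(2)
proof (induction l arbitrary: x)
  case (Cons i l)
  then show ?case using frechet_derivative_cong[OF assms(1) Cons.prems, of "pderivs l s" "pderivs l t"] by simp
qed (use assms(3) in simp)

lemma pderivs_move:
  assumes N: "open N" "smooth_on N s" "x \<in> N"
  shows "pderivs (l1 @ i # l2) s x = pderivs (i # l1 @ l2) s x"
  using N(3)
proof (induction l1 arbitrary: x)
  case (Cons j l1)
  have "pderivs ((j # l1) @ i # l2) s x = frechet_derivative (pderivs (i # l1 @ l2) s) (at x) (axis j 1)"
    using frechet_derivative_cong[OF N(1) Cons.prems Cons.IH] by simp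
  also have "\<dots> = pderivs (i # (j # l1) @ l2) s x"
    using second_derivative_commute[OF N(1) smooth_on_pderivs[OF N(1,2)] Cons.prems] by simp
  finally show ?case .
qed simp

lemma pderivs_perm:
  assumes N: "open N" "smooth_on N s" "x \<in> N" and "mset l = mset l'"
  shows "pderivs l s x = pderivs l' s x"
  using N(3) assms(4)
proof (induction l arbitrary: l' x)
  case (Cons i l)
  then have "i \<in> set l'" by (metis list.set_intros(1) mset_eq_setD)
  from split_list[OF this] obtain l1 l2 where l': "l' = l1 @ i # l2" by blast
  then have "mset l = mset (l1 @ l2)" using Cons.prems by simp
  then have "pderivs l s z = pderivs (l1 @ l2) s z" if "z \<in> N" for z by (rule Cons.IH[OF that])
  then have "pderivs (i # l) s x = pderivs (i # l1 @ l2) s x"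
    using frechet_derivative_cong[OF N(1) Cons.prems(1), of "pderivs l s" "pderivs (l1 @ l2) s"] by simp
  then show ?case using pderivs_move[OF N(1,2) Cons.prems(1)] l' by simp
qed simp

text \<open>An ordering of the multi-index, the same one that \<open>mderiv\<close> chooses.\<close>

definition list_of :: "'n multiset \<Rightarrow> 'n list" where
  "list_of I = (SOME l. mset l = I)"

lemma mset_list_of [simp]: "mset (list_of I) = I"
  unfolding list_of_def by (rule someI_ex) (rule ex_mset)

lemma length_list_of [simp]: "length (list_of I) = size I"
  by (metis mset_list_of size_mset)

lemma mderiv_list_of: "mderiv I s = pderivs (list_of I) s"
  by (simp add: mderiv_def list_of_def)

lemma mderiv_mset:
  assumes "open N" "smooth_on N s" "x \<in> N"
  shows "mderiv (mset l) s x = pderivs l s x"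
  unfolding mderiv_list_of by (rule pderivs_perm[OF assms]) simp

lemma mderiv_empty [simp]: "mderiv {#} s = s"
proof -
  have "list_of ({#} :: 'a multiset) = []" by (metis mset_list_of mset_zero_iff)
  then show ?thesis by (simp add: mderiv_list_of)
qed

lemma mderiv_cong:
  "open N \<Longrightarrow> x \<in> N \<Longrightarrow> (\<And>x. x \<in> N \<Longrightarrow> s x = t x) \<Longrightarrow> mderiv I s x = mderiv I t x"
  unfolding mderiv_list_of by (rule pderivs_cong)

lemma mderiv_add_mset:
  assumes "open N" "smooth_on N s" "x \<in> N"
  shows "frechet_derivative (mderiv I s) (at x) (axis i 1) = mderiv (add_mset i I) s x"
proof -
  have "mderiv (mset (i # list_of I)) s x = pderivs (i # list_of I) s x" by (rule mderiv_mset[OF assms])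
  then show ?thesis by (simp add: mderiv_list_of)
qed

lemma frechet_derivative_linear_comp:
  assumes "bounded_linear L" "f differentiable (at x)"
  shows "frechet_derivative (\<lambda>y. L (f y)) (at x) v = L (frechet_derivative f (at x) v)"
  using has_derivative_frechet[OF bounded_linear.has_derivative[OF assms(1) assms(2)[unfolded frechet_derivative_works]]]
  by simp

section \<open>Jet coordinates\<close>

text \<open>The jet prolongation of a function in coordinates: the point of the model space formed by its
  derivatives.\<close>

definition jet_coords :: "(real^'n \<Rightarrow> real^'m) \<Rightarrow> real^'n \<Rightarrow> ('n::finite, 'm::finite, 's::finite) jetspace" where
  "jet_coords s x = (x, \<chi> I. mderiv (Rep_mindex I) s x)"

text \<open>The projection of a jet to the total space, in coordinates.\<close>

definition base_point :: "('n::finite, 'm::finite, 's::finite) jetspace \<Rightarrow> (real^'n) \<times> (real^'m)" where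
  "base_point y = (fst y, ucoord y {#})"

text \<open>The total derivative \<open>D\<^sub>j\<close> as a tangent vector at \<open>y\<close>. Its components of top order would need derivatives of
  one order more, which \<open>y\<close> does not contain; they are put to \<open>0\<close>.\<close>

definition total_vec :: "'n \<Rightarrow> ('n::finite, 'm::finite, 'r::finite option) jetspace \<Rightarrow> ('n, 'm, 'r option) jetspace" where
  "total_vec j y = (axis j 1, \<chi> I. if size (Rep_mindex I) < CARD('r) then ucoord y (add_mset j (Rep_mindex I)) else 0)"

text \<open>Equality up to components of order greater than \<open>k\<close>; it expresses that functions are of order at
  most \<open>k\<close>.\<close>

definition agree :: "nat \<Rightarrow> ('n::finite, 'm::finite, 's::finite) jetspace \<Rightarrow> ('n, 'm, 's) jetspace \<Rightarrow> bool" where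
  "agree k y z \<longleftrightarrow> fst y = fst z \<and> (\<forall>I. size (Rep_mindex I) \<le> k \<longrightarrow> snd y $ I = snd z $ I)"

lemma jorder_option [simp]: "jorder TYPE('r::finite option) = CARD('r)"
  by (simp add: jorder_def)

lemma Rep_Abs_mindex [simp]:
  "size I \<le> CARD('r) \<Longrightarrow> Rep_mindex (Abs_mindex I :: ('n::finite, 'r::finite option) mindex) = I"
  by (simp add: Abs_mindex_inverse)

lemma size_Rep_mindex: "size (Rep_mindex (I :: ('n::finite, 'r::finite option) mindex)) \<le> CARD('r)"
  using Rep_mindex[of I] by simp

lemma ucoord_jet_coords [simp]:
  "size I \<le> CARD('r) \<Longrightarrow> ucoord (jet_coords s x :: ('n::finite, 'm::finite, 'r::finite option) jetspace) I = mderiv I s x"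
  by (simp add: ucoord_def jet_coords_def)

lemma fst_jet_coords [simp]: "fst (jet_coords s x) = x"
  by (simp add: jet_coords_def)

lemma base_point_jet_coords [simp]:
  "base_point (jet_coords s x :: ('n::finite, 'm::finite, 'r::finite option) jetspace) = (x, s x)"
  by (simp add: base_point_def)

lemma agree_ucoord:
  fixes y :: "('n::finite, 'm::finite, 'r::finite option) jetspace"
  shows "agree k y z \<Longrightarrow> size I \<le> k \<Longrightarrow> size I \<le> CARD('r) \<Longrightarrow> ucoord y I = ucoord z I"
  unfolding agree_def ucoord_def by simp

lemma agreeI:
  fixes y :: "('n::finite, 'm::finite, 'r::finite option) jetspace"
  assumes "fst y = fst z" "\<And>I. size I \<le> k \<Longrightarrow> size I \<le> CARD('r) \<Longrightarrow> ucoord y I = ucoord z I"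
  shows "agree k y z"
  unfolding agree_def
proof (intro conjI allI impI)
  fix I :: "('n, 'r option) mindex" assume "size (Rep_mindex I) \<le> k"
  then show "snd y $ I = snd z $ I"
    using assms(2)[of "Rep_mindex I"] size_Rep_mindex[of I] by (simp add: ucoord_def Rep_mindex_inverse)
qed (rule assms(1))

lemma agree_base_point:
  fixes y :: "('n::finite, 'm::finite, 'r::finite option) jetspace"
  shows "agree k y z \<Longrightarrow> base_point y = base_point z"
  unfolding base_point_def using agree_ucoord[of k y z "{#}"] by (simp add: agree_def)

lemma agree_mono: "agree k y z \<Longrightarrow> j \<le> k \<Longrightarrow> agree j y z"
  unfolding agree_def by (meson order_trans)

lemma agree_refl [simp]: "agree k y y"
  by (simp add: agree_def)

lemma agree_sym: "agree k y z \<Longrightarrow> agree k z y"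
  by (simp add: agree_def)

lemma linear_ucoord: "linear (\<lambda>y. ucoord y I)"
  by (rule linearI) (simp_all add: ucoord_def)

lemma bounded_linear_ucoord: "bounded_linear (\<lambda>y. ucoord y I)"
  using linear_ucoord linear_conv_bounded_linear by blast

lemma linear_base_point: "linear base_point"
  by (rule linearI) (simp_all add: base_point_def ucoord_def)

lemma smooth_on_jet_coords:
  assumes "open N" "smooth_on N s"
  shows "smooth_on N (jet_coords s :: _ \<Rightarrow> ('n::finite, 'm::finite, 's::finite) jetspace)"
  unfolding jet_coords_def mderiv_list_of
  by (intro smooth_on_Pair smooth_on_id smooth_on_vec_lambda smooth_on_pderivs assms)

lemma jet_coords_cong:
  "open N \<Longrightarrow> x \<in> N \<Longrightarrow> (\<And>x. x \<in> N \<Longrightarrow> s x = t x) \<Longrightarrow> jet_coords s x = jet_coords t x"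
  unfolding jet_coords_def using mderiv_cong[of N x s t] by simp

text \<open>Along the jet of an actual function the derivative in direction \<open>j\<close> shifts the multi-index, so only its
  components of top order can differ from those of \<open>D\<^sub>j\<close>.\<close>

lemma jet_coords_derivative:
  fixes s :: "real^'n::finite \<Rightarrow> real^'m::finite"
  assumes N: "open N" "smooth_on N s" "x \<in> N"
  shows "agree (CARD('r) - 1)
    (frechet_derivative (jet_coords s :: _ \<Rightarrow> ('n, 'm, 'r::finite option) jetspace) (at x) (axis j 1))
    (total_vec j (jet_coords s x))"
proof (rule agreeI)
  have d: "(jet_coords s :: _ \<Rightarrow> ('n, 'm, 'r option) jetspace) differentiable (at x)"
    using smooth_on_differentiable[OF smooth_on_jet_coords[OF N(1,2)] N(1,3)] .
  have "frechet_derivative (\<lambda>x. fst (jet_coords s x :: ('n, 'm, 'r option) jetspace)) (at x) (axis j 1)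
      = fst (frechet_derivative (jet_coords s :: _ \<Rightarrow> ('n, 'm, 'r option) jetspace) (at x) (axis j 1))"
    by (rule frechet_derivative_linear_comp[OF bounded_linear_fst d])
  then show "fst (frechet_derivative (jet_coords s :: _ \<Rightarrow> ('n, 'm, 'r option) jetspace) (at x) (axis j 1))
      = fst (total_vec j (jet_coords s x))"
    by (simp add: total_vec_def)
  fix I :: "'n multiset" assume "size I \<le> CARD('r) - 1" "size I \<le> CARD('r)"
  moreover have "CARD('r) > 0" by simp
  ultimately have I: "size I < CARD('r)" by linarith
  have "ucoord (frechet_derivative (jet_coords s :: _ \<Rightarrow> ('n, 'm, 'r option) jetspace) (at x) (axis j 1)) I
      = frechet_derivative (\<lambda>x. ucoord (jet_coords s x :: ('n, 'm, 'r option) jetspace) I) (at x) (axis j 1)"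
    by (rule frechet_derivative_linear_comp[OF bounded_linear_ucoord d, symmetric])
  also have "(\<lambda>x. ucoord (jet_coords s x :: ('n, 'm, 'r option) jetspace) I) = mderiv I s"
    using I by auto
  also have "frechet_derivative (mderiv I s) (at x) (axis j 1) = mderiv (add_mset j I) s x"
    by (rule mderiv_add_mset[OF N])
  also have "\<dots> = ucoord (total_vec j (jet_coords s x) :: ('n, 'm, 'r option) jetspace) I"
    using I by (simp add: ucoord_def total_vec_def) (simp add: jet_coords_def)
  finally show "ucoord (frechet_derivative (jet_coords s :: _ \<Rightarrow> ('n, 'm, 'r option) jetspace) (at x) (axis j 1)) I
      = ucoord (total_vec j (jet_coords s x) :: ('n, 'm, 'r option) jetspace) I" .
qed

text \<open>Along the lines through \<open>y\<close> and \<open>z\<close> in the directions \<open>v\<close> and \<open>w\<close> the function \<open>G\<close> takes the same values,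
  since corresponding points agree up to order \<open>k\<close>.\<close>

lemma derivative_agree:
  fixes G :: "('n::finite, 'm::finite, 's::finite) jetspace \<Rightarrow> 'b::euclidean_space"
  assumes Dom: "open Dom" "smooth_on Dom G" "y \<in> Dom" "z \<in> Dom"
    and G: "\<And>y z. y \<in> Dom \<Longrightarrow> z \<in> Dom \<Longrightarrow> agree k y z \<Longrightarrow> G y = G z"
    and yz: "agree k y z" "agree k v w"
  shows "frechet_derivative G (at y) v = frechet_derivative G (at z) w"
proof -
  define T where "T = (\<lambda>t::real. y + t *\<^sub>R v) -` Dom \<inter> (\<lambda>t::real. z + t *\<^sub>R w) -` Dom"
  have T: "open T" "0 \<in> T"
    unfolding T_def using Dom
    by (auto intro!: open_Int open_vimage continuous_on_add continuous_on_const continuous_on_scaleR continuous_on_id)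
  have line: "frechet_derivative (\<lambda>t::real. G (y + t *\<^sub>R v)) (at 0) 1 = frechet_derivative G (at y) v" if "y \<in> Dom" for y v
  proof -
    have 1: "((\<lambda>t::real. y + t *\<^sub>R v) has_derivative (\<lambda>h. h *\<^sub>R v)) (at 0)"
      by (auto intro!: derivative_eq_intros)
    have 2: "(G has_derivative frechet_derivative G (at y)) (at (y + 0 *\<^sub>R v))"
      using smooth_on_has_derivative[OF Dom(2,1) that] by simp
    show ?thesis using frechet_derivative_compose[OF 1 2] by simp
  qed
  have "frechet_derivative (\<lambda>t::real. G (y + t *\<^sub>R v)) (at 0) = frechet_derivative (\<lambda>t. G (z + t *\<^sub>R w)) (at 0)"
  proof (rule frechet_derivative_cong[OF T])
    fix t assume "t \<in> T"
    then have "y + t *\<^sub>R v \<in> Dom" "z + t *\<^sub>R w \<in> Dom" by (auto simp: T_def)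
    then show "G (y + t *\<^sub>R v) = G (z + t *\<^sub>R w)"
      by (rule G) (use yz in \<open>simp add: agree_def\<close>)
  qed
  then show ?thesis using line[OF Dom(3), of v] line[OF Dom(4), of w] by simp
qed

section \<open>Every point of the model space is the jet of a polynomial\<close>

text \<open>With the factorials in the denominator, a partial derivative just removes one index.\<close>

definition monomial_at :: "real^'n::finite \<Rightarrow> 'n multiset \<Rightarrow> real^'n \<Rightarrow> real" where
  "monomial_at a K x = (\<Prod>i\<in>UNIV. (x $ i - a $ i) ^ count K i / fact (count K i))"

lemma smooth_on_monomial: "smooth_on UNIV (monomial_at a K)"
proof -
  have base: "smooth_on UNIV (\<lambda>x::real^'a. x $ i - a $ i)" for i
  proof -
    have "smooth_on UNIV (\<lambda>x::real^'a. x $ i + (- a $ i))"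
      by (intro smooth_on_add smooth_on_vec_nth smooth_on_id smooth_on_const open_UNIV)
    then show ?thesis by simp
  qed
  have pw: "smooth_on UNIV (\<lambda>x::real^'a. (x $ i - a $ i) ^ k)" for i k
    by (induction k) (simp_all add: smooth_on_const smooth_on_mult base)
  have "smooth_on UNIV (\<lambda>x. \<Prod>i\<in>UNIV. (x $ i - a $ i) ^ count K i * inverse (fact (count K i)))"
    by (intro smooth_on_prod smooth_on_mult pw smooth_on_const open_UNIV)
  then show ?thesis unfolding monomial_at_def divide_inverse .
qed

lemma monomial_derivative:
  "frechet_derivative (monomial_at a K) (at x) (axis j 1)
    = (if j \<in># K then monomial_at a (K - {#j#}) x else 0)"
proof -
  define R where "R = (\<lambda>K. \<Prod>i\<in>UNIV - {j}. (x $ i - a $ i) ^ count K i / fact (count K i))"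
  have d1: "((\<lambda>t. monomial_at a K (x + t *\<^sub>R axis j 1)) has_real_derivative
      frechet_derivative (monomial_at a K) (at x) (axis j 1)) (at 0)"
    by (rule has_real_derivative_along_line)
      (use smooth_on_has_derivative[OF smooth_on_monomial open_UNIV, of x] in simp)
  have eq: "(\<lambda>t. monomial_at a K (x + t *\<^sub>R axis j 1))
      = (\<lambda>t. (x $ j - a $ j + t) ^ count K j / fact (count K j) * R K)"
  proof
    fix t
    have "monomial_at a K (x + t *\<^sub>R axis j 1)
      = ((x + t *\<^sub>R axis j 1) $ j - a $ j) ^ count K j / fact (count K j)
        * (\<Prod>i\<in>UNIV - {j}. ((x + t *\<^sub>R axis j 1) $ i - a $ i) ^ count K i / fact (count K i))"
      unfolding monomial_at_def by (rule prod.remove) auto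
    also have "(\<Prod>i\<in>UNIV - {j}. ((x + t *\<^sub>R axis j 1) $ i - a $ i) ^ count K i / fact (count K i)) = R K"
      unfolding R_def by (rule prod.cong) (auto simp: axis_def)
    finally show "monomial_at a K (x + t *\<^sub>R axis j 1)
      = (x $ j - a $ j + t) ^ count K j / fact (count K j) * R K"
      by (simp add: axis_def algebra_simps)
  qed
  have d2: "((\<lambda>t. (x $ j - a $ j + t) ^ count K j / fact (count K j) * R K) has_real_derivative
      (if j \<in># K then monomial_at a (K - {#j#}) x else 0)) (at 0)"
  proof (cases "j \<in># K")
    case False
    then have "count K j = 0" by (simp add: not_in_iff)
    then show ?thesis using False by simp
  next
    case True
    then obtain k where k: "count K j = Suc k" by (metis count_greater_zero_iff gr0_implies_Suc)
    have "monomial_at a (K - {#j#}) x = (x $ j - a $ j) ^ k / fact k * R (K - {#j#})"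
      unfolding monomial_at_def R_def using k by (subst prod.remove[of _ j]) auto
    also have "R (K - {#j#}) = R K" unfolding R_def by (rule prod.cong) auto
    finally have m: "monomial_at a (K - {#j#}) x = (x $ j - a $ j) ^ k / fact k * R K" .
    have "((\<lambda>t. (x $ j - a $ j + t) ^ Suc k / fact (Suc k) * R K) has_real_derivative
        (real (Suc k) * (x $ j - a $ j + 0) ^ k / fact (Suc k) * R K)) (at 0)"
      by (rule derivative_eq_intros refl | simp)+
    also have "real (Suc k) * (x $ j - a $ j + 0) ^ k / fact (Suc k) * R K = monomial_at a (K - {#j#}) x"
      unfolding m by (simp add: divide_simps del: of_nat_Suc)
    finally show ?thesis using True k by simp
  qed
  show ?thesis by (rule DERIV_unique[OF d1[unfolded eq] d2])
qed

lemma monomial_at_center: "monomial_at a K a = (if K = {#} then 1 else 0)"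
proof (cases "K = {#}")
  case False
  then obtain i where "i \<in># K" by blast
  then show ?thesis using False
    unfolding monomial_at_def by (auto intro!: bexI[of _ i] simp: zero_power)
qed (simp add: monomial_at_def)

definition taylor_poly :: "('n::finite, 'm::finite, 's::finite) jetspace \<Rightarrow> real^'n \<Rightarrow> real^'m" where
  "taylor_poly y x = (\<Sum>J\<in>UNIV. monomial_at (fst y) (Rep_mindex J) x *\<^sub>R snd y $ J)"

lemma smooth_on_taylor_poly: "smooth_on UNIV (taylor_poly y)"
  unfolding taylor_poly_def
  by (intro smooth_on_sum smooth_on_scaleR smooth_on_monomial smooth_on_const open_UNIV)

lemma pderivs_taylor_poly:
  fixes y :: "('n::finite, 'm::finite, 's::finite) jetspace"
  shows "pderivs l (taylor_poly y) = (\<lambda>x. \<Sum>J\<in>UNIV.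
     (if mset l \<subseteq># Rep_mindex J then monomial_at (fst y) (Rep_mindex J - mset l) x else 0) *\<^sub>R snd y $ J)"
proof (induction l)
  case Nil
  then show ?case by (simp add: taylor_poly_def fun_eq_iff)
next
  case (Cons i l)
  let ?a = "fst y"
  let ?M = "\<lambda>J x. if mset l \<subseteq># Rep_mindex J then monomial_at ?a (Rep_mindex J - mset l) x else 0"
  show ?case
  proof
    fix x
    let ?d = "\<lambda>J v. if mset l \<subseteq># Rep_mindex J then frechet_derivative (monomial_at ?a (Rep_mindex J - mset l)) (at x) v else 0"
    have "(?M J has_derivative ?d J) (at x)" for J
      using smooth_on_has_derivative[OF smooth_on_monomial open_UNIV, of x ?a "Rep_mindex J - mset l"]
      by (cases "mset l \<subseteq># Rep_mindex J") simp_all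
    then have "((\<lambda>x. \<Sum>J\<in>UNIV. ?M J x *\<^sub>R snd y $ J) has_derivative (\<lambda>v. \<Sum>J\<in>UNIV. ?d J v *\<^sub>R snd y $ J)) (at x)"
      by (intro has_derivative_sum has_derivative_scaleR_left)
    then have "pderivs (i # l) (taylor_poly y) x = (\<Sum>J\<in>UNIV. ?d J (axis i 1) *\<^sub>R snd y $ J)"
      unfolding pderivs.simps Cons.IH by (simp add: has_derivative_frechet)
    also have "\<dots> = (\<Sum>J\<in>UNIV. (if mset (i # l) \<subseteq># Rep_mindex J
        then monomial_at ?a (Rep_mindex J - mset (i # l)) x else 0) *\<^sub>R snd y $ J)"
    proof (rule sum.cong[OF refl])
      fix J :: "('n, 's) mindex"
      have "mset (i # l) \<subseteq># Rep_mindex J \<longleftrightarrow> mset l \<subseteq># Rep_mindex J \<and> i \<in># Rep_mindex J - mset l"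
      proof (cases "mset l \<subseteq># Rep_mindex J")
        case True
        then show ?thesis
          using subset_mset.le_diff_conv2[OF True, of "{#i#}"] by simp
      next
        case False
        then show ?thesis by (metis mset.simps(2) mset_subset_eq_insertD subset_mset.less_imp_le)
      qed
      moreover have "Rep_mindex J - mset l - {#i#} = Rep_mindex J - mset (i # l)" by simp
      ultimately show "?d J (axis i 1) *\<^sub>R snd y $ J = (if mset (i # l) \<subseteq># Rep_mindex J
        then monomial_at ?a (Rep_mindex J - mset (i # l)) x else 0) *\<^sub>R snd y $ J"
        by (auto simp: monomial_derivative)
    qed
    finally show "pderivs (i # l) (taylor_poly y) x = (\<Sum>J\<in>UNIV. (if mset (i # l) \<subseteq># Rep_mindex J
        then monomial_at ?a (Rep_mindex J - mset (i # l)) x else 0) *\<^sub>R snd y $ J)" .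
  qed
qed

lemma jet_coords_taylor_poly:
  fixes y :: "('n::finite, 'm::finite, 's::finite) jetspace"
  shows "jet_coords (taylor_poly y) (fst y) = y"
proof -
  have "mderiv (Rep_mindex I) (taylor_poly y) (fst y) = snd y $ I" for I :: "('n, 's) mindex"
  proof -
    have "mderiv (Rep_mindex I) (taylor_poly y) (fst y) = (\<Sum>J\<in>UNIV. (if J = I then 1 else 0) *\<^sub>R snd y $ J)"
      unfolding mderiv_list_of pderivs_taylor_poly
    proof (rule sum.cong[OF refl])
      fix J :: "('n, 's) mindex"
      have "Rep_mindex I \<subseteq># Rep_mindex J \<and> Rep_mindex J - Rep_mindex I = {#} \<longleftrightarrow> J = I"
        using Rep_mindex_inject[of J I] subset_mset.antisym[of "Rep_mindex I" "Rep_mindex J"]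
        by (auto simp: Diff_eq_empty_iff_mset)
      then show "(if mset (list_of (Rep_mindex I)) \<subseteq># Rep_mindex J
          then monomial_at (fst y) (Rep_mindex J - mset (list_of (Rep_mindex I))) (fst y) else 0) *\<^sub>R snd y $ J
        = (if J = I then 1 else 0) *\<^sub>R snd y $ J"
        by (auto simp: monomial_at_center)
    qed
    also have "\<dots> = (\<Sum>J\<in>UNIV. if J = I then snd y $ J else 0)" by (rule sum.cong) auto
    also have "\<dots> = snd y $ I" by simp
    finally show ?thesis .
  qed
  then show ?thesis by (simp add: jet_coords_def vec_eq_iff prod_eq_iff)
qed

section \<open>The hodograph prolongation in coordinates\<close>

text \<open>The components \<open>U\<^sub>I\<close> of the prolongation, defined by solving \<open>\<Sum>\<^sub>i (D\<^sub>j X\<^sup>i) U\<^sub>I\<^sub>+\<^sub>i = D\<^sub>j U\<^sub>I\<close> for \<open>U\<^sub>I\<^sub>+\<^sub>i\<close>. The recursion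
  treats the indices one after the other and so runs over lists; that the order is immaterial is seen
  only when the \<open>U\<^sub>I\<close> are realised as derivatives of a section.\<close>

primrec prolong_comp ::
  "((real^'n) \<times> (real^'m) \<Rightarrow> (real^'n) \<times> (real^'m)) \<Rightarrow> 'n list \<Rightarrow>
   ('n::finite, 'm::finite, 'r::finite option) jetspace \<Rightarrow> real^'m" where
  "prolong_comp h [] = (\<lambda>y. snd (h (base_point y)))"
| "prolong_comp h (i # l) = (\<lambda>y. \<Sum>j\<in>UNIV. matrix_inv (total_jacobian (fst \<circ> h) y) $ i $ j *\<^sub>R
     frechet_derivative (prolong_comp h l) (at y) (total_vec j y))"

definition prolong_map ::
  "((real^'n) \<times> (real^'m) \<Rightarrow> (real^'n) \<times> (real^'m)) \<Rightarrow>
   ('n::finite, 'm::finite, 'r::finite option) jetspace \<Rightarrow> ('n, 'm, 'r option) jetspace" where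
  "prolong_map h y = (fst (h (base_point y)), \<chi> I. prolong_comp h (list_of (Rep_mindex I)) y)"

definition prolong_dom ::
  "((real^'n) \<times> (real^'m) \<Rightarrow> (real^'n) \<times> (real^'m)) \<Rightarrow> ((real^'n) \<times> (real^'m)) set \<Rightarrow>
   ('n::finite, 'm::finite, 'r::finite option) jetspace set" where
  "prolong_dom h W = {y. base_point y \<in> W \<and> det (total_jacobian (fst \<circ> h) y) \<noteq> 0}"

lemma ucoord_prolong_map:
  "size I \<le> CARD('r) \<Longrightarrow> ucoord (prolong_map h y :: ('n::finite, 'm::finite, 'r::finite option) jetspace) I
    = prolong_comp h (list_of I) y"
  by (simp add: ucoord_def prolong_map_def)

lemma total_jacobian_nth:
  assumes "linear (frechet_derivative X (at (base_point y)))"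
  shows "total_jacobian X y $ i $ j = frechet_derivative X (at (base_point y)) (axis i 1, ucoord y {#i#}) $ j"
proof -
  let ?D = "frechet_derivative X (at (base_point y))"
  let ?u = "ucoord y {#i#}"
  have u: "?u = (\<Sum>\<alpha>\<in>UNIV. ?u $ \<alpha> *\<^sub>R axis \<alpha> 1)"
    by (simp add: basis_expansion scalar_mult_eq_scaleR flip: scalar_mult_eq_scaleR)
  have "(axis i 1, ?u) = (axis i (1::real), 0) + (\<Sum>\<alpha>\<in>UNIV. ?u $ \<alpha> *\<^sub>R (0, axis \<alpha> 1))"
    by (simp add: prod_eq_iff fst_sum snd_sum u[symmetric])
  then have "?D (axis i 1, ?u) = ?D ((axis i 1, 0) + (\<Sum>\<alpha>\<in>UNIV. ?u $ \<alpha> *\<^sub>R (0, axis \<alpha> 1)))"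
    by simp
  also have "\<dots> = ?D (axis i 1, 0) + (\<Sum>\<alpha>\<in>UNIV. ?u $ \<alpha> *\<^sub>R ?D (0, axis \<alpha> 1))"
    using assms by (simp only: linear_add linear_sum linear_scale)
  finally show ?thesis
    by (simp add: total_jacobian_def Let_def base_point_def sum_component)
qed

context
  fixes W :: "((real^'n::finite) \<times> (real^'m::finite)) set"
    and h :: "(real^'n) \<times> (real^'m) \<Rightarrow> (real^'n) \<times> (real^'m)"
  assumes W: "open W" and h: "smooth_on W h"
begin

lemma smooth_fst_h: "smooth_on W (fst \<circ> h)"
  using smooth_on_fst[OF W h] by (simp add: o_def)

lemma open_base: "open {y :: ('n, 'm, 'r::finite option) jetspace. base_point y \<in> W}"
  using W linear_continuous_on[of "base_point :: ('n, 'm, 'r option) jetspace \<Rightarrow> _"] linear_base_point linear_conv_bounded_linear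
    continuous_open_vimage[of W "base_point :: ('n, 'm, 'r option) jetspace \<Rightarrow> _"]
  by (metis (no_types, lifting) Collect_cong continuous_on_eq_continuous_at open_UNIV UNIV_I vimage_def)

lemma total_jacobian_h:
  assumes "base_point y \<in> W"
  shows "total_jacobian (fst \<circ> h) y $ i $ j
    = frechet_derivative (fst \<circ> h) (at (base_point y)) (axis i 1, ucoord y {#i#}) $ j"
  by (rule total_jacobian_nth[OF smooth_on_linear_derivative[OF smooth_fst_h W assms]])

lemma smooth_total_jacobian:
  "smooth_on {y :: ('n, 'm, 'r::finite option) jetspace. base_point y \<in> W} (\<lambda>y. total_jacobian (fst \<circ> h) y $ i $ j)"
proof -
  let ?B = "{y :: ('n, 'm, 'r option) jetspace. base_point y \<in> W}"
  have bp: "smooth_on ?B (\<lambda>y. base_point y)"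
    by (rule smooth_on_linear[OF open_base linear_base_point smooth_on_id[OF open_base]])
  have D: "smooth_on ?B (\<lambda>y. frechet_derivative (fst \<circ> h) (at (base_point y)) b)" for b
    by (rule smooth_on_compose[OF smooth_on_derivative[OF smooth_fst_h] bp open_base W]) auto
  have u: "smooth_on ?B (\<lambda>y. (axis i (1::real), ucoord y {#i#}))"
    by (intro smooth_on_Pair smooth_on_const open_base smooth_on_linear[OF open_base linear_ucoord] smooth_on_id)
  have "smooth_on ?B (\<lambda>y. \<Sum>b\<in>Basis. ((axis i 1, ucoord y {#i#}) \<bullet> b) *\<^sub>R
      frechet_derivative (fst \<circ> h) (at (base_point y)) b)"
    by (intro smooth_on_sum smooth_on_scaleR open_base D smooth_on_bounded_linear[OF open_base bounded_linear_inner_left u])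
  then have "smooth_on ?B (\<lambda>y. frechet_derivative (fst \<circ> h) (at (base_point y)) (axis i 1, ucoord y {#i#}))"
    by (rule smooth_on_eq[OF _ open_base])
      (rule linear_basis_expand[OF smooth_on_linear_derivative[OF smooth_fst_h W], symmetric], simp)
  then have "smooth_on ?B (\<lambda>y. frechet_derivative (fst \<circ> h) (at (base_point y)) (axis i 1, ucoord y {#i#}) $ j)"
    by (rule smooth_on_vec_nth[OF open_base])
  then show ?thesis by (rule smooth_on_eq[OF _ open_base]) (simp add: total_jacobian_h)
qed

lemma open_prolong_dom: "open (prolong_dom h W :: ('n, 'm, 'r::finite option) jetspace set)"
proof -
  let ?B = "{y :: ('n, 'm, 'r option) jetspace. base_point y \<in> W}"
  have "smooth_on ?B (\<lambda>y. det (total_jacobian (fst \<circ> h) y))"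
    by (rule smooth_on_det[OF open_base smooth_total_jacobian])
  from continuous_open_preimage[OF smooth_on_continuous_on[OF this] open_base, of "- {0}"]
  have "open (?B \<inter> (\<lambda>y. det (total_jacobian (fst \<circ> h) y)) -` (- {0}))" by (simp add: open_Compl)
  moreover have "?B \<inter> (\<lambda>y. det (total_jacobian (fst \<circ> h) y)) -` (- {0}) = prolong_dom h W"
    by (auto simp: prolong_dom_def)
  ultimately show ?thesis by simp
qed

lemma prolong_dom_base: "y \<in> prolong_dom h W \<Longrightarrow> base_point y \<in> W"
  by (simp add: prolong_dom_def)

lemma inverse_total_jacobian:
  assumes "y \<in> prolong_dom h W"
  shows "matrix_inv (total_jacobian (fst \<circ> h) y) ** total_jacobian (fst \<circ> h) y = mat 1"
    "total_jacobian (fst \<circ> h) y ** matrix_inv (total_jacobian (fst \<circ> h) y) = mat 1"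
proof -
  have "\<exists>B. total_jacobian (fst \<circ> h) y ** B = mat 1 \<and> B ** total_jacobian (fst \<circ> h) y = mat 1"
    using assms by (simp add: prolong_dom_def flip: invertible_det_nz invertible_def)
  from someI_ex[OF this]
  show "matrix_inv (total_jacobian (fst \<circ> h) y) ** total_jacobian (fst \<circ> h) y = mat 1"
    "total_jacobian (fst \<circ> h) y ** matrix_inv (total_jacobian (fst \<circ> h) y) = mat 1"
    unfolding matrix_inv_def by auto
qed

lemma smooth_inverse_total_jacobian:
  "smooth_on (prolong_dom h W :: ('n, 'm, 'r::finite option) jetspace set)
    (\<lambda>y. matrix_inv (total_jacobian (fst \<circ> h) y) $ i $ j)"
proof -
  let ?O = "prolong_dom h W :: ('n, 'm, 'r option) jetspace set"
  let ?A = "\<lambda>y. total_jacobian (fst \<circ> h) y"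
  have A: "smooth_on ?O (\<lambda>y. ?A y $ i $ j)" for i j
    by (rule smooth_on_subset[OF smooth_total_jacobian]) (auto simp: prolong_dom_def)
  have "smooth_on ?O (\<lambda>y. matrix_inv (?A y) *v axis j 1)"
  proof (rule smooth_on_solve[OF open_prolong_dom, where L = "\<lambda>y v. ?A y *v v" and b = "\<lambda>_. axis j 1"])
    show "DIM(real^'n) = CARD('n)" by simp
    show "inj ((*v) (?A y))" if "y \<in> ?O" for y
    proof (rule inj_on_inverseI)
      show "matrix_inv (?A y) *v (?A y *v v) = v" for v
        using inverse_total_jacobian(1)[OF that] by (simp add: matrix_vector_mul_assoc)
    qed
    show "smooth_on ?O (\<lambda>y. ?A y *v v)" for v
      unfolding matrix_vector_mult_def
      by (intro smooth_on_vec_lambda smooth_on_sum smooth_on_mult A smooth_on_const open_prolong_dom)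
    show "?A y *v (matrix_inv (?A y) *v axis j 1) = axis j 1" if "y \<in> ?O" for y
      using inverse_total_jacobian(2)[OF that] by (simp add: matrix_vector_mul_assoc)
  qed (use smooth_on_const[OF open_prolong_dom] in simp_all)
  from smooth_on_vec_nth[OF open_prolong_dom this, of i]
  show ?thesis by (simp add: matrix_vector_mul_component inner_axis row_def column_def matrix_vector_mult_basis)
qed

lemma smooth_total_vec: "smooth_on UNIV (total_vec j :: ('n, 'm, 'r::finite option) jetspace \<Rightarrow> _)"
  unfolding total_vec_def
proof (intro smooth_on_Pair smooth_on_const open_UNIV smooth_on_vec_lambda)
  fix I :: "('n, 'r option) mindex"
  show "smooth_on UNIV (\<lambda>y::('n, 'm, 'r option) jetspace.
      if size (Rep_mindex I) < CARD('r) then ucoord y (add_mset j (Rep_mindex I)) else 0)"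
    using smooth_on_linear[OF open_UNIV linear_ucoord smooth_on_id[OF open_UNIV]]
    by (cases "size (Rep_mindex I) < CARD('r)") (simp_all add: smooth_on_const)
qed

lemma smooth_prolong_comp:
  "smooth_on (prolong_dom h W :: ('n, 'm, 'r::finite option) jetspace set) (prolong_comp h l)"
proof (induction l)
  case Nil
  have "smooth_on (prolong_dom h W :: ('n, 'm, 'r option) jetspace set) (\<lambda>y. h (base_point y))"
    by (rule smooth_on_compose[OF h smooth_on_linear[OF open_prolong_dom linear_base_point
            smooth_on_id[OF open_prolong_dom]] open_prolong_dom W])
      (auto simp: prolong_dom_def)
  then show ?case by (simp add: smooth_on_snd[OF open_prolong_dom])
next
  case (Cons i l)
  show ?case
    unfolding prolong_comp.simps
    by (intro smooth_on_sum smooth_on_scaleR open_prolong_dom smooth_inverse_total_jacobian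
        smooth_on_derivative_apply Cons smooth_on_subset[OF smooth_total_vec subset_UNIV])
qed

lemma smooth_prolong_map:
  "smooth_on (prolong_dom h W :: ('n, 'm, 'r::finite option) jetspace set) (prolong_map h)"
proof -
  have "smooth_on (prolong_dom h W :: ('n, 'm, 'r option) jetspace set) (\<lambda>y. h (base_point y))"
    by (rule smooth_on_compose[OF h smooth_on_linear[OF open_prolong_dom linear_base_point
            smooth_on_id[OF open_prolong_dom]] open_prolong_dom W])
      (auto simp: prolong_dom_def)
  then show ?thesis
    unfolding prolong_map_def
    by (intro smooth_on_Pair smooth_on_vec_lambda open_prolong_dom smooth_on_fst smooth_prolong_comp)
qed

lemma total_jacobian_agree:
  fixes y z :: "('n, 'm, 'r::finite option) jetspace"
  assumes "y \<in> prolong_dom h W" "z \<in> prolong_dom h W" "agree k y z" "1 \<le> k"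
  shows "total_jacobian (fst \<circ> h) y = total_jacobian (fst \<circ> h) z"
proof -
  have "CARD('r) > 0" by simp
  then have u: "ucoord y {#i#} = ucoord z {#i#}" for i
    using agree_ucoord[OF assms(3), of "{#i#}"] assms(4) by simp
  show ?thesis
    unfolding vec_eq_iff total_jacobian_h[OF prolong_dom_base[OF assms(1)]]
      total_jacobian_h[OF prolong_dom_base[OF assms(2)]] agree_base_point[OF assms(3)] u by simp
qed

text \<open>Passing from \<open>U\<^sub>I\<close> to \<open>U\<^sub>I\<^sub>+\<^sub>i\<close> involves the first order data \<open>D\<^sub>j X\<^sup>i\<close> and one total derivative, hence
  raises the order by at most one.\<close>

lemma prolong_comp_agree:
  fixes y z :: "('n, 'm, 'r::finite option) jetspace"
  assumes "length l \<le> CARD('r)" "y \<in> prolong_dom h W" "z \<in> prolong_dom h W" "agree (length l) y z"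
  shows "prolong_comp h l y = prolong_comp h l z"
  using assms
proof (induction l arbitrary: y z)
  case Nil
  then show ?case using agree_base_point by fastforce
next
  case (Cons i l)
  have l: "length l < CARD('r)" using Cons.prems(1) by simp
  have J: "total_jacobian (fst \<circ> h) y = total_jacobian (fst \<circ> h) z"
    by (rule total_jacobian_agree[OF Cons.prems(2-4)]) simp
  have "frechet_derivative (prolong_comp h l) (at y) (total_vec j y)
      = frechet_derivative (prolong_comp h l) (at z) (total_vec j z)" for j
  proof (rule derivative_agree[OF open_prolong_dom smooth_prolong_comp Cons.prems(2,3)])
    show "prolong_comp h l y = prolong_comp h l z"
      if "y \<in> prolong_dom h W" "z \<in> prolong_dom h W" "agree (length l) y z" for y z :: "('n, 'm, 'r option) jetspace"
      by (rule Cons.IH[OF _ that]) (use l in simp)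
    show "agree (length l) y z" using agree_mono[OF Cons.prems(4)] by simp
    show "agree (length l) (total_vec j y) (total_vec j z)"
      unfolding agree_def total_vec_def
    proof (intro conjI allI impI)
      fix I :: "('n, 'r option) mindex" assume I: "size (Rep_mindex I) \<le> length l"
      have "ucoord y (add_mset j (Rep_mindex I)) = ucoord z (add_mset j (Rep_mindex I))"
        by (rule agree_ucoord[OF Cons.prems(4)]) (use I l in auto)
      then show "snd (axis j 1, \<chi> I. if size (Rep_mindex I) < CARD('r) then ucoord y (add_mset j (Rep_mindex I)) else 0) $ I
        = snd (axis j 1, \<chi> I. if size (Rep_mindex I) < CARD('r) then ucoord z (add_mset j (Rep_mindex I)) else 0) $ I"
        by simp
    qed simp
  qed
  then show ?case by (simp add: J)
qed

lemma derivative_prolong_comp_agree: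
  fixes y :: "('n, 'm, 'r::finite option) jetspace"
  assumes "length l < CARD('r)" "y \<in> prolong_dom h W" "agree (CARD('r) - 1) v w"
  shows "frechet_derivative (prolong_comp h l) (at y) v = frechet_derivative (prolong_comp h l) (at y) w"
proof (rule derivative_agree[OF open_prolong_dom smooth_prolong_comp assms(2,2)])
  show "prolong_comp h l y = prolong_comp h l z"
    if "y \<in> prolong_dom h W" "z \<in> prolong_dom h W" "agree (length l) y z" for y z :: "('n, 'm, 'r option) jetspace"
    by (rule prolong_comp_agree[OF _ that]) (use assms in simp)
  show "agree (length l) v w" by (rule agree_mono[OF assms(3)]) (use assms(1) in simp)
qed simp

text \<open>The defining relation of the recursion, multiplied by the matrix \<open>D\<^sub>j X\<^sup>i\<close> instead of its inverse.\<close>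

lemma total_derivative_prolong_comp:
  assumes "y \<in> prolong_dom h W"
  shows "frechet_derivative (prolong_comp h l) (at y) (total_vec j y)
    = (\<Sum>i\<in>UNIV. total_jacobian (fst \<circ> h) y $ j $ i *\<^sub>R prolong_comp h (i # l) y)"
proof -
  let ?A = "total_jacobian (fst \<circ> h) y" and ?D = "\<lambda>j. frechet_derivative (prolong_comp h l) (at y) (total_vec j y)"
  have "(\<Sum>i\<in>UNIV. ?A $ j $ i *\<^sub>R prolong_comp h (i # l) y)
      = (\<Sum>i\<in>UNIV. \<Sum>k\<in>UNIV. (?A $ j $ i * matrix_inv ?A $ i $ k) *\<^sub>R ?D k)"
    by (simp add: scaleR_sum_right)
  also have "\<dots> = (\<Sum>k\<in>UNIV. \<Sum>i\<in>UNIV. (?A $ j $ i * matrix_inv ?A $ i $ k) *\<^sub>R ?D k)"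
    by (rule sum.swap)
  also have "\<dots> = (\<Sum>k\<in>UNIV. (?A ** matrix_inv ?A) $ j $ k *\<^sub>R ?D k)"
    by (simp add: matrix_matrix_mult_def scaleR_sum_left)
  also have "\<dots> = (\<Sum>k\<in>UNIV. (if j = k then ?D k else 0))"
    unfolding inverse_total_jacobian(2)[OF assms] by (rule sum.cong) (auto simp: mat_def)
  finally show ?thesis by simp
qed

lemma solve_prolong_comp:
  assumes "y \<in> prolong_dom h W"
    and "\<And>j. frechet_derivative (prolong_comp h l) (at y) (total_vec j y)
      = (\<Sum>i\<in>UNIV. total_jacobian (fst \<circ> h) y $ j $ i *\<^sub>R P i)"
  shows "prolong_comp h (i # l) y = P i"
proof -
  let ?A = "total_jacobian (fst \<circ> h) y"
  have "prolong_comp h (i # l) y = (\<Sum>j\<in>UNIV. \<Sum>k\<in>UNIV. (matrix_inv ?A $ i $ j * ?A $ j $ k) *\<^sub>R P k)"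
    by (simp add: assms(2) scaleR_sum_right)
  also have "\<dots> = (\<Sum>k\<in>UNIV. \<Sum>j\<in>UNIV. (matrix_inv ?A $ i $ j * ?A $ j $ k) *\<^sub>R P k)"
    by (rule sum.swap)
  also have "\<dots> = (\<Sum>k\<in>UNIV. (matrix_inv ?A ** ?A) $ i $ k *\<^sub>R P k)"
    by (simp add: matrix_matrix_mult_def scaleR_sum_left)
  also have "\<dots> = (\<Sum>k\<in>UNIV. (if i = k then P k else 0))"
    unfolding inverse_total_jacobian(1)[OF assms(1)] by (rule sum.cong) (auto simp: mat_def)
  finally show ?thesis by simp
qed

end

lemma linear_axis_expand:
  fixes L :: "real^'n::finite \<Rightarrow> 'b::real_vector"
  assumes "linear L"
  shows "L v = (\<Sum>j\<in>UNIV. v $ j *\<^sub>R L (axis j 1))"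
proof -
  have "L (\<Sum>j\<in>UNIV. v $ j *\<^sub>R axis j 1) = (\<Sum>j\<in>UNIV. v $ j *\<^sub>R L (axis j 1))"
    using assms by (simp add: linear_sum linear_scale)
  then show ?thesis by (simp add: basis_expansion flip: scalar_mult_eq_scaleR)
qed

section \<open>Transformed sections in coordinates\<close>

text \<open>\<open>D\<^sub>j X\<^sup>i\<close> at the jet of \<open>s\<close> is the Jacobian matrix of \<open>x \<mapsto> X (x, s x)\<close>, up to transposition.\<close>

lemma graph_derivative:
  fixes h :: "(real^'n::finite) \<times> (real^'m::finite) \<Rightarrow> (real^'n) \<times> (real^'m)"
  assumes W: "open W" "smooth_on W h" and N: "open N" "smooth_on N s" "x \<in> N" and x: "(x, s x) \<in> W"
  shows "((\<lambda>x. fst (h (x, s x))) has_derivative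
    (*v) (transpose (total_jacobian (fst \<circ> h) (jet_coords s x :: ('n, 'm, 'r::finite option) jetspace)))) (at x)"
proof -
  let ?y = "jet_coords s x :: ('n, 'm, 'r option) jetspace"
  let ?D = "frechet_derivative (fst \<circ> h) (at (x, s x))" and ?S = "frechet_derivative s (at x)"
  have s: "(s has_derivative ?S) (at x)" by (rule smooth_on_has_derivative[OF N(2,1,3)])
  have D: "((fst \<circ> h) has_derivative ?D) (at (x, s x))"
    by (rule smooth_on_has_derivative[OF smooth_fst_h[OF W] W(1) x])
  have "((\<lambda>x. (x, s x)) has_derivative (\<lambda>v. (v, ?S v))) (at x)"
    by (rule has_derivative_Pair[OF has_derivative_ident s])
  from diff_chain_at[OF this D]
  have der: "((\<lambda>x. fst (h (x, s x))) has_derivative (\<lambda>v. ?D (v, ?S v))) (at x)"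
    by (simp add: o_def)
  have "?D (axis j 1, ?S (axis j 1)) $ i = total_jacobian (fst \<circ> h) ?y $ j $ i" for i j
  proof -
    have "ucoord ?y {#j#} = mderiv {#j#} s x" by (rule ucoord_jet_coords) (simp add: Suc_le_eq)
    also have "\<dots> = ?S (axis j 1)" using mderiv_add_mset[OF N, of "{#}" j] by simp
    finally show ?thesis using total_jacobian_h[OF W, of ?y j i] x by simp
  qed
  then have eq: "?D (v, ?S v) = transpose (total_jacobian (fst \<circ> h) ?y) *v v" for v
    using linear_axis_expand[OF has_derivative_linear[OF der], of v]
    by (simp add: vec_eq_iff matrix_vector_mult_def transpose_def sum_component mult.commute)
  show ?thesis using der unfolding eq .
qed

lemma det_total_jacobian_iff:
  fixes h :: "(real^'n::finite) \<times> (real^'m::finite) \<Rightarrow> (real^'n) \<times> (real^'m)"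
  assumes W: "open W" "smooth_on W h" and N: "open N" "smooth_on N s" "x \<in> N" and x: "(x, s x) \<in> W"
  shows "det (total_jacobian (fst \<circ> h) (jet_coords s x :: ('n, 'm, 'r::finite option) jetspace)) \<noteq> 0
    \<longleftrightarrow> inj (frechet_derivative (\<lambda>x. fst (h (x, s x))) (at x))"
proof -
  let ?A = "transpose (total_jacobian (fst \<circ> h) (jet_coords s x :: ('n, 'm, 'r option) jetspace))"
  have "frechet_derivative (\<lambda>x. fst (h (x, s x))) (at x) = (*v) ?A"
    by (rule has_derivative_frechet[OF graph_derivative[OF W N x]])
  moreover have "det (matrix ((*v) ?A)) \<noteq> 0 \<longleftrightarrow> inj ((*v) ?A)"
    by (rule det_nz_iff_inj) (rule matrix_vector_mul_linear)
  ultimately show ?thesis by (simp add: matrix_of_matrix_vector_mul det_transpose)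
qed

lemma smooth_on_graph:
  fixes h :: "(real^'n::finite) \<times> (real^'m::finite) \<Rightarrow> 'b::euclidean_space"
  assumes W: "open W" "smooth_on W h" and N: "open N" "smooth_on N s" and x: "\<And>x. x \<in> N \<Longrightarrow> (x, s x) \<in> W"
  shows "smooth_on N (\<lambda>x. h (x, s x))"
  by (rule smooth_on_compose[OF W(2) smooth_on_Pair[OF N(1) smooth_on_id[OF N(1)] N(2)] N(1) W(1)]) (use x in auto)

text \<open>The chain rule that motivates the recursion: the partial derivatives of the transformed section
  satisfy the same linear systems as the components of the prolongation. As the latter are known to
  be of order at most the length of the list, the derivative along the jet of \<open>s\<close> may be replaced by \<open>D\<^sub>j\<close>.\<close>

lemma pderivs_transformed_section:
  fixes h :: "(real^'n::finite) \<times> (real^'m::finite) \<Rightarrow> (real^'n) \<times> (real^'m)"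
  assumes W: "open W" "smooth_on W h" and N: "open N" "smooth_on N s" and N': "open N'" "smooth_on N' s'"
    and X: "\<And>x. x \<in> N \<Longrightarrow> X x \<in> N'"
    and graph: "\<And>x. x \<in> N \<Longrightarrow> h (x, s x) = (X x, s' (X x))"
    and dom: "\<And>x. x \<in> N \<Longrightarrow> (jet_coords s x :: ('n, 'm, 'r::finite option) jetspace) \<in> prolong_dom h W"
    and l: "length l \<le> CARD('r)" and x: "x \<in> N"
  shows "pderivs l s' (X x) = prolong_comp h l (jet_coords s x :: ('n, 'm, 'r option) jetspace)"
  using l x
proof (induction l arbitrary: x)
  case Nil
  then show ?case using graph by simp
next
  case (Cons i l)
  let ?j = "\<lambda>x. jet_coords s x :: ('n, 'm, 'r option) jetspace"
  have IH: "pderivs l s' (X z) = prolong_comp h l (?j z)" if "z \<in> N" for z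
    by (rule Cons.IH[OF _ that]) (use Cons.prems in simp)
  have xW: "(z, s z) \<in> W" if "z \<in> N" for z using prolong_dom_base[OF W dom[OF that]] by simp
  have Xder: "(X has_derivative (*v) (transpose (total_jacobian (fst \<circ> h) (?j x)))) (at x)"
    by (rule has_derivative_transform_within_open[OF graph_derivative[OF W N Cons.prems(2) xW[OF Cons.prems(2)]] N(1) Cons.prems(2)])
      (simp add: graph)
  have s'der: "(pderivs l s' has_derivative frechet_derivative (pderivs l s') (at (X x))) (at (X x))"
    by (rule smooth_on_has_derivative[OF smooth_on_pderivs[OF N'] N'(1) X[OF Cons.prems(2)]])
  have jder: "(?j has_derivative frechet_derivative ?j (at x)) (at x)"
    by (rule smooth_on_has_derivative[OF smooth_on_jet_coords[OF N] N(1) Cons.prems(2)])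
  have Gder: "(prolong_comp h l has_derivative frechet_derivative (prolong_comp h l) (at (?j x))) (at (?j x))"
    by (rule smooth_on_has_derivative[OF smooth_prolong_comp[OF W] open_prolong_dom[OF W] dom[OF Cons.prems(2)]])
  show ?case
  proof (subst solve_prolong_comp[OF W dom[OF Cons.prems(2)], where P = "\<lambda>i. pderivs (i # l) s' (X x)"])
    fix j
    have "frechet_derivative (prolong_comp h l) (at (?j x)) (total_vec j (?j x))
        = frechet_derivative (prolong_comp h l) (at (?j x)) (frechet_derivative ?j (at x) (axis j 1))"
      by (rule derivative_prolong_comp_agree[OF W _ dom[OF Cons.prems(2)]
            agree_sym[OF jet_coords_derivative[OF N Cons.prems(2)]]]) (use Cons.prems in simp)
    also have "\<dots> = frechet_derivative (\<lambda>x. prolong_comp h l (?j x)) (at x) (axis j 1)"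
      by (simp add: frechet_derivative_compose[OF jder Gder])
    also have "frechet_derivative (\<lambda>x. prolong_comp h l (?j x)) (at x)
        = frechet_derivative (\<lambda>x. pderivs l s' (X x)) (at x)"
      by (rule frechet_derivative_cong[OF N(1) Cons.prems(2)]) (rule IH[symmetric])
    also have "\<dots> (axis j 1) = frechet_derivative (pderivs l s') (at (X x))
        (transpose (total_jacobian (fst \<circ> h) (?j x)) *v axis j 1)"
      by (simp add: frechet_derivative_compose[OF Xder s'der])
    also have "\<dots> = (\<Sum>i\<in>UNIV. (transpose (total_jacobian (fst \<circ> h) (?j x)) *v axis j 1) $ i *\<^sub>R
        frechet_derivative (pderivs l s') (at (X x)) (axis i 1))"
      by (rule linear_axis_expand[OF has_derivative_linear[OF s'der]])
    also have "(\<lambda>i. (transpose (total_jacobian (fst \<circ> h) (?j x)) *v axis j 1) $ i)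
        = (\<lambda>i. total_jacobian (fst \<circ> h) (?j x) $ j $ i)"
      by (simp add: fun_eq_iff matrix_vector_mult_basis column_transpose row_def)
    finally show "frechet_derivative (prolong_comp h l) (at (?j x)) (total_vec j (?j x))
        = (\<Sum>i\<in>UNIV. total_jacobian (fst \<circ> h) (?j x) $ j $ i *\<^sub>R pderivs (i # l) s' (X x))"
      by (simp add: fun_eq_iff)
  qed simp
qed

lemma jet_coords_transformed_section:
  fixes h :: "(real^'n::finite) \<times> (real^'m::finite) \<Rightarrow> (real^'n) \<times> (real^'m)"
  assumes W: "open W" "smooth_on W h" and N: "open N" "smooth_on N s" and N': "open N'" "smooth_on N' s'"
    and X: "\<And>x. x \<in> N \<Longrightarrow> X x \<in> N'"
    and graph: "\<And>x. x \<in> N \<Longrightarrow> h (x, s x) = (X x, s' (X x))"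
    and dom: "\<And>x. x \<in> N \<Longrightarrow> (jet_coords s x :: ('n, 'm, 'r::finite option) jetspace) \<in> prolong_dom h W"
    and x: "x \<in> N"
  shows "jet_coords s' (X x) = prolong_map h (jet_coords s x :: ('n, 'm, 'r option) jetspace)"
proof -
  have "mderiv (Rep_mindex I) s' (X x) = prolong_comp h (list_of (Rep_mindex I)) (jet_coords s x :: ('n, 'm, 'r option) jetspace)"
    for I :: "('n, 'r option) mindex"
    unfolding mderiv_list_of
    by (rule pderivs_transformed_section[OF W N N' X graph dom _ x]) (use size_Rep_mindex in simp_all)
  then show ?thesis
    by (simp add: jet_coords_def[of s'] prolong_map_def graph[OF x])
qed

text \<open>The condition on the determinant says that \<open>x \<mapsto> X (x, s x)\<close> is a local diffeomorphism; \<open>\<eta>\<close> is its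
  inverse, and \<open>x' \<mapsto> U (\<eta> x', s (\<eta> x'))\<close> is the transformed section.\<close>

lemma transformed_section_exists:
  fixes h :: "(real^'n::finite) \<times> (real^'m::finite) \<Rightarrow> (real^'n) \<times> (real^'m)"
  assumes W: "open W" "smooth_on W h" and N0: "open N0" "smooth_on N0 s" "x0 \<in> N0"
    and dom0: "(jet_coords s x0 :: ('n, 'm, 'r::finite option) jetspace) \<in> prolong_dom h W"
  obtains N N' \<eta> where "open N" "N \<subseteq> N0" "x0 \<in> N" "open N'" "smooth_on N' \<eta>" "\<eta> ` N' = N"
    "\<forall>x\<in>N. fst (h (x, s x)) \<in> N' \<and> \<eta> (fst (h (x, s x))) = x"
    "\<forall>x'\<in>N'. fst (h (\<eta> x', s (\<eta> x'))) = x'"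
    "\<forall>x\<in>N. (jet_coords s x :: ('n, 'm, 'r option) jetspace) \<in> prolong_dom h W"
proof -
  let ?j = "\<lambda>x. jet_coords s x :: ('n, 'm, 'r option) jetspace"
  let ?X = "\<lambda>x. fst (h (x, s x))"
  define S where "S = N0 \<inter> ?j -` prolong_dom h W"
  have S: "open S" "S \<subseteq> N0" "x0 \<in> S"
    unfolding S_def using dom0 N0 
      continuous_open_preimage[OF smooth_on_continuous_on[OF smooth_on_jet_coords[OF N0(1,2)]] N0(1) open_prolong_dom[OF W]]
    by auto
  have sS: "smooth_on S s" by (rule smooth_on_subset[OF N0(2) S(2)])
  have W_S: "(x, s x) \<in> W" if "x \<in> S" for x
    using prolong_dom_base[OF W, of "?j x"] that by (simp add: S_def)
  have smX: "smooth_on S ?X"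
    by (rule smooth_on_fst[OF S(1) smooth_on_graph[OF W S(1) sS W_S]])
  have inj: "inj (frechet_derivative ?X (at x0))"
    using det_total_jacobian_iff[OF W S(1) sS S(3) W_S[OF S(3)], where 'r='r] dom0 by (simp add: prolong_dom_def)
  have dim: "DIM(real^'n) = CARD('n)" by simp
  show thesis
  proof (rule smooth_inverse_function[OF S(1) smX S(3) inj dim])
    fix U V g
    assume U: "open U" "U \<subseteq> S" "x0 \<in> U" "open V" "?X ` U = V" "g ` V = U" "smooth_on V g"
      "\<And>x. x \<in> U \<Longrightarrow> g (?X x) = x" "\<And>y. y \<in> V \<Longrightarrow> ?X (g y) = y"
    show thesis
    proof (rule that[of U V g])
      show "U \<subseteq> N0" using U(2) S(2) by blast
      show "\<forall>x\<in>U. ?j x \<in> prolong_dom h W" using U(2) by (auto simp: S_def)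
      show "\<forall>x\<in>U. ?X x \<in> V \<and> g (?X x) = x" using U(5,8) by blast
      show "\<forall>x'\<in>V. ?X (g x') = x'" using U(9) by blast
    qed fact+
  qed
qed

text \<open>A jet is represented by its Taylor polynomial, and the jet of the transformed section represents its
  prolongation. Identities between components of the prolongation are thereby reduced to identities
  between derivatives of sections.\<close>

lemma realise_prolongation:
  fixes h :: "(real^'n::finite) \<times> (real^'m::finite) \<Rightarrow> (real^'n) \<times> (real^'m)"
    and y :: "('n, 'm, 'r::finite option) jetspace"
  assumes W: "open W" "smooth_on W h" and y: "y \<in> prolong_dom h W"
  obtains s s' N' \<eta> x' where "smooth_on UNIV s" "open N'" "smooth_on N' s'" "smooth_on N' \<eta>" "x' \<in> N'"
    "jet_coords s (\<eta> x') = y" "jet_coords s' x' = prolong_map h y"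
    "\<forall>x'\<in>N'. (\<eta> x', s (\<eta> x')) \<in> W \<and> h (\<eta> x', s (\<eta> x')) = (x', s' x')"
    "\<forall>x'\<in>N'. inj (frechet_derivative \<eta> (at x'))"
    "\<forall>l. length l \<le> CARD('r) \<longrightarrow> pderivs l s' x' = prolong_comp h l y"
proof -
  let ?s = "taylor_poly y"
  have j: "jet_coords ?s (fst y) = y" by (rule jet_coords_taylor_poly)
  have y': "(jet_coords ?s (fst y) :: ('n, 'm, 'r option) jetspace) \<in> prolong_dom h W" using y unfolding j .
  obtain N N' \<eta> where N: "open N" "N \<subseteq> UNIV" "fst y \<in> N" "open N'" "smooth_on N' \<eta>" "\<eta> ` N' = N"
    "\<forall>x\<in>N. fst (h (x, ?s x)) \<in> N' \<and> \<eta> (fst (h (x, ?s x))) = x"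
    "\<forall>x'\<in>N'. fst (h (\<eta> x', ?s (\<eta> x'))) = x'"
    "\<forall>x\<in>N. (jet_coords ?s x :: ('n, 'm, 'r option) jetspace) \<in> prolong_dom h W"
    by (rule transformed_section_exists[OF W open_UNIV smooth_on_taylor_poly UNIV_I y']) (rule that; assumption)
  define s' where "s' = (\<lambda>x'. snd (h (\<eta> x', ?s (\<eta> x'))))"
  have \<eta>N: "\<eta> x' \<in> N" if "x' \<in> N'" for x' using N(6) that by blast
  have inW: "(x, ?s x) \<in> W" if "x \<in> N" for x using prolong_dom_base[OF W bspec[OF N(9) that]] by simp
  have sN: "smooth_on N ?s" by (rule smooth_on_subset[OF smooth_on_taylor_poly subset_UNIV])
  have smh: "smooth_on N (\<lambda>x. h (x, ?s x))" by (rule smooth_on_graph[OF W N(1) sN inW])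
  have "smooth_on N' (\<lambda>x'. h (\<eta> x', ?s (\<eta> x')))"
    by (rule smooth_on_compose[OF smh N(5,4,1)]) (use \<eta>N in auto)
  then have s': "smooth_on N' s'" unfolding s'_def by (rule smooth_on_snd[OF N(4)])
  have graph: "h (\<eta> x', ?s (\<eta> x')) = (x', s' x')" if "x' \<in> N'" for x'
    using bspec[OF N(8) that] by (simp add: s'_def prod_eq_iff)
  let ?X = "\<lambda>x. fst (h (x, ?s x))"
  have graph2: "h (x, ?s x) = (?X x, s' (?X x))" if "x \<in> N" for x
    using bspec[OF N(7) that] by (simp add: s'_def prod_eq_iff)
  have "jet_coords s' (?X (fst y)) = prolong_map h (jet_coords ?s (fst y) :: ('n, 'm, 'r option) jetspace)"
    by (rule jet_coords_transformed_section[OF W N(1) sN N(4) s' _ graph2 bspec[OF N(9)] N(3)]) (use N(7) in auto)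
  then have j': "jet_coords s' (?X (fst y)) = prolong_map h y" unfolding j .
  have inj\<eta>: "inj (frechet_derivative \<eta> (at x'))" if x': "x' \<in> N'" for x'
  proof -
    have 1: "(\<eta> has_derivative frechet_derivative \<eta> (at x')) (at x')"
      by (rule smooth_on_has_derivative[OF N(5,4) x'])
    have 2: "(?X has_derivative frechet_derivative ?X (at (\<eta> x'))) (at (\<eta> x'))"
      by (rule smooth_on_has_derivative[OF smooth_on_fst[OF N(1) smh] N(1) \<eta>N[OF x']])
    have "frechet_derivative (\<lambda>x'. ?X (\<eta> x')) (at x') = frechet_derivative (\<lambda>x'. x') (at x')"
      by (rule frechet_derivative_cong[OF N(4) x' bspec[OF N(8)]])
    also have "\<dots> = (\<lambda>v. v)" by simp
    finally have "(\<lambda>v. frechet_derivative ?X (at (\<eta> x')) (frechet_derivative \<eta> (at x') v)) = (\<lambda>v. v)"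
      unfolding frechet_derivative_compose[OF 1 2] .
    then have "frechet_derivative ?X (at (\<eta> x')) (frechet_derivative \<eta> (at x') v) = v" for v
      by (rule fun_cong)
    then show ?thesis by (rule inj_on_inverseI)
  qed
  have pd: "pderivs l s' (?X (fst y)) = prolong_comp h l y" if l: "length l \<le> CARD('r)" for l
  proof -
    have "pderivs l s' (?X (fst y)) = prolong_comp h l (jet_coords ?s (fst y) :: ('n, 'm, 'r option) jetspace)"
      by (rule pderivs_transformed_section[OF W N(1) sN N(4) s' _ graph2 bspec[OF N(9)] l N(3)]) (use N(7) in auto)
    then show ?thesis unfolding j .
  qed
  show thesis
  proof (rule that[of ?s N' s' \<eta> "?X (fst y)"])
    show "?X (fst y) \<in> N'" "jet_coords ?s (\<eta> (?X (fst y))) = y" using bspec[OF N(7) N(3)] j by auto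
    show "\<forall>x'\<in>N'. (\<eta> x', ?s (\<eta> x')) \<in> W \<and> h (\<eta> x', ?s (\<eta> x')) = (x', s' x')"
      using inW \<eta>N graph by blast
    show "smooth_on UNIV ?s" by (rule smooth_on_taylor_poly)
    show "\<forall>x'\<in>N'. inj (frechet_derivative \<eta> (at x'))" using inj\<eta> by blast
    show "\<forall>l. length l \<le> CARD('r) \<longrightarrow> pderivs l s' (?X (fst y)) = prolong_comp h l y" using pd by blast
  qed (fact N(4) s' N(5) j')+
qed

text \<open>For sections, transforming by \<open>h\<close> and then by \<open>k\<close> gives back the original section. The determinant
  condition holds for \<open>k\<close> because the base map of the second transformation is the inverse \<open>\<eta>\<close> of that of
  the first.\<close>

lemma prolong_map_inverse:
  fixes h k :: "(real^'n::finite) \<times> (real^'m::finite) \<Rightarrow> (real^'n) \<times> (real^'m)"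
    and y :: "('n, 'm, 'r::finite option) jetspace"
  assumes W: "open W" "smooth_on W h" and W': "open W'" "smooth_on W' k"
    and hW: "\<And>z. z \<in> W \<Longrightarrow> h z \<in> W'" and kh: "\<And>z. z \<in> W \<Longrightarrow> k (h z) = z"
    and y: "y \<in> prolong_dom h W"
  shows "prolong_map h y \<in> prolong_dom k W'" "prolong_map k (prolong_map h y) = y"
proof -
  obtain s s' N' \<eta> x' where *: "smooth_on UNIV s" "open N'" "smooth_on N' s'" "smooth_on N' \<eta>" "x' \<in> N'"
    "jet_coords s (\<eta> x') = y" "jet_coords s' x' = prolong_map h y"
    "\<forall>x'\<in>N'. (\<eta> x', s (\<eta> x')) \<in> W \<and> h (\<eta> x', s (\<eta> x')) = (x', s' x')"
    "\<forall>x'\<in>N'. inj (frechet_derivative \<eta> (at x'))"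
    "\<forall>l. length l \<le> CARD('r) \<longrightarrow> pderivs l s' x' = prolong_comp h l y"
    by (rule realise_prolongation[OF W y]) (rule that; assumption)
  have inW': "(z, s' z) \<in> W'" and kgraph: "k (z, s' z) = (\<eta> z, s (\<eta> z))" if "z \<in> N'" for z
    using bspec[OF *(8) that] hW kh by metis+
  have dom: "(jet_coords s' z :: ('n, 'm, 'r option) jetspace) \<in> prolong_dom k W'" if z: "z \<in> N'" for z
  proof -
    have "frechet_derivative (\<lambda>x. fst (k (x, s' x))) (at z) = frechet_derivative \<eta> (at z)"
      by (rule frechet_derivative_cong[OF *(2) z]) (simp add: kgraph)
    then show ?thesis
      using det_total_jacobian_iff[OF W' *(2,3) z inW'[OF z], where 'r='r] bspec[OF *(9) z] inW'[OF z]
      by (simp add: prolong_dom_def)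
  qed
  from dom[OF *(5)] show "prolong_map h y \<in> prolong_dom k W'" unfolding *(7) .
  have "jet_coords s (\<eta> x') = prolong_map k (jet_coords s' x' :: ('n, 'm, 'r option) jetspace)"
    by (rule jet_coords_transformed_section[OF W' *(2,3) open_UNIV *(1) _ kgraph dom *(5)]) auto
  then show "prolong_map k (prolong_map h y) = y" unfolding *(6,7) by simp
qed

text \<open>Partial derivatives of the transformed section commute.\<close>

lemma prolong_comp_perm:
  fixes h :: "(real^'n::finite) \<times> (real^'m::finite) \<Rightarrow> (real^'n) \<times> (real^'m)"
    and y :: "('n, 'm, 'r::finite option) jetspace"
  assumes W: "open W" "smooth_on W h" and y: "y \<in> prolong_dom h W"
    and l: "mset l = mset l'" "length l \<le> CARD('r)"
  shows "prolong_comp h l y = prolong_comp h l' y"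
proof -
  obtain s s' N' \<eta> x' where *: "smooth_on UNIV s" "open N'" "smooth_on N' s'" "smooth_on N' \<eta>" "x' \<in> N'"
    "jet_coords s (\<eta> x') = y" "jet_coords s' x' = prolong_map h y"
    "\<forall>x'\<in>N'. (\<eta> x', s (\<eta> x')) \<in> W \<and> h (\<eta> x', s (\<eta> x')) = (x', s' x')"
    "\<forall>x'\<in>N'. inj (frechet_derivative \<eta> (at x'))"
    "\<forall>l. length l \<le> CARD('r) \<longrightarrow> pderivs l s' x' = prolong_comp h l y"
    by (rule realise_prolongation[OF W y]) (rule that; assumption)
  have "length l' \<le> CARD('r)" using l by (metis size_mset)
  then show ?thesis using pderivs_perm[OF *(2,3,5) l(1)] *(10) l(2) by simp
qed

section \<open>Invariance of the contact equations\<close>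

lemma ucoord_total_vec:
  fixes y :: "('n::finite, 'm::finite, 'r::finite option) jetspace"
  shows "size I < CARD('r) \<Longrightarrow> ucoord (total_vec j y) I = ucoord y (add_mset j I)"
  by (simp add: ucoord_def total_vec_def)

text \<open>The contact equations say that the components of order less than \<open>r\<close> of a vector in the kernel are
  those of a combination of total derivatives.\<close>

lemma contact_kernel_agree:
  fixes y :: "('n::finite, 'm::finite, 'r::finite option) jetspace"
  assumes "v \<in> contact_kernel y"
  shows "agree (CARD('r) - 1) v (\<Sum>j\<in>UNIV. fst v $ j *\<^sub>R total_vec j y)"
proof (rule agreeI)
  show "fst v = fst (\<Sum>j\<in>UNIV. fst v $ j *\<^sub>R total_vec j y)"
    by (simp add: fst_sum total_vec_def basis_expansion flip: scalar_mult_eq_scaleR)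
  fix I :: "'n multiset" assume "size I \<le> CARD('r) - 1" "size I \<le> CARD('r)"
  moreover have "CARD('r) > 0" by simp
  ultimately have I: "size I < CARD('r)" by linarith
  have "ucoord (\<Sum>j\<in>UNIV. fst v $ j *\<^sub>R total_vec j y) I = (\<Sum>j\<in>UNIV. fst v $ j *\<^sub>R ucoord (total_vec j y) I)"
    by (simp only: linear_sum[OF linear_ucoord] linear_scale[OF linear_ucoord])
  also have "\<dots> = (\<Sum>j\<in>UNIV. fst v $ j *\<^sub>R ucoord y (add_mset j I))"
    using I by (simp add: ucoord_total_vec)
  also have "\<dots> = ucoord v I" using assms I by (simp add: contact_kernel_def)
  finally show "ucoord v I = ucoord (\<Sum>j\<in>UNIV. fst v $ j *\<^sub>R total_vec j y) I" by simp
qed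

lemma prolong_map_derivative:
  fixes h :: "(real^'n::finite) \<times> (real^'m::finite) \<Rightarrow> (real^'n) \<times> (real^'m)"
    and y :: "('n, 'm, 'r::finite option) jetspace"
  assumes W: "open W" "smooth_on W h" and y: "y \<in> prolong_dom h W"
  shows "fst (frechet_derivative (prolong_map h) (at y) v) = frechet_derivative (fst \<circ> h) (at (base_point y)) (base_point v)"
    "size I \<le> CARD('r) \<Longrightarrow> ucoord (frechet_derivative (prolong_map h) (at y) v) I
      = frechet_derivative (prolong_comp h (list_of I)) (at y) v"
proof -
  have d: "(prolong_map h :: ('n, 'm, 'r option) jetspace \<Rightarrow> _) differentiable (at y)"
    by (rule smooth_on_differentiable[OF smooth_prolong_map[OF W] open_prolong_dom[OF W] y])
  have bl: "bounded_linear (base_point :: ('n, 'm, 'r option) jetspace \<Rightarrow> _)"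
    using linear_base_point linear_conv_bounded_linear by blast
  have D: "((fst \<circ> h) has_derivative frechet_derivative (fst \<circ> h) (at (base_point y))) (at (base_point y))"
    by (rule smooth_on_has_derivative[OF smooth_fst_h[OF W] W(1) prolong_dom_base[OF W y]])
  have "fst (frechet_derivative (prolong_map h) (at y) v) = frechet_derivative (\<lambda>y. fst (prolong_map h y)) (at y) v"
    by (rule frechet_derivative_linear_comp[OF bounded_linear_fst d, symmetric])
  also have "(\<lambda>y. fst (prolong_map h y)) = (\<lambda>y :: ('n, 'm, 'r option) jetspace. (fst \<circ> h) (base_point y))"
    by (simp add: prolong_map_def)
  also have "frechet_derivative (\<lambda>y :: ('n, 'm, 'r option) jetspace. (fst \<circ> h) (base_point y)) (at y) v
      = frechet_derivative (fst \<circ> h) (at (base_point y)) (base_point v)"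
    by (simp only: frechet_derivative_compose[OF bounded_linear_imp_has_derivative[OF bl] D])
  finally show "fst (frechet_derivative (prolong_map h) (at y) v)
      = frechet_derivative (fst \<circ> h) (at (base_point y)) (base_point v)" .
  assume "size I \<le> CARD('r)"
  then have "(\<lambda>y :: ('n, 'm, 'r option) jetspace. ucoord (prolong_map h y) I) = prolong_comp h (list_of I)"
    by (simp add: ucoord_prolong_map)
  then show "ucoord (frechet_derivative (prolong_map h) (at y) v) I
      = frechet_derivative (prolong_comp h (list_of I)) (at y) v"
    using frechet_derivative_linear_comp[OF bounded_linear_ucoord d, of I v] by simp
qed

text \<open>Up to components of top order \<open>v\<close> is \<open>\<Sum>\<^sub>j v\<^sup>j D\<^sub>j\<close>, and the components \<open>U\<^sub>I\<close> with \<open>|I| < r\<close> do not see top order. The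
  recursion for \<open>D\<^sub>j U\<^sub>I\<close> then is the contact equation for the image.\<close>

lemma prolong_map_contact:
  fixes h :: "(real^'n::finite) \<times> (real^'m::finite) \<Rightarrow> (real^'n) \<times> (real^'m)"
    and y :: "('n, 'm, 'r::finite option) jetspace"
  assumes W: "open W" "smooth_on W h" and y: "y \<in> prolong_dom h W" and v: "v \<in> contact_kernel y"
  shows "frechet_derivative (prolong_map h) (at y) v \<in> contact_kernel (prolong_map h y)"
  unfolding contact_kernel_def
proof (intro CollectI allI impI)
  let ?A = "total_jacobian (fst \<circ> h) y" and ?v = "fst v"
  let ?w = "frechet_derivative (prolong_map h) (at y) v"
  let ?D = "frechet_derivative (fst \<circ> h) (at (base_point y))"
  have linD: "linear ?D" by (rule smooth_on_linear_derivative[OF smooth_fst_h[OF W] W(1) prolong_dom_base[OF W y]])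
  have r: "CARD('r) > 0" by simp
  have w: "fst ?w $ i = (\<Sum>j\<in>UNIV. ?v $ j * ?A $ j $ i)" for i
  proof -
    have "ucoord v {#} = (\<Sum>i\<in>UNIV. ?v $ i *\<^sub>R ucoord y {#i#})"
      using v r by (simp add: contact_kernel_def)
    then have "base_point v = (\<Sum>j\<in>UNIV. ?v $ j *\<^sub>R (axis j 1, ucoord y {#j#}))"
      by (simp add: base_point_def prod_eq_iff fst_sum snd_sum basis_expansion flip: scalar_mult_eq_scaleR)
    then have "fst ?w = (\<Sum>j\<in>UNIV. ?v $ j *\<^sub>R ?D (axis j 1, ucoord y {#j#}))"
      unfolding prolong_map_derivative(1)[OF W y] using linD by (simp only: linear_sum linear_scale)
    then show ?thesis
      by (simp add: sum_component total_jacobian_h[OF W prolong_dom_base[OF W y]])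
  qed
  fix I :: "'n multiset" assume "size I < jorder TYPE('r option)"
  then have I: "size I < CARD('r)" by simp
  let ?G = "prolong_comp h (list_of I) :: ('n, 'm, 'r option) jetspace \<Rightarrow> _"
  have linG: "linear (frechet_derivative ?G (at y))"
    by (rule smooth_on_linear_derivative[OF smooth_prolong_comp[OF W] open_prolong_dom[OF W] y])
  have "ucoord ?w I = frechet_derivative ?G (at y) v"
    by (rule prolong_map_derivative(2)[OF W y]) (use I in simp)
  also have "\<dots> = frechet_derivative ?G (at y) (\<Sum>j\<in>UNIV. ?v $ j *\<^sub>R total_vec j y)"
    by (rule derivative_prolong_comp_agree[OF W _ y contact_kernel_agree[OF v]]) (use I in simp)
  also have "\<dots> = (\<Sum>j\<in>UNIV. ?v $ j *\<^sub>R frechet_derivative ?G (at y) (total_vec j y))"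
    using linG by (simp only: linear_sum linear_scale)
  also have "\<dots> = (\<Sum>j\<in>UNIV. \<Sum>i\<in>UNIV. (?v $ j * ?A $ j $ i) *\<^sub>R prolong_comp h (i # list_of I) y)"
    unfolding total_derivative_prolong_comp[OF W y] by (simp only: scaleR_sum_right scaleR_scaleR)
  also have "\<dots> = (\<Sum>i\<in>UNIV. \<Sum>j\<in>UNIV. (?v $ j * ?A $ j $ i) *\<^sub>R prolong_comp h (i # list_of I) y)"
    by (rule sum.swap)
  also have "\<dots> = (\<Sum>i\<in>UNIV. fst ?w $ i *\<^sub>R prolong_comp h (i # list_of I) y)"
    unfolding w scaleR_sum_left ..
  also have "\<dots> = (\<Sum>i\<in>UNIV. fst ?w $ i *\<^sub>R ucoord (prolong_map h y) (add_mset i I))"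
  proof (rule sum.cong[OF refl])
    fix i
    have "prolong_comp h (i # list_of I) y = prolong_comp h (list_of (add_mset i I)) y"
      by (rule prolong_comp_perm[OF W y]) (use I in auto)
    then show "fst ?w $ i *\<^sub>R prolong_comp h (i # list_of I) y
        = fst ?w $ i *\<^sub>R ucoord (prolong_map h y) (add_mset i I)"
      using I by (simp add: ucoord_prolong_map)
  qed
  finally show "ucoord ?w I - (\<Sum>i\<in>UNIV. fst ?w $ i *\<^sub>R ucoord (prolong_map h y) (add_mset i I)) = 0"
    by simp
qed

lemma prolong_map_vertical:
  fixes h :: "(real^'n::finite) \<times> (real^'m::finite) \<Rightarrow> (real^'n) \<times> (real^'m)"
    and y :: "('n, 'm, 'r::finite option) jetspace"
  assumes W: "open W" "smooth_on W h" and y: "y \<in> prolong_dom h W" and v: "agree (CARD('r) - 1) v 0"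
  shows "agree (CARD('r) - 1) (frechet_derivative (prolong_map h) (at y) v) 0"
proof (rule agreeI)
  have "base_point v = 0"
    using agree_base_point[OF v] linear_0[OF linear_base_point] by metis
  then show "fst (frechet_derivative (prolong_map h) (at y) v) = fst 0"
    unfolding prolong_map_derivative(1)[OF W y]
    using linear_0[OF smooth_on_linear_derivative[OF smooth_fst_h[OF W] W(1) prolong_dom_base[OF W y]]] by simp
  fix I :: "'n multiset" assume "size I \<le> CARD('r) - 1" "size I \<le> CARD('r)"
  moreover have "CARD('r) > 0" by simp
  ultimately have I: "size I < CARD('r)" by linarith
  have "ucoord (frechet_derivative (prolong_map h) (at y) v) I = frechet_derivative (prolong_comp h (list_of I)) (at y) v"
    by (rule prolong_map_derivative(2)[OF W y]) (use I in simp)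
  also have "\<dots> = frechet_derivative (prolong_comp h (list_of I)) (at y) 0"
    by (rule derivative_prolong_comp_agree[OF W _ y v]) (use I in simp)
  also have "\<dots> = 0"
    by (rule linear_0[OF smooth_on_linear_derivative[OF smooth_prolong_comp[OF W] open_prolong_dom[OF W] y]])
  also have "0 = ucoord (0 :: ('n, 'm, 'r option) jetspace) I" by (simp add: ucoord_def)
  finally show "ucoord (frechet_derivative (prolong_map h) (at y) v) I = ucoord (0 :: ('n, 'm, 'r option) jetspace) I" .
qed

section \<open>Adapted charts\<close>

text \<open>A linear right inverse splits the space into the target and the kernel.\<close>

lemma dim_kernel_surj:
  fixes D :: "'a::euclidean_space \<Rightarrow> 'b::euclidean_space"
  assumes D: "linear D" "surj D"
  shows "dim {v. D v = 0} + DIM('b) = DIM('a)"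
proof -
  obtain g where g: "linear g" "D \<circ> g = id" using linear_surjective_right_inverse[OF D] by blast
  then have Dg: "D (g w) = w" for w by (metis comp_apply id_apply)
  define K where "K = {v. D v = 0}"
  have K: "subspace K" unfolding K_def by (rule linear_subspace_kernel[OF D(1)])
  define \<Phi> where "\<Phi> = (\<lambda>(w, k). g w + k)"
  have lin: "linear \<Phi>"
    by (rule linearI) (auto simp: \<Phi>_def linear_add[OF g(1)] linear_scale[OF g(1)] scaleR_add_right)
  have inj: "inj_on \<Phi> ((UNIV::'b set) \<times> K)"
  proof (rule inj_onI)
    fix p q assume pq: "p \<in> (UNIV::'b set) \<times> K" "q \<in> (UNIV::'b set) \<times> K" "\<Phi> p = \<Phi> q"
    obtain w k w' k' where [simp]: "p = (w, k)" "q = (w', k')" by (cases p, cases q)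
    have "D (g w + k) = D (g w' + k')" using pq by (simp add: \<Phi>_def)
    then have "w = w'" using pq by (simp add: linear_add[OF D(1)] Dg K_def)
    then show "p = q" using pq by (simp add: \<Phi>_def)
  qed
  have img: "\<Phi> ` ((UNIV::'b set) \<times> K) = UNIV"
  proof (intro equalityI subsetI UNIV_I)
    fix v
    have "v = \<Phi> (D v, v - g (D v))" by (simp add: \<Phi>_def)
    moreover have "(D v, v - g (D v)) \<in> (UNIV::'b set) \<times> K" by (simp add: K_def linear_diff[OF D(1)] Dg)
    ultimately show "v \<in> \<Phi> ` ((UNIV::'b set) \<times> K)" by (rule image_eqI)
  qed
  have "subspace ((UNIV::'b set) \<times> K)" by (rule subspace_Times[OF subspace_UNIV K])
  then have sp: "span ((UNIV::'b set) \<times> K) = (UNIV::'b set) \<times> K" by (simp only: span_eq_iff)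
  have "dim (\<Phi> ` ((UNIV::'b set) \<times> K)) = dim ((UNIV::'b set) \<times> K)"
    using eucl.dim_image_eq[OF lin, of "(UNIV::'b set) \<times> K"] inj unfolding sp by simp
  then show ?thesis using dim_Times[OF subspace_UNIV K, where 'a = 'b] img by (simp add: K_def)
qed

lemma max_atlas_reparam:
  fixes H :: "'b::euclidean_space \<Rightarrow> 'b"
  assumes A: "is_atlas A" "c0 \<in> A" and U: "open U" "U \<subseteq> cmap c0 ` cdom c0" "smooth_on U H"
    and V: "open V" "smooth_on V g" "H ` U = V" "g ` V = U" "\<And>x. x \<in> U \<Longrightarrow> g (H x) = x"
  shows "({q \<in> cdom c0. cmap c0 q \<in> U}, \<lambda>q. H (cmap c0 q)) \<in> max_atlas A"
proof -
  define c where "c = ({q \<in> cdom c0. cmap c0 q \<in> U}, \<lambda>q. H (cmap c0 q))"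
  have c: "cdom c = {q \<in> cdom c0. cmap c0 q \<in> U}" "cmap c = (\<lambda>q. H (cmap c0 q))" by (simp_all add: c_def)
  have ch0: "is_chart c0" using A atlas_chart by blast
  have injc: "inj_on (cmap c) (cdom c)"
  proof (rule inj_onI)
    fix x y assume xy: "x \<in> cdom c" "y \<in> cdom c" "cmap c x = cmap c y"
    have U': "x \<in> cdom c0" "y \<in> cdom c0" "cmap c0 x \<in> U" "cmap c0 y \<in> U" using xy by (auto simp: c)
    have "H (cmap c0 x) = H (cmap c0 y)" using xy by (simp add: c)
    then have "cmap c0 x = cmap c0 y" using V(5)[OF U'(3)] V(5)[OF U'(4)] by metis
    moreover have "inj_on (cmap c0) (cdom c0)" using ch0 by (simp add: is_chart_def)
    ultimately show "x = y" using U'(1,2) by (metis inj_onD)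
  qed
  have img: "cmap c ` cdom c = V"
  proof -
    have "cmap c0 ` cdom c = U" using U(2) c(1) by auto
    then have "H ` cmap c0 ` cdom c = V" using V(3) by simp
    then show ?thesis by (simp add: c(2) image_image)
  qed
  have chc: "is_chart c" using injc img V(1) by (simp add: is_chart_def)
  have cinvc: "cinv c y = cinv c0 (g y)" "g y \<in> U" if y: "y \<in> V" for y
  proof -
    obtain x where x: "x \<in> cdom c" "y = cmap c x" using y img by blast
    then have gy: "g y = cmap c0 x" using V(5) c by simp
    have "x \<in> cdom c0" using x(1) c(1) by simp
    then show "cinv c y = cinv c0 (g y)" unfolding gy unfolding x(2) by (simp only: cinv_cmap[OF chc x(1)] cinv_cmap[OF ch0])
    show "g y \<in> U" using V(4) y by blast
  qed
  have "smooth_transition c d \<and> smooth_transition d c" if d: "d \<in> A" for d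
  proof
    have dch: "is_chart d" using d A atlas_chart by blast
    have tr: "open (cmap c0 ` (cdom c0 \<inter> cdom d))" "smooth_on (cmap c0 ` (cdom c0 \<inter> cdom d)) (cmap d \<circ> cinv c0)"
      "open (cmap d ` (cdom d \<inter> cdom c0))" "smooth_on (cmap d ` (cdom d \<inter> cdom c0)) (cmap c0 \<circ> cinv d)"
      using A d unfolding is_atlas_def smooth_transition_def by blast+
    let ?S = "cmap c ` (cdom c \<inter> cdom d)"
    have S: "?S = V \<inter> g -` (cmap c0 ` (cdom c0 \<inter> cdom d))"
    proof (intro equalityI subsetI)
      fix y assume "y \<in> ?S"
      then obtain x where x: "x \<in> cdom c" "x \<in> cdom d" "y = cmap c x" by blast
      then have "g y = cmap c0 x" using V(5) c by simp
      then show "y \<in> V \<inter> g -` (cmap c0 ` (cdom c0 \<inter> cdom d))" using x img c(1) by auto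
    next
      fix y assume y: "y \<in> V \<inter> g -` (cmap c0 ` (cdom c0 \<inter> cdom d))"
      then obtain x where x: "x \<in> cdom c0" "x \<in> cdom d" "g y = cmap c0 x" by blast
      obtain z where z: "z \<in> cdom c" "y = cmap c z" using y img by blast
      then have "g y = cmap c0 z" using V(5) c by simp
      then have eq: "cmap c0 x = cmap c0 z" using x by simp
      have zc: "z \<in> cdom c0" using z(1) c(1) by simp
      have "x = z" using cinv_cmap[OF ch0 x(1)] cinv_cmap[OF ch0 zc] unfolding eq by simp
      then show "y \<in> ?S" using z x by blast
    qed
    have oS: "open ?S" unfolding S by (rule continuous_open_preimage[OF smooth_on_continuous_on[OF V(2)] V(1) tr(1)])
    have "smooth_on ?S (\<lambda>y. (cmap d \<circ> cinv c0) (g y))"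
      by (rule smooth_on_compose[OF tr(2) smooth_on_subset[OF V(2)] oS tr(1)]) (unfold S, auto)
    then have "smooth_on ?S (cmap d \<circ> cinv c)"
    proof (rule smooth_on_eq[OF _ oS])
      fix y assume "y \<in> ?S"
      then have "y \<in> V" using img by blast
      then show "(cmap d \<circ> cinv c0) (g y) = (cmap d \<circ> cinv c) y" by (simp add: cinvc)
    qed
    then show "smooth_transition c d" using oS by (simp add: smooth_transition_def)
    let ?S' = "cmap d ` (cdom d \<inter> cdom c)"
    have S': "?S' = cmap d ` (cdom d \<inter> cdom c0) \<inter> (cmap c0 \<circ> cinv d) -` U"
      by (auto simp: c(1) cinv_cmap[OF dch])
    have oS': "open ?S'" unfolding S' by (rule continuous_open_preimage[OF smooth_on_continuous_on[OF tr(4)] tr(3) U(1)])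
    have "smooth_on ?S' (\<lambda>y. H ((cmap c0 \<circ> cinv d) y))"
      by (rule smooth_on_compose[OF U(3) smooth_on_subset[OF tr(4)] oS' U(1)]) (unfold S', auto)
    then have "smooth_on ?S' (cmap c \<circ> cinv d)"
      by (rule smooth_on_eq[OF _ oS']) (simp add: c(2))
    then show "smooth_transition d c" using oS' by (simp add: smooth_transition_def)
  qed
  moreover have "cdom c \<subseteq> carrier_of A" using A(2) c(1) by (auto simp: carrier_of_def)
  ultimately have "c \<in> max_atlas A" using chc by (simp add: max_atlas_def)
  then show ?thesis by (simp add: c_def)
qed

lemma fibred_atlas:
  assumes "fibred_manifold F"
  shows "is_atlas (tot F)" "is_atlas (base F)"
    "smooth_map_on (tot F) (base F) (carrier_of (tot F)) (proj F)"
  using assms by (auto simp: fibred_manifold_def smooth_manifold_def)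

text \<open>The projection is a submersion. Completing its coordinate expression \<open>P\<close> by a linear map \<open>L\<close> that is
  injective on the kernel of the derivative of \<open>P\<close> gives a local diffeomorphism \<open>(P, L)\<close>, in whose
  coordinates the projection is the first component.\<close>

lemma adapted_charts_exist:
  fixes F :: "('e, 'q, 'n::finite, 'm::finite) fibred"
  assumes F: "fibred_manifold F" and e: "e \<in> carrier_of (tot F)"
  obtains c b where "(c, b) \<in> adapted_charts F" "e \<in> cdom c"
proof -
  note A = fibred_atlas[OF F]
  obtain c0 where c0: "c0 \<in> tot F" "e \<in> cdom c0" using e by (auto simp: carrier_of_def)
  obtain b where b: "b \<in> base F" "proj F e \<in> cdom b"
    using smooth_map_on_range[OF A(3,1,2) e] by (auto simp: carrier_of_def)
  have ch0: "is_chart c0" using c0 A atlas_chart by blast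
  have "rep_smooth_at c0 b (carrier_of (tot F)) (proj F) e"
    by (rule smooth_map_on_rep_atlas[OF A c0 b e])
  then obtain T where T: "open T" "cmap c0 e \<in> T"
    "T \<subseteq> cmap c0 ` {q \<in> carrier_of (tot F) \<inter> cdom c0. proj F q \<in> cdom b}"
    "smooth_on T (cmap b \<circ> proj F \<circ> cinv c0)"
    unfolding rep_smooth_at_def by blast
  define P where "P = cmap b \<circ> proj F \<circ> cinv c0"
  define D where "D = frechet_derivative P (at (cmap c0 e))"
  have linD: "linear D" unfolding D_def P_def by (rule smooth_on_linear_derivative[OF T(4,1,2)])
  have surjD: "surj D"
  proof (rule surjI)
    fix w
    have "tangent_of (base F) (proj F e) b w \<in> tangent_space (base F) (proj F e)"
      by (rule tangent_of_props(1)[OF A(2) b])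
    also have "\<dots> = tangent_map (tot F) (base F) (proj F) e ` tangent_space (tot F) e"
      using F e by (simp add: fibred_manifold_def)
    finally obtain v where v: "v \<in> tangent_space (tot F) e"
      "tangent_of (base F) (proj F e) b w = tangent_map (tot F) (base F) (proj F) e v" by blast
    have "w = tangent_map (tot F) (base F) (proj F) e v b"
      using tangent_of_props(2)[OF A(2) b, of w] v(2) by simp
    also have "\<dots> = D (v c0)"
      unfolding D_def P_def by (rule tangent_map_apply[OF A e v(1) c0 b])
    finally have "\<exists>z. D z = w" by metis
    then show "D (SOME z. D z = w) = w" by (rule someI_ex)
  qed
  define K where "K = {v. D v = 0}"
  have "dim K = dim (UNIV :: (real^'m) set)"
    using dim_kernel_surj[OF linD surjD] by (simp add: K_def)
  moreover have K: "subspace K" unfolding K_def by (rule linear_subspace_kernel[OF linD])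
  ultimately obtain L where L: "linear L" "L ` K = (UNIV :: (real^'m) set)" "\<And>x. x \<in> K \<Longrightarrow> norm (L x) = norm x"
    using isometry_subspaces[OF K subspace_UNIV] by metis
  \<comment> \<open>\<open>L\<close> is an isometry on \<open>K\<close>, and \<open>D\<close> is injective modulo \<open>K\<close>, so the derivative \<open>(D, L)\<close> of \<open>H\<close> is injective\<close>
  define H where "H = (\<lambda>z. (P z, L z))"
  have smP: "smooth_on T P" using T(4) by (simp add: P_def)
  have smH: "smooth_on T H"
    unfolding H_def by (intro smooth_on_Pair T(1) smP smooth_on_linear[OF T(1) L(1)] smooth_on_id)
  have "(H has_derivative (\<lambda>v. (D v, L v))) (at (cmap c0 e))"
    unfolding H_def D_def
    by (intro has_derivative_Pair smooth_on_has_derivative[OF smP T(1,2)] bounded_linear_imp_has_derivative)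
      (use L(1) linear_conv_bounded_linear in blast)
  then have DH: "frechet_derivative H (at (cmap c0 e)) = (\<lambda>v. (D v, L v))" by (rule has_derivative_frechet)
  have inj: "inj (frechet_derivative H (at (cmap c0 e)))"
    unfolding DH
  proof (rule injI)
    fix v w assume eq: "(D v, L v) = (D w, L w)"
    then have "v - w \<in> K" "L (v - w) = 0" by (simp_all add: K_def linear_diff[OF linD] linear_diff[OF L(1)])
    then show "v = w" using L(3)[of "v - w"] by simp
  qed
  have dim: "DIM((real^'n) \<times> (real^'m)) = CARD('n + 'm)" by simp
  show thesis
  proof (rule smooth_inverse_function[OF T(1) smH T(2) inj dim])
    fix U V g
    assume U: "open U" "U \<subseteq> T" "cmap c0 e \<in> U" "open V" "H ` U = V" "g ` V = U" "smooth_on V g"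
      "\<And>x. x \<in> U \<Longrightarrow> g (H x) = x"
    define c where "c = ({q \<in> cdom c0. cmap c0 q \<in> U}, \<lambda>q. H (cmap c0 q))"
    have Uc0: "U \<subseteq> cmap c0 ` cdom c0" using U(2) T(3) by blast
    have cm: "c \<in> max_atlas (tot F)"
      unfolding c_def
      by (rule max_atlas_reparam[OF A(1) c0(1) U(1) Uc0 smooth_on_subset[OF smH U(2)] U(4,7,5,6,8)])
    have pr: "proj F q \<in> cdom b \<and> fst (cmap c q) = cmap b (proj F q)" if q: "q \<in> cdom c" for q
    proof -
      have q0: "q \<in> cdom c0" "cmap c0 q \<in> U" using q by (auto simp: c_def)
      then obtain q' where q': "q' \<in> cdom c0" "proj F q' \<in> cdom b" "cmap c0 q = cmap c0 q'"
        using U(2) T(3) by blast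
      have "q = q'" using cinv_cmap[OF ch0 q0(1)] cinv_cmap[OF ch0 q'(1)] unfolding q'(3) by simp
      then show ?thesis using q' q0 by (simp add: c_def H_def P_def cinv_cmap[OF ch0])
    qed
    have "(c, b) \<in> adapted_charts F"
      unfolding adapted_charts_def using cm max_atlas_supset[OF A(2) b(1)] pr by auto
    moreover have "e \<in> cdom c" using c0 U(3) by (simp add: c_def)
    ultimately show thesis by (rule that)
  qed
qed

lemma adapted_chartsD:
  assumes "(c, b) \<in> adapted_charts F"
  shows "c \<in> max_atlas (tot F)" "b \<in> max_atlas (base F)" "is_chart c" "is_chart b"
    "\<And>e. e \<in> cdom c \<Longrightarrow> proj F e \<in> cdom b" "\<And>e. e \<in> cdom c \<Longrightarrow> fst (cmap c e) = cmap b (proj F e)"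
  using assms max_atlas_chart unfolding adapted_charts_def by blast+

section \<open>Local sections in adapted charts\<close>

text \<open>Near \<open>q\<close> a section is the graph of its coordinate representative. The points \<open>z\<close> are kept within the
  domain of the section, since nothing is known about \<open>s\<close> elsewhere.\<close>

lemma section_in_chart:
  fixes F :: "('e, 'q, 'n::finite, 'm::finite) fibred"
  assumes F: "fibred_manifold F" and cb: "(c, b) \<in> adapted_charts F"
    and s: "local_section F U s" "q \<in> U" "s q \<in> cdom c"
  obtains N where "open N" "cmap b q \<in> N" "smooth_on N (section_rep c b s)"
    "\<forall>x\<in>N. \<exists>z\<in>U. z \<in> cdom b \<and> x = cmap b z \<and> cinv b x = z \<and> s z \<in> cdom c \<and> proj F (s z) = z \<and>
       cmap c (s z) = (x, section_rep c b s x)"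
proof -
  note A = fibred_atlas[OF F] and ad = adapted_chartsD[OF cb]
  have sm: "smooth_map_on (base F) (tot F) U s" and pr: "\<And>z. z \<in> U \<Longrightarrow> proj F (s z) = z"
    using s(1) by (auto simp: local_section_def)
  have qb: "q \<in> cdom b" using ad(5)[OF s(3)] pr[OF s(2)] by simp
  have "rep_smooth_at b c U s q" by (rule smooth_map_on_rep[OF A(2,1) sm ad(2) qb ad(1) s(3,2)])
  then obtain T where T: "open T" "cmap b q \<in> T" "T \<subseteq> cmap b ` {z \<in> U \<inter> cdom b. s z \<in> cdom c}"
    "smooth_on T (cmap c \<circ> s \<circ> cinv b)"
    unfolding rep_smooth_at_def by blast
  have "smooth_on T (\<lambda>x. snd ((cmap c \<circ> s \<circ> cinv b) x))" by (rule smooth_on_snd[OF T(1,4)])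
  moreover have "(\<lambda>x. snd ((cmap c \<circ> s \<circ> cinv b) x)) = section_rep c b s"
    by (simp add: section_rep_def fun_eq_iff)
  ultimately have sr: "smooth_on T (section_rep c b s)" by simp
  have pts: "\<exists>z\<in>U. z \<in> cdom b \<and> x = cmap b z \<and> cinv b x = z \<and> s z \<in> cdom c \<and> proj F (s z) = z \<and>
       cmap c (s z) = (x, section_rep c b s x)" if x: "x \<in> T" for x
  proof -
    obtain z where z: "z \<in> U" "z \<in> cdom b" "s z \<in> cdom c" "x = cmap b z" using T(3) x by blast
    have inv: "cinv b x = z" using z cinv_cmap[OF ad(4)] by simp
    have "fst (cmap c (s z)) = x" using ad(6)[OF z(3)] pr[OF z(1)] z(4) by simp
    moreover have "snd (cmap c (s z)) = section_rep c b s x" by (simp add: section_rep_def inv)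
    ultimately have "cmap c (s z) = (x, section_rep c b s x)" by (simp add: prod_eq_iff)
    then show ?thesis using z inv pr[OF z(1)] by blast
  qed
  show thesis by (rule that[OF T(1,2) sr]) (use pts in blast)
qed

lemma section_from_coords:
  fixes F :: "('e, 'q, 'n::finite, 'm::finite) fibred"
  assumes F: "fibred_manifold F" and cb: "(c, b) \<in> adapted_charts F"
    and N: "open N" "smooth_on N \<sigma>" "\<forall>x\<in>N. (x, \<sigma> x) \<in> cmap c ` cdom c"
    and s_def: "s = (\<lambda>q. cinv c (cmap b q, \<sigma> (cmap b q)))"
  shows "local_section F {q \<in> cdom b. cmap b q \<in> N} s"
    "\<And>x. x \<in> N \<Longrightarrow> \<exists>q \<in> cdom b. x = cmap b q"
    "\<And>q. q \<in> cdom b \<Longrightarrow> cmap b q \<in> N \<Longrightarrow> s q \<in> cdom c \<and> cmap c (s q) = (cmap b q, \<sigma> (cmap b q))"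
    "\<And>x. x \<in> N \<Longrightarrow> section_rep c b s x = \<sigma> x"
proof -
  note A = fibred_atlas[OF F] and ad = adapted_chartsD[OF cb]
  show sub: "\<exists>q \<in> cdom b. x = cmap b q" if x: "x \<in> N" for x
  proof -
    obtain e where "e \<in> cdom c" "(x, \<sigma> x) = cmap c e" using bspec[OF N(3) x] by blast
    then show ?thesis using ad(5,6)[of e] by (metis fst_conv)
  qed
  show sq: "s q \<in> cdom c \<and> cmap c (s q) = (cmap b q, \<sigma> (cmap b q))" if "q \<in> cdom b" "cmap b q \<in> N" for q
    unfolding s_def using cinv_image[OF ad(3) bspec[OF N(3) that(2)]] by blast
  have sm: "smooth_map_on (base F) (tot F) {q \<in> cdom b. cmap b q \<in> N} s"
    unfolding s_def
    by (rule smooth_map_on_from_model[OF A(2,1) ad(2,1) N(1), where h = "\<lambda>x. (x, \<sigma> x)"])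
      (use sub N in \<open>auto intro: smooth_on_Pair smooth_on_id\<close>)
  have "proj F (s q) = q" if "q \<in> cdom b" "cmap b q \<in> N" for q
  proof -
    have "cmap b (proj F (s q)) = cmap b q" using ad(6)[of "s q"] sq[OF that] by simp
    moreover have "proj F (s q) \<in> cdom b" using ad(5) sq[OF that] by blast
    ultimately show ?thesis using cinv_cmap[OF ad(4)] that(1) by metis
  qed
  then show "local_section F {q \<in> cdom b. cmap b q \<in> N} s" using sm by (simp add: local_section_def)
  show "section_rep c b s x = \<sigma> x" if x: "x \<in> N" for x
  proof -
    obtain q where q: "q \<in> cdom b" "x = cmap b q" using sub[OF x] by blast
    then show ?thesis using sq[of q] x cinv_cmap[OF ad(4) q(1)] by (simp add: section_rep_def)
  qed
qed

section \<open>Jets in adapted charts\<close>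

lemma jet_equiv_refl: "jet_equiv F r q s s"
  by (auto simp: jet_equiv_def)

lemma jet_equiv_sym: "jet_equiv F r q s t \<Longrightarrow> jet_equiv F r q t s"
  unfolding jet_equiv_def by (auto split: prod.splits)

lemma jet_equiv_trans: "jet_equiv F r q s t \<Longrightarrow> jet_equiv F r q t u \<Longrightarrow> jet_equiv F r q s u"
  unfolding jet_equiv_def by (auto split: prod.splits)

lemma jet_eqI: "jet_equiv F r q s t \<Longrightarrow> jet F r s q = jet F r t q"
proof -
  assume eq: "jet_equiv F r q s t"
  have "jet_equiv F r q s u \<longleftrightarrow> jet_equiv F r q t u" for u
    using jet_equiv_trans[OF eq] jet_equiv_trans[OF jet_equiv_sym[OF eq]] by (rule iffI[rotated])
  then show ?thesis by (simp add: jet_def)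
qed

lemma rep_section_jet:
  assumes "s \<in> sections_at F q"
  shows "rep_section (jet F r s q) \<in> sections_at F q" "jet_equiv F r q s (rep_section (jet F r s q))"
proof -
  have "s \<in> snd (jet F r s q)" using assms by (simp add: jet_def jet_equiv_refl)
  then have "rep_section (jet F r s q) \<in> snd (jet F r s q)" unfolding rep_section_def by (rule someI[of "\<lambda>s'. s' \<in> _"])
  then show "rep_section (jet F r s q) \<in> sections_at F q" "jet_equiv F r q s (rep_section (jet F r s q))"
    by (auto simp: jet_def)
qed

lemma fst_jet [simp]: "fst (jet F r s q) = q"
  by (simp add: jet_def)

lemma target_jet: "s \<in> sections_at F q \<Longrightarrow> target (jet F r s q) = s q"
  using rep_section_jet(2)[of s F q r] by (simp add: target_def jet_equiv_def)

lemma jet_chart_jet: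
  fixes F :: "('e, 'q, 'n::finite, 'm::finite) fibred"
  assumes cb: "(c, b) \<in> adapted_charts F" and s: "s \<in> sections_at F q" "s q \<in> cdom c"
  shows "cmap (jet_chart TYPE('s::finite) F c b) (jet F (jorder TYPE('s)) s q) = jet_coords (section_rep c b s) (cmap b q)"
proof -
  let ?t = "rep_section (jet F (jorder TYPE('s)) s q)"
  have "mderiv (Rep_mindex I) (section_rep c b ?t) (cmap b q) = mderiv (Rep_mindex I) (section_rep c b s) (cmap b q)"
    for I :: "('n, 's) mindex"
  proof -
    have "size (Rep_mindex I) \<le> jorder TYPE('s)" using Rep_mindex[of I] by (simp add: jorder_def)
    then show ?thesis
      using rep_section_jet(2)[OF s(1), of "jorder TYPE('s)"] cb s(2) unfolding jet_equiv_def by fastforce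
  qed
  then show ?thesis by (simp add: jet_chart_def jet_coords_def)
qed

lemma cdom_jet_chart: "cdom (jet_chart TYPE('s::finite) F c b) = {p \<in> jets F (jorder TYPE('s)). target p \<in> cdom c}"
  by (simp add: jet_chart_def)

section \<open>Sections transformed by a map of the total spaces\<close>

definition rep_domain :: "('e, 'x) chart \<Rightarrow> ('e2, 'y) chart \<Rightarrow> 'e set \<Rightarrow> ('e \<Rightarrow> 'e2) \<Rightarrow> 'x set" where
  "rep_domain c d U f = cmap c ` {e \<in> U \<inter> cdom c. f e \<in> cdom d}"

lemma rep_domain_open:
  assumes "is_atlas A" "is_atlas B" "smooth_map_on A B U f" "c \<in> max_atlas A" "d \<in> max_atlas B"
  shows "open (rep_domain c d U f)" "smooth_on (rep_domain c d U f) (cmap d \<circ> f \<circ> cinv c)"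
  unfolding rep_domain_def using rep_set_open[of U c f d] smooth_map_on_rep[OF assms(1-4) _ assms(5)] by auto

lemma inj_rep_deriv_transition:
  assumes A: "is_atlas A" and c: "c \<in> max_atlas A" "d \<in> max_atlas A" and p: "p \<in> cdom c" "p \<in> cdom d"
  shows "inj (rep_deriv c d (\<lambda>q. q) p)"
proof (rule inj_on_inverseI)
  fix v
  have ch: "is_chart c" "is_chart d" using max_atlas_chart[OF c(1)] max_atlas_chart[OF c(2)] .
  have "rep_deriv d c (\<lambda>q. q) p (rep_deriv c d (\<lambda>q. q) p v) = rep_deriv c c (\<lambda>q. q) p v"
    by (rule derivative_compose_rep[OF ch p(1) rep_smooth_at_max_atlas[OF A c p]
          rep_smooth_at_max_atlas[OF A c(2,1) p(2,1)], symmetric])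
  also have "rep_deriv c c (\<lambda>q. q) p = frechet_derivative (\<lambda>y. y) (at (cmap c p))"
    by (rule frechet_derivative_cong[of "cmap c ` cdom c"])
      (use ch p in \<open>auto simp: cinv_cmap is_chart_def\<close>)
  also have "\<dots> v = v" by simp
  finally show "rep_deriv d c (\<lambda>q. q) p (rep_deriv c d (\<lambda>q. q) p v) = v" .
qed

text \<open>Changing charts on either side composes the derivative with invertible maps.\<close>

lemma inj_rep_deriv_change:
  assumes A: "is_atlas A" "is_atlas B" and f: "rep_smooth_at c d U f p"
    and c: "c \<in> max_atlas A" "c' \<in> max_atlas A" "p \<in> cdom c" "p \<in> cdom c'"
    and d: "d \<in> max_atlas B" "d' \<in> max_atlas B" "f p \<in> cdom d" "f p \<in> cdom d'"
    and inj: "inj (rep_deriv c d f p)"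
  shows "inj (rep_deriv c' d' f p)"
proof -
  have ch: "is_chart c" "is_chart c'" "is_chart d" "is_chart d'"
    using max_atlas_chart[OF c(1)] max_atlas_chart[OF c(2)] max_atlas_chart[OF d(1)] max_atlas_chart[OF d(2)] .
  have f': "rep_smooth_at c' d U f p" by (rule rep_smooth_at_change[OF A f c d(1,1,3,3)])
  have "rep_deriv c' d' (\<lambda>q. f q) p v = rep_deriv d d' (\<lambda>q. q) (f p) (rep_deriv c' d f p v)" for v
    by (rule derivative_compose_rep[OF ch(2,3) c(4) f' rep_smooth_at_max_atlas[OF A(2) d]])
  moreover have "rep_deriv c' d (\<lambda>q. f q) p v = rep_deriv c d f p (rep_deriv c' c (\<lambda>q. q) p v)" for v
    by (rule derivative_compose_rep[OF ch(2,1) c(4) rep_smooth_at_max_atlas[OF A(1) c(2,1,4,3)] f])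
  ultimately have "rep_deriv c' d' (\<lambda>q. f q) p
      = (\<lambda>v. rep_deriv d d' (\<lambda>q. q) (f p) (rep_deriv c d f p (rep_deriv c' c (\<lambda>q. q) p v)))"
    by (simp add: fun_eq_iff)
  moreover have "inj (\<lambda>v. rep_deriv d d' (\<lambda>q. q) (f p) (rep_deriv c d f p (rep_deriv c' c (\<lambda>q. q) p v)))"
    using inj_rep_deriv_transition[OF A(1) c(2,1,4,3)] inj_rep_deriv_transition[OF A(2) d] inj
    unfolding inj_def by meson
  ultimately have "inj (rep_deriv c' d' (\<lambda>q. f q) p)" by (simp only:)
  then show ?thesis .
qed

text \<open>The determinant condition at the jet of \<open>s\<close> has a meaning free of coordinates: the map
  \<open>\<pi>' \<circ> f \<circ> s\<close> between the bases is a local diffeomorphism. Hence it holds in all charts as soon as it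
  holds in one.\<close>

lemma prolong_dom_iff:
  fixes F :: "('e, 'q, 'n::finite, 'm::finite) fibred" and F' :: "('e2, 'q2, 'n, 'm) fibred"
  assumes F: "fibred_manifold F" "fibred_manifold F'" and f: "smooth_map_on (tot F) (tot F') Dom f"
    and cb: "(c, b) \<in> adapted_charts F" and cb': "(c', b') \<in> adapted_charts F'"
    and s: "local_section F V s" "q \<in> V" "s q \<in> cdom c" "s q \<in> Dom" "f (s q) \<in> cdom c'"
  shows "(jet_coords (section_rep c b s) (cmap b q) :: ('n, 'm, 'r::finite option) jetspace)
      \<in> prolong_dom (cmap c' \<circ> f \<circ> cinv c) (rep_domain c c' Dom f)
    \<longleftrightarrow> inj (rep_deriv b b' (\<lambda>z. proj F' (f (s z))) q)"
proof -
  note A = fibred_atlas[OF F(1)] and A' = fibred_atlas[OF F(2)]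
  note ad = adapted_chartsD[OF cb] and ad' = adapted_chartsD[OF cb']
  let ?h = "cmap c' \<circ> f \<circ> cinv c" and ?W = "rep_domain c c' Dom f" and ?\<sigma> = "section_rep c b s"
  have W: "open ?W" "smooth_on ?W ?h" using rep_domain_open[OF A(1) A'(1) f ad(1) ad'(1)] .
  obtain N where N: "open N" "cmap b q \<in> N" "smooth_on N ?\<sigma>"
    "\<forall>x\<in>N. \<exists>z\<in>V. z \<in> cdom b \<and> x = cmap b z \<and> cinv b x = z \<and> s z \<in> cdom c \<and> proj F (s z) = z \<and>
       cmap c (s z) = (x, ?\<sigma> x)"
    by (rule section_in_chart[OF F(1) cb s(1-3)]) (rule that; assumption)
  have xW: "(cmap b q, ?\<sigma> (cmap b q)) \<in> ?W"
  proof -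
    obtain z where z: "z \<in> cdom b" "cmap b q = cmap b z" "cinv b (cmap b q) = z" "cmap c (s z) = (cmap b q, ?\<sigma> (cmap b q))"
      using N(2,4) by blast
    have "q \<in> cdom b" using ad(5)[OF s(3)] s(1,2) by (simp add: local_section_def)
    then have "z = q" using z(3) cinv_cmap[OF ad(4)] by simp
    then show ?thesis using z(4) s(3-5) unfolding rep_domain_def by (metis (mono_tags, lifting) IntI image_eqI mem_Collect_eq)
  qed
  define N1 where "N1 = N \<inter> (\<lambda>x. (x, ?\<sigma> x)) -` ?W"
  have N1: "open N1" "cmap b q \<in> N1"
    unfolding N1_def
    using continuous_open_preimage[OF smooth_on_continuous_on[OF smooth_on_Pair[OF N(1) smooth_on_id[OF N(1)] N(3)]] N(1) W(1)]
      N(2) xW by auto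
  have eq: "fst (?h (x, ?\<sigma> x)) = (cmap b' \<circ> (\<lambda>z. proj F' (f (s z))) \<circ> cinv b) x" if x: "x \<in> N1" for x
  proof -
    obtain z where z: "cinv b x = z" "s z \<in> cdom c" "cmap c (s z) = (x, ?\<sigma> x)"
      using N(4) x by (auto simp: N1_def)
    have "(x, ?\<sigma> x) \<in> ?W" using x by (simp add: N1_def)
    then obtain e where e: "e \<in> cdom c" "f e \<in> cdom c'" "cmap c (s z) = cmap c e" using z(3) by (auto simp: rep_domain_def)
    have "s z = e" using cinv_cmap[OF ad(3) z(2)] cinv_cmap[OF ad(3) e(1)] unfolding e(3) by simp
    then have "f (s z) \<in> cdom c'" using e(2) by simp
    from ad'(6)[OF this] show ?thesis using z by (simp add: z(3)[symmetric] cinv_cmap[OF ad(3) z(2)])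
  qed
  have "frechet_derivative (\<lambda>x. fst (?h (x, ?\<sigma> x))) (at (cmap b q)) = rep_deriv b b' (\<lambda>z. proj F' (f (s z))) q"
    by (rule frechet_derivative_cong[OF N1 eq])
  then show ?thesis
    using det_total_jacobian_iff[OF W N(1,3,2) xW, where 'r = 'r] xW by (simp add: prolong_dom_def)
qed

text \<open>The bridge between the geometric and the coordinate description: if \<open>f\<close> carries the image of \<open>s\<close> into
  that of \<open>s'\<close>, then their coordinate representatives are related as in the coordinate theory.\<close>

lemma transformed_jet_coords:
  fixes F :: "('e, 'q, 'n::finite, 'm::finite) fibred" and F' :: "('e2, 'q2, 'n, 'm) fibred"
  assumes F: "fibred_manifold F" "fibred_manifold F'" and f: "smooth_map_on (tot F) (tot F') Dom f"
    and cb: "(c, b) \<in> adapted_charts F" and cb': "(c', b') \<in> adapted_charts F'"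
    and s: "local_section F V s" "q \<in> V" "s q \<in> cdom c" "f (s q) \<in> cdom c'"
    and s': "local_section F' V' s'"
    and img: "\<And>z. z \<in> V \<Longrightarrow> proj F' (f (s z)) \<in> V' \<and> s' (proj F' (f (s z))) = f (s z)"
    and dom: "(jet_coords (section_rep c b s) (cmap b q) :: ('n, 'm, 'r::finite option) jetspace)
      \<in> prolong_dom (cmap c' \<circ> f \<circ> cinv c) (rep_domain c c' Dom f)"
  shows "(jet_coords (section_rep c' b' s') (cmap b' (proj F' (f (s q)))) :: ('n, 'm, 'r option) jetspace)
    = prolong_map (cmap c' \<circ> f \<circ> cinv c) (jet_coords (section_rep c b s) (cmap b q))"
proof -
  note A = fibred_atlas[OF F(1)] and A' = fibred_atlas[OF F(2)]
  note ad = adapted_chartsD[OF cb] and ad' = adapted_chartsD[OF cb']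
  let ?h = "cmap c' \<circ> f \<circ> cinv c" and ?W = "rep_domain c c' Dom f"
  let ?\<sigma> = "section_rep c b s" and ?\<sigma>' = "section_rep c' b' s'"
  let ?q' = "proj F' (f (s q))"
  let ?j = "\<lambda>x. jet_coords ?\<sigma> x :: ('n, 'm, 'r option) jetspace"
  have W: "open ?W" "smooth_on ?W ?h" using rep_domain_open[OF A(1) A'(1) f ad(1) ad'(1)] .
  obtain N where N: "open N" "cmap b q \<in> N" "smooth_on N ?\<sigma>"
    "\<forall>x\<in>N. \<exists>z\<in>V. z \<in> cdom b \<and> x = cmap b z \<and> cinv b x = z \<and> s z \<in> cdom c \<and> proj F (s z) = z \<and>
       cmap c (s z) = (x, ?\<sigma> x)"
    by (rule section_in_chart[OF F(1) cb s(1-3)]) (rule that; assumption)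
  have q': "?q' \<in> V'" "s' ?q' \<in> cdom c'" using img[OF s(2)] s(4) by auto
  obtain N' where N': "open N'" "cmap b' ?q' \<in> N'" "smooth_on N' ?\<sigma>'"
    by (rule section_in_chart[OF F(2) cb' s' q']) (rule that; assumption)
  define N1 where "N1 = N \<inter> ?j -` prolong_dom ?h ?W"
  have N1: "open N1"
    unfolding N1_def by (rule continuous_open_preimage[OF smooth_on_continuous_on[OF smooth_on_jet_coords[OF N(1,3)]] N(1) open_prolong_dom[OF W]])
  have xW: "(x, ?\<sigma> x) \<in> ?W" if "x \<in> N1" for x
    using prolong_dom_base[OF W, of "?j x"] that by (simp add: N1_def)
  have \<sigma>1: "smooth_on N1 ?\<sigma>" by (rule smooth_on_subset[OF N(3)]) (auto simp: N1_def)
  let ?X = "\<lambda>x. fst (?h (x, ?\<sigma> x))"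
  have smX: "smooth_on N1 ?X" by (rule smooth_on_fst[OF N1 smooth_on_graph[OF W N1 \<sigma>1 xW]])
  \<comment> \<open>near \<open>cmap b q\<close> the determinant does not vanish, and the transformed points stay where \<open>s'\<close> is known\<close>
  define N2 where "N2 = N1 \<inter> ?X -` N'"
  have N2: "open N2"
    unfolding N2_def by (rule continuous_open_preimage[OF smooth_on_continuous_on[OF smX] N1 N'(1)])
  have graph: "?h (x, ?\<sigma> x) = (?X x, ?\<sigma>' (?X x)) \<and> (\<forall>z. cinv b x = z \<longrightarrow> ?X x = cmap b' (proj F' (f (s z))))"
    if x: "x \<in> N1" for x
  proof -
    obtain z where z: "z \<in> V" "cinv b x = z" "s z \<in> cdom c" "cmap c (s z) = (x, ?\<sigma> x)"
      using N(4) x by (auto simp: N1_def)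
    obtain e where e: "e \<in> cdom c" "f e \<in> cdom c'" "cmap c (s z) = cmap c e"
      using xW[OF x] z(4) by (auto simp: rep_domain_def)
    have "s z = e" using cinv_cmap[OF ad(3) z(3)] cinv_cmap[OF ad(3) e(1)] unfolding e(3) by simp
    then have fc: "f (s z) \<in> cdom c'" using e(2) by simp
    have h: "?h (x, ?\<sigma> x) = cmap c' (f (s z))" by (simp add: z(4)[symmetric] cinv_cmap[OF ad(3) z(3)])
    have X: "?X x = cmap b' (proj F' (f (s z)))" unfolding h by (rule ad'(6)[OF fc])
    have "?\<sigma>' (?X x) = snd (cmap c' (f (s z)))"
      unfolding X using img[OF z(1)] cinv_cmap[OF ad'(4) ad'(5)[OF fc]] by (simp add: section_rep_def)
    then show ?thesis using X h z(2) by (simp add: prod_eq_iff)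
  qed
  have qb: "q \<in> cdom b" using ad(5)[OF s(3)] s(1,2) by (simp add: local_section_def)
  have q1: "cmap b q \<in> N1" using N(2) dom by (simp add: N1_def)
  have Xq: "?X (cmap b q) = cmap b' ?q'"
    using graph[OF q1] cinv_cmap[OF ad(4) qb] by blast
  have q2: "cmap b q \<in> N2" using q1 N'(2) Xq by (simp add: N2_def)
  have "jet_coords ?\<sigma>' (?X (cmap b q)) = prolong_map ?h (?j (cmap b q))"
  proof (rule jet_coords_transformed_section[OF W N2 smooth_on_subset[OF \<sigma>1] N'(1,3) _ _ _ q2])
    show "N2 \<subseteq> N1" by (auto simp: N2_def)
    show "?X x \<in> N'" if "x \<in> N2" for x using that by (simp add: N2_def)
    show "?h (x, ?\<sigma> x) = (?X x, ?\<sigma>' (?X x))" if "x \<in> N2" for x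
      using conjunct1[OF graph, of x] that unfolding N2_def by blast
    show "?j x \<in> prolong_dom ?h ?W" if "x \<in> N2" for x using that by (simp add: N2_def N1_def)
  qed
  then show ?thesis unfolding Xq .
qed

section \<open>The jet bundle as a manifold\<close>

lemma smooth_map_on_id:
  assumes A: "is_atlas A"
  shows "smooth_map_on A A (carrier_of A) (\<lambda>q. q)"
proof (rule smooth_map_onI[OF A A])
  fix p assume "p \<in> carrier_of A"
  then obtain c where c: "c \<in> A" "p \<in> cdom c" by (auto simp: carrier_of_def)
  then have "is_chart c" "cdom c \<subseteq> carrier_of A" using atlas_chart[OF A] by (auto simp: carrier_of_def)
  moreover have "smooth_on (cmap c ` cdom c) (cmap c \<circ> (\<lambda>q. q) \<circ> cinv c)"
    by (rule smooth_on_eq[OF smooth_on_id]) (use \<open>is_chart c\<close> in \<open>auto simp: is_chart_def\<close>)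
  ultimately have "rep_smooth_at c c (carrier_of A) (\<lambda>q. q) p"
    unfolding rep_smooth_at_def using c by (intro exI[of _ "cmap c ` cdom c"]) (auto simp: is_chart_def)
  then show "\<exists>c\<in>max_atlas A. \<exists>d\<in>max_atlas A. p \<in> cdom c \<and> p \<in> cdom d \<and> rep_smooth_at c d (carrier_of A) (\<lambda>q. q) p"
    using c max_atlas_supset[OF A] by blast
qed

lemma sections_atE:
  assumes "s \<in> sections_at F q"
  obtains V where "local_section F V s" "q \<in> V"
  using assms by (auto simp: sections_at_def)

lemma local_section_sections_at: "local_section F V s \<Longrightarrow> q \<in> V \<Longrightarrow> s \<in> sections_at F q"
  by (auto simp: sections_at_def)

lemma section_carrier:
  assumes F: "fibred_manifold F" and s: "local_section F V s" "q \<in> V"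
  shows "s q \<in> carrier_of (tot F)" "proj F (s q) = q"
  using s smooth_map_on_range[OF _ fibred_atlas(2,1)[OF F], of V s q] by (auto simp: local_section_def)

lemma base_point_section:
  fixes F :: "('e, 'q, 'n::finite, 'm::finite) fibred"
  assumes cb: "(c, b) \<in> adapted_charts F" and s: "local_section F V s" "q \<in> V" "s q \<in> cdom c"
  shows "cmap c (s q) = (cmap b q, section_rep c b s (cmap b q))"
proof -
  note ad = adapted_chartsD[OF cb]
  have pr: "proj F (s q) = q" using s by (simp add: local_section_def)
  then have "q \<in> cdom b" using ad(5)[OF s(3)] by simp
  then show ?thesis using ad(6)[OF s(3)] pr cinv_cmap[OF ad(4)] by (simp add: prod_eq_iff section_rep_def)
qed

abbreviation chart_change where
  "chart_change c d \<equiv> cmap d \<circ> (\<lambda>e. e) \<circ> cinv c"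

abbreviation chart_overlap where
  "chart_overlap F c d \<equiv> rep_domain c d (carrier_of (tot F)) (\<lambda>e. e)"

text \<open>A change of adapted charts is a transformation of the total space over a change of charts of the
  base, by which a section is carried to itself. The base map is invertible, so the determinant
  condition holds everywhere.\<close>

lemma jet_coords_change:
  fixes F :: "('e, 'q, 'n::finite, 'm::finite) fibred"
  assumes F: "fibred_manifold F" and cb: "(c, b) \<in> adapted_charts F" and cb': "(c', b') \<in> adapted_charts F"
    and s: "s \<in> sections_at F q" "s q \<in> cdom c" "s q \<in> cdom c'"
  shows "(jet_coords (section_rep c b s) (cmap b q) :: ('n, 'm, 'r::finite option) jetspace)
      \<in> prolong_dom (chart_change c c') (chart_overlap F c c')"
    "(jet_coords (section_rep c' b' s) (cmap b' q) :: ('n, 'm, 'r option) jetspace)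
      = prolong_map (chart_change c c') (jet_coords (section_rep c b s) (cmap b q))"
proof -
  note A = fibred_atlas[OF F] and ad = adapted_chartsD[OF cb] and ad' = adapted_chartsD[OF cb']
  obtain V where V: "local_section F V s" "q \<in> V" using sections_atE[OF s(1)] .
  note sc = section_carrier[OF F V]
  have qb: "q \<in> cdom b" "q \<in> cdom b'" using ad(5)[OF s(2)] ad'(5)[OF s(3)] sc by auto
  obtain N where N: "open N" "cmap b q \<in> N" "smooth_on N (section_rep c b s)"
    "\<forall>x\<in>N. \<exists>z\<in>V. z \<in> cdom b \<and> x = cmap b z \<and> cinv b x = z \<and> s z \<in> cdom c \<and> proj F (s z) = z \<and>
       cmap c (s z) = (x, section_rep c b s x)"
    by (rule section_in_chart[OF F cb V s(2)]) (rule that; assumption)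
  have "rep_deriv b b' (\<lambda>z. proj F (s z)) q = rep_deriv b b' (\<lambda>z. z) q"
  proof (rule frechet_derivative_cong[OF N(1,2)])
    fix x assume "x \<in> N"
    then obtain z where "cinv b x = z" "proj F (s z) = z" using N(4) by blast
    then show "(cmap b' \<circ> (\<lambda>z. proj F (s z)) \<circ> cinv b) x = (cmap b' \<circ> (\<lambda>z. z) \<circ> cinv b) x" by simp
  qed
  then have "inj (rep_deriv b b' (\<lambda>z. proj F (s z)) q)"
    using inj_rep_deriv_transition[OF A(2) ad(2) ad'(2) qb] by (simp only:)
  then show dom: "(jet_coords (section_rep c b s) (cmap b q) :: ('n, 'm, 'r option) jetspace)
      \<in> prolong_dom (chart_change c c') (chart_overlap F c c')"
    unfolding prolong_dom_iff[OF F F smooth_map_on_id[OF A(1)] cb cb' V s(2) sc(1) s(3)] .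
  have "(jet_coords (section_rep c' b' s) (cmap b' (proj F (s q))) :: ('n, 'm, 'r option) jetspace)
      = prolong_map (chart_change c c') (jet_coords (section_rep c b s) (cmap b q))"
    by (rule transformed_jet_coords[OF F F smooth_map_on_id[OF A(1)] cb cb' V s(2,3) V(1) _ dom])
      (use V(1) in \<open>auto simp: local_section_def\<close>)
  then show "(jet_coords (section_rep c' b' s) (cmap b' q) :: ('n, 'm, 'r option) jetspace)
      = prolong_map (chart_change c c') (jet_coords (section_rep c b s) (cmap b q))"
    by (simp only: sc(2))
qed

text \<open>Jets are equal as soon as their coordinates agree in one chart, as the coordinates in any other chart
  are obtained by applying the same map.\<close>

lemma jet_eq_from_chart:
  fixes F :: "('e, 'q, 'n::finite, 'm::finite) fibred"
  assumes F: "fibred_manifold F" and cb: "(c, b) \<in> adapted_charts F"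
    and s: "s \<in> sections_at F q" "s q \<in> cdom c" and t: "t \<in> sections_at F q" "t q \<in> cdom c"
    and eq: "(jet_coords (section_rep c b s) (cmap b q) :: ('n, 'm, 'r::finite option) jetspace)
      = jet_coords (section_rep c b t) (cmap b q)"
  shows "jet F (CARD('r)) s q = jet F (CARD('r)) t q"
proof (rule jet_eqI)
  obtain V V' where V: "local_section F V s" "q \<in> V" "local_section F V' t" "q \<in> V'"
    using s(1) t(1) by (auto simp: sections_at_def)
  have "cmap c (s q) = cmap c (t q)"
    using arg_cong[OF eq, of base_point] base_point_section[OF cb V(1,2) s(2)] base_point_section[OF cb V(3,4) t(2)]
    by simp
  then have st: "s q = t q"
    using cinv_cmap[OF adapted_chartsD(3)[OF cb] s(2)] cinv_cmap[OF adapted_chartsD(3)[OF cb] t(2)] by metis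
  have "mderiv I (section_rep c' b' s) (cmap b' q) = mderiv I (section_rep c' b' t) (cmap b' q)"
    if cb': "(c', b') \<in> adapted_charts F" and sc: "s q \<in> cdom c'" and I: "size I \<le> CARD('r)" for c' b' I
  proof -
    have "(jet_coords (section_rep c' b' s) (cmap b' q) :: ('n, 'm, 'r option) jetspace)
        = jet_coords (section_rep c' b' t) (cmap b' q)"
      using jet_coords_change(2)[OF F cb cb' s sc, where 'r = 'r] jet_coords_change(2)[OF F cb cb' t, where 'r = 'r]
        sc st eq by simp
    from arg_cong[OF this, of "\<lambda>y. ucoord y I"] I show ?thesis by simp
  qed
  then show "jet_equiv F (CARD('r)) q s t"
    unfolding jet_equiv_def using st by blast
qed

lemma jetsE:
  assumes "p \<in> jets F r"
  obtains s V q where "p = jet F r s q" "s \<in> sections_at F q" "local_section F V s" "q \<in> V" "fst p = q" "target p = s q"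
proof -
  obtain s q where p: "p = jet F r s q" "s \<in> sections_at F q" using assms by (auto simp: jets_def)
  moreover obtain V where "local_section F V s" "q \<in> V" using sections_atE[OF p(2)] .
  ultimately show thesis using that target_jet[OF p(2), of r] by simp
qed

lemma cdom_jet_chart_option: "cdom (jet_chart TYPE('r::finite option) F c b) = {p \<in> jets F (CARD('r)). target p \<in> cdom c}"
  by (simp add: jet_chart_def)

lemma jet_chart_jet_option:
  fixes F :: "('e, 'q, 'n::finite, 'm::finite) fibred"
  assumes "(c, b) \<in> adapted_charts F" "s \<in> sections_at F q" "s q \<in> cdom c"
  shows "cmap (jet_chart TYPE('r::finite option) F c b) (jet F (CARD('r)) s q) = jet_coords (section_rep c b s) (cmap b q)"
  using jet_chart_jet[OF assms, where 's = "'r option"] by simp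

lemma base_point_jet_chart:
  fixes F :: "('e, 'q, 'n::finite, 'm::finite) fibred"
  assumes F: "fibred_manifold F" and cb: "(c, b) \<in> adapted_charts F"
    and p: "p \<in> cdom (jet_chart TYPE('r::finite option) F c b)"
  shows "base_point (cmap (jet_chart TYPE('r option) F c b) p) = cmap c (target p)"
proof -
  have "p \<in> jets F (CARD('r))" "target p \<in> cdom c" using p by (auto simp: cdom_jet_chart_option)
  then obtain s V q where s: "p = jet F (CARD('r)) s q" "s \<in> sections_at F q" "local_section F V s" "q \<in> V" "target p = s q"
    by (elim jetsE) blast
  have sq: "s q \<in> cdom c" using \<open>target p \<in> cdom c\<close> s(5) by simp
  show ?thesis
    unfolding s(1) jet_chart_jet_option[OF cb s(2) sq] target_jet[OF s(2)]
    using base_point_section[OF cb s(3,4) sq] by simp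
qed

lemma inj_jet_chart:
  fixes F :: "('e, 'q, 'n::finite, 'm::finite) fibred"
  assumes F: "fibred_manifold F" and cb: "(c, b) \<in> adapted_charts F"
  shows "inj_on (cmap (jet_chart TYPE('r::finite option) F c b)) (cdom (jet_chart TYPE('r option) F c b))"
proof (rule inj_onI)
  fix p p' assume p: "p \<in> cdom (jet_chart TYPE('r option) F c b)" "p' \<in> cdom (jet_chart TYPE('r option) F c b)"
    and eq: "cmap (jet_chart TYPE('r option) F c b) p = cmap (jet_chart TYPE('r option) F c b) p'"
  note ad = adapted_chartsD[OF cb]
  have j: "p \<in> jets F (CARD('r))" "p' \<in> jets F (CARD('r))" and t: "target p \<in> cdom c" "target p' \<in> cdom c"
    using p by (auto simp: cdom_jet_chart_option)
  obtain s V q where s: "p = jet F (CARD('r)) s q" "s \<in> sections_at F q" "local_section F V s" "q \<in> V" "target p = s q"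
    using j(1) by (elim jetsE) blast
  obtain s' V' q' where s': "p' = jet F (CARD('r)) s' q'" "s' \<in> sections_at F q'" "local_section F V' s'" "q' \<in> V'" "target p' = s' q'"
    using j(2) by (elim jetsE) blast
  have sq: "s q \<in> cdom c" "s' q' \<in> cdom c" using t s s' by auto
  have eq': "(jet_coords (section_rep c b s) (cmap b q) :: ('n, 'm, 'r option) jetspace)
      = jet_coords (section_rep c b s') (cmap b q')"
    using eq unfolding s(1) s'(1) jet_chart_jet_option[OF cb s(2) sq(1)] jet_chart_jet_option[OF cb s'(2) sq(2)] .
  have "cmap b q = cmap b q'" using arg_cong[OF eq', of fst] by simp
  moreover have "q \<in> cdom b" "q' \<in> cdom b"
    using ad(5)[OF sq(1)] ad(5)[OF sq(2)] section_carrier(2)[OF F s(3,4)] section_carrier(2)[OF F s'(3,4)] by auto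
  ultimately have qq: "q = q'" using cinv_cmap[OF ad(4)] by metis
  show "p = p'"
    unfolding s(1) s'(1) using jet_eq_from_chart[OF F cb s(2) sq(1), of s'] s'(2) sq(2) eq' unfolding qq by blast
qed

text \<open>The jet is represented by the Taylor polynomial, restricted to where its graph lies in the chart.\<close>

lemma jet_chart_realise:
  fixes F :: "('e, 'q, 'n::finite, 'm::finite) fibred" and y :: "('n, 'm, 'r::finite option) jetspace"
  assumes F: "fibred_manifold F" and cb: "(c, b) \<in> adapted_charts F" and y: "base_point y \<in> cmap c ` cdom c"
  shows "\<exists>p \<in> cdom (jet_chart TYPE('r option) F c b). cmap (jet_chart TYPE('r option) F c b) p = y"
proof -
  note ad = adapted_chartsD[OF cb]
  let ?\<sigma> = "taylor_poly y"
  define N where "N = (\<lambda>x. (x, ?\<sigma> x)) -` (cmap c ` cdom c)"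
  have cont: "continuous_on UNIV (\<lambda>x. (x, ?\<sigma> x))"
    by (rule smooth_on_continuous_on[OF smooth_on_Pair[OF open_UNIV smooth_on_id[OF open_UNIV] smooth_on_taylor_poly]])
  have oN: "open N" unfolding N_def
    using ad(3) by (intro open_vimage cont) (simp add: is_chart_def)
  have j: "jet_coords ?\<sigma> (fst y) = y" by (rule jet_coords_taylor_poly)
  have "base_point y = (fst y, ?\<sigma> (fst y))" using base_point_jet_coords[of ?\<sigma> "fst y", where 'r = 'r] j by simp
  then have yN: "fst y \<in> N" using y by (simp add: N_def)
  define s where "s = (\<lambda>q. cinv c (cmap b q, ?\<sigma> (cmap b q)))"
  have smN: "smooth_on N ?\<sigma>" by (rule smooth_on_subset[OF smooth_on_taylor_poly subset_UNIV])
  have NN: "\<forall>x\<in>N. (x, ?\<sigma> x) \<in> cmap c ` cdom c" by (simp add: N_def)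
  note sec = section_from_coords[OF F cb oN smN NN s_def]
  obtain q where q: "q \<in> cdom b" "fst y = cmap b q" using sec(2)[OF yN] by blast
  have qN: "cmap b q \<in> N" using yN q(2) by simp
  have ls: "s \<in> sections_at F q"
    by (rule local_section_sections_at[OF sec(1)]) (use q qN in auto)
  have sq: "s q \<in> cdom c" using sec(3)[OF q(1) qN] by blast
  have "jet_coords (section_rep c b s) (cmap b q) = (jet_coords ?\<sigma> (cmap b q) :: ('n, 'm, 'r option) jetspace)"
    by (rule jet_coords_cong[OF oN qN]) (rule sec(4))
  then have "cmap (jet_chart TYPE('r option) F c b) (jet F (CARD('r)) s q) = y"
    using jet_chart_jet_option[OF cb ls sq, where 'r = 'r] j q(2) by simp
  moreover have "jet F (CARD('r)) s q \<in> cdom (jet_chart TYPE('r option) F c b)"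
    using ls sq target_jet[OF ls] by (auto simp: cdom_jet_chart_option jets_def)
  ultimately show ?thesis by blast
qed

lemma jet_chart_image:
  fixes F :: "('e, 'q, 'n::finite, 'm::finite) fibred"
  assumes F: "fibred_manifold F" and cb: "(c, b) \<in> adapted_charts F"
  shows "cmap (jet_chart TYPE('r::finite option) F c b) ` cdom (jet_chart TYPE('r option) F c b)
    = {y. base_point y \<in> cmap c ` cdom c}"
proof (intro equalityI subsetI)
  fix y assume "y \<in> cmap (jet_chart TYPE('r option) F c b) ` cdom (jet_chart TYPE('r option) F c b)"
  then obtain p where p: "p \<in> cdom (jet_chart TYPE('r option) F c b)" "y = cmap (jet_chart TYPE('r option) F c b) p" by blast
  then show "y \<in> {y. base_point y \<in> cmap c ` cdom c}"
    using base_point_jet_chart[OF F cb p(1)] by (simp add: cdom_jet_chart_option)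
next
  fix y :: "('n, 'm, 'r option) jetspace" assume "y \<in> {y. base_point y \<in> cmap c ` cdom c}"
  then show "y \<in> cmap (jet_chart TYPE('r option) F c b) ` cdom (jet_chart TYPE('r option) F c b)"
    using jet_chart_realise[OF F cb, of y] by blast
qed

lemma is_chart_jet_chart:
  fixes F :: "('e, 'q, 'n::finite, 'm::finite) fibred"
  assumes F: "fibred_manifold F" and cb: "(c, b) \<in> adapted_charts F"
  shows "is_chart (jet_chart TYPE('r::finite option) F c b)"
proof -
  have "open {y :: ('n, 'm, 'r option) jetspace. base_point y \<in> cmap c ` cdom c}"
    by (rule open_base[OF _ smooth_on_const[where c = 0]])
      (use adapted_chartsD(3)[OF cb] in \<open>simp_all add: is_chart_def\<close>)
  then show ?thesis
    unfolding is_chart_def jet_chart_image[OF F cb] using inj_jet_chart[OF F cb] by blast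
qed

lemma jet_chart_change:
  fixes F :: "('e, 'q, 'n::finite, 'm::finite) fibred"
  assumes F: "fibred_manifold F" and cb: "(c, b) \<in> adapted_charts F" and cb': "(c', b') \<in> adapted_charts F"
    and p: "p \<in> cdom (jet_chart TYPE('r::finite option) F c b)" "p \<in> cdom (jet_chart TYPE('r option) F c' b')"
  shows "cmap (jet_chart TYPE('r option) F c b) p \<in> prolong_dom (chart_change c c') (chart_overlap F c c')"
    "cmap (jet_chart TYPE('r option) F c' b') p = prolong_map (chart_change c c') (cmap (jet_chart TYPE('r option) F c b) p)"
proof -
  have j: "p \<in> jets F (CARD('r))" and t: "target p \<in> cdom c" "target p \<in> cdom c'"
    using p by (auto simp: cdom_jet_chart_option)
  obtain s V q where s: "p = jet F (CARD('r)) s q" "s \<in> sections_at F q" "target p = s q"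
    using j by (elim jetsE) blast
  have sq: "s q \<in> cdom c" "s q \<in> cdom c'" using t s by auto
  show "cmap (jet_chart TYPE('r option) F c b) p \<in> prolong_dom (chart_change c c') (chart_overlap F c c')"
    unfolding s(1) jet_chart_jet_option[OF cb s(2) sq(1)] by (rule jet_coords_change(1)[OF F cb cb' s(2) sq])
  show "cmap (jet_chart TYPE('r option) F c' b') p = prolong_map (chart_change c c') (cmap (jet_chart TYPE('r option) F c b) p)"
    unfolding s(1) jet_chart_jet_option[OF cb s(2) sq(1)] jet_chart_jet_option[OF cb' s(2) sq(2)]
    by (rule jet_coords_change(2)[OF F cb cb' s(2) sq])
qed

lemma chart_overlap_smooth:
  assumes F: "fibred_manifold F" and cb: "(c, b) \<in> adapted_charts F" and cb': "(c', b') \<in> adapted_charts F"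
  shows "open (chart_overlap F c c')" "smooth_on (chart_overlap F c c') (chart_change c c')"
  using rep_domain_open[OF fibred_atlas(1,1)[OF F] smooth_map_on_id[OF fibred_atlas(1)[OF F]]
      adapted_chartsD(1)[OF cb] adapted_chartsD(1)[OF cb']] .

text \<open>The determinant condition on the right hand side is automatic, as every point of the overlap is the
  jet of a section.\<close>

lemma jet_overlap_image:
  fixes F :: "('e, 'q, 'n::finite, 'm::finite) fibred"
  assumes F: "fibred_manifold F" and cb: "(c, b) \<in> adapted_charts F" and cb': "(c', b') \<in> adapted_charts F"
  shows "cmap (jet_chart TYPE('r::finite option) F c b) ` (cdom (jet_chart TYPE('r option) F c b) \<inter> cdom (jet_chart TYPE('r option) F c' b'))
    = prolong_dom (chart_change c c') (chart_overlap F c c')" (is "?L = ?R")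
proof (intro equalityI subsetI)
  show "y \<in> ?R" if "y \<in> ?L" for y
    using that jet_chart_change(1)[OF F cb cb', where 'r = 'r] by blast
  fix y assume "y \<in> ?R"
  then have "base_point y \<in> chart_overlap F c c'" by (simp add: prolong_dom_def)
  then obtain e where e: "e \<in> cdom c" "e \<in> cdom c'" "base_point y = cmap c e" by (auto simp: rep_domain_def)
  then obtain p where p: "p \<in> cdom (jet_chart TYPE('r option) F c b)" "cmap (jet_chart TYPE('r option) F c b) p = y"
    using jet_chart_realise[OF F cb, of y] by blast
  have t: "target p \<in> cdom c" "p \<in> jets F (CARD('r))" using p by (auto simp: cdom_jet_chart_option)
  have "cmap c (target p) = cmap c e" using base_point_jet_chart[OF F cb p(1)] p(2) e(3) by simp
  then have "target p = e" using cinv_cmap[OF adapted_chartsD(3)[OF cb]] e(1) t(1) by metis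
  then have "p \<in> cdom (jet_chart TYPE('r option) F c' b')" using e t by (simp add: cdom_jet_chart_option)
  then show "y \<in> ?L" using p by blast
qed

lemma is_atlas_jet_atlas:
  fixes F :: "('e, 'q, 'n::finite, 'm::finite) fibred"
  assumes F: "fibred_manifold F"
  shows "is_atlas (jet_atlas TYPE('r::finite option) F)"
  unfolding is_atlas_def
proof (intro conjI ballI)
  show "is_chart d" if "d \<in> jet_atlas TYPE('r option) F" for d
    using that is_chart_jet_chart[OF F] by (auto simp: jet_atlas_def)
  fix d d' assume "d \<in> jet_atlas TYPE('r option) F" "d' \<in> jet_atlas TYPE('r option) F"
  then obtain c b c' b' where cb: "(c, b) \<in> adapted_charts F" "(c', b') \<in> adapted_charts F"
    and d: "d = jet_chart TYPE('r option) F c b" "d' = jet_chart TYPE('r option) F c' b'"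
    by (auto simp: jet_atlas_def)
  note W = chart_overlap_smooth[OF F cb]
  have o: "open (cmap d ` (cdom d \<inter> cdom d'))"
    unfolding d jet_overlap_image[OF F cb] by (rule open_prolong_dom[OF W])
  have "smooth_on (cmap d ` (cdom d \<inter> cdom d')) (prolong_map (chart_change c c'))"
    unfolding d jet_overlap_image[OF F cb] by (rule smooth_prolong_map[OF W])
  then have "smooth_on (cmap d ` (cdom d \<inter> cdom d')) (cmap d' \<circ> cinv d)"
  proof (rule smooth_on_eq[OF _ o])
    fix y assume "y \<in> cmap d ` (cdom d \<inter> cdom d')"
    then obtain p where p: "p \<in> cdom d" "p \<in> cdom d'" "y = cmap d p" by blast
    have "is_chart d" unfolding d by (rule is_chart_jet_chart[OF F cb(1)])
    then have "(cmap d' \<circ> cinv d) y = cmap d' p" using p by (simp add: cinv_cmap)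
    also have "\<dots> = prolong_map (chart_change c c') y"
      using jet_chart_change(2)[OF F cb p(1,2)[unfolded d]] by (simp only: p(3) d)
    finally show "prolong_map (chart_change c c') y = (cmap d' \<circ> cinv d) y" by simp
  qed
  then show "smooth_transition d d'" using o by (simp add: smooth_transition_def)
qed

lemma jet_atlas_cover:
  assumes F: "fibred_manifold F" and p: "p \<in> jets F (CARD('r::finite))"
  obtains c b where "(c, b) \<in> adapted_charts F" "p \<in> cdom (jet_chart TYPE('r option) F c b)"
proof -
  obtain s V q where s: "local_section F V s" "q \<in> V" "target p = s q" using p by (elim jetsE) blast
  then have "target p \<in> carrier_of (tot F)" using section_carrier[OF F] by simp
  then obtain c b where "(c, b) \<in> adapted_charts F" "target p \<in> cdom c" by (rule adapted_charts_exist[OF F])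
  then show thesis using that p by (simp add: cdom_jet_chart_option)
qed

lemma carrier_jet_atlas:
  assumes F: "fibred_manifold F"
  shows "carrier_of (jet_atlas TYPE('r::finite option) F) = jets F (CARD('r))"
proof (intro equalityI subsetI)
  show "p \<in> jets F (CARD('r))" if p: "p \<in> carrier_of (jet_atlas TYPE('r option) F)" for p
  proof -
    obtain d where d: "d \<in> jet_atlas TYPE('r option) F" "p \<in> cdom d" using p unfolding carrier_of_def by blast
    then obtain c b where "d = jet_chart TYPE('r option) F c b" unfolding jet_atlas_def by blast
    then show ?thesis using d(2) by (simp add: cdom_jet_chart_option)
  qed
  show "p \<in> carrier_of (jet_atlas TYPE('r option) F)" if p: "p \<in> jets F (CARD('r))" for p
  proof -
    obtain c b where cb: "(c, b) \<in> adapted_charts F" "p \<in> cdom (jet_chart TYPE('r option) F c b)"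
      by (rule jet_atlas_cover[OF F p])
    have "jet_chart TYPE('r option) F c b \<in> jet_atlas TYPE('r option) F" unfolding jet_atlas_def using cb(1) by blast
    then show ?thesis unfolding carrier_of_def using cb(2) by (rule UN_I)
  qed
qed

lemma jet_chart_in_atlas: "(c, b) \<in> adapted_charts F \<Longrightarrow> jet_chart T F c b \<in> jet_atlas T F"
  unfolding jet_atlas_def by blast

lemma rep_deriv_jet_chart:
  fixes F :: "('e, 'q, 'n::finite, 'm::finite) fibred"
  assumes F: "fibred_manifold F" and cb: "(c, b) \<in> adapted_charts F" and cb': "(c', b') \<in> adapted_charts F"
    and p: "p \<in> cdom (jet_chart TYPE('r::finite option) F c b)" "p \<in> cdom (jet_chart TYPE('r option) F c' b')"
  shows "rep_deriv (jet_chart TYPE('r option) F c b) (jet_chart TYPE('r option) F c' b') (\<lambda>q. q) p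
    = frechet_derivative (prolong_map (chart_change c c')) (at (cmap (jet_chart TYPE('r option) F c b) p))"
proof (rule frechet_derivative_cong[OF open_prolong_dom[OF chart_overlap_smooth[OF F cb cb']]
      jet_chart_change(1)[OF F cb cb' p]])
  fix y :: "('n, 'm, 'r option) jetspace" assume "y \<in> prolong_dom (chart_change c c') (chart_overlap F c c')"
  then obtain p where p: "p \<in> cdom (jet_chart TYPE('r option) F c b)" "p \<in> cdom (jet_chart TYPE('r option) F c' b')"
    "y = cmap (jet_chart TYPE('r option) F c b) p"
    unfolding jet_overlap_image[OF F cb cb', symmetric] by blast
  show "(cmap (jet_chart TYPE('r option) F c' b') \<circ> (\<lambda>q. q) \<circ> cinv (jet_chart TYPE('r option) F c b)) y
      = prolong_map (chart_change c c') y"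
    using jet_chart_change(2)[OF F cb cb' p(1,2)] cinv_cmap[OF is_chart_jet_chart[OF F cb] p(1)] p(3) by simp
qed

lemma jet_tangent_change:
  fixes F :: "('e, 'q, 'n::finite, 'm::finite) fibred"
  assumes F: "fibred_manifold F" and cb: "(c, b) \<in> adapted_charts F" and cb': "(c', b') \<in> adapted_charts F"
    and p: "p \<in> cdom (jet_chart TYPE('r::finite option) F c b)" "p \<in> cdom (jet_chart TYPE('r option) F c' b')"
    and v: "v \<in> tangent_space (jet_atlas TYPE('r option) F) p"
  shows "v (jet_chart TYPE('r option) F c' b')
    = frechet_derivative (prolong_map (chart_change c c')) (at (cmap (jet_chart TYPE('r option) F c b) p))
        (v (jet_chart TYPE('r option) F c b))"
  using tangent_space_change[OF v jet_chart_in_atlas[OF cb] jet_chart_in_atlas[OF cb'] p] rep_deriv_jet_chart[OF F cb cb' p]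
  by (simp only:)

text \<open>Transition maps of the jet bundle are prolongations, hence preserve the contact equations; so these
  can be tested in a single chart.\<close>

lemma cartan_iff:
  fixes F :: "('e, 'q, 'n::finite, 'm::finite) fibred"
  assumes F: "fibred_manifold F" and cb: "(c, b) \<in> adapted_charts F"
    and p: "p \<in> cdom (jet_chart TYPE('r::finite option) F c b)"
  shows "v \<in> cartan TYPE('r option) F p \<longleftrightarrow> v \<in> tangent_space (jet_atlas TYPE('r option) F) p \<and>
    v (jet_chart TYPE('r option) F c b) \<in> contact_kernel (cmap (jet_chart TYPE('r option) F c b) p)"
proof (intro iffI conjI)
  assume *: "v \<in> tangent_space (jet_atlas TYPE('r option) F) p \<and>
    v (jet_chart TYPE('r option) F c b) \<in> contact_kernel (cmap (jet_chart TYPE('r option) F c b) p)"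
  show "v \<in> cartan TYPE('r option) F p"
    unfolding cartan_def
  proof (intro CollectI conjI ballI impI)
    show "v \<in> tangent_space (jet_atlas TYPE('r option) F) p" using * by blast
    fix d assume d: "d \<in> jet_atlas TYPE('r option) F" "p \<in> cdom d"
    then obtain c' b' where cb': "(c', b') \<in> adapted_charts F" and dd: "d = jet_chart TYPE('r option) F c' b'"
      by (auto simp: jet_atlas_def)
    have p': "p \<in> cdom (jet_chart TYPE('r option) F c' b')" using d(2) unfolding dd .
    show "v d \<in> contact_kernel (cmap d p)"
      unfolding dd jet_tangent_change[OF F cb cb' p p' conjunct1[OF *]] jet_chart_change(2)[OF F cb cb' p p']
      by (rule prolong_map_contact[OF chart_overlap_smooth[OF F cb cb'] jet_chart_change(1)[OF F cb cb' p p'] conjunct2[OF *]])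
  qed
qed (use p jet_chart_in_atlas[OF cb] in \<open>auto simp: cartan_def\<close>)

section \<open>The vertical distribution\<close>

text \<open>The projection to jets of the order just below, in coordinates.\<close>

definition truncate_jet :: "('n::finite, 'm::finite, 'r::finite option) jetspace \<Rightarrow> ('n, 'm, 'r) jetspace" where
  "truncate_jet y = (fst y, \<chi> I. ucoord y (Rep_mindex I))"

lemma size_Rep_mindex_less: "size (Rep_mindex (I :: ('n::finite, 'r::finite) mindex)) < CARD('r)"
  using Rep_mindex[of I] by simp

lemma linear_truncate_jet: "linear truncate_jet"
  by (rule linearI) (simp_all add: truncate_jet_def ucoord_def vec_eq_iff)

lemma truncate_jet_zero:
  fixes v :: "('n::finite, 'm::finite, 'r::finite option) jetspace"
  shows "truncate_jet v = 0 \<longleftrightarrow> agree (CARD('r) - 1) v 0"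
proof
  assume t: "truncate_jet v = 0"
  show "agree (CARD('r) - 1) v 0"
  proof (rule agreeI)
    show "fst v = fst 0" using t by (simp add: truncate_jet_def prod_eq_iff)
    fix I :: "'n multiset" assume "size I \<le> CARD('r) - 1" "size I \<le> CARD('r)"
    moreover have "CARD('r) > 0" by simp
    ultimately have "size I < CARD('r)" by linarith
    then have "Rep_mindex (Abs_mindex I :: ('n, 'r) mindex) = I" by (simp add: Abs_mindex_inverse)
    moreover have "snd (truncate_jet v) $ Abs_mindex I = 0" using t by simp
    ultimately show "ucoord v I = ucoord (0 :: ('n, 'm, 'r option) jetspace) I"
      by (simp add: truncate_jet_def ucoord_def)
  qed
next
  assume a: "agree (CARD('r) - 1) v 0"
  have "ucoord v (Rep_mindex I) = 0" for I :: "('n, 'r) mindex"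
    using agree_ucoord[OF a, of "Rep_mindex I"] size_Rep_mindex_less[of I] by (simp add: ucoord_def)
  moreover have "fst v = 0" using a by (simp add: agree_def)
  ultimately show "truncate_jet v = 0" by (simp add: truncate_jet_def prod_eq_iff vec_eq_iff)
qed

lemma truncate_jet_coords:
  fixes s :: "real^'n::finite \<Rightarrow> real^'m::finite"
  shows "truncate_jet (jet_coords s x :: ('n, 'm, 'r::finite option) jetspace) = jet_coords s x"
proof -
  have "ucoord (jet_coords s x :: ('n, 'm, 'r option) jetspace) (Rep_mindex I) = mderiv (Rep_mindex I) s x"
    for I :: "('n, 'r) mindex"
    using size_Rep_mindex_less[of I] by simp
  then show ?thesis by (simp add: truncate_jet_def) (simp add: jet_coords_def)
qed

lemma jet_proj_in_chart:
  fixes F :: "('e, 'q, 'n::finite, 'm::finite) fibred"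
  assumes F: "fibred_manifold F" and cb: "(c, b) \<in> adapted_charts F"
    and p: "p \<in> jets F (CARD('r::finite))"
  shows "target (jet_proj F (jorder TYPE('r)) p) = target p"
    "jet_proj F (jorder TYPE('r)) p \<in> jets F (jorder TYPE('r))"
    "target p \<in> cdom c \<Longrightarrow> cmap (jet_chart TYPE('r) F c b) (jet_proj F (jorder TYPE('r)) p)
      = truncate_jet (cmap (jet_chart TYPE('r option) F c b) p)"
proof -
  obtain s q where s: "p = jet F (CARD('r)) s q" "s \<in> sections_at F q" "fst p = q" using p by (elim jetsE) blast
  let ?t = "rep_section p"
  have t: "?t \<in> sections_at F q" using rep_section_jet(1)[OF s(2)] s(1) by simp
  have jp: "jet_proj F (jorder TYPE('r)) p = jet F (jorder TYPE('r)) ?t q"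
    by (simp add: jet_proj_def s(3))
  show tg: "target (jet_proj F (jorder TYPE('r)) p) = target p"
    unfolding jp target_jet[OF t] by (simp add: target_def s(3))
  show "jet_proj F (jorder TYPE('r)) p \<in> jets F (jorder TYPE('r))" unfolding jp jets_def using t by blast
  assume "target p \<in> cdom c"
  then have tc: "?t q \<in> cdom c" by (simp add: target_def s(3))
  have "cmap (jet_chart TYPE('r option) F c b) p = jet_coords (section_rep c b ?t) (cmap b q)"
    by (simp add: jet_chart_def jet_coords_def s(3))
  then show "cmap (jet_chart TYPE('r) F c b) (jet_proj F (jorder TYPE('r)) p)
      = truncate_jet (cmap (jet_chart TYPE('r option) F c b) p)"
    unfolding jp jet_chart_jet[OF cb t tc] by (simp add: truncate_jet_coords)
qed

text \<open>The tangent map of the projection is evaluated through some chart, not necessarily the one in which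
  the result is wanted; between the two lies a transition map.\<close>

lemma tangent_jet_proj:
  fixes F :: "('e, 'q, 'n::finite, 'm::finite) fibred"
  assumes F: "fibred_manifold F" and cb: "(c, b) \<in> adapted_charts F"
    and p: "p \<in> cdom (jet_chart TYPE('r::finite option) F c b)"
    and v: "v \<in> tangent_space (jet_atlas TYPE('r option) F) p"
  shows "tangent_map (jet_atlas TYPE('r option) F) (jet_atlas TYPE('r) F) (jet_proj F (jorder TYPE('r))) p v
      (jet_chart TYPE('r) F c b) = truncate_jet (v (jet_chart TYPE('r option) F c b))"
proof -
  let ?J = "jet_atlas TYPE('r option) F" and ?pi = "jet_proj F (jorder TYPE('r))"
  let ?d = "jet_chart TYPE('r) F c b" and ?c = "jet_chart TYPE('r option) F c b"
  define e where "e = (SOME e. e \<in> ?J \<and> p \<in> cdom e)"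
  have "e \<in> ?J \<and> p \<in> cdom e"
    unfolding e_def by (rule someI[of "\<lambda>e. e \<in> ?J \<and> p \<in> cdom e" ?c]) (use p jet_chart_in_atlas[OF cb] in blast)
  then obtain c0 b0 where cb0: "(c0, b0) \<in> adapted_charts F" and e: "e = jet_chart TYPE('r option) F c0 b0" "p \<in> cdom e"
    unfolding jet_atlas_def by blast
  have p0: "p \<in> cdom (jet_chart TYPE('r option) F c0 b0)" using e by simp
  have pj: "p \<in> jets F (CARD('r))" "target p \<in> cdom c" using p by (auto simp: cdom_jet_chart_option)
  have dom: "?d \<in> jet_atlas TYPE('r) F \<and> ?pi p \<in> cdom ?d"
    using jet_chart_in_atlas[OF cb] jet_proj_in_chart(1,2)[OF F cb pj(1)] pj(2) by (simp add: cdom_jet_chart)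
  let ?h = "chart_change c0 c" and ?W = "chart_overlap F c0 c"
  note W = chart_overlap_smooth[OF F cb0 cb]
  let ?y = "cmap e p"
  have y: "?y \<in> prolong_dom ?h ?W" unfolding e(1) by (rule jet_chart_change(1)[OF F cb0 cb p0 p])
  have der: "frechet_derivative (cmap ?d \<circ> ?pi \<circ> cinv e) (at ?y) = frechet_derivative (\<lambda>y. truncate_jet (prolong_map ?h y)) (at ?y)"
  proof (rule frechet_derivative_cong[OF open_prolong_dom[OF W] y])
    fix z :: "('n, 'm, 'r option) jetspace" assume "z \<in> prolong_dom ?h ?W"
    then obtain p' where p': "p' \<in> cdom (jet_chart TYPE('r option) F c0 b0)" "p' \<in> cdom ?c"
      "z = cmap (jet_chart TYPE('r option) F c0 b0) p'"
      unfolding jet_overlap_image[OF F cb0 cb, symmetric] by blast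
    have "p' \<in> jets F (CARD('r))" "target p' \<in> cdom c" using p'(2) by (auto simp: cdom_jet_chart_option)
    then have "cmap ?d (?pi p') = truncate_jet (cmap ?c p')" by (rule jet_proj_in_chart(3)[OF F cb])
    then show "(cmap ?d \<circ> ?pi \<circ> cinv e) z = truncate_jet (prolong_map ?h z)"
      using jet_chart_change(2)[OF F cb0 cb p'(1,2)] cinv_cmap[OF is_chart_jet_chart[OF F cb0] p'(1)] p'(3) e(1) by simp
  qed
  have "frechet_derivative (cmap ?d \<circ> ?pi \<circ> cinv e) (at ?y) (v e)
      = truncate_jet (frechet_derivative (prolong_map ?h) (at ?y) (v e))"
    unfolding der by (rule frechet_derivative_linear_comp)
      (use linear_truncate_jet linear_conv_bounded_linear smooth_on_differentiable[OF smooth_prolong_map[OF W] open_prolong_dom[OF W] y] in auto)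
  also have "frechet_derivative (prolong_map ?h) (at ?y) (v e) = v ?c"
    unfolding e(1) by (rule jet_tangent_change[OF F cb0 cb p0 p v, symmetric])
  finally have "frechet_derivative (cmap ?d \<circ> ?pi \<circ> cinv e) (at ?y) (v e) = truncate_jet (v ?c)" .
  then show ?thesis
    unfolding tangent_map_def e_def[symmetric] Let_def using dom by (simp only: if_True simp_thms)
qed

lemma jet_vertical_iff:
  fixes F :: "('e, 'q, 'n::finite, 'm::finite) fibred"
  assumes F: "fibred_manifold F" and cb: "(c, b) \<in> adapted_charts F"
    and p: "p \<in> cdom (jet_chart TYPE('r::finite option) F c b)"
  shows "v \<in> jet_vertical TYPE('r option) F p \<longleftrightarrow> v \<in> tangent_space (jet_atlas TYPE('r option) F) p \<and>
    agree (CARD('r) - 1) (v (jet_chart TYPE('r option) F c b)) 0"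
proof
  assume "v \<in> jet_vertical TYPE('r option) F p"
  then have v: "v \<in> tangent_space (jet_atlas TYPE('r option) F) p"
    "tangent_map (jet_atlas TYPE('r option) F) (jet_atlas TYPE('r) F) (jet_proj F (jorder TYPE('r))) p v = 0"
    by (auto simp: jet_vertical_def)
  have "truncate_jet (v (jet_chart TYPE('r option) F c b)) = 0"
    using tangent_jet_proj[OF F cb p v(1)] v(2) by simp
  then show "v \<in> tangent_space (jet_atlas TYPE('r option) F) p \<and>
    agree (CARD('r) - 1) (v (jet_chart TYPE('r option) F c b)) 0"
    using v(1) truncate_jet_zero by blast
next
  assume *: "v \<in> tangent_space (jet_atlas TYPE('r option) F) p \<and>
    agree (CARD('r) - 1) (v (jet_chart TYPE('r option) F c b)) 0"
  have pj: "p \<in> jets F (CARD('r))" using p by (auto simp: cdom_jet_chart_option)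
  have "tangent_map (jet_atlas TYPE('r option) F) (jet_atlas TYPE('r) F) (jet_proj F (jorder TYPE('r))) p v d = 0" for d
  proof (cases "d \<in> jet_atlas TYPE('r) F \<and> jet_proj F (jorder TYPE('r)) p \<in> cdom d")
    case False
    then show ?thesis by (rule tangent_map_outside)
  next
    case True
    then obtain c' b' where cb': "(c', b') \<in> adapted_charts F" and d: "d = jet_chart TYPE('r) F c' b'"
      unfolding jet_atlas_def by blast
    have "target p \<in> cdom c'"
      using True jet_proj_in_chart(1)[OF F cb pj] unfolding d by (simp add: cdom_jet_chart)
    then have p': "p \<in> cdom (jet_chart TYPE('r option) F c' b')" using pj by (simp add: cdom_jet_chart_option)
    have "agree (CARD('r) - 1) (v (jet_chart TYPE('r option) F c' b')) 0"
      unfolding jet_tangent_change[OF F cb cb' p p' conjunct1[OF *]]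
      by (rule prolong_map_vertical[OF chart_overlap_smooth[OF F cb cb'] jet_chart_change(1)[OF F cb cb' p p'] conjunct2[OF *]])
    then show ?thesis
      unfolding d tangent_jet_proj[OF F cb' p' conjunct1[OF *]] by (simp only: truncate_jet_zero)
  qed
  then show "v \<in> jet_vertical TYPE('r option) F p"
    using * unfolding jet_vertical_def by (simp add: fun_eq_iff)
qed

section \<open>The corank of the Cartan distribution\<close>

text \<open>Listing the multiplicities and appending the difference to the maximal size puts these multisets in
  bijection with the lists of \<open>n + 1\<close> natural numbers of sum \<open>k\<close>.\<close>

lemma card_multisets_less:
  "card {I :: 'n::finite multiset. size I < Suc k} = (CARD('n) + k) choose k"
proof -
  obtain xs :: "'n list" where xs: "set xs = UNIV" "distinct xs" using finite_distinct_list[OF finite] by metis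
  have len: "length xs = CARD('n)" using xs distinct_card by metis
  define f where "f = (\<lambda>I. map (count I) xs @ [k - size I])"
  have sz: "size I = sum_list (map (count I) xs)" for I :: "'n multiset"
  proof -
    have "size I = sum (count I) UNIV"
      unfolding size_multiset_overloaded_eq by (rule sum.mono_neutral_left) (auto simp: not_in_iff)
    then show ?thesis using xs by (simp add: sum_list_distinct_conv_sum_set)
  qed
  have "bij_betw f {I :: 'n multiset. size I < Suc k} {l :: nat list. length l = Suc (CARD('n)) \<and> sum_list l = k}"
  proof (rule bij_betw_imageI)
    show "inj_on f {I. size I < Suc k}"
    proof (rule inj_onI)
      fix I J assume "f I = f J"
      then have "\<forall>x\<in>set xs. count I x = count J x" by (simp add: f_def)
      then show "I = J" using xs by (simp add: multiset_eq_iff)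
    qed
    show "f ` {I :: 'n multiset. size I < Suc k} = {l :: nat list. length l = Suc (CARD('n)) \<and> sum_list l = k}"
    proof (intro equalityI subsetI)
      fix l assume "l \<in> f ` {I. size I < Suc k}"
      then show "l \<in> {l :: nat list. length l = Suc (CARD('n)) \<and> sum_list l = k}"
        by (auto simp: f_def len sz)
    next
      fix l :: "nat list" assume "l \<in> {l. length l = Suc (CARD('n)) \<and> sum_list l = k}"
      then have l: "length l = Suc (CARD('n))" "sum_list l = k" by auto
      then obtain l' a where l': "l = l' @ [a]" by (metis length_Suc_conv_rev)
      have len': "length l' = CARD('n)" using l l' by simp
      define g where "g = (\<lambda>x. the (map_of (zip xs l') x))"
      have g: "map g xs = l'"
        using xs len len' by (intro nth_equalityI) (auto simp: g_def map_of_zip_nth)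
      define I where "I = Abs_multiset g"
      have cI: "count I = g" unfolding I_def by (rule count_Abs_multiset) simp
      have "f I = l' @ [k - sum_list l']" by (simp add: f_def sz cI g)
      moreover have "k - sum_list l' = a" "size I < Suc k" using l l' by (auto simp: sz cI g)
      ultimately show "l \<in> f ` {I. size I < Suc k}" using l' by (intro image_eqI[of _ _ I]) auto
    qed
  qed
  then have "card {I :: 'n multiset. size I < Suc k} = card {l :: nat list. length l = Suc (CARD('n)) \<and> sum_list l = k}"
    by (rule bij_betw_same_card)
  also have "\<dots> = (k + Suc (CARD('n)) - 1) choose k" by (rule card_length_sum_list)
  finally show ?thesis by (simp add: add.commute)
qed

lemma card_mindex: "CARD(('n::finite, 'r::finite) mindex) = (CARD('n) + CARD('r) - 1) choose (CARD('r) - 1)"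
proof -
  have "CARD(('n, 'r) mindex) = card {I :: 'n multiset. size I < CARD('r)}"
    by (rule type_definition.card[OF type_definition_mindex])
  moreover obtain k where "CARD('r) = Suc k" using gr0_implies_Suc[of "CARD('r)"] by auto
  ultimately show ?thesis by (simp add: card_multisets_less)
qed

lemma contact_kernel_subspace: "subspace (contact_kernel (y :: ('n::finite, 'm::finite, 's::finite) jetspace))"
  unfolding subspace_def contact_kernel_def
  by (auto simp: ucoord_def scaleR_left_distrib sum.distrib scaleR_right_diff_distrib scaleR_sum_right[symmetric]
      simp flip: scaleR_scaleR)

text \<open>The contact equations are independent: in each of them another component \<open>u\<^sub>I\<close> of the vector can be
  prescribed.\<close>

lemma dim_contact_kernel:
  fixes y :: "('n::finite, 'm::finite, 'r::finite option) jetspace"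
  shows "DIM(('n, 'm, 'r option) jetspace) = dim (contact_kernel y) + CARD('m) * ((CARD('n) + CARD('r) - 1) choose (CARD('r) - 1))"
proof -
  define D :: "('n, 'm, 'r option) jetspace \<Rightarrow> (real^'m)^('n, 'r) mindex" where
    "D = (\<lambda>v. \<chi> I. ucoord v (Rep_mindex I) - (\<Sum>i\<in>UNIV. fst v $ i *\<^sub>R ucoord y (add_mset i (Rep_mindex I))))"
  have lin: "linear D"
    by (rule linearI) (auto simp: D_def ucoord_def vec_eq_iff scaleR_left_distrib sum.distrib sum_component sum_distrib_left algebra_simps)
  have surj: "surj D"
  proof (rule surjI)
    fix w :: "(real^'m)^('n, 'r) mindex"
    let ?v = "(0, \<chi> I. w $ Abs_mindex (Rep_mindex I)) :: ('n, 'm, 'r option) jetspace"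
    have "ucoord ?v (Rep_mindex I) = w $ I" for I :: "('n, 'r) mindex"
      using size_Rep_mindex_less[of I] by (simp add: ucoord_def Rep_mindex_inverse)
    then show "D ?v = w" by (simp add: D_def vec_eq_iff)
  qed
  have "contact_kernel y = {v. D v = 0}"
  proof (intro equalityI subsetI)
    fix v assume v: "v \<in> contact_kernel y"
    have "ucoord v (Rep_mindex I) - (\<Sum>i\<in>UNIV. fst v $ i *\<^sub>R ucoord y (add_mset i (Rep_mindex I))) = 0"
      for I :: "('n, 'r) mindex"
      using v size_Rep_mindex_less[of I] by (simp add: contact_kernel_def)
    then show "v \<in> {v. D v = 0}" by (simp add: D_def vec_eq_iff)
  next
    fix v assume "v \<in> {v. D v = 0}"
    then have D: "D v $ I = 0" for I by simp
    show "v \<in> contact_kernel y"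
      unfolding contact_kernel_def
    proof (intro CollectI allI impI)
      fix I :: "'n multiset" assume "size I < jorder TYPE('r option)"
      then have "Rep_mindex (Abs_mindex I :: ('n, 'r) mindex) = I" by (simp add: Abs_mindex_inverse)
      then show "ucoord v I - (\<Sum>i\<in>UNIV. fst v $ i *\<^sub>R ucoord y (add_mset i I)) = 0"
        using D[of "Abs_mindex I"] by (simp add: D_def)
    qed
  qed
  moreover have "DIM((real^'m)^('n, 'r) mindex) = CARD('m) * ((CARD('n) + CARD('r) - 1) choose (CARD('r) - 1))"
    by (simp add: card_mindex)
  ultimately show ?thesis using dim_kernel_surj[OF lin surj] by (simp add: mult.commute)
qed

lemma dim_image_linear_inj:
  fixes f :: "'a::euclidean_space \<Rightarrow> 'b::real_vector"
  assumes "linear f" "inj f"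
  shows "dim (f ` S) = dim S"
proof -
  interpret finite_dimensional_vector_space_pair_1 "scaleR :: real \<Rightarrow> 'a \<Rightarrow> 'a" Basis "scaleR :: real \<Rightarrow> 'b \<Rightarrow> 'b"
    by unfold_locales
  show ?thesis
    by (rule dim_image_eq) (use assms in \<open>auto intro: inj_on_subset\<close>)
qed

lemma corank_cartan:
  fixes F :: "('e, 'q, 'n::finite, 'm::finite) fibred"
  assumes F: "fibred_manifold F"
  shows "corank_distribution (CARD('m) * ((CARD('n) + CARD('r::finite) - 1) choose (CARD('r) - 1)))
    (jet_atlas TYPE('r option) F) (cartan TYPE('r option) F)"
  unfolding corank_distribution_def
proof
  fix p assume "p \<in> carrier_of (jet_atlas TYPE('r option) F)"
  then have "p \<in> jets F (CARD('r))" by (simp add: carrier_jet_atlas[OF F])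
  then obtain c b where cb: "(c, b) \<in> adapted_charts F" and p: "p \<in> cdom (jet_chart TYPE('r option) F c b)"
    by (rule jet_atlas_cover[OF F])
  let ?J = "jet_atlas TYPE('r option) F" and ?c = "jet_chart TYPE('r option) F c b"
  note J = is_atlas_jet_atlas[OF F, where 'r = 'r]
  note T = tangent_of_props[OF J jet_chart_in_atlas[OF cb] p]
  let ?t = "tangent_of ?J p ?c" and ?K = "contact_kernel (cmap ?c p)"
  have inj: "inj ?t" by (rule inj_on_inverseI[where g = "\<lambda>v. v ?c"]) (rule T(2))
  have tan: "tangent_space ?J p = range ?t" using T(1,3) by (metis (no_types, lifting) rangeI rangeE subsetI subset_antisym)
  have car: "cartan TYPE('r option) F p = ?t ` ?K"
  proof (intro equalityI subsetI)
    fix v assume "v \<in> cartan TYPE('r option) F p"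
    then have "v \<in> tangent_space ?J p" "v ?c \<in> ?K" using cartan_iff[OF F cb p] by blast+
    then show "v \<in> ?t ` ?K" using T(3) by (metis image_eqI)
  next
    fix v assume "v \<in> ?t ` ?K"
    then obtain w where "w \<in> ?K" "v = ?t w" by blast
    then show "v \<in> cartan TYPE('r option) F p" using cartan_iff[OF F cb p] T(1,2) by simp
  qed
  have "subspace (cartan TYPE('r option) F p)"
    unfolding car by (rule linear_subspace_image[OF T(4) contact_kernel_subspace])
  moreover have "cartan TYPE('r option) F p \<subseteq> tangent_space ?J p" by (auto simp: cartan_def)
  moreover have "dim (tangent_space ?J p) = dim (cartan TYPE('r option) F p)
      + CARD('m) * ((CARD('n) + CARD('r) - 1) choose (CARD('r) - 1))"
    unfolding tan car dim_image_linear_inj[OF T(4) inj] dim_UNIV by (rule dim_contact_kernel)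
  ultimately show "subspace (cartan TYPE('r option) F p) \<and> cartan TYPE('r option) F p \<subseteq> tangent_space ?J p \<and>
      dim (tangent_space ?J p) = dim (cartan TYPE('r option) F p)
      + CARD('m) * ((CARD('n) + CARD('r) - 1) choose (CARD('r) - 1))" by blast
qed

section \<open>The hodograph prolongation\<close>

lemma local_diffeo_smooth:
  assumes A: "is_atlas A" "is_atlas B" and f: "local_diffeo_on A B (carrier_of A) f"
  shows "smooth_map_on A B (carrier_of A) f"
proof (rule smooth_map_onI[OF A])
  fix p assume p: "p \<in> carrier_of A"
  then obtain W where W: "p \<in> W" "W \<subseteq> carrier_of A" "smooth_map_on A B W f"
    using f unfolding local_diffeo_on_def diffeo_on_def by blast
  obtain c where c: "c \<in> A" "p \<in> cdom c" using p by (auto simp: carrier_of_def)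
  obtain d where d: "d \<in> B" "f p \<in> cdom d" using smooth_map_on_range[OF W(3) A W(1)] by (auto simp: carrier_of_def)
  have "rep_smooth_at c d (carrier_of A) f p"
    by (rule rep_smooth_at_mono[OF smooth_map_on_rep_atlas[OF A W(3) c d W(1)] W(2)])
  then show "\<exists>c\<in>max_atlas A. \<exists>d\<in>max_atlas B. p \<in> cdom c \<and> f p \<in> cdom d \<and> rep_smooth_at c d (carrier_of A) f p"
    using c d max_atlas_supset[OF A(1) c(1)] max_atlas_supset[OF A(2) d(1)] by blast
qed

abbreviation rep_map :: "('e, 'x) chart \<Rightarrow> ('e2, 'y) chart \<Rightarrow> ('e \<Rightarrow> 'e2) \<Rightarrow> 'x \<Rightarrow> 'y" where
  "rep_map c d f \<equiv> cmap d \<circ> f \<circ> cinv c"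

text \<open>The domain and the prolongation itself are parameters fixed by equations, to serve as short names; the
  type argument carries the order.\<close>

locale hodograph =
  fixes F :: "('e, 'q, 'n::finite, 'm::finite) fibred"
    and F' :: "('e2, 'q2, 'n::finite, 'm::finite) fibred"
    and f :: "'e \<Rightarrow> 'e2"
    and R :: "'r::finite itself"
    and Dom :: "('q, 'e) jet set"
    and \<Phi> :: "('q, 'e) jet \<Rightarrow> ('q2, 'e2) jet"
  assumes F: "fibred_manifold F" and F': "fibred_manifold F'"
    and diffeo: "local_diffeo_on (tot F) (tot F') (carrier_of (tot F)) f"
    and Dom_def: "Dom = prolongation_domain TYPE('r option) F F' f"
    and \<Phi>_def: "\<Phi> = prolongation F F' f (CARD('r))"
begin

abbreviation "ad \<equiv> adapted_charts F"
abbreviation "ad' \<equiv> adapted_charts F'"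
abbreviation "J \<equiv> jet_atlas TYPE('r option) F"
abbreviation "J' \<equiv> jet_atlas TYPE('r option) F'"
abbreviation "jc \<equiv> jet_chart TYPE('r option) F"
abbreviation "jc' \<equiv> jet_chart TYPE('r option) F'"
abbreviation "M \<equiv> carrier_of (tot F)"

lemma smooth_f: "smooth_map_on (tot F) (tot F') M f"
  by (rule local_diffeo_smooth[OF fibred_atlas(1)[OF F] fibred_atlas(1)[OF F'] diffeo])

lemma f_carrier: "e \<in> M \<Longrightarrow> f e \<in> carrier_of (tot F')"
  by (rule smooth_map_on_range[OF smooth_f fibred_atlas(1)[OF F] fibred_atlas(1)[OF F']])

lemma chart_carrier: "(c, b) \<in> ad \<Longrightarrow> e \<in> cdom c \<Longrightarrow> e \<in> M"
  using max_atlas_carrier[OF adapted_chartsD(1)] unfolding carrier_of_def by fast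

lemma rep_f:
  assumes "(c, b) \<in> ad" "(c', b') \<in> ad'"
  shows "open (rep_domain c c' M f)" "smooth_on (rep_domain c c' M f) (rep_map c c' f)"
  using rep_domain_open[OF fibred_atlas(1)[OF F] fibred_atlas(1)[OF F'] smooth_f
      adapted_chartsD(1)[OF assms(1)] adapted_chartsD(1)[OF assms(2)]] .

lemma smooth_base_map:
  assumes s: "local_section F V s"
  shows "smooth_map_on (base F) (base F') V (\<lambda>z. proj F' (f (s z)))"
proof -
  note A = fibred_atlas[OF F] and A' = fibred_atlas[OF F']
  have sm: "smooth_map_on (base F) (tot F) V s" using s by (simp add: local_section_def)
  have "smooth_map_on (base F) (tot F') V (\<lambda>z. f (s z))"
    by (rule smooth_map_on_compose[OF A(2,1) A'(1) sm smooth_f]) (use section_carrier(1)[OF F s] in auto)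
  then show ?thesis
    by (rule smooth_map_on_compose[OF A(2) A'(1,2) _ A'(3)])
      (use section_carrier(1)[OF F s] f_carrier in auto)
qed

text \<open>The condition on the determinant is imposed in all charts, but it is independent of them.\<close>

lemma Dom_iff:
  assumes cb: "(c, b) \<in> ad" and cb': "(c', b') \<in> ad'"
    and p: "p \<in> cdom (jc c b)" "f (target p) \<in> cdom c'"
  shows "p \<in> Dom \<longleftrightarrow> cmap (jc c b) p \<in> prolong_dom (rep_map c c' f) (rep_domain c c' M f)"
proof -
  have pj: "p \<in> jets F (CARD('r))" "target p \<in> cdom c" using p by (auto simp: cdom_jet_chart_option)
  have assoc: "fst \<circ> cmap d' \<circ> f \<circ> cinv d = fst \<circ> rep_map d d' f" for d :: "('e, (real^'n) \<times> (real^'m)) chart" and d' :: "('e2, (real^'n) \<times> (real^'m)) chart"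
    by (simp add: comp_assoc)
  have bp: "base_point (cmap (jc d a) p) \<in> rep_domain d d' M f"
    if "(d, a) \<in> ad" "target p \<in> cdom d" "f (target p) \<in> cdom d'" for d a d'
  proof -
    have "p \<in> cdom (jc d a)" using that pj by (simp add: cdom_jet_chart_option)
    then have "base_point (cmap (jc d a) p) = cmap d (target p)" by (rule base_point_jet_chart[OF F that(1)])
    then show ?thesis using that chart_carrier[OF that(1,2)] by (auto simp: rep_domain_def)
  qed
  show ?thesis
  proof
    assume "p \<in> Dom"
    then have "det (total_jacobian (fst \<circ> cmap c' \<circ> f \<circ> cinv c) (cmap (jc c b) p)) \<noteq> 0"
      using cb cb' pj p(2) unfolding Dom_def prolongation_domain_def by blast
    then show "cmap (jc c b) p \<in> prolong_dom (rep_map c c' f) (rep_domain c c' M f)"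
      using bp[OF cb pj(2) p(2)] by (simp add: prolong_dom_def assoc)
  next
    assume *: "cmap (jc c b) p \<in> prolong_dom (rep_map c c' f) (rep_domain c c' M f)"
    obtain s V q where s: "p = jet F (CARD('r)) s q" "s \<in> sections_at F q" "local_section F V s" "q \<in> V" "target p = s q"
      using pj(1) by (elim jetsE) blast
    let ?X = "\<lambda>z. proj F' (f (s z))"
    have sc: "s q \<in> cdom c" "s q \<in> M" "f (s q) \<in> cdom c'" using pj(2) p(2) s(5) section_carrier(1)[OF F s(3,4)] by auto
    note dj = adapted_chartsD
    have inj: "inj (rep_deriv b b' ?X q)"
      using * prolong_dom_iff[OF F F' smooth_f cb cb' s(3,4) sc, where 'r = 'r]
      unfolding s(1) jet_chart_jet_option[OF cb s(2) sc(1)] by blast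
    have base: "q \<in> cdom a" if "(d, a) \<in> ad" "s q \<in> cdom d" for d a
      using dj(5)[OF that] section_carrier(2)[OF F s(3,4)] by simp
    have "det (total_jacobian (fst \<circ> cmap d' \<circ> f \<circ> cinv d) (cmap (jc d a) p)) \<noteq> 0"
      if d: "(d, a) \<in> ad" "(d', a') \<in> ad'" "target p \<in> cdom d" "f (target p) \<in> cdom d'" for d a d' a'
    proof -
      have sd: "s q \<in> cdom d" "f (s q) \<in> cdom d'" using d s(5) by auto
      have rs: "rep_smooth_at b b' V ?X q"
        by (rule smooth_map_on_rep[OF fibred_atlas(2)[OF F] fibred_atlas(2)[OF F'] smooth_base_map[OF s(3)]
              dj(2)[OF cb] base[OF cb sc(1)] dj(2)[OF cb'] dj(5)[OF cb' sc(3)] s(4)])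
      have "inj (rep_deriv a a' ?X q)"
        by (rule inj_rep_deriv_change[OF fibred_atlas(2)[OF F] fibred_atlas(2)[OF F'] rs
              dj(2)[OF cb] dj(2)[OF d(1)] base[OF cb sc(1)] base[OF d(1) sd(1)]
              dj(2)[OF cb'] dj(2)[OF d(2)] dj(5)[OF cb' sc(3)] dj(5)[OF d(2) sd(2)] inj])
      then have "cmap (jc d a) p \<in> prolong_dom (rep_map d d' f) (rep_domain d d' M f)"
        using prolong_dom_iff[OF F F' smooth_f d(1,2) s(3,4) sd(1) sc(2) sd(2), where 'r = 'r]
        unfolding s(1) jet_chart_jet_option[OF d(1) s(2) sd(1)] by blast
      then show ?thesis by (simp add: prolong_dom_def assoc)
    qed
    then show "p \<in> Dom" unfolding Dom_def prolongation_domain_def using pj(1) by auto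
  qed
qed

lemma Dom_jets: "p \<in> Dom \<Longrightarrow> p \<in> jets F (CARD('r))"
  by (simp add: Dom_def prolongation_domain_def)

lemma Dom_charts:
  assumes "p \<in> Dom"
  obtains c b c' b' where "(c, b) \<in> ad" "(c', b') \<in> ad'" "p \<in> cdom (jc c b)" "f (target p) \<in> cdom c'"
proof -
  note pj = Dom_jets[OF assms]
  obtain c b where cb: "(c, b) \<in> ad" "p \<in> cdom (jc c b)" by (rule jet_atlas_cover[OF F pj])
  have "f (target p) \<in> carrier_of (tot F')"
    using cb(2) chart_carrier[OF cb(1)] f_carrier by (simp add: cdom_jet_chart_option)
  then obtain c' b' where "(c', b') \<in> ad'" "f (target p) \<in> cdom c'" by (rule adapted_charts_exist[OF F'])
  then show thesis using that cb by blast
qed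

text \<open>The representative is restricted to a neighbourhood on which the base map is a diffeomorphism onto
  an open set; there its image is the graph of the transformed section.\<close>

lemma image_section_exists:
  assumes p: "p \<in> Dom"
  shows "\<exists>s V s' V'. p = jet F (CARD('r)) s (fst p) \<and> fst p \<in> V \<and> local_section F V s \<and>
     local_section F' V' s' \<and> f ` s ` V = s' ` V'"
proof -
  obtain c b c' b' where cb: "(c, b) \<in> ad" and cb': "(c', b') \<in> ad'" and pc: "p \<in> cdom (jc c b)" "f (target p) \<in> cdom c'"
    by (rule Dom_charts[OF p])
  note dj = adapted_chartsD[OF cb] and dj' = adapted_chartsD[OF cb']
  let ?h = "rep_map c c' f" and ?W = "rep_domain c c' M f"
  note W = rep_f[OF cb cb']
  obtain s0 V0 q where s0: "p = jet F (CARD('r)) s0 q" "s0 \<in> sections_at F q" "local_section F V0 s0" "q \<in> V0" "target p = s0 q" "fst p = q"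
    using Dom_jets[OF p] by (elim jetsE) blast
  have sc: "s0 q \<in> cdom c" using pc(1) s0(5) by (simp add: cdom_jet_chart_option)
  let ?\<sigma> = "section_rep c b s0"
  obtain N0 where N0: "open N0" "cmap b q \<in> N0" "smooth_on N0 ?\<sigma>"
    by (rule section_in_chart[OF F cb s0(3,4) sc]) (rule that; assumption)
  have "(jet_coords ?\<sigma> (cmap b q) :: ('n, 'm, 'r option) jetspace) \<in> prolong_dom ?h ?W"
    using p Dom_iff[OF cb cb' pc] unfolding s0(1) jet_chart_jet_option[OF cb s0(2) sc] by blast
  then obtain N N' \<eta> where N: "open N" "N \<subseteq> N0" "cmap b q \<in> N" "open N'" "smooth_on N' \<eta>" "\<eta> ` N' = N"
    "\<forall>x\<in>N. fst (?h (x, ?\<sigma> x)) \<in> N' \<and> \<eta> (fst (?h (x, ?\<sigma> x))) = x"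
    "\<forall>x'\<in>N'. fst (?h (\<eta> x', ?\<sigma> (\<eta> x'))) = x'"
    "\<forall>x\<in>N. (jet_coords ?\<sigma> x :: ('n, 'm, 'r option) jetspace) \<in> prolong_dom ?h ?W"
    by (rule transformed_section_exists[OF W N0(1,3,2)]) (rule that; assumption)
  define \<sigma>' where "\<sigma>' = (\<lambda>x'. snd (?h (\<eta> x', ?\<sigma> (\<eta> x'))))"
  have inW: "(x, ?\<sigma> x) \<in> ?W" if "x \<in> N" for x using prolong_dom_base[OF W bspec[OF N(9) that]] by simp
  have \<sigma>N: "smooth_on N ?\<sigma>" by (rule smooth_on_subset[OF N0(3) N(2)])
  have "smooth_on N' (\<lambda>x'. ?h (\<eta> x', ?\<sigma> (\<eta> x')))"
    by (rule smooth_on_compose[OF smooth_on_graph[OF W N(1) \<sigma>N inW] N(5,4,1)]) (use N(6) in auto)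
  then have \<sigma>': "smooth_on N' \<sigma>'" unfolding \<sigma>'_def by (rule smooth_on_snd[OF N(4)])
  have fN: "cinv c (x, ?\<sigma> x) \<in> cdom c \<and> f (cinv c (x, ?\<sigma> x)) \<in> cdom c' \<and> (x, ?\<sigma> x) \<in> cmap c ` cdom c" if x: "x \<in> N" for x
  proof -
    obtain e where e: "e \<in> cdom c" "f e \<in> cdom c'" "(x, ?\<sigma> x) = cmap c e" using inW[OF x] by (auto simp: rep_domain_def)
    then show ?thesis using cinv_cmap[OF dj(3) e(1)] by simp
  qed
  have graph: "?h (\<eta> x', ?\<sigma> (\<eta> x')) = (x', \<sigma>' x')" if "x' \<in> N'" for x'
    using bspec[OF N(8) that] by (simp add: \<sigma>'_def prod_eq_iff)
  have img: "\<forall>x\<in>N. (x, ?\<sigma> x) \<in> cmap c ` cdom c" using fN by blast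
  have img': "\<forall>x'\<in>N'. (x', \<sigma>' x') \<in> cmap c' ` cdom c'"
  proof
    fix x' assume x': "x' \<in> N'"
    then have "\<eta> x' \<in> N" using N(6) by blast
    from fN[OF this] have "?h (\<eta> x', ?\<sigma> (\<eta> x')) \<in> cmap c' ` cdom c'" by simp
    then show "(x', \<sigma>' x') \<in> cmap c' ` cdom c'" using graph[OF x'] by simp
  qed
  define s where "s = (\<lambda>q. cinv c (cmap b q, ?\<sigma> (cmap b q)))"
  define s' where "s' = (\<lambda>q. cinv c' (cmap b' q, \<sigma>' (cmap b' q)))"
  note sec = section_from_coords[OF F cb N(1) \<sigma>N img s_def]
  note sec' = section_from_coords[OF F' cb' N(4) \<sigma>' img' s'_def]
  let ?V = "{z \<in> cdom b. cmap b z \<in> N}" and ?V' = "{z \<in> cdom b'. cmap b' z \<in> N'}"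
  have qb: "q \<in> cdom b" using dj(5)[OF sc] section_carrier(2)[OF F s0(3,4)] by simp
  then have qV: "q \<in> ?V" using N(3) by simp
  have sq: "s q \<in> cdom c" using sec(3)[OF qb N(3)] by blast
  have "p = jet F (CARD('r)) s q"
    unfolding s0(1)
  proof (rule jet_eq_from_chart[OF F cb s0(2) sc local_section_sections_at[OF sec(1) qV] sq])
    show "(jet_coords ?\<sigma> (cmap b q) :: ('n, 'm, 'r option) jetspace) = jet_coords (section_rep c b s) (cmap b q)"
      by (rule jet_coords_cong[OF N(1,3)]) (rule sec(4)[symmetric])
  qed
  moreover have "f ` s ` ?V = s' ` ?V'"
  proof -
    have key: "f (s z) = s' w" if z: "z \<in> cdom b" "cmap b z \<in> N" and w: "cmap b' w \<in> N'" "cmap b z = \<eta> (cmap b' w)" for z w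
    proof -
      have "f (s z) \<in> cdom c'" using fN[OF z(2)] by (simp add: s_def)
      then have "f (s z) = cinv c' (cmap c' (f (s z)))" by (simp only: cinv_cmap[OF dj'(3)])
      also have "cmap c' (f (s z)) = ?h (\<eta> (cmap b' w), ?\<sigma> (\<eta> (cmap b' w)))" by (simp add: s_def w(2))
      also have "\<dots> = (cmap b' w, \<sigma>' (cmap b' w))" by (rule graph[OF w(1)])
      finally show ?thesis by (simp add: s'_def)
    qed
    show ?thesis
    proof (intro equalityI subsetI)
      fix e assume "e \<in> f ` s ` ?V"
      then obtain z where z: "z \<in> cdom b" "cmap b z \<in> N" "e = f (s z)" by blast
      let ?x' = "fst (?h (cmap b z, ?\<sigma> (cmap b z)))"
      have x': "?x' \<in> N'" "\<eta> ?x' = cmap b z" using bspec[OF N(7) z(2)] by auto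
      obtain w where w: "w \<in> cdom b'" "?x' = cmap b' w" using sec'(2)[OF x'(1)] by blast
      have wN: "cmap b' w \<in> N'" "cmap b z = \<eta> (cmap b' w)" using x' w(2) by auto
      show "e \<in> s' ` ?V'" unfolding z(3) key[OF z(1,2) wN] using w(1) wN(1) by blast
    next
      fix e assume "e \<in> s' ` ?V'"
      then obtain w where w: "w \<in> cdom b'" "cmap b' w \<in> N'" "e = s' w" by blast
      then have "\<eta> (cmap b' w) \<in> N" using N(6) by blast
      then obtain z where z: "z \<in> cdom b" "\<eta> (cmap b' w) = cmap b z" using sec(2) by blast
      have zN: "cmap b z \<in> N" using \<open>\<eta> (cmap b' w) \<in> N\<close> z(2) by simp
      have "e = f (s z)" unfolding w(3) by (rule key[OF z(1) zN w(2) z(2)[symmetric], symmetric])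
      then show "e \<in> f ` s ` ?V" using z(1) zN by blast
    qed
  qed
  ultimately show ?thesis using sec(1) sec'(1) qV unfolding s0(6)
    by (intro exI[of _ s] exI[of _ ?V] exI[of _ s'] exI[of _ ?V'] conjI)
qed

text \<open>By the existence of such sections the choice in the definition of the prolongation is effective.
  Its independence of the choices follows from the coordinate expression that is the same for all of
  them.\<close>

lemma prolongation_section:
  assumes p: "p \<in> Dom"
  obtains s V s' V' where "p = jet F (CARD('r)) s (fst p)" "fst p \<in> V" "local_section F V s" "local_section F' V' s'"
    "f ` s ` V = s' ` V'" "\<Phi> p = jet F' (CARD('r)) s' (proj F' (f (s (fst p))))"
proof -
  have "\<exists>p' s V s' V'. p = jet F (CARD('r)) s (fst p) \<and> fst p \<in> V \<and> local_section F V s \<and>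
     local_section F' V' s' \<and> f ` s ` V = s' ` V' \<and> p' = jet F' (CARD('r)) s' (proj F' (f (s (fst p))))"
    using image_section_exists[OF p] by blast
  from someI_ex[OF this, folded prolongation_def, folded \<Phi>_def] show thesis using that by blast
qed

lemma prolongation_props:
  assumes p: "p \<in> Dom"
  shows "\<Phi> p \<in> jets F' (CARD('r))" "target (\<Phi> p) = f (target p)"
    "\<And>c b c' b'. (c, b) \<in> ad \<Longrightarrow> (c', b') \<in> ad' \<Longrightarrow> p \<in> cdom (jc c b) \<Longrightarrow> f (target p) \<in> cdom c' \<Longrightarrow>
      cmap (jc' c' b') (\<Phi> p) = prolong_map (rep_map c c' f) (cmap (jc c b) p)"
proof -
  obtain s V s' V' where s: "p = jet F (CARD('r)) s (fst p)" "fst p \<in> V" "local_section F V s" "local_section F' V' s'"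
    "f ` s ` V = s' ` V'" "\<Phi> p = jet F' (CARD('r)) s' (proj F' (f (s (fst p))))"
    by (rule prolongation_section[OF p])
  let ?q = "fst p" and ?q' = "proj F' (f (s (fst p)))"
  have sat: "s \<in> sections_at F ?q" by (rule local_section_sections_at[OF s(3,2)])
  have tp: "target p = s ?q" using target_jet[OF sat, of "CARD('r)"] s(1) by simp
  have img: "proj F' (f (s z)) \<in> V' \<and> s' (proj F' (f (s z))) = f (s z)" if z: "z \<in> V" for z
  proof -
    have "f (s z) \<in> s' ` V'" using s(5) z by blast
    then obtain w where w: "w \<in> V'" "f (s z) = s' w" by blast
    then show ?thesis using section_carrier(2)[OF F' s(4) w(1)] by simp
  qed
  have sat': "s' \<in> sections_at F' ?q'" by (rule local_section_sections_at[OF s(4)]) (use img[OF s(2)] in blast)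
  show "\<Phi> p \<in> jets F' (CARD('r))" unfolding s(6) jets_def using sat' by blast
  show "target (\<Phi> p) = f (target p)"
    unfolding s(6) target_jet[OF sat'] tp using img[OF s(2)] by blast
  fix c b c' b' assume cb: "(c, b) \<in> ad" "(c', b') \<in> ad'" and pc: "p \<in> cdom (jc c b)" "f (target p) \<in> cdom c'"
  have sc: "s ?q \<in> cdom c" "f (s ?q) \<in> cdom c'" using pc tp by (auto simp: cdom_jet_chart_option)
  have sc': "s' ?q' \<in> cdom c'" using img[OF s(2)] sc(2) by simp
  have jp: "cmap (jc c b) p = jet_coords (section_rep c b s) (cmap b ?q)"
    using jet_chart_jet_option[OF cb(1) sat sc(1), where 'r = 'r] s(1) by simp
  have dom: "(jet_coords (section_rep c b s) (cmap b ?q) :: ('n, 'm, 'r option) jetspace)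
      \<in> prolong_dom (rep_map c c' f) (rep_domain c c' M f)"
    using p Dom_iff[OF cb pc] jp by simp
  have "cmap (jc' c' b') (\<Phi> p) = jet_coords (section_rep c' b' s') (cmap b' ?q')"
    unfolding s(6) by (rule jet_chart_jet_option[OF cb(2) sat' sc'])
  also have "\<dots> = prolong_map (rep_map c c' f) (jet_coords (section_rep c b s) (cmap b ?q))"
    by (rule transformed_jet_coords[OF F F' smooth_f cb s(3,2) sc s(4) img dom])
  finally show "cmap (jc' c' b') (\<Phi> p) = prolong_map (rep_map c c' f) (cmap (jc c b) p)"
    unfolding jp .
qed

subsection \<open>Inverting the prolongation over an open set on which the map is a diffeomorphism\<close>

context
  fixes W0
  assumes W0: "diffeo_on (tot F) (tot F') W0 f" 
begin

abbreviation (input) "g \<equiv> inv_into W0 f"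
abbreviation (input) "WD \<equiv> {p \<in> Dom. target p \<in> W0}"

lemma W0_props: "smooth_map_on (tot F) (tot F') W0 f" "smooth_map_on (tot F') (tot F) (f ` W0) g"
  "inj_on f W0" "W0 \<subseteq> M"
  using W0 smooth_map_on_subset[OF _ fibred_atlas(1)[OF F]] by (auto simp: diffeo_on_def)

text \<open>The coordinate expressions of \<open>f\<close> and of its inverse on \<open>W0\<close> are inverse to each other on their exact
  domains.\<close>

lemma rep_local:
  assumes cb: "(c, b) \<in> ad" and cb': "(c', b') \<in> ad'"
  shows "open (rep_domain c c' W0 f)" "smooth_on (rep_domain c c' W0 f) (rep_map c c' f)"
    "open (rep_domain c' c (f ` W0) g)" "smooth_on (rep_domain c' c (f ` W0) g) (rep_map c' c g)"
    "z \<in> rep_domain c c' W0 f \<Longrightarrow> rep_map c c' f z \<in> rep_domain c' c (f ` W0) g"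
    "z \<in> rep_domain c c' W0 f \<Longrightarrow> rep_map c' c g (rep_map c c' f z) = z"
    "w \<in> rep_domain c' c (f ` W0) g \<Longrightarrow> rep_map c' c g w \<in> rep_domain c c' W0 f"
    "w \<in> rep_domain c' c (f ` W0) g \<Longrightarrow> rep_map c c' f (rep_map c' c g w) = w"
proof -
  note A = fibred_atlas(1)[OF F] and A' = fibred_atlas(1)[OF F']
  note dj = adapted_chartsD[OF cb] and dj' = adapted_chartsD[OF cb']
  show "open (rep_domain c c' W0 f)" "smooth_on (rep_domain c c' W0 f) (rep_map c c' f)"
    using rep_domain_open[OF A A' W0_props(1) dj(1) dj'(1)] .
  show "open (rep_domain c' c (f ` W0) g)" "smooth_on (rep_domain c' c (f ` W0) g) (rep_map c' c g)"
    using rep_domain_open[OF A' A W0_props(2) dj'(1) dj(1)] .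
  have gf: "g (f e) = e" if "e \<in> W0" for e using that W0_props(3) by simp
  show "rep_map c c' f z \<in> rep_domain c' c (f ` W0) g" "rep_map c' c g (rep_map c c' f z) = z"
    if z: "z \<in> rep_domain c c' W0 f"
  proof -
    obtain e where e: "e \<in> W0" "e \<in> cdom c" "f e \<in> cdom c'" "z = cmap c e" using z by (auto simp: rep_domain_def)
    have hz: "rep_map c c' f z = cmap c' (f e)" using e by (simp add: cinv_cmap[OF dj(3)])
    show "rep_map c c' f z \<in> rep_domain c' c (f ` W0) g"
      unfolding hz rep_domain_def using e gf[OF e(1)] by (intro imageI) auto
    show "rep_map c' c g (rep_map c c' f z) = z" unfolding hz using e gf[OF e(1)] by (simp add: cinv_cmap[OF dj'(3)])
  qed
  show "rep_map c' c g w \<in> rep_domain c c' W0 f" "rep_map c c' f (rep_map c' c g w) = w"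
    if w: "w \<in> rep_domain c' c (f ` W0) g"
  proof -
    obtain e where e: "e \<in> W0" "g (f e) \<in> cdom c" "f e \<in> cdom c'" "w = cmap c' (f e)"
      using w by (auto simp: rep_domain_def)
    have ec: "e \<in> cdom c" using e(2) gf[OF e(1)] by simp
    have kw: "rep_map c' c g w = cmap c e" using e gf[OF e(1)] by (simp add: cinv_cmap[OF dj'(3)])
    show "rep_map c' c g w \<in> rep_domain c c' W0 f"
      unfolding kw rep_domain_def using e ec by (intro imageI) auto
    show "rep_map c c' f (rep_map c' c g w) = w" unfolding kw using e ec by (simp add: cinv_cmap[OF dj(3)])
  qed
qed

lemma prolong_dom_local:
  assumes cb: "(c, b) \<in> ad" and cb': "(c', b') \<in> ad'"
    and p: "p \<in> WD" "p \<in> cdom (jc c b)" "\<Phi> p \<in> cdom (jc' c' b')"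
  shows "cmap (jc c b) p \<in> prolong_dom (rep_map c c' f) (rep_domain c c' W0 f)"
proof -
  have pD: "p \<in> Dom" "target p \<in> W0" using p(1) by auto
  have t: "f (target p) \<in> cdom c'" "target p \<in> cdom c"
    using p prolongation_props(2)[OF pD(1)] by (auto simp: cdom_jet_chart_option)
  have "cmap (jc c b) p \<in> prolong_dom (rep_map c c' f) (rep_domain c c' M f)"
    using Dom_iff[OF cb cb' p(2) t(1)] pD(1) by blast
  moreover have "base_point (cmap (jc c b) p) \<in> rep_domain c c' W0 f"
    using base_point_jet_chart[OF F cb p(2)] pD t by (auto simp: rep_domain_def)
  ultimately show ?thesis by (simp add: prolong_dom_def)
qed

text \<open>Points of the coordinate domain come from jets on which the prolongation is defined: with
  \<open>prolong_dom_local\<close> this identifies the exact domain of the coordinate expression.\<close>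

lemma prolong_dom_realise:
  assumes cb: "(c, b) \<in> ad" and cb': "(c', b') \<in> ad'"
    and y: "y \<in> prolong_dom (rep_map c c' f) (rep_domain c c' W0 f)"
  obtains p where "p \<in> WD" "p \<in> cdom (jc c b)" "\<Phi> p \<in> cdom (jc' c' b')" "y = cmap (jc c b) p"
proof -
  have "base_point y \<in> rep_domain c c' W0 f" using y by (simp add: prolong_dom_def)
  then obtain e where e: "e \<in> W0" "e \<in> cdom c" "f e \<in> cdom c'" "base_point y = cmap c e" by (auto simp: rep_domain_def)
  then obtain p where p: "p \<in> cdom (jc c b)" "cmap (jc c b) p = y" using jet_chart_realise[OF F cb, of y] by blast
  have tc: "target p \<in> cdom c" using p(1) by (simp add: cdom_jet_chart_option)
  have "cmap c (target p) = cmap c e" using base_point_jet_chart[OF F cb p(1)] p(2) e(4) by simp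
  then have t: "target p = e" using cinv_cmap[OF adapted_chartsD(3)[OF cb]] e(2) tc by metis
  have "rep_domain c c' W0 f \<subseteq> rep_domain c c' M f" using W0_props(4) by (auto simp: rep_domain_def)
  then have "cmap (jc c b) p \<in> prolong_dom (rep_map c c' f) (rep_domain c c' M f)"
    using y p(2) by (auto simp: prolong_dom_def)
  then have pD: "p \<in> Dom" using Dom_iff[OF cb cb' p(1)] t e(3) by simp
  then have "\<Phi> p \<in> cdom (jc' c' b')"
    using prolongation_props(1,2)[OF pD] t e(3) by (simp add: cdom_jet_chart_option)
  then show thesis using that[of p] pD t e(1) p by simp
qed

lemma \<Phi>_charts:
  assumes p: "p \<in> WD"
  obtains c b c' b' where "(c, b) \<in> ad" "(c', b') \<in> ad'" "p \<in> cdom (jc c b)" "\<Phi> p \<in> cdom (jc' c' b')" "f (target p) \<in> cdom c'"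
proof -
  have pD: "p \<in> Dom" using p by simp
  obtain c b c' b' where "(c, b) \<in> ad" "(c', b') \<in> ad'" "p \<in> cdom (jc c b)" "f (target p) \<in> cdom c'"
    by (rule Dom_charts[OF pD])
  then show thesis using that prolongation_props(1,2)[OF pD] by (simp add: cdom_jet_chart_option)
qed

lemma \<Phi>_rep:
  assumes cb: "(c, b) \<in> ad" and cb': "(c', b') \<in> ad'"
    and p: "p \<in> WD" "p \<in> cdom (jc c b)" "\<Phi> p \<in> cdom (jc' c' b')"
  shows "cmap (jc' c' b') (\<Phi> p) = prolong_map (rep_map c c' f) (cmap (jc c b) p)"
  using prolongation_props(2,3)[of p] cb cb' p by (auto simp: cdom_jet_chart_option)

lemma inj_\<Phi>: "inj_on \<Phi> WD"
proof (rule inj_onI)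
  fix p p2 assume p: "p \<in> WD" "p2 \<in> WD" and eq: "\<Phi> p = \<Phi> p2"
  obtain c b c' b' where cb: "(c, b) \<in> ad" "(c', b') \<in> ad'" and pc: "p \<in> cdom (jc c b)" "\<Phi> p \<in> cdom (jc' c' b')"
    by (rule \<Phi>_charts[OF p(1)])
  have "f (target p) = f (target p2)" using prolongation_props(2)[of p] prolongation_props(2)[of p2] p eq by simp
  then have "target p = target p2" using W0_props(3) p by (simp add: inj_on_def)
  then have p2c: "p2 \<in> cdom (jc c b)" using pc(1) Dom_jets[of p2] p(2) by (simp add: cdom_jet_chart_option)
  have p2c': "\<Phi> p2 \<in> cdom (jc' c' b')" using pc(2) eq by simp
  note L = rep_local[OF cb]
  note inv = prolong_map_inverse(2)[OF L(1-4) L(5,6)]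
  have "cmap (jc c b) p = prolong_map (rep_map c' c g) (cmap (jc' c' b') (\<Phi> p))"
    unfolding \<Phi>_rep[OF cb p(1) pc] by (rule inv[OF _ _ prolong_dom_local[OF cb p(1) pc], symmetric])
  moreover have "cmap (jc c b) p2 = prolong_map (rep_map c' c g) (cmap (jc' c' b') (\<Phi> p2))"
    unfolding \<Phi>_rep[OF cb p(2) p2c p2c'] by (rule inv[OF _ _ prolong_dom_local[OF cb p(2) p2c p2c'], symmetric])
  ultimately have "cmap (jc c b) p = cmap (jc c b) p2" using eq by simp
  then show "p = p2" using inj_jet_chart[OF F cb(1), where 'r = 'r] pc(1) p2c by (auto dest: inj_onD)
qed

lemma \<Phi>_rep_inverse:
  assumes cb: "(c, b) \<in> ad" and cb': "(c', b') \<in> ad'"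
    and y': "y' \<in> prolong_dom (rep_map c' c g) (rep_domain c' c (f ` W0) g)"
  obtains p where "p \<in> WD" "p \<in> cdom (jc c b)" "\<Phi> p \<in> cdom (jc' c' b')" "y' = cmap (jc' c' b') (\<Phi> p)"
    "prolong_map (rep_map c' c g) y' = cmap (jc c b) p"
proof -
  note L = rep_local[OF cb cb']
  have 1: "prolong_map (rep_map c' c g) y' \<in> prolong_dom (rep_map c c' f) (rep_domain c c' W0 f)"
    by (rule prolong_map_inverse(1)[OF L(3,4,1,2) L(7,8) y'])
  have 2: "prolong_map (rep_map c c' f) (prolong_map (rep_map c' c g) y') = y'"
    by (rule prolong_map_inverse(2)[OF L(3,4,1,2) L(7,8) y'])
  obtain p where p: "p \<in> WD" "p \<in> cdom (jc c b)" "\<Phi> p \<in> cdom (jc' c' b')"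
    "prolong_map (rep_map c' c g) y' = cmap (jc c b) p"
    by (rule prolong_dom_realise[OF cb cb' 1])
  show thesis by (rule that[OF p(1-3) _ p(4)]) (use 2 \<Phi>_rep[OF cb cb' p(1-3)] p(4) in simp)
qed

text \<open>In charts the prolongation is \<open>prolong_map h\<close>, and its inverse is \<open>prolong_map k\<close> with \<open>k\<close> the coordinate
  expression of the inverse of \<open>f\<close>.\<close>

lemma \<Phi>_local_rep:
  assumes cb: "(c, b) \<in> ad" and cb': "(c', b') \<in> ad'"
    and p: "p \<in> WD" "p \<in> cdom (jc c b)" "\<Phi> p \<in> cdom (jc' c' b')"
  shows "rep_smooth_at (jc c b) (jc' c' b') WD \<Phi> p"
    "rep_deriv (jc c b) (jc' c' b') \<Phi> p = frechet_derivative (prolong_map (rep_map c c' f)) (at (cmap (jc c b) p))"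
    "rep_smooth_at (jc' c' b') (jc c b) (\<Phi> ` WD) (inv_into WD \<Phi>) (\<Phi> p)"
    "rep_deriv (jc' c' b') (jc c b) (inv_into WD \<Phi>) (\<Phi> p)
      = frechet_derivative (prolong_map (rep_map c' c g)) (at (cmap (jc' c' b') (\<Phi> p)))"
    "cmap (jc' c' b') (\<Phi> p) \<in> prolong_dom (rep_map c' c g) (rep_domain c' c (f ` W0) g)"
    "prolong_map (rep_map c' c g) (cmap (jc' c' b') (\<Phi> p)) = cmap (jc c b) p"
proof -
  note L = rep_local[OF cb cb']
  let ?O = "prolong_dom (rep_map c c' f) (rep_domain c c' W0 f) :: ('n, 'm, 'r option) jetspace set"
  let ?O' = "prolong_dom (rep_map c' c g) (rep_domain c' c (f ` W0) g) :: ('n, 'm, 'r option) jetspace set"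
  have o: "open ?O" "smooth_on ?O (prolong_map (rep_map c c' f))"
    by (rule open_prolong_dom[OF L(1,2)], rule smooth_prolong_map[OF L(1,2)])
  have o': "open ?O'" "smooth_on ?O' (prolong_map (rep_map c' c g))"
    by (rule open_prolong_dom[OF L(3,4)], rule smooth_prolong_map[OF L(3,4)])
  have ch: "is_chart (jc c b)" "is_chart (jc' c' b')"
    by (rule is_chart_jet_chart[OF F cb], rule is_chart_jet_chart[OF F' cb'])
  have y: "cmap (jc c b) p \<in> ?O" by (rule prolong_dom_local[OF cb cb' p])
  have eq: "(cmap (jc' c' b') \<circ> \<Phi> \<circ> cinv (jc c b)) z = prolong_map (rep_map c c' f) z" if z: "z \<in> ?O" for z
  proof -
    obtain p where p: "p \<in> WD" "p \<in> cdom (jc c b)" "\<Phi> p \<in> cdom (jc' c' b')" "z = cmap (jc c b) p"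
      by (rule prolong_dom_realise[OF cb cb' z])
    show ?thesis using \<Phi>_rep[OF cb cb' p(1-3)] cinv_cmap[OF ch(1) p(2)] p(4) by simp
  qed
  have sub: "?O \<subseteq> cmap (jc c b) ` {q \<in> WD \<inter> cdom (jc c b). \<Phi> q \<in> cdom (jc' c' b')}"
  proof
    fix z assume z: "z \<in> ?O"
    obtain p where "p \<in> WD" "p \<in> cdom (jc c b)" "\<Phi> p \<in> cdom (jc' c' b')" "z = cmap (jc c b) p"
      by (rule prolong_dom_realise[OF cb cb' z])
    then show "z \<in> cmap (jc c b) ` {q \<in> WD \<inter> cdom (jc c b). \<Phi> q \<in> cdom (jc' c' b')}" by blast
  qed
  have "smooth_on ?O (cmap (jc' c' b') \<circ> \<Phi> \<circ> cinv (jc c b))"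
    by (rule smooth_on_eq[OF o(2,1)]) (rule eq[symmetric])
  then show "rep_smooth_at (jc c b) (jc' c' b') WD \<Phi> p" unfolding rep_smooth_at_def using o(1) y sub by blast
  show "rep_deriv (jc c b) (jc' c' b') \<Phi> p = frechet_derivative (prolong_map (rep_map c c' f)) (at (cmap (jc c b) p))"
    by (rule frechet_derivative_cong[OF o(1) y eq])
  show y': "cmap (jc' c' b') (\<Phi> p) \<in> ?O'"
    unfolding \<Phi>_rep[OF cb cb' p] by (rule prolong_map_inverse(1)[OF L(1-4) L(5,6) y])
  show "prolong_map (rep_map c' c g) (cmap (jc' c' b') (\<Phi> p)) = cmap (jc c b) p"
    unfolding \<Phi>_rep[OF cb cb' p] by (rule prolong_map_inverse(2)[OF L(1-4) L(5,6) y])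
  have eq': "(cmap (jc c b) \<circ> inv_into WD \<Phi> \<circ> cinv (jc' c' b')) z = prolong_map (rep_map c' c g) z" if z: "z \<in> ?O'" for z
  proof -
    obtain p where p: "p \<in> WD" "p \<in> cdom (jc c b)" "\<Phi> p \<in> cdom (jc' c' b')" "z = cmap (jc' c' b') (\<Phi> p)"
      "prolong_map (rep_map c' c g) z = cmap (jc c b) p"
      by (rule \<Phi>_rep_inverse[OF cb cb' z])
    have "inv_into WD \<Phi> (\<Phi> p) = p" by (rule inv_into_f_f[OF inj_\<Phi> p(1)])
    then show ?thesis using cinv_cmap[OF ch(2) p(3)] p(4,5) by simp
  qed
  have sub': "?O' \<subseteq> cmap (jc' c' b') ` {q \<in> \<Phi> ` WD \<inter> cdom (jc' c' b'). inv_into WD \<Phi> q \<in> cdom (jc c b)}"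
  proof
    fix z assume z: "z \<in> ?O'"
    obtain p where p: "p \<in> WD" "p \<in> cdom (jc c b)" "\<Phi> p \<in> cdom (jc' c' b')" "z = cmap (jc' c' b') (\<Phi> p)"
      by (rule \<Phi>_rep_inverse[OF cb cb' z])
    have "inv_into WD \<Phi> (\<Phi> p) = p" by (rule inv_into_f_f[OF inj_\<Phi> p(1)])
    then have "\<Phi> p \<in> {q \<in> \<Phi> ` WD \<inter> cdom (jc' c' b'). inv_into WD \<Phi> q \<in> cdom (jc c b)}"
      using p(1-3) imageI[OF p(1), of \<Phi>] by simp
    then show "z \<in> cmap (jc' c' b') ` {q \<in> \<Phi> ` WD \<inter> cdom (jc' c' b'). inv_into WD \<Phi> q \<in> cdom (jc c b)}"
      unfolding p(4) by (rule imageI)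
  qed
  have "smooth_on ?O' (cmap (jc c b) \<circ> inv_into WD \<Phi> \<circ> cinv (jc' c' b'))"
    by (rule smooth_on_eq[OF o'(2,1)]) (rule eq'[symmetric])
  then show "rep_smooth_at (jc' c' b') (jc c b) (\<Phi> ` WD) (inv_into WD \<Phi>) (\<Phi> p)"
    unfolding rep_smooth_at_def using o'(1) y' sub' by blast
  show "rep_deriv (jc' c' b') (jc c b) (inv_into WD \<Phi>) (\<Phi> p)
      = frechet_derivative (prolong_map (rep_map c' c g)) (at (cmap (jc' c' b') (\<Phi> p)))"
    by (rule frechet_derivative_cong[OF o'(1) y' eq'])
qed

lemma atlases: "is_atlas J" "is_atlas J'"
  by (rule is_atlas_jet_atlas[OF F], rule is_atlas_jet_atlas[OF F'])

lemma diffeo_\<Phi>: "diffeo_on J J' WD \<Phi>"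
  unfolding diffeo_on_def
proof (intro conjI inj_\<Phi>)
  note mx = max_atlas_supset[OF atlases(1) jet_chart_in_atlas] max_atlas_supset[OF atlases(2) jet_chart_in_atlas]
  show "smooth_map_on J J' WD \<Phi>"
  proof (rule smooth_map_onI[OF atlases])
    fix p assume p: "p \<in> WD"
    obtain c b c' b' where cb: "(c, b) \<in> ad" "(c', b') \<in> ad'" and pc: "p \<in> cdom (jc c b)" "\<Phi> p \<in> cdom (jc' c' b')"
      by (rule \<Phi>_charts[OF p])
    show "\<exists>c\<in>max_atlas J. \<exists>d\<in>max_atlas J'. p \<in> cdom c \<and> \<Phi> p \<in> cdom d \<and> rep_smooth_at c d WD \<Phi> p"
      using mx(1)[OF cb(1)] mx(2)[OF cb(2)] pc \<Phi>_local_rep(1)[OF cb p pc] by blast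
  qed
  show "smooth_map_on J' J (\<Phi> ` WD) (inv_into WD \<Phi>)"
  proof (rule smooth_map_onI[OF atlases(2,1)])
    fix p' assume "p' \<in> \<Phi> ` WD"
    then obtain p where p: "p \<in> WD" and p': "p' = \<Phi> p" by blast
    obtain c b c' b' where cb: "(c, b) \<in> ad" "(c', b') \<in> ad'" and pc: "p \<in> cdom (jc c b)" "\<Phi> p \<in> cdom (jc' c' b')"
      by (rule \<Phi>_charts[OF p])
    have inv: "inv_into WD \<Phi> (\<Phi> p) = p" by (rule inv_into_f_f[OF inj_\<Phi> p])
    show "\<exists>c\<in>max_atlas J'. \<exists>d\<in>max_atlas J. p' \<in> cdom c \<and> inv_into WD \<Phi> p' \<in> cdom d
        \<and> rep_smooth_at c d (\<Phi> ` WD) (inv_into WD \<Phi>) p'"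
      unfolding p' inv
      by (intro bexI[of _ "jc' c' b'"] bexI[of _ "jc c b"] conjI)
        (rule pc(2) pc(1) \<Phi>_local_rep(3)[OF cb p pc] mx(1)[OF cb(1)] mx(2)[OF cb(2)])+
  qed
qed

text \<open>One inclusion is the invariance under the prolongation, the other the invariance under the
  prolongation of the inverse.\<close>

lemma tangent_\<Phi>_image:
  assumes p: "p \<in> WD"
  shows "tangent_map J J' \<Phi> p ` cartan TYPE('r option) F p = cartan TYPE('r option) F' (\<Phi> p)"
    "tangent_map J J' \<Phi> p ` jet_vertical TYPE('r option) F p = jet_vertical TYPE('r option) F' (\<Phi> p)"
proof -
  obtain c b c' b' where cb: "(c, b) \<in> ad" "(c', b') \<in> ad'" and pc: "p \<in> cdom (jc c b)" "\<Phi> p \<in> cdom (jc' c' b')"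
    by (rule \<Phi>_charts[OF p])
  note L = rep_local[OF cb] and R = \<Phi>_local_rep[OF cb p pc]
  note y = prolong_dom_local[OF cb p pc]
  let ?T = "tangent_map J J' \<Phi> p" and ?S = "tangent_map J' J (inv_into WD \<Phi>) (\<Phi> p)"
  have sm: "smooth_map_on J J' WD \<Phi>" "smooth_map_on J' J (\<Phi> ` WD) (inv_into WD \<Phi>)"
    using diffeo_\<Phi> by (auto simp: diffeo_on_def)
  have inv: "inv_into WD \<Phi> (\<Phi> p) = p" by (rule inv_into_f_f[OF inj_\<Phi> p])
  have T: "?T v \<in> tangent_space J' (\<Phi> p)" "?T v (jc' c' b') = frechet_derivative (prolong_map (rep_map c c' f)) (at (cmap (jc c b) p)) (v (jc c b))"
    if v: "v \<in> tangent_space J p" for v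
    using tangent_map_in[OF atlases sm(1) p v]
      tangent_map_apply[OF atlases sm(1) p v jet_chart_in_atlas[OF cb(1)] pc(1) jet_chart_in_atlas[OF cb(2)] pc(2)]
    unfolding R(2) .
  have S: "?S w \<in> tangent_space J p" "?S w (jc c b) = frechet_derivative (prolong_map (rep_map c' c g)) (at (cmap (jc' c' b') (\<Phi> p))) (w (jc' c' b'))"
    "?T (?S w) = w"
    if w: "w \<in> tangent_space J' (\<Phi> p)" for w
  proof -
    have pi: "\<Phi> p \<in> \<Phi> ` WD" using p by (rule imageI)
    show "?S w \<in> tangent_space J p" using tangent_map_in[OF atlases(2,1) sm(2) pi w] unfolding inv .
    have "inv_into WD \<Phi> (\<Phi> p) \<in> cdom (jc c b)" using pc(1) inv by simp
    then show "?S w (jc c b) = frechet_derivative (prolong_map (rep_map c' c g)) (at (cmap (jc' c' b') (\<Phi> p))) (w (jc' c' b'))"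
      using tangent_map_apply[OF atlases(2,1) sm(2) pi w jet_chart_in_atlas[OF cb(2)] pc(2) jet_chart_in_atlas[OF cb(1)]]
      unfolding R(4) by blast
    show "?T (?S w) = w" by (rule diffeo_on_tangent_inverse(2)[OF atlases diffeo_\<Phi> p w])
  qed
  show "?T ` cartan TYPE('r option) F p = cartan TYPE('r option) F' (\<Phi> p)"
  proof (intro equalityI subsetI)
    fix w assume "w \<in> ?T ` cartan TYPE('r option) F p"
    then obtain v where v: "v \<in> tangent_space J p" "v (jc c b) \<in> contact_kernel (cmap (jc c b) p)" "w = ?T v"
      using cartan_iff[OF F cb(1) pc(1)] by blast
    have "frechet_derivative (prolong_map (rep_map c c' f)) (at (cmap (jc c b) p)) (v (jc c b))
        \<in> contact_kernel (cmap (jc' c' b') (\<Phi> p))"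
      unfolding \<Phi>_rep[OF cb p pc] by (rule prolong_map_contact[OF L(1,2) y v(2)])
    then show "w \<in> cartan TYPE('r option) F' (\<Phi> p)"
      unfolding cartan_iff[OF F' cb(2) pc(2)] v(3) T(2)[OF v(1)] using T(1)[OF v(1)] by blast
  next
    fix w assume "w \<in> cartan TYPE('r option) F' (\<Phi> p)"
    then have w: "w \<in> tangent_space J' (\<Phi> p)" "w (jc' c' b') \<in> contact_kernel (cmap (jc' c' b') (\<Phi> p))"
      using cartan_iff[OF F' cb(2) pc(2)] by blast+
    have "frechet_derivative (prolong_map (rep_map c' c g)) (at (cmap (jc' c' b') (\<Phi> p))) (w (jc' c' b'))
        \<in> contact_kernel (prolong_map (rep_map c' c g) (cmap (jc' c' b') (\<Phi> p)))"
      by (rule prolong_map_contact[OF L(3,4) R(5) w(2)])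
    then have "?S w \<in> cartan TYPE('r option) F p"
      unfolding cartan_iff[OF F cb(1) pc(1)] S(2)[OF w(1)] R(6) using S(1)[OF w(1)] by blast
    then have "?T (?S w) \<in> ?T ` cartan TYPE('r option) F p" by (rule imageI)
    then show "w \<in> ?T ` cartan TYPE('r option) F p" unfolding S(3)[OF w(1)] .
  qed
  show "?T ` jet_vertical TYPE('r option) F p = jet_vertical TYPE('r option) F' (\<Phi> p)"
  proof (intro equalityI subsetI)
    fix w assume "w \<in> ?T ` jet_vertical TYPE('r option) F p"
    then obtain v where v: "v \<in> tangent_space J p" "agree (CARD('r) - 1) (v (jc c b)) 0" "w = ?T v"
      using jet_vertical_iff[OF F cb(1) pc(1)] by blast
    show "w \<in> jet_vertical TYPE('r option) F' (\<Phi> p)"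
      unfolding jet_vertical_iff[OF F' cb(2) pc(2)] v(3) T(2)[OF v(1)]
      using T(1)[OF v(1)] prolong_map_vertical[OF L(1,2) y v(2)] by blast
  next
    fix w assume "w \<in> jet_vertical TYPE('r option) F' (\<Phi> p)"
    then have w: "w \<in> tangent_space J' (\<Phi> p)" "agree (CARD('r) - 1) (w (jc' c' b')) 0"
      using jet_vertical_iff[OF F' cb(2) pc(2)] by blast+
    have "?S w \<in> jet_vertical TYPE('r option) F p"
      unfolding jet_vertical_iff[OF F cb(1) pc(1)] S(2)[OF w(1)]
      using S(1)[OF w(1)] prolong_map_vertical[OF L(3,4) R(5) w(2)] by blast
    then have "?T (?S w) \<in> ?T ` jet_vertical TYPE('r option) F p" by (rule imageI)
    then show "w \<in> ?T ` jet_vertical TYPE('r option) F p" unfolding S(3)[OF w(1)] .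
  qed
qed

end

lemma diffeo_neighbourhood:
  assumes "p \<in> Dom"
  obtains W0 where "diffeo_on (tot F) (tot F') W0 f" "p \<in> {p \<in> Dom. target p \<in> W0}"
proof -
  obtain c b c' b' where "(c, b) \<in> ad" "p \<in> cdom (jc c b)" by (rule Dom_charts[OF assms])
  then have "target p \<in> M" using chart_carrier by (simp add: cdom_jet_chart_option)
  then obtain W0 where "target p \<in> W0" "diffeo_on (tot F) (tot F') W0 f"
    using diffeo unfolding local_diffeo_on_def by blast
  then show thesis using that assms by blast
qed

lemma cartan_tangent: "cartan TYPE('r option) F p \<subseteq> tangent_space J p"
  by (auto simp: cartan_def)

subsection \<open>The contact property\<close>

lemma prolongation_cartan:
  assumes "p \<in> Dom"
  shows "\<Phi> p \<in> jets F' (CARD('r))"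
    "tangent_map J J' \<Phi> p ` cartan TYPE('r option) F p = cartan TYPE('r option) F' (\<Phi> p)"
proof -
  show "\<Phi> p \<in> jets F' (CARD('r))" by (rule prolongation_props(1)[OF assms])
  obtain W0 where W0: "diffeo_on (tot F) (tot F') W0 f" "p \<in> {p \<in> Dom. target p \<in> W0}" by (rule diffeo_neighbourhood[OF assms])
  show "tangent_map J J' \<Phi> p ` cartan TYPE('r option) F p = cartan TYPE('r option) F' (\<Phi> p)"
    by (rule tangent_\<Phi>_image(1)[OF W0])
qed

lemma prolongation_local_diffeo: "local_diffeo_on J J' Dom \<Phi>"
  unfolding local_diffeo_on_def
proof (intro conjI ballI)
  have loc: "\<exists>W. p \<in> W \<and> W \<subseteq> Dom \<and> diffeo_on J J' W \<Phi>" if p: "p \<in> Dom" for p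
  proof -
    obtain W0 where W0: "diffeo_on (tot F) (tot F') W0 f" "p \<in> {p \<in> Dom. target p \<in> W0}" by (rule diffeo_neighbourhood[OF p])
    have "{p \<in> Dom. target p \<in> W0} \<subseteq> Dom" by auto
    with W0(2) show ?thesis using diffeo_\<Phi>[OF W0(1)] by (intro exI[of _ "{p \<in> Dom. target p \<in> W0}"] conjI)
  qed
  show "\<exists>W. p \<in> W \<and> W \<subseteq> Dom \<and> diffeo_on J J' W \<Phi>" if "p \<in> Dom" for p by (rule loc[OF that])
  show "openin (mtop J) Dom"
  proof (subst openin_subopen, intro ballI)
    fix p assume "p \<in> Dom"
    then obtain W where W: "p \<in> W" "W \<subseteq> Dom" "diffeo_on J J' W \<Phi>" using loc by blast
    then have "openin (mtop J) W" by (simp add: diffeo_on_def smooth_map_on_def)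
    then show "\<exists>T. openin (mtop J) T \<and> p \<in> T \<and> T \<subseteq> Dom" using W by blast
  qed
qed

text \<open>A diffeomorphic restriction of the prolongation to any other open set has the same tangent maps; the
  tangent map of its inverse undoes them on vectors that are images of Cartan vectors, and by
  equality of the distributions all Cartan vectors are such images.\<close>

lemma prolongation_contact:
  "local_k_contact_transformation (CARD('m) * ((CARD('n) + CARD('r) - 1) choose (CARD('r) - 1)))
     J (cartan TYPE('r option) F) J' (cartan TYPE('r option) F') Dom \<Phi>"
  unfolding local_k_contact_transformation_def
proof (intro conjI allI impI ballI corank_cartan prolongation_local_diffeo F F')
  fix W p assume W: "W \<subseteq> Dom \<and> diffeo_on J J' W \<Phi>" and p: "p \<in> W"
  then have pD: "p \<in> Dom" by blast
  show "tangent_map J J' \<Phi> p ` cartan TYPE('r option) F p \<subseteq> cartan TYPE('r option) F' (\<Phi> p)"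
    using prolongation_cartan(2)[OF pD] by blast
  show "tangent_map J' J (inv_into W \<Phi>) (\<Phi> p) ` cartan TYPE('r option) F' (\<Phi> p) \<subseteq> cartan TYPE('r option) F p"
  proof
    fix u assume "u \<in> tangent_map J' J (inv_into W \<Phi>) (\<Phi> p) ` cartan TYPE('r option) F' (\<Phi> p)"
    then obtain v where v: "v \<in> cartan TYPE('r option) F p" "u = tangent_map J' J (inv_into W \<Phi>) (\<Phi> p) (tangent_map J J' \<Phi> p v)"
      unfolding prolongation_cartan(2)[OF pD, symmetric] by blast
    have "v \<in> tangent_space J p" using v(1) cartan_tangent by blast
    then have "u = v"
      unfolding v(2) by (rule diffeo_on_tangent_inverse(1)[OF is_atlas_jet_atlas[OF F] is_atlas_jet_atlas[OF F'] conjunct2[OF W] p])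
    then show "u \<in> cartan TYPE('r option) F p" using v(1) by simp
  qed
qed

lemma prolongation_legendrian:
  "legendrian_polarised_transcontact J (cartan TYPE('r option) F) (jet_vertical TYPE('r option) F)
     J' (cartan TYPE('r option) F') (jet_vertical TYPE('r option) F') Dom \<Phi>"
  unfolding legendrian_polarised_transcontact_def
proof (intro ballI conjI allI impI)
  fix p assume p: "p \<in> Dom"
  show "tangent_map J J' \<Phi> p ` cartan TYPE('r option) F p \<subseteq> cartan TYPE('r option) F' (\<Phi> p)"
    using prolongation_cartan(2)[OF p] by blast
  fix H assume H: "polarised_legendrian J (cartan TYPE('r option) F) (jet_vertical TYPE('r option) F) p H"
  obtain W0 where W0: "diffeo_on (tot F) (tot F') W0 f" "p \<in> {p \<in> Dom. target p \<in> W0}" by (rule diffeo_neighbourhood[OF p])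
  show "polarised_legendrian J' (cartan TYPE('r option) F') (jet_vertical TYPE('r option) F') (\<Phi> p) (tangent_map J J' \<Phi> p ` H)"
  proof (rule polarised_legendrian_image[where D = "cartan TYPE('r option) F" and D' = "cartan TYPE('r option) F'"
        and G = "jet_vertical TYPE('r option) F" and G' = "jet_vertical TYPE('r option) F'",
        OF is_atlas_jet_atlas[OF F] is_atlas_jet_atlas[OF F'] diffeo_\<Phi>[OF W0(1)] W0(2) cartan_tangent _ _ _ H])
    show "tangent_map J J' \<Phi> q ` cartan TYPE('r option) F q = cartan TYPE('r option) F' (\<Phi> q)"
      if "q \<in> {p \<in> Dom. target p \<in> W0}" for q
      by (rule tangent_\<Phi>_image(1)[OF W0(1) that])
    show "tangent_map J J' \<Phi> p ` jet_vertical TYPE('r option) F p = jet_vertical TYPE('r option) F' (\<Phi> p)"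
      by (rule tangent_\<Phi>_image(2)[OF W0])
    show "jet_vertical TYPE('r option) F p \<subseteq> tangent_space J p" by (auto simp: jet_vertical_def)
  qed
qed

end

theorem proposition12p5:
  fixes F :: "('e, 'q, 'n::finite, 'm::finite) fibred"
    and F' :: "('e2, 'q2, 'n, 'm) fibred"
    and \<Phi>0 :: "'e \<Rightarrow> 'e2"
    and r :: nat
  assumes "fibred_manifold F" and "fibred_manifold F'"
    and "r = CARD('r::finite)"
    and "hodograph_type F F' \<Phi>0"
  shows
    "(\<forall>p\<in>prolongation_domain TYPE('r option) F F' \<Phi>0.
        prolongation F F' \<Phi>0 r p \<in> jets F' r \<and>
        tangent_map (jet_atlas TYPE('r option) F) (jet_atlas TYPE('r option) F')
            (prolongation F F' \<Phi>0 r) p ` cartan TYPE('r option) F p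
          = cartan TYPE('r option) F' (prolongation F F' \<Phi>0 r p)) \<and>
     local_k_contact_transformation
        (CARD('m) * ((CARD('n) + r - 1) choose (r - 1)))
        (jet_atlas TYPE('r option) F) (cartan TYPE('r option) F)
        (jet_atlas TYPE('r option) F') (cartan TYPE('r option) F')
        (prolongation_domain TYPE('r option) F F' \<Phi>0) (prolongation F F' \<Phi>0 r) \<and>
     legendrian_polarised_transcontact
        (jet_atlas TYPE('r option) F) (cartan TYPE('r option) F) (jet_vertical TYPE('r option) F)
        (jet_atlas TYPE('r option) F') (cartan TYPE('r option) F') (jet_vertical TYPE('r option) F')
        (prolongation_domain TYPE('r option) F F' \<Phi>0) (prolongation F F' \<Phi>0 r)"
proof -
  interpret hodograph F F' \<Phi>0 "TYPE('r)" "prolongation_domain TYPE('r option) F F' \<Phi>0" "prolongation F F' \<Phi>0 r"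
    using assms by unfold_locales (auto simp: hodograph_type_def)
  show ?thesis
    using prolongation_cartan prolongation_contact prolongation_legendrian unfolding assms(3)[symmetric] by blast
qed

end
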